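(* Assume that the data $(\mu_0,\sigma,b)$ satisfy the Moment, Diffusion, Drift and Smoothness assumptions of the context. Assume moreover that the functions $$t\mapsto\nabla_\vartheta(c^{-1/2}b)^j([\vartheta,\vartheta'];t,x,\mu^\vartheta_t),\qquad j=1,\dots,d,$$ are all continuous at $t=0$ for every segment $[\vartheta,\vartheta']\subset\Theta$ and almost every $x\in\mathbb R^d$. If, for every $[\vartheta,\vartheta']\subset\Theta$ and every $z\in\mathbb R^p$ with $|z|=1$, at least one of the functions $$x\mapsto\nabla_\vartheta(c^{-1/2}b)^j([\vartheta,\vartheta'];0,x,\mu_0)^\top z,\qquad j=1,\dots,d,$$ does not vanish identically, then $\mathcal G$ is non-degenerate, i.e. $$\inf_{[\vartheta,\vartheta']\subset\Theta}\det\Big(\sum_{j=1}^d\int_0^T\int_{\mathbb R^d}\nabla_\vartheta(c^{-1/2}b)^j([\vartheta,\vartheta'];t,x,\mu^\vartheta_t)\nabla_\vartheta(c^{-1/2}b)^j([\vartheta,\vartheta'];t,x,\mu^\vartheta_t)^\top\mu^\vartheta_t(dx)dt\Big)>0.$$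
   Context: Fix integers $d,p\ge1$, a time horizon $T>0$ and a compact set $\Theta\subset\mathbb R^p$ with non-empty interior. For a probability measure $\nu$ on $\mathbb R^d$ let $\mathfrak m_r(\nu)=\int|y|^r\nu(dy)$ and $\mathcal P_r=\{\nu:\mathfrak m_r(\nu)<\infty\}$; $\mathcal W_1$ is the Wasserstein-1 distance on $\mathcal P_1$. Data: a probability $\mu_0$ on $\mathbb R^d$, a map $\sigma:[0,T]\times\mathbb R^d\to\mathbb R^d\otimes\mathbb R^d$ with $c=\sigma\sigma^\top$, and a map $b:\Theta\times[0,T]\times\mathbb R^d\times\mathcal P_1\to\mathbb R^d$. $c^{-1/2}$ is a square root of $c^{-1}$ fixed once and for all (so $(c^{-1/2})^\top c^{-1/2}=c^{-1}$). $f^j$ denotes the $j$-th component of an $\mathbb R^d$-valued $f$; $\nabla_\vartheta,\partial_{\vartheta_\ell}$ act only on the explicit argument $\vartheta$ of $b(\vartheta;t,x,\nu)$ (not on $\mu^\vartheta_t$). Moment assumption: $\mu_0\in\mathcal P_r$ for every $r\ge1$. Diffusion assumption: $\sigma$ is measurable, $|\sigma(t,x')-\sigma(t,x)|\le C|x'-x|$ for some $C\ge0$, and $\sigma_-^2|y|^2\le(c(t,x)y)^\top y\le\sigma_+^2|y|^2$ for some $\sigma_\pm>0$. Drift assumption: $b$ is measurable, $\sup_{t\in[0,T],\vartheta\in\Theta}|b(\vartheta;t,x',\nu')-b(\vartheta;t,x,\nu)|\le C(|x'-x|+\mathcal W_1(\nu',\nu))$ for some $C\ge0$, and $\sup_{t\in[0,T]}|b(\vartheta_0;t,0,\delta_0)|<\infty$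 for some $\vartheta_0\in\Theta$. Smoothness assumption: there are $r_1,r_2\ge1$, $C>0$ such that for every $\vartheta$ in the interior of $\Theta$, $\vartheta\mapsto b(\vartheta;t,x,\nu)$ is twice differentiable and for all $1\le\ell,\ell'\le p$: $\sup_{t}(|\partial_{\vartheta_\ell}b(\vartheta;t,x,\nu)|+|\partial^2_{\vartheta_\ell\vartheta_{\ell'}}b(\vartheta;t,x,\nu)|)\le C(1+|x|^{r_1}+\mathfrak m_{r_2}(\nu))$ and $\sup_t|\partial_{\vartheta_\ell}b(\vartheta;t,x',\nu')-\partial_{\vartheta_\ell}b(\vartheta;t,x,\nu)|\le C(|x'-x|+\mathcal W_1(\nu',\nu))$. McKean–Vlasov experiment: on $\mathcal C([0,T],\mathbb R^d)$ with canonical process $X$, $\overline{\mathbb P}_\vartheta$ is the unique law under which $dX_t=b(\vartheta;t,X_t,\mu^\vartheta_t)dt+\sigma(t,X_t)dB_t$ with $B$ a $d$-dimensional Brownian motion, $X_0\sim\mu_0$, and $\mu^\vartheta_t$ the law of $X_t$. $\mathcal G=(\overline{\mathbb P}_\vartheta)_{\vartheta\in\Theta}$. Segments: for $\vartheta,\vartheta'\in\Theta$, $[\vartheta,\vartheta']=\{\vartheta+\lambda(\vartheta'-\vartheta):\lambda\in[0,1]\}$ (possibly reduced to a point), and for a function $\phi$ on $\Theta$ and $[\vartheta,\vartheta']\subset\Theta$, $\phi([\vartheta,\vartheta'])=\int_0^1\phi(\vartheta+\lambda(\vartheta'-\vartheta))d\lambda$; in $\nabla_\vartheta(c^{-1/2}b)^j([\vartheta,\vartheta'];t,x,\mu^\vartheta_t)$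 the average concerns only the explicit parameter argument.
   Formalization: At boundary points of Θ, where Smoothness defines no gradient, b and its gradient are assumed to be continuous extensions from within Θ, uniformly in t, with a measurable gradient obeying the first-order growth and Lipschitz bounds; c^{-1/2} is assumed measurable. *)

theory Defs
  imports "HOL-Probability.Probability"
begin

section \<open>Moments and the Wasserstein distance\<close>

text \<open>
  The space of Borel probability measures is \<^term>\<open>space (prob_algebra borel)\<close>. On measures with
  finite first moment the Borel \<open>\<sigma>\<close>-field of the Wasserstein-1 distance is the trace of the
  \<open>\<sigma>\<close>-field of \<^term>\<open>prob_algebra borel\<close>; the latter is used for joint measurability below.
\<close>

definition moment :: "real \<Rightarrow> (real^'d) measure \<Rightarrow> real" where
  "moment r \<nu> = (\<integral>y. norm y powr r \<partial>\<nu>)"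

definition P_mom :: "real \<Rightarrow> (real^'d) measure set" where
  "P_mom r = {\<nu> \<in> space (prob_algebra borel). (\<integral>\<^sup>+ y. ennreal (norm y powr r) \<partial>\<nu>) < \<infinity>}"

definition couplings :: "(real^'d) measure \<Rightarrow> (real^'d) measure \<Rightarrow> ((real^'d) \<times> (real^'d)) measure set"
  where "couplings \<mu> \<nu> =
    {\<gamma> \<in> space (prob_algebra borel). distr \<gamma> borel fst = \<mu> \<and> distr \<gamma> borel snd = \<nu>}"

definition W1 :: "(real^'d) measure \<Rightarrow> (real^'d) measure \<Rightarrow> real" where
  "W1 \<mu> \<nu> = enn2real (INF \<gamma>\<in>couplings \<mu> \<nu>. \<integral>\<^sup>+ z. ennreal (dist (fst z) (snd z)) \<partial>\<gamma>)"


section \<open>Assumptions on the data\<close>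

text \<open>
  Throughout, \<open>b \<theta> t x \<nu>\<close> is the drift, \<open>\<sigma> t x\<close> the diffusion coefficient, and
  \<open>db \<theta> t x \<nu>\<close> the Jacobian of \<open>b\<close> in the explicit parameter: row \<open>j\<close> is
  \<open>\<nabla>\<^sub>\<theta> b\<^sup>j\<close> and column \<open>l\<close> is the partial derivative of \<open>b\<close> with respect to \<open>\<theta>\<^sub>l\<close>.
  Only times in \<open>{0..T}\<close> and parameters in \<open>\<Theta>\<close> matter.
\<close>

definition moment_assumption :: "(real^'d) measure \<Rightarrow> bool" where
  "moment_assumption \<mu>\<^sub>0 \<longleftrightarrow> (\<forall>r\<ge>1. \<mu>\<^sub>0 \<in> P_mom r)"

definition cmat :: "(real \<Rightarrow> real^'d \<Rightarrow> real^'d^'d) \<Rightarrow> real \<Rightarrow> real^'d \<Rightarrow> real^'d^'d" where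
  "cmat \<sigma> t x = \<sigma> t x ** transpose (\<sigma> t x)"

definition diffusion_assumption :: "real \<Rightarrow> (real \<Rightarrow> real^'d \<Rightarrow> real^'d^'d) \<Rightarrow> bool" where
  "diffusion_assumption T \<sigma> \<longleftrightarrow>
     (\<lambda>(t, x). \<sigma> t x) \<in> borel_measurable (restrict_space borel {0..T} \<Otimes>\<^sub>M borel) \<and>
     (\<exists>C\<ge>0. \<forall>t\<in>{0..T}. \<forall>x x'. norm (\<sigma> t x' - \<sigma> t x) \<le> C * norm (x' - x)) \<and>
     (\<exists>\<sigma>m>0. \<exists>\<sigma>p>0. \<forall>t\<in>{0..T}. \<forall>x y.
        \<sigma>m\<^sup>2 * (norm y)\<^sup>2 \<le> (cmat \<sigma> t x *v y) \<bullet> y \<and> (cmat \<sigma> t x *v y) \<bullet> y \<le> \<sigma>p\<^sup>2 * (norm y)\<^sup>2)"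

definition drift_assumption ::
  "real \<Rightarrow> (real^'p) set \<Rightarrow> (real^'p \<Rightarrow> real \<Rightarrow> real^'d \<Rightarrow> (real^'d) measure \<Rightarrow> real^'d) \<Rightarrow> bool" where
  "drift_assumption T \<Theta> b \<longleftrightarrow>
     (\<lambda>(\<theta>, t, x, \<nu>). b \<theta> t x \<nu>) \<in> borel_measurable
        (restrict_space borel \<Theta> \<Otimes>\<^sub>M restrict_space borel {0..T} \<Otimes>\<^sub>M borel \<Otimes>\<^sub>M
         restrict_space (prob_algebra borel) (P_mom 1)) \<and>
     (\<exists>C\<ge>0. \<forall>t\<in>{0..T}. \<forall>\<theta>\<in>\<Theta>. \<forall>x x'. \<forall>\<nu>\<in>P_mom 1. \<forall>\<nu>'\<in>P_mom 1.
        norm (b \<theta> t x' \<nu>' - b \<theta> t x \<nu>) \<le> C * (norm (x' - x) + W1 \<nu>' \<nu>)) \<and>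
     (\<exists>\<theta>\<^sub>0\<in>\<Theta>. \<exists>K. \<forall>t\<in>{0..T}. norm (b \<theta>\<^sub>0 t 0 (return borel 0)) \<le> K)"

text \<open>
  \<open>H l l'\<close> is the second partial derivative in the coordinates \<open>l\<close> and \<open>l'\<close>. The growth bound
  is vacuous when the moment of order \<open>r\<^sub>2\<close> of \<open>\<nu>\<close> is infinite, hence the premise
  \<^prop>\<open>\<nu> \<in> P_mom r\<^sub>2\<close>.
\<close>

definition smoothness_assumption ::
  "real \<Rightarrow> (real^'p) set \<Rightarrow> (real^'p \<Rightarrow> real \<Rightarrow> real^'d \<Rightarrow> (real^'d) measure \<Rightarrow> real^'d) \<Rightarrow>
   (real^'p \<Rightarrow> real \<Rightarrow> real^'d \<Rightarrow> (real^'d) measure \<Rightarrow> real^'p^'d) \<Rightarrow> bool" where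
  "smoothness_assumption T \<Theta> b db \<longleftrightarrow>
     (\<exists>r\<^sub>1\<ge>1. \<exists>r\<^sub>2\<ge>1. \<exists>C>0. \<forall>\<theta>\<in>interior \<Theta>. \<forall>t\<in>{0..T}. \<forall>x. \<forall>\<nu>\<in>P_mom 1.
        ((\<lambda>\<eta>. b \<eta> t x \<nu>) has_derivative (\<lambda>h. db \<theta> t x \<nu> *v h)) (at \<theta>) \<and>
        (\<exists>H :: 'p \<Rightarrow> 'p \<Rightarrow> real^'d.
           (\<forall>l. ((\<lambda>\<eta>. column l (db \<eta> t x \<nu>)) has_derivative (\<lambda>h. \<Sum>l'\<in>UNIV. (h $ l') *\<^sub>R H l l'))
                  (at \<theta>)) \<and>
           (\<nu> \<in> P_mom r\<^sub>2 \<longrightarrow> (\<forall>l l'. norm (column l (db \<theta> t x \<nu>)) + norm (H l l')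
              \<le> C * (1 + norm x powr r\<^sub>1 + moment r\<^sub>2 \<nu>)))) \<and>
        (\<forall>x'. \<forall>\<nu>'\<in>P_mom 1. \<forall>l.
           norm (column l (db \<theta> t x' \<nu>') - column l (db \<theta> t x \<nu>)) \<le> C * (norm (x' - x) + W1 \<nu>' \<nu>)))"

text \<open>
  Segments in \<open>\<Theta>\<close> may meet, or lie in, the boundary of \<open>\<Theta>\<close>, where the smoothness assumption
  does not define a gradient. There \<open>b\<close> and its gradient are understood as continuous extensions
  from within \<open>\<Theta>\<close>, in the sense in which they are continuous inside: uniformly in \<open>t\<close> (in the
  interior, the growth bound makes both locally Lipschitz in \<open>\<theta>\<close> uniformly in \<open>t\<close>). The extended
  gradient obeys the first-order bounds of the smoothness assumption; if \<open>\<Theta>\<close> is the closure of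
  its interior, these bounds carry over to the boundary by taking limits.
\<close>

definition boundary_extension ::
  "real \<Rightarrow> (real^'p) set \<Rightarrow> (real^'p \<Rightarrow> real \<Rightarrow> real^'d \<Rightarrow> (real^'d) measure \<Rightarrow> real^'d) \<Rightarrow>
   (real^'p \<Rightarrow> real \<Rightarrow> real^'d \<Rightarrow> (real^'d) measure \<Rightarrow> real^'p^'d) \<Rightarrow> bool" where
  "boundary_extension T \<Theta> b db \<longleftrightarrow>
     (\<forall>\<theta>\<in>frontier \<Theta>. \<forall>x. \<forall>\<nu>\<in>(\<Inter>r\<in>{1..}. P_mom r).
        uniform_limit {0..T} (\<lambda>\<eta> t. b \<eta> t x \<nu>) (\<lambda>t. b \<theta> t x \<nu>) (at \<theta> within \<Theta>) \<and>
        uniform_limit {0..T} (\<lambda>\<eta> t. db \<eta> t x \<nu>) (\<lambda>t. db \<theta> t x \<nu>) (at \<theta> within \<Theta>)) \<and>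
     (\<lambda>(\<theta>, t, x, \<nu>). db \<theta> t x \<nu>) \<in> borel_measurable
        (restrict_space borel \<Theta> \<Otimes>\<^sub>M restrict_space borel {0..T} \<Otimes>\<^sub>M borel \<Otimes>\<^sub>M
         restrict_space (prob_algebra borel) (P_mom 1)) \<and>
     (\<exists>r\<^sub>1\<ge>1. \<exists>r\<^sub>2\<ge>1. \<exists>C>0. \<forall>\<theta>\<in>frontier \<Theta>. \<forall>t\<in>{0..T}. \<forall>x. \<forall>\<nu>\<in>P_mom 1. \<forall>l.
        (\<nu> \<in> P_mom r\<^sub>2 \<longrightarrow>
           norm (column l (db \<theta> t x \<nu>)) \<le> C * (1 + norm x powr r\<^sub>1 + moment r\<^sub>2 \<nu>)) \<and>
        (\<forall>x'. \<forall>\<nu>'\<in>P_mom 1.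
           norm (column l (db \<theta> t x' \<nu>') - column l (db \<theta> t x \<nu>)) \<le> C * (norm (x' - x) + W1 \<nu>' \<nu>)))"

text \<open>
  A factor \<open>s\<close> with \<open>s\<^sup>T s = c\<^sup>-\<^sup>1\<close>, chosen measurably in \<open>(t, x)\<close> so that the components of \<open>s b\<close> can
  be integrated; \<open>s\<close> need not be symmetric or continuous.
\<close>

definition is_inv_sqrt ::
  "real \<Rightarrow> (real \<Rightarrow> real^'d \<Rightarrow> real^'d^'d) \<Rightarrow> (real \<Rightarrow> real^'d \<Rightarrow> real^'d^'d) \<Rightarrow> bool" where
  "is_inv_sqrt T \<sigma> s \<longleftrightarrow>
     (\<lambda>(t, x). s t x) \<in> borel_measurable (restrict_space borel {0..T} \<Otimes>\<^sub>M borel) \<and>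
     (\<forall>t\<in>{0..T}. \<forall>x. transpose (s t x) ** s t x = matrix_inv (cmat \<sigma> t x))"


section \<open>Brownian motion and the stochastic integral\<close>

definition brownian_motion ::
  "'w measure \<Rightarrow> (real \<Rightarrow> 'w measure) \<Rightarrow> real \<Rightarrow> (real \<Rightarrow> 'w \<Rightarrow> real^'d) \<Rightarrow> bool" where
  "brownian_motion M F T B \<longleftrightarrow>
     (\<forall>t\<in>{0..T}. B t \<in> borel_measurable (F t)) \<and>
     (AE \<omega> in M. B 0 \<omega> = 0 \<and> continuous_on {0..T} (\<lambda>t. B t \<omega>)) \<and>
     (\<forall>s t. 0 \<le> s \<and> s < t \<and> t \<le> T \<longrightarrow>
        distr M borel (\<lambda>\<omega>. B t \<omega> - B s \<omega>)
          = density lborel (\<lambda>y. ennreal (\<Prod>i\<in>UNIV. normal_density 0 (sqrt (t - s)) (y $ i))) \<and>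
        prob_space.indep_set M (sets (F s))
          {(\<lambda>\<omega>. B t \<omega> - B s \<omega>) -` A \<inter> space M | A. A \<in> sets borel})"

text \<open>
  A simple integrand on \<open>[0,t]\<close> takes the value \<open>H i\<close> on \<open>(\<tau> i, \<tau> (i+1)]\<close> for \<open>i < n\<close>.
\<close>

definition simple_integrand ::
  "(real \<Rightarrow> 'w measure) \<Rightarrow> real \<Rightarrow> nat \<Rightarrow> (nat \<Rightarrow> real) \<Rightarrow> (nat \<Rightarrow> 'w \<Rightarrow> real^'d^'d) \<Rightarrow> bool" where
  "simple_integrand F t n \<tau> H \<longleftrightarrow>
     \<tau> 0 = 0 \<and> \<tau> n = t \<and> (\<forall>i<n. \<tau> i \<le> \<tau> (Suc i)) \<and>
     (\<forall>i<n. H i \<in> borel_measurable (F (\<tau> i)) \<and> bounded (H i ` space (F (\<tau> i))))"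

definition simple_process ::
  "nat \<Rightarrow> (nat \<Rightarrow> real) \<Rightarrow> (nat \<Rightarrow> 'w \<Rightarrow> real^'d^'d) \<Rightarrow> real \<Rightarrow> 'w \<Rightarrow> real^'d^'d" where
  "simple_process n \<tau> H u \<omega> = (\<Sum>i<n. indicator {\<tau> i<..\<tau> (Suc i)} u *\<^sub>R H i \<omega>)"

definition simple_integral ::
  "nat \<Rightarrow> (nat \<Rightarrow> real) \<Rightarrow> (nat \<Rightarrow> 'w \<Rightarrow> real^'d^'d) \<Rightarrow> (real \<Rightarrow> 'w \<Rightarrow> real^'d) \<Rightarrow> 'w \<Rightarrow> real^'d" where
  "simple_integral n \<tau> H B \<omega> = (\<Sum>i<n. H i \<omega> *v (B (\<tau> (Suc i)) \<omega> - B (\<tau> i) \<omega>))"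

text \<open>
  The square-integrable Ito integral \<open>I = \<integral>\<^sub>0\<^sup>t \<Phi>\<^sub>u dB\<^sub>u\<close>: \<open>I\<close> is the \<open>L\<^sup>2\<close>-limit of the integrals of
  simple integrands that approximate \<open>\<Phi>\<close> in \<open>L\<^sup>2([0,t] \<times> \<Omega>)\<close>. No localisation is needed because \<open>\<sigma>\<close> is bounded.
\<close>

definition has_ito_integral ::
  "'w measure \<Rightarrow> (real \<Rightarrow> 'w measure) \<Rightarrow> (real \<Rightarrow> 'w \<Rightarrow> real^'d) \<Rightarrow>
   (real \<Rightarrow> 'w \<Rightarrow> real^'d^'d) \<Rightarrow> real \<Rightarrow> ('w \<Rightarrow> real^'d) \<Rightarrow> bool" where
  "has_ito_integral M F B \<Phi> t I \<longleftrightarrow>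
     I \<in> borel_measurable M \<and>
     (\<exists>n \<tau> H. (\<forall>k. simple_integrand F t (n k) (\<tau> k) (H k)) \<and>
        (\<lambda>k. \<integral>\<^sup>+ \<omega>. (\<integral>\<^sup>+ u\<in>{0..t}.
            ennreal ((norm (\<Phi> u \<omega> - simple_process (n k) (\<tau> k) (H k) u \<omega>))\<^sup>2) \<partial>lborel) \<partial>M)
          \<longlonglongrightarrow> 0 \<and>
        (\<lambda>k. \<integral>\<^sup>+ \<omega>. ennreal ((norm (I \<omega> - simple_integral (n k) (\<tau> k) (H k) B \<omega>))\<^sup>2) \<partial>M)
          \<longlonglongrightarrow> 0)"


section \<open>The McKean--Vlasov experiment\<close>

text \<open>
  The trace on continuous paths of the product \<open>\<sigma>\<close>-field is the Borel \<open>\<sigma>\<close>-field of uniform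
  convergence on the space of continuous paths.
\<close>

definition path_space :: "real \<Rightarrow> (real \<Rightarrow> real^'d) measure" where
  "path_space T = restrict_space (\<Pi>\<^sub>M t\<in>{0..T}. borel) {\<omega>. continuous_on {0..T} \<omega>}"

definition marginal :: "(real \<Rightarrow> real^'d) measure \<Rightarrow> real \<Rightarrow> (real^'d) measure" where
  "marginal P t = distr P borel (\<lambda>\<omega>. \<omega> t)"

text \<open>
  \<open>P\<close> is a law on path space under which the canonical process solves
  \<open>dX\<^sub>t = \<beta>(t, X\<^sub>t, \<mu>\<^sub>t) dt + \<sigma>(t, X\<^sub>t) dB\<^sub>t\<close> with \<open>X\<^sub>0 \<sim> \<mu>\<^sub>0\<close> and \<open>\<mu>\<^sub>t\<close> the law of \<open>X\<^sub>t\<close>. Since \<open>\<sigma>\<close> is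
  invertible, a driving Brownian motion exists on path space itself.
\<close>

definition mckean_vlasov_law ::
  "real \<Rightarrow> (real^'d) measure \<Rightarrow> (real \<Rightarrow> real^'d \<Rightarrow> real^'d^'d) \<Rightarrow>
   (real \<Rightarrow> real^'d \<Rightarrow> (real^'d) measure \<Rightarrow> real^'d) \<Rightarrow> (real \<Rightarrow> real^'d) measure \<Rightarrow> bool" where
  "mckean_vlasov_law T \<mu>\<^sub>0 \<sigma> \<beta> P \<longleftrightarrow>
     prob_space P \<and> sets P = sets (path_space T) \<and>
     marginal P 0 = \<mu>\<^sub>0 \<and> (\<forall>t\<in>{0..T}. marginal P t \<in> P_mom 1) \<and>
     (\<exists>F B. filtration (space P) F \<and> (\<forall>t. subalgebra P (F t)) \<and>
        brownian_motion P F T B \<and>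
        (\<forall>t\<in>{0..T}. (\<lambda>\<omega>. \<omega> t) \<in> borel_measurable (F t)) \<and>
        (AE \<omega> in P. set_integrable lborel {0..T} (\<lambda>u. \<beta> u (\<omega> u) (marginal P u))) \<and>
        (\<forall>t\<in>{0..T}. has_ito_integral P F B (\<lambda>u \<omega>. \<sigma> u (\<omega> u)) t
           (\<lambda>\<omega>. \<omega> t - \<omega> 0 - (LINT u:{0..t}|lborel. \<beta> u (\<omega> u) (marginal P u)))))"


section \<open>Averaged gradients and the information matrix\<close>

text \<open>
  Row \<open>j\<close> of \<^term>\<open>s t x ** db \<theta> t x \<nu>\<close>, because \<open>s = c\<^sup>-\<^sup>1\<^sup>/\<^sup>2\<close> does not depend on the parameter.
\<close>

definition grad_sb ::
  "(real \<Rightarrow> real^'d \<Rightarrow> real^'d^'d) \<Rightarrow> (real^'p \<Rightarrow> real \<Rightarrow> real^'d \<Rightarrow> (real^'d) measure \<Rightarrow> real^'p^'d) \<Rightarrow>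
   'd \<Rightarrow> real^'p \<Rightarrow> real \<Rightarrow> real^'d \<Rightarrow> (real^'d) measure \<Rightarrow> real^'p" where
  "grad_sb s db j \<theta> t x \<nu> = (s t x ** db \<theta> t x \<nu>) $ j"

lemma grad_sb_is_gradient:
  assumes "((\<lambda>\<eta>. b \<eta> t x \<nu>) has_derivative (\<lambda>h. db \<theta> t x \<nu> *v h)) (at \<theta>)"
  shows "((\<lambda>\<eta>. (s t x *v b \<eta> t x \<nu>) $ j) has_derivative (\<lambda>h. grad_sb s db j \<theta> t x \<nu> \<bullet> h)) (at \<theta>)"
proof -
  have "((\<lambda>\<eta>. (s t x *v b \<eta> t x \<nu>) $ j) has_derivative (\<lambda>h. (s t x *v (db \<theta> t x \<nu> *v h)) $ j)) (at \<theta>)"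
    by (intro bounded_linear.has_derivative[OF bounded_linear_vec_nth]
        bounded_linear.has_derivative[OF matrix_vector_mul_bounded_linear] assms)
  then show ?thesis
    unfolding grad_sb_def matrix_vector_mul_assoc matrix_vector_mul_component .
qed

definition seg_grad ::
  "(real \<Rightarrow> real^'d \<Rightarrow> real^'d^'d) \<Rightarrow> (real^'p \<Rightarrow> real \<Rightarrow> real^'d \<Rightarrow> (real^'d) measure \<Rightarrow> real^'p^'d) \<Rightarrow>
   'd \<Rightarrow> real^'p \<Rightarrow> real^'p \<Rightarrow> real \<Rightarrow> real^'d \<Rightarrow> (real^'d) measure \<Rightarrow> real^'p" where
  "seg_grad s db j \<theta> \<theta>' t x \<nu> = (LINT l:{0..1}|lborel. grad_sb s db j (\<theta> + l *\<^sub>R (\<theta>' - \<theta>)) t x \<nu>)"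

definition info_matrix ::
  "real \<Rightarrow> (real \<Rightarrow> real^'d \<Rightarrow> real^'d^'d) \<Rightarrow>
   (real^'p \<Rightarrow> real \<Rightarrow> real^'d \<Rightarrow> (real^'d) measure \<Rightarrow> real^'p^'d) \<Rightarrow>
   (real^'p \<Rightarrow> (real \<Rightarrow> real^'d) measure) \<Rightarrow> real^'p \<Rightarrow> real^'p \<Rightarrow> real^'p^'p" where
  "info_matrix T s db P \<theta> \<theta>' =
     (\<Sum>j\<in>UNIV. LINT t:{0..T}|lborel. (LINT x|marginal (P \<theta>) t.
        (let v = seg_grad s db j \<theta> \<theta>' t x (marginal (P \<theta>) t) in \<chi> k l. v $ k * v $ l)))"

end

theory Submission
  imports Defs
begin

text \<open>
  Let \<open>W\<close> be the average of the Jacobian \<open>db\<close> along a segment; it is Lipschitz in \<open>(x, \<nu>)\<close>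
  uniformly in \<open>t\<close>, and the information matrix \<open>I\<close> satisfies \<open>z \<bullet> I z = \<integral>\<integral> |s W z|\<^sup>2 d\<mu>\<^sub>t dt\<close>.
  Non-degeneracy at time \<open>0\<close> and continuity at \<open>t = 0\<close> give a point \<open>x1\<close> at which \<open>|W z|\<close>, taken at
  \<open>\<nu> = \<mu>\<^sub>t\<close>, is bounded below for small \<open>t\<close>. As \<open>W1 \<mu>\<^sub>t \<mu>\<^sub>0\<close> tends to \<open>0\<close> with \<open>t\<close> uniformly in the
  parameter, one may compare with \<open>\<nu> = \<mu>\<^sub>0\<close>, where \<open>W\<close> is continuous in the segment uniformly in
  \<open>t\<close>; so the bound persists for \<open>x\<close> near \<open>x1\<close> and for all neighbouring segments and directions,
  without any stability of \<open>\<mu>\<^sub>t\<close> in the parameter.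

  It remains to bound \<open>\<mu>\<^sub>t (ball x1 r)\<close> from below uniformly in the parameter on some time interval.
  Subtract from the path a curve that steers a point charged by \<open>\<mu>\<^sub>0\<close> to \<open>x1\<close>. For the resulting
  process \<open>Y\<close>, ellipticity and a large \<open>\<alpha>\<close> make the expectation of \<open>exp (-\<alpha> |Y|\<^sup>2)\<close> decay at most
  exponentially in time, at a rate that is beaten on short intervals by the smallness of
  \<open>exp (-\<alpha> r\<^sup>2)\<close> off the ball. This one-step estimate only uses the isometry and the sixth moment
  of increments of the stochastic integral, not Ito's formula.

  The pairs of a segment and a direction form a compact set, so \<open>z \<bullet> I z\<close> is bounded below
  uniformly, and hence so is \<open>det I\<close>.
\<close>

section \<open>Matrices\<close>

text \<open>The mass of a ball is where the constants compete. The radius \<open>r\<close> is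
  dictated by the Lipschitz constant of \<open>W\<close>, the time \<open>\<delta>\<close> by the
  Wasserstein comparison, and steering to \<open>x1\<close> within time \<open>\<delta>\<close> may
  take a velocity of order \<open>1 / \<delta>\<close>. The barrier decays at rate
  \<open>\<alpha> * K\<^sup>2 + K1\<^sup>2 / m\<^sup>2\<close>: the velocity enters only through
  \<open>K1\<close>, in a term free of \<open>\<alpha>\<close>, while
  \<open>4 * K\<^sup>2 * \<delta> \<le> r\<^sup>2\<close> ensures that the other term costs at most
  the factor \<open>exp (- (\<alpha> * r\<^sup>2 / 4))\<close>. So \<open>\<alpha>\<close> may be
  chosen last and as large as necessary. Iterating the one-step estimate sums \<open>t / h\<close>
  errors, each of which must be o(h); the sixth moment turns the cubic Taylor remainder into an
  error of order h^(3/2). The constants in these errors may depend on the parameter, since they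
  vanish as h tends to 0; only the rate has to be uniform. The factor \<open>s\<close> may be
  discontinuous in \<open>x\<close>, so all comparisons are made for \<open>W\<close>, and
  \<open>s\<close> enters only through two-sided norm bounds given by ellipticity.\<close>

lemma norm_matrix_power2: "(norm (A :: real^'n^'m))\<^sup>2 = (\<Sum>i\<in>UNIV. \<Sum>j\<in>UNIV. (A $ i $ j)\<^sup>2)"
  by (simp add: norm_vec_def L2_set_def sum_nonneg real_sqrt_pow2)

lemma norm_transpose: "norm (transpose (A :: real^'n^'m)) = norm A"
proof -
  have "(norm (transpose A))\<^sup>2 = (norm A)\<^sup>2"
    unfolding norm_matrix_power2 by (simp add: transpose_def) (rule sum.swap)
  then show ?thesis by simp
qed

lemma norm_matrix_vector_mult_le: "norm ((A :: real^'n^'m) *v x) \<le> norm A * norm x"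
proof -
  have "norm (A *v x) = L2_set (\<lambda>i. A $ i \<bullet> x) UNIV"
    by (simp add: norm_vec_def matrix_vector_mul_component L2_set_def)
  also have "\<dots> = L2_set (\<lambda>i. \<bar>A $ i \<bullet> x\<bar>) UNIV"
    by (simp add: L2_set_def)
  also have "\<dots> \<le> L2_set (\<lambda>i. norm (A $ i) * norm x) UNIV"
    by (intro L2_set_mono) (auto simp: Cauchy_Schwarz_ineq2)
  also have "\<dots> = norm A * norm x"
    by (simp add: norm_vec_def L2_set_left_distrib)
  finally show ?thesis .
qed

text \<open>The matrix norm of the type class is the Frobenius norm, whereas the assumptions bound
  the Jacobian column by column; this passes from the latter to the former.\<close>

lemma norm_matrix_le_sum_columns: "norm (A :: real^'n^'m) \<le> (\<Sum>l\<in>UNIV. norm (column l A))"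
proof -
  have "norm A = norm (transpose A)" by (simp add: norm_transpose)
  also have "\<dots> = L2_set (\<lambda>l. norm (column l A)) UNIV"
    unfolding norm_vec_def[of "transpose A"] by (simp add: transpose_def column_def)
  also have "\<dots> \<le> (\<Sum>l\<in>UNIV. \<bar>norm (column l A)\<bar>)"
    by (rule L2_set_le_sum_abs)
  finally show ?thesis by simp
qed

lemma norm_matrix_mult_le: "norm ((A :: real^'n^'m) ** (B :: real^'k^'n)) \<le> norm A * norm B"
proof -
  have "(norm (A ** B))\<^sup>2 = (norm (transpose (A ** B)))\<^sup>2" by (simp add: norm_transpose)
  also have "\<dots> = (\<Sum>l\<in>UNIV. (norm (A *v column l B))\<^sup>2)"
  proof -
    have "transpose (A ** B) $ l = A *v column l B" for l
      by (simp add: transpose_def column_def matrix_matrix_mult_def matrix_vector_mult_def vec_eq_iff)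
    then show ?thesis
      unfolding norm_vec_def[of "transpose (A ** B)"] by (simp add: L2_set_def sum_nonneg)
  qed
  also have "\<dots> \<le> (\<Sum>l\<in>UNIV. (norm A)\<^sup>2 * (norm (column l B))\<^sup>2)"
    by (intro sum_mono) (metis norm_ge_zero norm_matrix_vector_mult_le power_mono power_mult_distrib)
  also have "\<dots> = (norm A)\<^sup>2 * (norm (transpose B))\<^sup>2"
    unfolding norm_vec_def[of "transpose B"]
    by (simp add: L2_set_def sum_nonneg sum_distrib_left transpose_def column_def)
  also have "\<dots> = (norm A * norm B)\<^sup>2" by (simp add: norm_transpose power_mult_distrib)
  finally show ?thesis by (rule power2_le_imp_le) simp
qed

text \<open>Ellipticity is a statement about \<open>S ** transpose S\<close>. In this form it bounds
  \<open>transpose S\<close> from below in every direction, which is what the isometry needs for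
  integrands of the form row times \<open>S\<close>.\<close>

lemma norm_transpose_mult_power2:
  "(norm (transpose (S :: real^'n^'n) *v y))\<^sup>2 = ((S ** transpose S) *v y) \<bullet> y"
  by (simp add: power2_norm_eq_inner matrix_vector_mul_assoc[symmetric] dot_lmul_matrix[symmetric]
      inner_commute)

lemma matrix_inv_right_inverse:
  assumes "invertible (A :: real^'n^'n)"
  shows "A ** matrix_inv A = mat 1"
  using assms unfolding invertible_def matrix_inv_def by (rule someI2_ex) auto

text \<open>The squared Frobenius norm is the trace of \<open>S ** transpose S\<close>, and each
  diagonal entry is at most \<open>p\<^sup>2\<close>. This bounds the integrand of the stochastic
  integral and is the origin of \<open>K = sqrt (CARD('d) * p\<^sup>2)\<close>.\<close>

lemma elliptic_norm_le:
  fixes S :: "real^'n^'n" and p :: real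
  assumes "\<And>y. ((S ** transpose S) *v y) \<bullet> y \<le> p\<^sup>2 * (norm y)\<^sup>2"
  shows "(norm S)\<^sup>2 \<le> CARD('n) * p\<^sup>2"
proof -
  have "(norm S)\<^sup>2 = (\<Sum>i\<in>UNIV. (norm (S $ i))\<^sup>2)"
    unfolding norm_vec_def[of S] by (simp add: L2_set_def sum_nonneg)
  also have "\<dots> = (\<Sum>i\<in>UNIV. (norm (transpose S *v axis i 1))\<^sup>2)"
    by (simp add: matrix_vector_mult_basis column_transpose row_def)
  also have "\<dots> \<le> (\<Sum>i\<in>(UNIV::'n set). p\<^sup>2)"
    by (intro sum_mono order_trans[OF eq_refl[OF norm_transpose_mult_power2] order_trans[OF assms]]) simp
  finally show ?thesis by simp
qed

text \<open>With c = S S^T and c w = v, the hypothesis on s gives |s v|^2 = v . w = |S^T w|^2.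
  Coercivity of c and Cauchy-Schwarz bound this above; v = S (S^T w) together with |S u| <= p |u|
  bounds it below. Only the product \<open>transpose s ** s\<close> enters, so every choice of the
  square root obeys the same bounds.\<close>

lemma elliptic_inv_sqrt_bounds:
  fixes S s :: "real^'n^'n" and m p :: real
  assumes m: "m > 0" and p: "p > 0"
    and ell: "\<And>y. m\<^sup>2 * (norm y)\<^sup>2 \<le> ((S ** transpose S) *v y) \<bullet> y"
      "\<And>y. ((S ** transpose S) *v y) \<bullet> y \<le> p\<^sup>2 * (norm y)\<^sup>2"
    and s: "transpose s ** s = matrix_inv (S ** transpose S)"
  shows "norm (s *v v) \<le> norm v / m" and "norm v / p \<le> norm (s *v v)"
proof -
  define c where "c = S ** transpose S"
  have "y = 0" if "c *v y = 0" for y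
    using ell(1)[of y] m that by (auto simp: c_def mult_le_0_iff)
  then have inv: "invertible c"
    by (simp add: invertible_left_inverse matrix_left_invertible_ker)
  define w where "w = matrix_inv c *v v"
  have cw: "c *v w = v"
    using inv by (simp add: w_def matrix_vector_mul_assoc matrix_inv_right_inverse)
  have sv: "(norm (s *v v))\<^sup>2 = v \<bullet> w"
  proof -
    have "(norm (s *v v))\<^sup>2 = (transpose s *v (s *v v)) \<bullet> v"
      by (metis dot_lmul_matrix power2_norm_eq_inner vector_transpose_matrix transpose_transpose)
    then show ?thesis
      using s by (simp add: matrix_vector_mul_assoc w_def c_def inner_commute)
  qed
  have 1: "m\<^sup>2 * (norm w)\<^sup>2 \<le> v \<bullet> w" using ell(1)[of w] cw by (simp add: c_def)
  have CS: "v \<bullet> w \<le> norm v * norm w" by (rule norm_cauchy_schwarz)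
  have "m\<^sup>2 * (norm w)\<^sup>2 \<le> norm v * norm w" using 1 CS by linarith
  then have "m\<^sup>2 * norm w \<le> norm v"
    by (cases "norm w = 0") (auto simp: power2_eq_square)
  then have "m\<^sup>2 * (norm v * norm w) \<le> norm v * norm v"
    by (metis mult.left_commute mult_left_mono norm_ge_zero)
  moreover have "m\<^sup>2 * (norm (s *v v))\<^sup>2 \<le> m\<^sup>2 * (norm v * norm w)"
    using CS sv by (simp add: mult_left_mono)
  ultimately have "(m * norm (s *v v))\<^sup>2 \<le> (norm v)\<^sup>2"
    by (simp add: power2_eq_square power_mult_distrib algebra_simps)
  then have "m * norm (s *v v) \<le> norm v" by (rule power2_le_imp_le) simp
  then show "norm (s *v v) \<le> norm v / m" using m by (simp add: field_simps)
  have opT: "norm (transpose S *v y) \<le> p * norm y" for y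
    using ell(2)[of y] p
    by - (rule power2_le_imp_le, simp_all add: norm_transpose_mult_power2 power_mult_distrib del: transpose_matrix_vector)
  \<comment> \<open>The operator norm of S equals that of its transpose; ellipticity speaks directly
    only about the transpose.\<close>
  have op: "norm (S *v u) \<le> p * norm u" for u
  proof (cases "S *v u = 0")
    case False
    have "(norm (S *v u))\<^sup>2 = u \<bullet> (transpose S *v (S *v u))"
      by (metis dot_lmul_matrix power2_norm_eq_inner vector_transpose_matrix transpose_transpose inner_commute)
    also have "\<dots> \<le> norm u * (p * norm (S *v u))"
      using norm_cauchy_schwarz[of u] opT[of "S *v u"] by (meson mult_left_mono norm_ge_zero order_trans)
    finally show ?thesis using False by (simp add: power2_eq_square ac_simps)
  qed (use p in simp)
  have "norm v \<le> p * norm (transpose S *v w)"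
    using op[of "transpose S *v w"] cw by (simp add: c_def matrix_vector_mul_assoc del: transpose_matrix_vector)
  then have "(norm v)\<^sup>2 \<le> p\<^sup>2 * (norm (transpose S *v w))\<^sup>2"
    by (metis norm_ge_zero power_mono power_mult_distrib)
  also have "\<dots> = p\<^sup>2 * (norm (s *v v))\<^sup>2"
    using cw by (simp add: sv norm_transpose_mult_power2 c_def del: transpose_matrix_vector)
  finally have "norm v \<le> p * norm (s *v v)"
    using p by - (rule power2_le_imp_le, auto simp: power_mult_distrib)
  then show "norm v / p \<le> norm (s *v v)" using p by (simp add: field_simps)
qed

text \<open>A need not be symmetric, so eigenvalues are avoided. Every matrix on the segment from
  the identity to A is coercive, hence invertible, so the determinant keeps the sign it has at the
  identity. For the size, coercivity bounds the inverse of A in terms of \<kappa> alone; the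
  determinant is bounded on that compact ball, and the determinants of A and of its inverse multiply
  to 1.\<close>

lemma det_coercive_bound:
  fixes \<kappa> :: real
  assumes "\<kappa> > 0"
  shows "\<exists>C>0. \<forall>A :: real^'n^'n. (\<forall>z. norm z = 1 \<longrightarrow> \<kappa> \<le> z \<bullet> (A *v z)) \<longrightarrow> C \<le> det A"
proof -
  have cont_det: "continuous_on UNIV (det :: real^'n^'n \<Rightarrow> real)"
    unfolding det_def by (intro continuous_intros)
  define R where "R = CARD('n) / \<kappa>"
  have "bounded (det ` cball (0 :: real^'n^'n) R)"
    by (intro compact_imp_bounded compact_continuous_image compact_cball)
       (rule continuous_on_subset[OF cont_det], simp)
  then obtain K where K: "K > 0" "\<And>B :: real^'n^'n. norm B \<le> R \<Longrightarrow> \<bar>det B\<bar> \<le> K"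
    unfolding bounded_pos by (auto simp: mem_cball dist_norm)
  have "1 / K \<le> det A" if A: "\<forall>z. norm z = 1 \<longrightarrow> \<kappa> \<le> z \<bullet> (A *v z)" for A :: "real^'n^'n"
  proof -
    have co: "\<kappa> * (norm z)\<^sup>2 \<le> z \<bullet> (A *v z)" for z
    proof (cases "z = 0")
      case False
      define y where "y = (1 / norm z) *\<^sub>R z"
      have "norm y = 1" using False by (simp add: y_def)
      moreover have z: "z = norm z *\<^sub>R y" using False by (simp add: y_def)
      ultimately have "\<kappa> \<le> y \<bullet> (A *v y)" using A by blast
      then have "(norm z)\<^sup>2 * \<kappa> \<le> (norm z)\<^sup>2 * (y \<bullet> (A *v y))" by (simp add: mult_left_mono)
      also have "\<dots> = z \<bullet> (A *v z)"
        by (subst (2 3) z) (simp add: matrix_vector_mult_scaleR power2_eq_square)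
      finally show ?thesis by (simp add: mult.commute)
    qed simp
    define M where "M t = (1 - t) *\<^sub>R mat 1 + t *\<^sub>R A" for t :: real
    have Mz: "M t *v z = (1 - t) *\<^sub>R z + t *\<^sub>R (A *v z)" for t z
      by (simp add: M_def matrix_vector_mult_add_rdistrib scaleR_matrix_vector_assoc[symmetric])
    have nz: "det (M t) \<noteq> 0" if t: "0 \<le> t" "t \<le> 1" for t
    proof -
      have "z = 0" if "M t *v z = 0" for z
      proof -
        have "0 = z \<bullet> (M t *v z)" using that by simp
        also have "\<dots> = (1 - t) * (norm z)\<^sup>2 + t * (z \<bullet> (A *v z))"
          by (simp add: Mz inner_add_right power2_norm_eq_inner)
        also have "\<dots> \<ge> (1 - t) * (norm z)\<^sup>2 + t * (\<kappa> * (norm z)\<^sup>2)"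
          using t co[of z] by (intro add_left_mono mult_left_mono) auto
        finally have "((1 - t) + t * \<kappa>) * (norm z)\<^sup>2 \<le> 0" by (simp add: algebra_simps)
        moreover have "(1 - t) + t * \<kappa> > 0"
          using t assms by (cases "t = 1") (auto intro!: add_pos_nonneg)
        ultimately show ?thesis by (simp add: mult_le_0_iff)
      qed
      then have "invertible (M t)"
        by (simp add: invertible_left_inverse matrix_left_invertible_ker)
      then show ?thesis by (simp add: invertible_det_nz)
    qed
    have contM: "continuous_on {0..1} (\<lambda>t. det (M t))"
      unfolding M_def by (intro continuous_on_compose2[OF cont_det] continuous_intros) auto
    have pos: "det A > 0"
    proof (rule ccontr)
      assume "\<not> 0 < det A"
      then have "det (M 1) \<le> 0" "0 \<le> det (M 0)" by (auto simp: M_def)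
      then obtain t where "0 \<le> t" "t \<le> 1" "det (M t) = 0"
        using IVT2'[of "\<lambda>t. det (M t)" 1 0 0] contM by auto
      then show False using nz by blast
    qed
    then have inv: "invertible A" by (simp add: invertible_det_nz)
    define B where "B = matrix_inv A"
    have AB: "A ** B = mat 1" using inv by (simp add: B_def matrix_inv_right_inverse)
    have "norm (B *v w) \<le> norm w / \<kappa>" for w
    proof -
      have "\<kappa> * (norm (B *v w))\<^sup>2 \<le> (B *v w) \<bullet> w"
        using co[of "B *v w"] AB by (simp add: matrix_vector_mul_assoc)
      also have "\<dots> \<le> norm (B *v w) * norm w" by (rule norm_cauchy_schwarz)
      finally have "\<kappa> * norm (B *v w) \<le> norm w"
        by (cases "B *v w = 0") (auto simp: power2_eq_square)
      then show ?thesis using assms by (simp add: field_simps)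
    qed
    from this[of "axis _ 1"] have "norm (column l B) \<le> 1 / \<kappa>" for l
      by (simp add: matrix_vector_mult_basis)
    then have "norm B \<le> R"
      using order_trans[OF norm_matrix_le_sum_columns sum_mono[of UNIV "\<lambda>l. norm (column l B)" "\<lambda>_. 1 / \<kappa>"]]
      by (auto simp: R_def)
    then have "\<bar>det B\<bar> \<le> K" by (rule K)
    moreover have "det A * det B = 1" using AB by (metis det_I det_mul)
    ultimately show ?thesis
      using pos K(1) by (smt (verit) divide_le_eq mult_left_mono mult.commute)
  qed
  then show ?thesis using K(1) by (intro exI[of _ "1 / K"]) auto
qed

section \<open>Elementary inequalities\<close>

text \<open>f is only bounded and integrable, so no differential inequality is available. The
  supremum S of f weighted by exp (-2 L t) is finite thanks to B. Because the weight uses twice the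
  rate, the integral term contributes at most S / 2; absorbing it gives S <= 2 A, a bound free of
  B.\<close>

lemma gronwall_bounded:
  fixes f :: "real \<Rightarrow> real"
  assumes L: "0 < L" and A: "0 \<le> A"
    and nonneg: "\<And>t. t \<in> {0..T} \<Longrightarrow> 0 \<le> f t"
    and bdd: "\<And>t. t \<in> {0..T} \<Longrightarrow> f t \<le> B"
    and int: "set_integrable lborel {0..T} f"
    and le: "\<And>t. t \<in> {0..T} \<Longrightarrow> f t \<le> A + L * (LINT u:{0..t}|lborel. f u)"
    and t: "t \<in> {0..T}"
  shows "f t \<le> 2 * A * exp (2 * L * T)"
proof -
  define S where "S = (SUP t\<in>{0..T}. exp (- (2 * L * t)) * f t)"
  have bd: "bdd_above ((\<lambda>t. exp (- (2 * L * t)) * f t) ` {0..T})"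
  proof (rule bdd_aboveI2)
    fix u assume u: "u \<in> {0..T}"
    have "exp (- (2 * L * u)) * f u \<le> 1 * f u"
      using u L nonneg[OF u] by (intro mult_right_mono) auto
    then show "exp (- (2 * L * u)) * f u \<le> B" using bdd[OF u] by simp
  qed
  have S: "exp (- (2 * L * u)) * f u \<le> S" if "u \<in> {0..T}" for u
    unfolding S_def by (rule cSUP_upper[OF that bd])
  have fS: "f u \<le> S * exp (2 * L * u)" if "u \<in> {0..T}" for u
    using S[OF that] by (simp add: exp_minus field_simps)
  have "exp (- (2 * L * t)) * f t \<le> A + S / 2" if t: "t \<in> {0..T}" for t
  proof -
    have hbi: "has_bochner_integral lborel (\<lambda>u. indicator {0..t} u *\<^sub>R (S * exp (2 * L * u)))
        (S / (2 * L) * exp (2 * L * t) - S / (2 * L) * exp (2 * L * 0))"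
      using t L
      by (intro has_bochner_integral_FTC_Icc)
         (auto intro!: derivative_eq_intros continuous_intros
           simp: has_real_derivative_iff_has_vector_derivative[symmetric])
    have "(LINT u:{0..t}|lborel. f u) \<le> (LINT u:{0..t}|lborel. S * exp (2 * L * u))"
    proof (rule set_integral_mono)
      show "set_integrable lborel {0..t} f" using int by (rule set_integrable_subset) (use t in auto)
      show "set_integrable lborel {0..t} (\<lambda>u. S * exp (2 * L * u))"
        unfolding set_integrable_def using hbi by (rule integrable.intros)
    qed (use t fS in auto)
    also have "\<dots> = S / (2 * L) * exp (2 * L * t) - S / (2 * L)"
      unfolding set_lebesgue_integral_def
      using has_bochner_integral_integral_eq[OF hbi] by simp
    finally have "L * (LINT u:{0..t}|lborel. f u) \<le> L * (S / (2 * L) * exp (2 * L * t) - S / (2 * L))"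
      using L by (simp add: mult_left_mono)
    also have "\<dots> = S / 2 * exp (2 * L * t) - S / 2" using L by (simp add: field_simps)
    finally have "f t \<le> A + S / 2 * exp (2 * L * t) - S / 2" using le[OF t] by linarith
    moreover have "0 \<le> S"
      using S[OF t] nonneg[OF t] by (meson exp_ge_zero mult_nonneg_nonneg order_trans)
    ultimately have "f t \<le> A * exp (2 * L * t) + S / 2 * exp (2 * L * t)"
      using A t L by (smt (verit, best) atLeastAtMost_iff mult_less_cancel_left2 one_le_exp_iff zero_le_mult_iff divide_nonneg_nonneg)
    then show ?thesis by (simp add: exp_minus field_simps)
  qed
  then have "S \<le> A + S / 2" unfolding S_def using t by (intro cSUP_least) auto
  then have "S \<le> 2 * A" by simp
  then have "f t \<le> 2 * A * exp (2 * L * t)"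
    using fS[OF t] by (meson exp_ge_zero mult_right_mono order_trans)
  also have "\<dots> \<le> 2 * A * exp (2 * L * T)" using t L A by (intro mult_left_mono) auto
  finally show ?thesis .
qed

text \<open>The fourth-order Maclaurin remainder is nonnegative, so only the cubic term costs
  anything and the bound holds for all real u.\<close>

lemma exp_ge_quadratic: "1 + u + u\<^sup>2 / 2 - \<bar>u\<bar>^3 / 6 \<le> exp (u :: real)"
proof -
  obtain t where "exp u = (\<Sum>m<4. u ^ m / fact m) + exp t / fact 4 * u ^ 4"
    using Maclaurin_exp_le[of u 4] by blast
  moreover have "(\<Sum>m<4. u ^ m / fact m) = 1 + u + u\<^sup>2 / 2 + u^3 / 6"
    by (simp add: eval_nat_numeral)
  moreover have "0 \<le> exp t / fact 4 * u ^ 4" by simp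
  moreover have "- (\<bar>u\<bar>^3) \<le> u^3" by (simp add: abs_if power3_eq_cube)
  ultimately show ?thesis by linarith
qed

text \<open>One term of the exponential series, with 720 = 6!. It turns exponential moments into
  sixth moments.\<close>

lemma power6_le_exp: "x ^ 6 \<le> 720 * (exp x + exp (- x :: real))"
proof -
  obtain t where "exp \<bar>x\<bar> = (\<Sum>m<7. \<bar>x\<bar> ^ m / fact m) + exp t / fact 7 * \<bar>x\<bar> ^ 7"
    using Maclaurin_exp_le[of "\<bar>x\<bar>" 7] by metis
  moreover have "\<bar>x\<bar> ^ 6 / fact 6 \<le> (\<Sum>m<7. \<bar>x\<bar> ^ m / fact m)"
    by (intro member_le_sum) auto
  moreover have "0 \<le> exp t / fact 7 * \<bar>x\<bar> ^ 7" by simp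
  ultimately have "\<bar>x\<bar> ^ 6 / fact 6 \<le> exp \<bar>x\<bar>" by linarith
  then have "\<bar>x\<bar> ^ 6 \<le> 720 * exp \<bar>x\<bar>" by (simp add: fact_numeral field_simps)
  moreover have "exp \<bar>x\<bar> \<le> exp x + exp (- x)" by (simp add: abs_if)
  ultimately show ?thesis by simp
qed

section \<open>The Gaussian barrier function\<close>

text \<open>Lower powers are dominated by 1 + r^4, and exp s >= s^2 / 2 with s = \<alpha> r^2
  handles the fourth power. It makes the Taylor remainder of the barrier uniform in the base
  point.\<close>

lemma gaussian_moment_bound:
  fixes \<alpha> r :: real
  assumes "\<alpha> > 0" "0 \<le> r" "k \<le> 4"
  shows "exp (- (\<alpha> * r\<^sup>2)) * r ^ k \<le> 1 + 2 / \<alpha>\<^sup>2"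
proof -
  have "r ^ k \<le> 1 + r ^ 4"
  proof (cases "r \<le> 1")
    case True
    then show ?thesis using assms power_le_one[of r k] by (smt (verit) zero_le_power)
  next
    case False
    then have "r ^ k \<le> r ^ 4" using assms by (intro power_increasing) auto
    then show ?thesis by simp
  qed
  then have "exp (- (\<alpha> * r\<^sup>2)) * r ^ k \<le> exp (- (\<alpha> * r\<^sup>2)) * (1 + r ^ 4)"
    by (intro mult_left_mono) auto
  also have "\<dots> = exp (- (\<alpha> * r\<^sup>2)) + exp (- (\<alpha> * r\<^sup>2)) * r ^ 4" by (simp add: algebra_simps)
  also have "\<dots> \<le> 1 + 2 / \<alpha>\<^sup>2"
  proof (intro add_mono)
    show "exp (- (\<alpha> * r\<^sup>2)) \<le> 1" using assms by simp
    have "(\<alpha> * r\<^sup>2)\<^sup>2 / 2 \<le> exp (\<alpha> * r\<^sup>2)"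
      using exp_lower_Taylor_quadratic[of "\<alpha> * r\<^sup>2"] assms
      by (smt (verit) mult_nonneg_nonneg zero_le_power2)
    then show "exp (- (\<alpha> * r\<^sup>2)) * r ^ 4 \<le> 2 / \<alpha>\<^sup>2"
      using assms by (simp add: exp_minus field_simps power2_eq_square eval_nat_numeral)
  qed
  finally show ?thesis .
qed

text \<open>Up to the factor -2 \<alpha> this map is the gradient of the Gaussian barrier. The
  constant is 1 from moving the vector under a weight at most 1, plus 2 from the change of the
  weight, which is multiplied by the smaller of the two norms. It does not depend on \<alpha>
  because \<alpha> r^2 exp (-\<alpha> r^2) <= 1.\<close>

lemma gaussian_weight_lipschitz:
  fixes y y' :: "'a :: real_inner"
  assumes "\<alpha> > 0"
  shows "norm (exp (- (\<alpha> * (norm y')\<^sup>2)) *\<^sub>R y' - exp (- (\<alpha> * (norm y)\<^sup>2)) *\<^sub>R y) \<le> 3 * norm (y' - y)"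
proof -
  have *: "norm (exp (- (\<alpha> * (norm y')\<^sup>2)) *\<^sub>R y' - exp (- (\<alpha> * (norm y)\<^sup>2)) *\<^sub>R y) \<le> 3 * norm (y' - y)"
    if le: "norm y \<le> norm y'" for y y' :: 'a
  proof -
    define a b where "a = norm y" and "b = norm y'"
    define g where "g r = exp (- (\<alpha> * r\<^sup>2))" for r :: real
    have ab: "0 \<le> a" "a \<le> b" using le by (auto simp: a_def b_def)
    have "\<bar>g b - g a\<bar> * a \<le> 2 * (b - a)"
    proof (cases "a = b")
      case False
      then have "a < b" using ab by simp
      have "\<exists>\<xi>. a < \<xi> \<and> \<xi> < b \<and> g b - g a = (b - a) * (- 2 * \<alpha> * \<xi> * g \<xi>)"
        unfolding g_def by (intro MVT2 \<open>a < b\<close>) (auto intro!: derivative_eq_intros simp: algebra_simps)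
      then obtain \<xi> where xi: "a < \<xi>" "\<xi> < b" "g b - g a = (b - a) * (- 2 * \<alpha> * \<xi> * g \<xi>)" by blast
      have "\<alpha> * \<xi>\<^sup>2 * g \<xi> \<le> 1"
        using order_trans[OF _ exp_ge_add_one_self[of "\<alpha> * \<xi>\<^sup>2"], of "\<alpha> * \<xi>\<^sup>2"]
        by (simp add: g_def exp_minus field_simps)
      have "\<bar>g b - g a\<bar> * a = (b - a) * (2 * \<alpha> * \<xi> * g \<xi>) * a"
        using xi ab assms by (simp add: abs_mult g_def)
      also have "\<dots> \<le> (b - a) * (2 * \<alpha> * \<xi> * g \<xi>) * \<xi>"
        using xi ab assms by (intro mult_left_mono) (auto simp: g_def)
      also have "\<dots> = 2 * (b - a) * (\<alpha> * \<xi>\<^sup>2 * g \<xi>)" by (simp add: power2_eq_square)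
      also have "\<dots> \<le> 2 * (b - a) * 1"
        using \<open>\<alpha> * \<xi>\<^sup>2 * g \<xi> \<le> 1\<close> ab by (intro mult_left_mono) auto
      finally show ?thesis by simp
    qed simp
    moreover have "b - a \<le> norm (y' - y)" unfolding a_def b_def by (rule norm_triangle_ineq2)
    ultimately have 1: "\<bar>g b - g a\<bar> * a \<le> 2 * norm (y' - y)" by simp
    have "norm (g b *\<^sub>R y' - g a *\<^sub>R y) = norm (g b *\<^sub>R (y' - y) + (g b - g a) *\<^sub>R y)"
      by (simp add: algebra_simps)
    also have "\<dots> \<le> g b * norm (y' - y) + \<bar>g b - g a\<bar> * a"
      by (rule norm_triangle_le) (simp add: a_def g_def)
    also have "\<dots> \<le> 1 * norm (y' - y) + 2 * norm (y' - y)"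
      using assms by (intro add_mono 1 mult_right_mono) (auto simp: g_def)
    finally show ?thesis by (simp add: g_def a_def b_def)
  qed
  show ?thesis
    using *[of y y'] *[of y' y] by (cases "norm y \<le> norm y'") (auto simp: norm_minus_commute)
qed

text \<open>Here x plays the role of a martingale increment and w of a drift increment, so the
  expansion is of second order in x and of first order in w. In x, the barrier at y + x is its value
  at y times exp u with u = -2 \<alpha> y.x - \<alpha> |x|^2, to which the quadratic lower bound
  applies; the powers of |y| in the remainder are absorbed by the Gaussian weight. In w, the
  inequality exp v >= 1 + v gives a linear term with the gradient at y + x, which the Lipschitz
  bound moves back to y at the price |x| |w|. The power |x|^6 is the cube of the term |x|^2 in
  u.\<close>

lemma gaussian_barrier_taylor:
  assumes "\<alpha> > 0"
  shows "\<exists>C\<ge>0. \<forall>y x w :: 'a :: real_inner.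
    exp (- (\<alpha> * (norm y)\<^sup>2)) * (1 - 2 * \<alpha> * (y \<bullet> x) - \<alpha> * (norm x)\<^sup>2 + 2 * \<alpha>\<^sup>2 * (y \<bullet> x)\<^sup>2)
      - 2 * \<alpha> * exp (- (\<alpha> * (norm y)\<^sup>2)) * (y \<bullet> w)
      - C * (norm x ^ 3 + norm x ^ 6 + norm x * norm w + (norm w)\<^sup>2)
    \<le> exp (- (\<alpha> * (norm (y + x + w))\<^sup>2))"
proof -
  define c where "c = 1 + 2 / \<alpha>\<^sup>2"
  define C where "C = 2 * \<alpha>\<^sup>2 * c + 6 * \<alpha>^3 * c + \<alpha>^3 + 6 * \<alpha> + \<alpha>"
  have c: "c \<ge> 0" by (simp add: c_def)
  have C: "C \<ge> 0" using assms c by (simp add: C_def)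
  have "exp (- (\<alpha> * (norm y)\<^sup>2)) * (1 - 2 * \<alpha> * (y \<bullet> x) - \<alpha> * (norm x)\<^sup>2 + 2 * \<alpha>\<^sup>2 * (y \<bullet> x)\<^sup>2)
      - 2 * \<alpha> * exp (- (\<alpha> * (norm y)\<^sup>2)) * (y \<bullet> w)
      - C * (norm x ^ 3 + norm x ^ 6 + norm x * norm w + (norm w)\<^sup>2)
    \<le> exp (- (\<alpha> * (norm (y + x + w))\<^sup>2))" for y x w :: 'a
  proof -
    define g where "g = exp (- (\<alpha> * (norm y)\<^sup>2))"
    define g' where "g' = exp (- (\<alpha> * (norm (y + x))\<^sup>2))"
    define u where "u = - 2 * \<alpha> * (y \<bullet> x) - \<alpha> * (norm x)\<^sup>2"
    define r h where "r = norm y" and "h = norm x"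
    have g: "0 \<le> g" "0 \<le> g'" "g' \<le> 1" using assms by (auto simp: g_def g'_def)
    have rh: "0 \<le> r" "0 \<le> h" by (auto simp: r_def h_def)
    have yx: "\<bar>y \<bullet> x\<bar> \<le> r * h" unfolding r_def h_def by (rule Cauchy_Schwarz_ineq2)
    have g'u: "g' = g * exp u"
      unfolding g'_def g_def u_def mult_exp_exp
      by (simp add: power2_norm_eq_inner inner_add_left inner_add_right inner_commute algebra_simps)
    have "\<bar>u\<bar> \<le> 2 * \<alpha> * (r * h) + \<alpha> * h\<^sup>2"
    proof -
      have "\<bar>u\<bar> \<le> \<bar>2 * \<alpha> * (y \<bullet> x)\<bar> + \<bar>\<alpha> * (norm x)\<^sup>2\<bar>" unfolding u_def by linarith
      also have "\<dots> = 2 * \<alpha> * \<bar>y \<bullet> x\<bar> + \<alpha> * h\<^sup>2" using assms by (simp add: abs_mult h_def)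
      also have "\<dots> \<le> 2 * \<alpha> * (r * h) + \<alpha> * h\<^sup>2" using assms yx by simp
      finally show ?thesis .
    qed
    then have "\<bar>u\<bar>^3 \<le> (2 * \<alpha> * (r * h) + \<alpha> * h\<^sup>2)^3" by (intro power_mono) auto
    also have "\<dots> \<le> 4 * ((2 * \<alpha> * (r * h))^3 + (\<alpha> * h\<^sup>2)^3)"
    proof -
      have cube: "(p + q)^3 \<le> 4 * (p^3 + q^3)" if "0 \<le> p" "0 \<le> q" for p q :: real
      proof -
        have "4 * (p^3 + q^3) - (p + q)^3 = 3 * (p + q) * (p - q)\<^sup>2"
          by (simp add: power3_eq_cube power2_eq_square algebra_simps)
        also have "\<dots> \<ge> 0" using that by simp
        finally show ?thesis by simp
      qed
      show ?thesis using assms rh by (intro cube) auto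
    qed
    finally have u3: "\<bar>u\<bar>^3 \<le> 32 * \<alpha>^3 * r^3 * h^3 + 4 * \<alpha>^3 * h^6"
      by (simp add: power_mult_distrib algebra_simps flip: power_mult)
    have gr: "g * r ^ k \<le> c" if "k \<le> 4" for k
      unfolding g_def r_def c_def by (rule gaussian_moment_bound) (use assms that in auto)
    \<comment> \<open>The cross term of the square is of order |y| |x|^3 and goes to the remainder;
      the term |x|^4 is nonnegative and is dropped.\<close>
    have u2: "u\<^sup>2 / 2 \<ge> 2 * \<alpha>\<^sup>2 * (y \<bullet> x)\<^sup>2 - 2 * \<alpha>\<^sup>2 * r * h^3"
    proof -
      have "u\<^sup>2 / 2 = 2 * \<alpha>\<^sup>2 * (y \<bullet> x)\<^sup>2 + 2 * \<alpha>\<^sup>2 * ((y \<bullet> x) * h\<^sup>2) + \<alpha>\<^sup>2 * h^4 / 2"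
        by (simp add: u_def h_def power2_eq_square eval_nat_numeral algebra_simps)
      moreover have "\<alpha>\<^sup>2 * h^4 / 2 \<ge> 0" by simp
      moreover have "(y \<bullet> x) * h\<^sup>2 \<ge> - (r * h * h\<^sup>2)"
        using yx by (metis abs_le_iff minus_mult_left mult_right_mono minus_le_iff zero_le_power2)
      then have "2 * \<alpha>\<^sup>2 * ((y \<bullet> x) * h\<^sup>2) \<ge> 2 * \<alpha>\<^sup>2 * (- (r * h * h\<^sup>2))"
        by (intro mult_left_mono) auto
      ultimately show ?thesis by (simp add: eval_nat_numeral algebra_simps)
    qed
    have "g * (1 + u + 2 * \<alpha>\<^sup>2 * (y \<bullet> x)\<^sup>2) - (2 * \<alpha>\<^sup>2 * c + 6 * \<alpha>^3 * c) * h^3 - \<alpha>^3 * h^6 \<le> g'"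
    proof -
      have "0 \<le> \<alpha>^3 * r^3 * h^3" "0 \<le> \<alpha>^3 * h^6" using rh assms by auto
      then have "\<bar>u\<bar>^3 / 6 \<le> 6 * (\<alpha>^3 * r^3 * h^3) + \<alpha>^3 * h^6" using u3 by linarith
      then have "(1 + u + 2 * \<alpha>\<^sup>2 * (y \<bullet> x)\<^sup>2) - 2 * \<alpha>\<^sup>2 * r * h^3 - 6 * (\<alpha>^3 * r^3 * h^3) - \<alpha>^3 * h^6
          \<le> 1 + u + u\<^sup>2 / 2 - \<bar>u\<bar>^3 / 6"
        using u2 by linarith
      then have "g * ((1 + u + 2 * \<alpha>\<^sup>2 * (y \<bullet> x)\<^sup>2) - 2 * \<alpha>\<^sup>2 * r * h^3 - 6 * (\<alpha>^3 * r^3 * h^3) - \<alpha>^3 * h^6)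
          \<le> g * (1 + u + u\<^sup>2 / 2 - \<bar>u\<bar>^3 / 6)"
        using g(1) by (rule mult_left_mono)
      also have "\<dots> \<le> g'"
        unfolding g'u using g by (intro mult_left_mono exp_ge_quadratic)
      finally have 1: "g * (1 + u + 2 * \<alpha>\<^sup>2 * (y \<bullet> x)\<^sup>2) - 2 * \<alpha>\<^sup>2 * h^3 * (g * r^1)
          - 6 * \<alpha>^3 * h^3 * (g * r^3) - \<alpha>^3 * h^6 * (g * r^0) \<le> g'"
        by (simp add: right_diff_distrib mult.assoc mult.left_commute mult.commute)
      have "2 * \<alpha>\<^sup>2 * h^3 * (g * r^1) \<le> 2 * \<alpha>\<^sup>2 * h^3 * c"
        using rh by (intro mult_left_mono gr) auto
      moreover have "6 * \<alpha>^3 * h^3 * (g * r^3) \<le> 6 * \<alpha>^3 * h^3 * c"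
        using rh assms by (intro mult_left_mono gr) auto
      moreover have "\<alpha>^3 * h^6 * (g * r^0) \<le> \<alpha>^3 * h^6 * 1"
        using rh assms by (intro mult_left_mono) (auto simp: g_def)
      moreover have "(2 * \<alpha>\<^sup>2 * c + 6 * \<alpha>^3 * c) * h^3 = 2 * \<alpha>\<^sup>2 * h^3 * c + 6 * \<alpha>^3 * h^3 * c"
        by (simp add: algebra_simps)
      ultimately show ?thesis using 1 by linarith
    qed
    moreover have "g' - 2 * \<alpha> * (g * (y \<bullet> w)) - 6 * \<alpha> * h * norm w - \<alpha> * (norm w)\<^sup>2
      \<le> exp (- (\<alpha> * (norm (y + x + w))\<^sup>2))"
    proof -
      have "exp (- (\<alpha> * (norm (y + x + w))\<^sup>2)) = g' * exp (- 2 * \<alpha> * ((y + x) \<bullet> w) - \<alpha> * (norm w)\<^sup>2)"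
        unfolding g'_def mult_exp_exp
        by (simp add: power2_norm_eq_inner inner_add_left inner_add_right inner_commute algebra_simps)
      also have "\<dots> \<ge> g' * (1 + (- 2 * \<alpha> * ((y + x) \<bullet> w) - \<alpha> * (norm w)\<^sup>2))"
        using g by (intro mult_left_mono exp_ge_add_one_self)
      finally have 1: "exp (- (\<alpha> * (norm (y + x + w))\<^sup>2))
          \<ge> g' - 2 * \<alpha> * (g' *\<^sub>R (y + x) \<bullet> w) - \<alpha> * (g' * (norm w)\<^sup>2)"
        by (simp add: algebra_simps)
      have "\<alpha> * (g' * (norm w)\<^sup>2) \<le> \<alpha> * (1 * (norm w)\<^sup>2)"
        using assms g by (intro mult_left_mono mult_right_mono) auto
      moreover have "g' *\<^sub>R (y + x) \<bullet> w \<le> g *\<^sub>R y \<bullet> w + 3 * h * norm w"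
      proof -
        have "(g' *\<^sub>R (y + x) - g *\<^sub>R y) \<bullet> w \<le> norm (g' *\<^sub>R (y + x) - g *\<^sub>R y) * norm w"
          by (rule norm_cauchy_schwarz)
        also have "\<dots> \<le> 3 * norm ((y + x) - y) * norm w"
          unfolding g_def g'_def by (intro mult_right_mono gaussian_weight_lipschitz assms) auto
        finally show ?thesis by (simp add: inner_diff_left h_def)
      qed
      then have "2 * \<alpha> * (g' *\<^sub>R (y + x) \<bullet> w) \<le> 2 * \<alpha> * (g *\<^sub>R y \<bullet> w + 3 * h * norm w)"
        using assms by (intro mult_left_mono) auto
      ultimately show ?thesis using 1 by (simp add: algebra_simps)
    qed
    moreover have "C * (h ^ 3 + h ^ 6 + h * norm w + (norm w)\<^sup>2)
        \<ge> (2 * \<alpha>\<^sup>2 * c + 6 * \<alpha>^3 * c) * h^3 + \<alpha>^3 * h^6 + 6 * \<alpha> * (h * norm w) + \<alpha> * (norm w)\<^sup>2"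
      unfolding distrib_left using assms c rh
      by (intro add_mono mult_right_mono) (auto simp: C_def)
    ultimately show ?thesis unfolding g_def[symmetric] h_def[symmetric] u_def
      by (simp add: algebra_simps flip: h_def)
  qed
  then show ?thesis using C by blast
qed

section \<open>Convergence in mean square and compactness\<close>

text \<open>Young's inequality with a weight e bounds the difference of the squares pointwise by a
  large multiple of the error plus a small multiple of the limit; e is fixed before k is
  chosen.\<close>

lemma integral_norm_power2_tendsto:
  fixes f :: "'a \<Rightarrow> 'b :: {banach, second_countable_topology}"
  assumes [measurable]: "\<And>k. F k \<in> borel_measurable N" "f \<in> borel_measurable N"
    and F: "\<And>k. integrable N (\<lambda>x. (norm (F k x - f x))\<^sup>2)"
    and f: "integrable N (\<lambda>x. (norm (f x))\<^sup>2)"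
    and lim: "(\<lambda>k. \<integral>x. (norm (F k x - f x))\<^sup>2 \<partial>N) \<longlonglongrightarrow> 0"
  shows "\<And>k. integrable N (\<lambda>x. (norm (F k x))\<^sup>2)"
    and "(\<lambda>k. \<integral>x. (norm (F k x))\<^sup>2 \<partial>N) \<longlonglongrightarrow> (\<integral>x. (norm (f x))\<^sup>2 \<partial>N)"
proof -
  show int: "integrable N (\<lambda>x. (norm (F k x))\<^sup>2)" for k
  proof (rule Bochner_Integration.integrable_bound)
    show "integrable N (\<lambda>x. 2 * (norm (F k x - f x))\<^sup>2 + 2 * (norm (f x))\<^sup>2)" using F f by simp
    have "(norm (F k x))\<^sup>2 \<le> 2 * (norm (F k x - f x))\<^sup>2 + 2 * (norm (f x))\<^sup>2" for x
    proof -
      have "norm (F k x) \<le> norm (F k x - f x) + norm (f x)" by (metis diff_add_cancel norm_triangle_ineq)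
      then have "(norm (F k x))\<^sup>2 \<le> (norm (F k x - f x) + norm (f x))\<^sup>2" by (simp add: power_mono)
      also have "\<dots> \<le> 2 * (norm (F k x - f x))\<^sup>2 + 2 * (norm (f x))\<^sup>2"
        using sum_squares_bound[of "norm (F k x - f x)" "norm (f x)"] by (simp add: power2_sum)
      finally show ?thesis .
    qed
    then show "AE x in N. norm ((norm (F k x))\<^sup>2) \<le> norm (2 * (norm (F k x - f x))\<^sup>2 + 2 * (norm (f x))\<^sup>2)"
      by auto
  qed simp
  define A where "A = (\<integral>x. (norm (f x))\<^sup>2 \<partial>N)"
  define a where "a k = (\<integral>x. (norm (F k x - f x))\<^sup>2 \<partial>N)" for k
  have A0: "A \<ge> 0" by (simp add: A_def)
  have key: "\<bar>(\<integral>x. (norm (F k x))\<^sup>2 \<partial>N) - A\<bar> \<le> (1 + 1 / e) * a k + e * A" if e: "e > 0" for e k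
  proof -
    have pw: "\<bar>(norm (F k x))\<^sup>2 - (norm (f x))\<^sup>2\<bar> \<le> (1 + 1 / e) * (norm (F k x - f x))\<^sup>2 + e * (norm (f x))\<^sup>2" for x
    proof -
      define p q d where "p = norm (F k x)" and "q = norm (f x)" and "d = norm (F k x - f x)"
      have "\<bar>p - q\<bar> \<le> d" unfolding p_def q_def d_def by (rule norm_triangle_ineq3)
      moreover have "p \<ge> 0" "q \<ge> 0" "d \<ge> 0" by (auto simp: p_def q_def d_def)
      moreover have "\<bar>p\<^sup>2 - q\<^sup>2\<bar> = \<bar>p - q\<bar> * (p + q)"
      proof -
        have "p\<^sup>2 - q\<^sup>2 = (p - q) * (p + q)" by (simp add: power2_eq_square algebra_simps)
        then show ?thesis using \<open>p \<ge> 0\<close> \<open>q \<ge> 0\<close> by (simp add: abs_mult)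
      qed
      moreover have "\<bar>p - q\<bar> * (p + q) \<le> d * (d + 2 * q)"
        using calculation by (intro mult_mono) auto
      moreover have "2 * (d * q) \<le> d\<^sup>2 / e + e * q\<^sup>2"
      proof -
        have "0 \<le> (d - e * q)\<^sup>2 / e" using e by simp
        also have "\<dots> = d\<^sup>2 / e + e * q\<^sup>2 - 2 * (d * q)" using e by (simp add: power2_eq_square field_simps)
        finally show ?thesis by simp
      qed
      ultimately show ?thesis unfolding p_def[symmetric] q_def[symmetric] d_def[symmetric]
        by (simp add: algebra_simps power2_eq_square)
    qed
    have "\<bar>(\<integral>x. (norm (F k x))\<^sup>2 \<partial>N) - A\<bar> = \<bar>\<integral>x. (norm (F k x))\<^sup>2 - (norm (f x))\<^sup>2 \<partial>N\<bar>"
      unfolding A_def using int f by simp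
    also have "\<dots> \<le> (\<integral>x. \<bar>(norm (F k x))\<^sup>2 - (norm (f x))\<^sup>2\<bar> \<partial>N)" by (rule integral_abs_bound)
    also have "\<dots> \<le> (\<integral>x. (1 + 1 / e) * (norm (F k x - f x))\<^sup>2 + e * (norm (f x))\<^sup>2 \<partial>N)"
      using int f F pw by (intro integral_mono) auto
    also have "\<dots> = (1 + 1 / e) * a k + e * A"
      unfolding a_def A_def using f F by simp
    finally show ?thesis .
  qed
  have "(\<lambda>k. \<integral>x. (norm (F k x))\<^sup>2 \<partial>N) \<longlonglongrightarrow> A"
  proof (rule LIMSEQ_I)
    fix r :: real assume r: "0 < r"
    define e where "e = r / (2 * (A + 1))"
    have e: "e > 0" "e * A < r / 2 + 0"
      using r A0 by (auto simp: e_def field_simps)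
    have "(\<lambda>k. (1 + 1 / e) * a k) \<longlonglongrightarrow> (1 + 1 / e) * 0"
      unfolding a_def by (intro tendsto_intros lim)
    then have "(\<lambda>k. (1 + 1 / e) * a k) \<longlonglongrightarrow> 0" by simp
    from order_tendstoD(2)[OF this, of "r / 2"] r
    obtain n0 where "\<forall>n\<ge>n0. (1 + 1 / e) * a n < r / 2" by (auto simp: eventually_sequentially)
    then have "\<forall>n\<ge>n0. norm ((\<integral>x. (norm (F n x))\<^sup>2 \<partial>N) - A) < r"
      using key[OF e(1)] e(2) by (smt (verit) field_sum_of_halves real_norm_def)
    then show "\<exists>no. \<forall>n\<ge>no. norm ((\<integral>x. (norm (F n x))\<^sup>2 \<partial>N) - A) < r" by blast
  qed
  then show "(\<lambda>k. \<integral>x. (norm (F k x))\<^sup>2 \<partial>N) \<longlonglongrightarrow> (\<integral>x. (norm (f x))\<^sup>2 \<partial>N)"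
    by (simp add: A_def)
qed

text \<open>f is not assumed continuous: the local lower bounds replace continuity of the
  information matrix in the parameter, which is never established.\<close>

lemma compact_locally_bounded_below:
  fixes f :: "'a :: topological_space \<Rightarrow> real"
  assumes S: "compact S"
    and loc: "\<And>x. x \<in> S \<Longrightarrow> \<exists>U \<kappa>. open U \<and> x \<in> U \<and> 0 < \<kappa> \<and> (\<forall>y\<in>S \<inter> U. \<kappa> \<le> f y)"
  shows "\<exists>\<kappa>>0. \<forall>y\<in>S. \<kappa> \<le> f y"
proof -
  obtain U \<kappa> where U: "\<And>x. x \<in> S \<Longrightarrow> open (U x) \<and> x \<in> U x \<and> 0 < \<kappa> x \<and> (\<forall>y\<in>S \<inter> U x. \<kappa> x \<le> f y)"
    using loc by metis
  obtain I where I: "I \<subseteq> S" "finite I" "S \<subseteq> (\<Union>x\<in>I. U x)"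
    using compactE_image[OF S, of S U] U by (metis UN_I subsetI)
  \<comment> \<open>The inserted 1 gives the minimum a value when the subcover is empty.\<close>
  define m where "m = Min (insert 1 (\<kappa> ` I))"
  have "m > 0" unfolding m_def using I U by (subst Min_gr_iff) auto
  moreover have "m \<le> f y" if "y \<in> S" for y
  proof -
    from that I(3) have "y \<in> (\<Union>x\<in>I. U x)" by (rule subsetD[rotated])
    then obtain x where x: "x \<in> I" "y \<in> U x" by (rule UN_E)
    then have "m \<le> \<kappa> x" unfolding m_def using I by (intro Min_le) auto
    moreover have "\<kappa> x \<le> f y" using U[of x] x(1,2) I(1) that by (meson IntI subsetD)
    ultimately show ?thesis by (rule order_trans)
  qed
  ultimately show ?thesis by blast
qed

section \<open>Measurability of matrix operations\<close>

lemma borel_measurable_vec_nth' [measurable (raw)]: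
  fixes f :: "'a \<Rightarrow> ('b :: {second_countable_topology, real_normed_vector})^'n"
  assumes "f \<in> borel_measurable M"
  shows "(\<lambda>x. f x $ i) \<in> borel_measurable M"
  using assms by (rule borel_measurable_continuous_on[OF linear_continuous_on[OF bounded_linear_vec_nth]])

lemma bounded_bilinear_matrix_vector_mult:
  "bounded_bilinear (\<lambda>(A :: real^'n^'m) x. A *v x)"
  by standard
     (auto simp: matrix_vector_mult_add_rdistrib matrix_vector_right_distrib matrix_vector_mult_scaleR
       scaleR_matrix_vector_assoc intro!: exI[of _ 1] norm_matrix_vector_mult_le)

lemma bounded_bilinear_matrix_mult:
  "bounded_bilinear (\<lambda>(A :: real^'n^'m) (B :: real^'k^'n). A ** B)"
proof
  fix A A' :: "real^'n^'m" and B B' :: "real^'k^'n" and r :: real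
  show "(A + A') ** B = A ** B + A' ** B" "A ** (B + B') = A ** B + A ** B'"
    "(r *\<^sub>R A) ** B = r *\<^sub>R (A ** B)" "A ** (r *\<^sub>R B) = r *\<^sub>R (A ** B)"
    by (simp_all add: matrix_matrix_mult_def vec_eq_iff sum.distrib algebra_simps sum_distrib_left)
  show "\<exists>K. \<forall>(A :: real^'n^'m) (B :: real^'k^'n). norm (A ** B) \<le> norm A * norm B * K"
    by (auto intro!: exI[of _ 1] norm_matrix_mult_le)
qed

lemma borel_measurable_matrix_vector_mult [measurable (raw)]:
  fixes A :: "'a \<Rightarrow> real^'n^'m"
  assumes [measurable]: "A \<in> borel_measurable M" "x \<in> borel_measurable M"
  shows "(\<lambda>\<omega>. A \<omega> *v x \<omega>) \<in> borel_measurable M"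
proof -
  have "continuous_on UNIV (\<lambda>p :: (real^'n^'m) \<times> (real^'n). fst p *v snd p)"
    by (intro bounded_bilinear.continuous_on[OF bounded_bilinear_matrix_vector_mult]
        continuous_on_fst continuous_on_snd continuous_on_id)
  from borel_measurable_continuous_on[OF this borel_measurable_Pair[OF assms]]
  show ?thesis by simp
qed

lemma borel_measurable_matrix_mult [measurable (raw)]:
  fixes A :: "'a \<Rightarrow> real^'n^'m" and B :: "'a \<Rightarrow> real^'k^'n"
  assumes [measurable]: "A \<in> borel_measurable M" "B \<in> borel_measurable M"
  shows "(\<lambda>\<omega>. A \<omega> ** B \<omega>) \<in> borel_measurable M"
proof -
  have "continuous_on UNIV (\<lambda>p :: (real^'n^'m) \<times> (real^'k^'n). fst p ** snd p)"
    by (intro bounded_bilinear.continuous_on[OF bounded_bilinear_matrix_mult]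
        continuous_on_fst continuous_on_snd continuous_on_id)
  from borel_measurable_continuous_on[OF this borel_measurable_Pair[OF assms]]
  show ?thesis by simp
qed

section \<open>Centred isotropic Gaussian vectors\<close>

text \<open>Written with the same density as in \<open>brownian_motion\<close>, so that the law of
  an increment is this measure by unfolding.\<close>

definition gaussian :: "real \<Rightarrow> (real^'d) measure" where
  "gaussian \<tau> = density lborel (\<lambda>y. ennreal (\<Prod>i\<in>UNIV. normal_density 0 (sqrt \<tau>) (y $ i)))"

lemma sets_gaussian [measurable_cong, simp]: "sets (gaussian \<tau>) = sets borel"
  and space_gaussian [simp]: "space (gaussian \<tau>) = UNIV"
  by (simp_all add: gaussian_def)

lemma prod_Basis_vec:
  fixes h :: "real^'d \<Rightarrow> real"
  shows "(\<Prod>b\<in>Basis. h b) = (\<Prod>i\<in>(UNIV :: 'd set). h (axis i 1))"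
proof -
  have inj: "inj (\<lambda>i :: 'd. axis i (1 :: real))" by (auto simp: inj_on_def axis_eq_axis)
  have "(Basis :: (real^'d) set) = range (\<lambda>i. axis i 1)" by (auto simp: Basis_vec_def)
  then have "(\<Prod>b\<in>Basis. h b) = prod h (range (\<lambda>i. axis i 1))" by simp
  also have "\<dots> = (\<Prod>i\<in>(UNIV :: 'd set). h (axis i 1))"
    by (subst prod.reindex[OF inj]) simp
  finally show ?thesis .
qed

text \<open>Lebesgue measure on vectors is the image of a product measure indexed by the basis
  vectors, where Fubini applies; coordinate i of a vector is its coefficient at
  \<open>axis i 1\<close>.\<close>

lemma lborel_integral_prod_vec:
  fixes f :: "'d :: finite \<Rightarrow> real \<Rightarrow> real"
  assumes int: "\<And>i. integrable lborel (f i)"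
  shows "integrable lborel (\<lambda>y :: real^'d. \<Prod>i\<in>UNIV. f i (y $ i))"
    and "(\<integral>y. (\<Prod>i\<in>UNIV. f i (y $ i)) \<partial>(lborel :: (real^'d) measure)) = (\<Prod>i\<in>UNIV. integral\<^sup>L lborel (f i))"
proof -
  interpret product_sigma_finite "\<lambda>_ :: real^'d. lborel :: real measure" ..
  let ?P = "Pi\<^sub>M (Basis :: (real^'d) set) (\<lambda>_. lborel :: real measure)"
  let ?h = "\<lambda>g :: real^'d \<Rightarrow> real. \<Sum>b\<in>Basis. g b *\<^sub>R b"
  have [measurable]: "f i \<in> borel_measurable borel" for i
    using borel_measurable_integrable[OF int[of i]] by simp
  have eq: "(\<Prod>i\<in>UNIV. f i (?h g $ i)) = (\<Prod>b\<in>Basis. f (axis_index b) (g b))" for g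
  proof -
    have "?h g $ i = g (axis i 1)" for i
    proof -
      have "?h g $ i = ?h g \<bullet> axis i 1" by (simp add: inner_axis)
      also have "\<dots> = g (axis i 1)" by (rule inner_sum_left_Basis) (simp add: axis_in_Basis_iff)
      finally show ?thesis .
    qed
    then show ?thesis unfolding prod_Basis_vec by simp
  qed
  have [measurable]: "?h \<in> borel_measurable ?P"
    by (intro borel_measurable_sum borel_measurable_scaleR measurable_component_singleton) auto
  have "integrable ?P (\<lambda>g. \<Prod>b\<in>Basis. f (axis_index b) (g b))"
    by (intro product_integrable_prod int) auto
  then show "integrable lborel (\<lambda>y :: real^'d. \<Prod>i\<in>UNIV. f i (y $ i))"
    by (subst lborel_eq) (simp add: integrable_distr_eq eq del: sum_component)
  have "(\<integral>y. (\<Prod>i\<in>UNIV. f i (y $ i)) \<partial>(lborel :: (real^'d) measure)) = (\<integral>g. (\<Prod>b\<in>Basis. f (axis_index b) (g b)) \<partial>?P)"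
    by (subst lborel_eq) (simp add: integral_distr eq del: sum_component)
  also have "\<dots> = (\<Prod>b\<in>(Basis :: (real^'d) set). integral\<^sup>L lborel (f (axis_index b)))"
    by (rule product_integral_prod[OF finite_Basis]) (rule int)
  also have "\<dots> = (\<Prod>i\<in>UNIV. integral\<^sup>L lborel (f i))" unfolding prod_Basis_vec by simp
  finally show "(\<integral>y. (\<Prod>i\<in>UNIV. f i (y $ i)) \<partial>(lborel :: (real^'d) measure)) = (\<Prod>i\<in>UNIV. integral\<^sup>L lborel (f i))" .
qed

lemma gaussian_integral_prod:
  fixes f :: "'d :: finite \<Rightarrow> real \<Rightarrow> real"
  assumes [measurable]: "\<And>i. f i \<in> borel_measurable borel"
    and int: "\<And>i. integrable lborel (\<lambda>x. normal_density 0 (sqrt \<tau>) x * f i x)"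
  shows "integrable (gaussian \<tau>) (\<lambda>y :: real^'d. \<Prod>i\<in>UNIV. f i (y $ i))"
    and "(\<integral>y. (\<Prod>i\<in>UNIV. f i (y $ i)) \<partial>(gaussian \<tau> :: (real^'d) measure))
      = (\<Prod>i\<in>UNIV. \<integral>x. normal_density 0 (sqrt \<tau>) x * f i x \<partial>lborel)"
  using lborel_integral_prod_vec[OF int]
  unfolding gaussian_def by (simp_all add: integrable_density integral_density prod_nonneg prod.distrib)

lemma normal_moments:
  assumes "\<tau> > 0"
  shows "has_bochner_integral lborel (\<lambda>x. normal_density 0 (sqrt \<tau>) x * x) 0"
    and "has_bochner_integral lborel (\<lambda>x. normal_density 0 (sqrt \<tau>) x * x\<^sup>2) \<tau>"
  using normal_moment_odd[of "sqrt \<tau>" 0 0] normal_moment_even[of "sqrt \<tau>" 0 1] assms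
  by (simp_all add: field_simps power2_eq_square)

text \<open>Completing the square in each coordinate. It yields the total mass and the exponential
  moments of simple integrals.\<close>

lemma gaussian_mgf:
  fixes l :: "real^'d"
  assumes "\<tau> > 0"
  shows "(\<integral>\<^sup>+y. ennreal (exp (l \<bullet> y)) \<partial>gaussian \<tau>) = ennreal (exp (\<tau> * (norm l)\<^sup>2 / 2))"
proof -
  have eq: "normal_density 0 (sqrt \<tau>) x * exp (a * x)
      = exp (\<tau> * a\<^sup>2 / 2) * normal_density (\<tau> * a) (sqrt \<tau>) x" for a x
  proof -
    have "- x\<^sup>2 / (2 * \<tau>) + a * x = \<tau> * a\<^sup>2 / 2 + - (x - \<tau> * a)\<^sup>2 / (2 * \<tau>)"
      using assms by (simp add: field_simps power2_eq_square)
    then have "exp (- x\<^sup>2 / (2 * \<tau>)) * exp (a * x) = exp (\<tau> * a\<^sup>2 / 2) * exp (- (x - \<tau> * a)\<^sup>2 / (2 * \<tau>))"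
      by (simp only: mult_exp_exp)
    then show ?thesis using assms by (simp add: normal_density_def field_simps)
  qed
  have st: "sqrt \<tau> > 0" using assms by simp
  have int: "integrable lborel (\<lambda>x. normal_density 0 (sqrt \<tau>) x * exp (a * x))" for a
    unfolding eq using st by simp
  have val: "(\<integral>x. normal_density 0 (sqrt \<tau>) x * exp (a * x) \<partial>lborel) = exp (\<tau> * a\<^sup>2 / 2)" for a
    unfolding eq using st by simp
  have e: "exp (l \<bullet> y) = (\<Prod>i\<in>UNIV. exp (l $ i * y $ i))" for y
    by (simp add: inner_vec_def exp_sum)
  have "(\<integral>\<^sup>+y. ennreal (exp (l \<bullet> y)) \<partial>gaussian \<tau>) = ennreal (\<integral>y. exp (l \<bullet> y) \<partial>gaussian \<tau>)"
    unfolding e by (intro nn_integral_eq_integral gaussian_integral_prod int) (auto intro!: prod_nonneg)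
  also have "(\<integral>y. exp (l \<bullet> y) \<partial>gaussian \<tau>) = (\<Prod>i\<in>UNIV. exp (\<tau> * (l $ i)\<^sup>2 / 2))"
    unfolding e by (subst gaussian_integral_prod) (auto simp: int val)
  also have "\<dots> = exp (\<tau> * (norm l)\<^sup>2 / 2)"
    by (simp add: exp_sum[symmetric] norm_vec_def L2_set_def sum_nonneg sum_distrib_left sum_divide_distrib)
  finally show ?thesis .
qed

lemma gaussian_moments:
  assumes "\<tau> > 0"
  shows "prob_space (gaussian \<tau> :: (real^'d) measure)"
    and "integrable (gaussian \<tau>) (\<lambda>y :: real^'d. y $ j)"
    and "(\<integral>y. y $ j \<partial>(gaussian \<tau> :: (real^'d) measure)) = 0"
    and "integrable (gaussian \<tau>) (\<lambda>y :: real^'d. y $ j * y $ k)"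
    and "(\<integral>y. y $ j * y $ k \<partial>(gaussian \<tau> :: (real^'d) measure)) = (if j = k then \<tau> else 0)"
proof -
  have st: "sqrt \<tau> > 0" using assms by simp
  note nm = normal_moments[OF assms]
  note nmi = has_bochner_integral_iff[THEN iffD1, OF nm(1)] has_bochner_integral_iff[THEN iffD1, OF nm(2)]
  \<comment> \<open>The total mass is the exponential moment at l = 0.\<close>
  have "emeasure (gaussian \<tau> :: (real^'d) measure) UNIV = (\<integral>\<^sup>+y. ennreal (exp ((0 :: real^'d) \<bullet> y)) \<partial>gaussian \<tau>)"
    by (simp add: nn_integral_const[of "gaussian \<tau>" 1, simplified])
  then show "prob_space (gaussian \<tau> :: (real^'d) measure)"
    using gaussian_mgf[OF assms, of "0 :: real^'d"] by (intro prob_spaceI) simp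
  \<comment> \<open>A single coordinate, and below a product of two, is written as a product over
    all coordinates whose other factors are 1.\<close>
  let ?f = "\<lambda>i x. if i = j then x else (1 :: real)"
  have 1: "(\<Prod>i\<in>UNIV. ?f i (y $ i)) = y $ j" for y :: "real^'d"
    by (simp add: prod.If_cases)
  have i1: "integrable lborel (\<lambda>x. normal_density 0 (sqrt \<tau>) x * ?f i x)" for i
    using nmi st by (cases "i = j") auto
  show "integrable (gaussian \<tau>) (\<lambda>y :: real^'d. y $ j)"
    using gaussian_integral_prod(1)[of ?f, OF _ i1] by (simp add: 1)
  have "(\<integral>y. y $ j \<partial>(gaussian \<tau> :: (real^'d) measure)) = (\<Prod>i\<in>UNIV. \<integral>x. normal_density 0 (sqrt \<tau>) x * ?f i x \<partial>lborel)"
    using gaussian_integral_prod(2)[of ?f, OF _ i1] by (simp add: 1)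
  also have "\<dots> = 0" using nmi by (intro prod_zero bexI[of _ j]) auto
  finally show "(\<integral>y. y $ j \<partial>(gaussian \<tau> :: (real^'d) measure)) = 0" .
  let ?g = "\<lambda>i x. (if i = j then x else (1 :: real)) * (if i = k then x else 1)"
  have 2: "(\<Prod>i\<in>UNIV. ?g i (y $ i)) = y $ j * y $ k" for y :: "real^'d"
    by (simp add: prod.distrib prod.If_cases)
  have i2: "integrable lborel (\<lambda>x. normal_density 0 (sqrt \<tau>) x * ?g i x)" for i
    using nmi st by (cases "i = j"; cases "i = k") (auto simp: power2_eq_square)
  show "integrable (gaussian \<tau>) (\<lambda>y :: real^'d. y $ j * y $ k)"
    using gaussian_integral_prod(1)[of ?g, OF _ i2] unfolding 2 by simp
  have "(\<integral>y. y $ j * y $ k \<partial>(gaussian \<tau> :: (real^'d) measure))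
      = (\<Prod>i\<in>UNIV. \<integral>x. normal_density 0 (sqrt \<tau>) x * ?g i x \<partial>lborel)"
    using gaussian_integral_prod(2)[of ?g, OF _ i2] unfolding 2 by simp
  also have "\<dots> = (if j = k then \<tau> else 0)"
  proof (cases "j = k")
    case True
    have "(\<Prod>i\<in>UNIV. \<integral>x. normal_density 0 (sqrt \<tau>) x * ?g i x \<partial>lborel)
        = (\<Prod>i\<in>UNIV. if i = j then \<tau> else 1)"
      using nmi st True by (intro prod.cong refl) (auto simp: power2_eq_square)
    then show ?thesis using True by (simp add: prod.If_cases)
  next
    case False
    then show ?thesis using nmi by (subst prod_zero) (auto intro!: exI[of _ j])
  qed
  finally show "(\<integral>y. y $ j * y $ k \<partial>(gaussian \<tau> :: (real^'d) measure)) = (if j = k then \<tau> else 0)" .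
qed

section \<open>Increments of Brownian motion\<close>

locale filtered_brownian = prob_space M
  for M :: "'w measure" +
  fixes F :: "real \<Rightarrow> 'w measure" and T :: real and B :: "real \<Rightarrow> 'w \<Rightarrow> real^'d"
  assumes filt: "filtration (space M) F"
    and sub: "\<And>t. subalgebra M (F t)"
    and bm: "brownian_motion M F T B"
begin

lemma space_F [simp]: "space (F t) = space M"
  using sub[of t] by (simp add: subalgebra_def)

lemma measurable_F_mono: "f \<in> measurable (F s) N \<Longrightarrow> s \<le> t \<Longrightarrow> f \<in> measurable (F t) N"
  using filtration.sets_F_mono[OF filt, of s t] by (auto simp: measurable_def)

lemma measurable_F_M: "f \<in> measurable (F s) N \<Longrightarrow> f \<in> measurable M N"
  using sub[of s] by (auto simp: measurable_def subalgebra_def)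

lemma B_measurable_F: "0 \<le> s \<Longrightarrow> s \<le> t \<Longrightarrow> t \<le> T \<Longrightarrow> B s \<in> borel_measurable (F t)"
  using bm by (auto simp: brownian_motion_def intro: measurable_F_mono)

lemma B_measurable [measurable]: "0 \<le> s \<Longrightarrow> s \<le> T \<Longrightarrow> B s \<in> borel_measurable M"
  using B_measurable_F[of s s] measurable_F_M by auto

lemma distr_increment:
  assumes "0 \<le> s" "s < t" "t \<le> T"
  shows "distr M borel (\<lambda>\<omega>. B t \<omega> - B s \<omega>) = gaussian (t - s)"
  using bm assms unfolding brownian_motion_def gaussian_def by blast

lemma indep_set_increment:
  assumes "0 \<le> s" "s < t" "t \<le> T"
  shows "indep_set (sets (F s)) {(\<lambda>\<omega>. B t \<omega> - B s \<omega>) -` A \<inter> space M | A. A \<in> sets borel}"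
  using bm assms unfolding brownian_motion_def by blast

lemma indep_var_increment:
  fixes \<xi> :: "'w \<Rightarrow> real" and f :: "real^'d \<Rightarrow> real"
  assumes st: "0 \<le> s" "s < t" "t \<le> T" and X: "\<xi> \<in> borel_measurable (F s)"
    and f [measurable]: "f \<in> borel_measurable borel"
  shows "indep_var borel \<xi> borel (\<lambda>\<omega>. f (B t \<omega> - B s \<omega>))"
proof -
  define G where "G = {(\<lambda>\<omega>. B t \<omega> - B s \<omega>) -` A \<inter> space M | A. A \<in> sets borel}"
  let ?A = "{\<xi> -` A \<inter> space M | A. A \<in> sets borel}"
  let ?C = "{(\<lambda>\<omega>. f (B t \<omega> - B s \<omega>)) -` A \<inter> space M | A. A \<in> sets borel}"
  have ind: "indep_set (sets (F s)) G"
    using indep_set_increment[OF st] by (simp add: G_def)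
  have "?A \<subseteq> sets (F s)"
    using measurable_sets[OF X] by auto
  moreover have "?C \<subseteq> G"
  proof safe
    fix A :: "real set" assume "A \<in> sets borel"
    then have "f -` A \<in> sets borel" using measurable_sets[OF f, of A] by simp
    then show "(\<lambda>\<omega>. f (B t \<omega> - B s \<omega>)) -` A \<inter> space M \<in> G"
      unfolding G_def by (auto intro!: exI[of _ "f -` A"])
  qed
  ultimately have ind': "indep_set ?A ?C"
    using ind unfolding indep_set_def by (elim indep_sets_mono_sets) (auto split: bool.split)
  have "Int_stable {h -` A \<inter> space M | A. A \<in> sets (borel :: real measure)}" for h :: "'w \<Rightarrow> real"
  proof (rule Int_stableI)
    fix a b assume "a \<in> {h -` A \<inter> space M | A. A \<in> sets (borel :: real measure)}"
      "b \<in> {h -` A \<inter> space M | A. A \<in> sets (borel :: real measure)}"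
    then obtain A A' where "a = h -` A \<inter> space M" "A \<in> sets borel"
      "b = h -` A' \<inter> space M" "A' \<in> sets borel" by blast
    then show "a \<inter> b \<in> {h -` A \<inter> space M | A. A \<in> sets (borel :: real measure)}"
      by (auto intro!: exI[of _ "A \<inter> A'"])
  qed
  then have "indep_set (sigma_sets (space M) ?A) (sigma_sets (space M) ?C)"
    by (intro indep_set_sigma_sets ind') 
  moreover have "(\<lambda>\<omega>. B t \<omega> - B s \<omega>) \<in> borel_measurable M" using st by simp
  ultimately show ?thesis
    unfolding indep_var_eq using X by (auto intro: measurable_F_M)
qed

text \<open>The freezing form of conditioning on \<open>F s\<close>: independence makes the joint
  law of X and the increment a product, so Tonelli integrates the increment against its Gaussian law
  with X held fixed.\<close>

lemma nn_integral_freeze: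
  assumes st: "0 \<le> s" "s < t" "t \<le> T" and X: "X \<in> measurable (F s) N"
    and f [measurable]: "f \<in> borel_measurable (N \<Otimes>\<^sub>M borel)"
  shows "(\<integral>\<^sup>+\<omega>. f (X \<omega>, B t \<omega> - B s \<omega>) \<partial>M) = (\<integral>\<^sup>+\<omega>. (\<integral>\<^sup>+y. f (X \<omega>, y) \<partial>gaussian (t - s)) \<partial>M)"
proof -
  let ?D = "\<lambda>\<omega>. B t \<omega> - B s \<omega>"
  have [measurable]: "X \<in> measurable M N" by (rule measurable_F_M[OF X])
  have [measurable]: "?D \<in> borel_measurable M" using st by simp
  interpret G: prob_space "gaussian (t - s) :: (real^'d) measure" using st by (intro gaussian_moments) simp
  interpret D: prob_space "distr M N X" by (rule prob_space_distr) simp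
  have "distr M N X \<Otimes>\<^sub>M gaussian (t - s) = distr M (N \<Otimes>\<^sub>M borel) (\<lambda>\<omega>. (X \<omega>, ?D \<omega>))"
  proof (rule pair_measure_eqI)
    show "sigma_finite_measure (distr M N X)" "sigma_finite_measure (gaussian (t - s) :: (real^'d) measure)" ..
    show "sets (distr M N X \<Otimes>\<^sub>M gaussian (t - s)) = sets (distr M (N \<Otimes>\<^sub>M borel) (\<lambda>\<omega>. (X \<omega>, ?D \<omega>)))"
      by (simp cong: sets_pair_measure_cong)
    fix A C assume A: "A \<in> sets (distr M N X)" and C: "C \<in> sets (gaussian (t - s) :: (real^'d) measure)"
    have "prob ((X -` A \<inter> space M) \<inter> (?D -` C \<inter> space M)) = prob (X -` A \<inter> space M) * prob (?D -` C \<inter> space M)"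
      using A C measurable_sets[OF X, of A] by (intro indep_setD[OF indep_set_increment[OF st]]) auto
    moreover have "(\<lambda>\<omega>. (X \<omega>, ?D \<omega>)) -` (A \<times> C) \<inter> space M = (X -` A \<inter> space M) \<inter> (?D -` C \<inter> space M)"
      by auto
    ultimately show "emeasure (distr M N X) A * emeasure (gaussian (t - s)) C
        = emeasure (distr M (N \<Otimes>\<^sub>M borel) (\<lambda>\<omega>. (X \<omega>, ?D \<omega>))) (A \<times> C)"
      using A C by (simp add: distr_increment[OF st, symmetric] emeasure_distr emeasure_eq_measure ennreal_mult)
  qed
  then have "(\<integral>\<^sup>+\<omega>. f (X \<omega>, ?D \<omega>) \<partial>M) = (\<integral>\<^sup>+p. f p \<partial>(distr M N X \<Otimes>\<^sub>M gaussian (t - s)))"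
    by (simp add: nn_integral_distr)
  also have "\<dots> = (\<integral>\<^sup>+x. (\<integral>\<^sup>+y. f (x, y) \<partial>gaussian (t - s)) \<partial>distr M N X)"
    by (rule G.nn_integral_fst[symmetric]) (simp cong: measurable_cong_sets sets_pair_measure_cong)
  also have "\<dots> = (\<integral>\<^sup>+\<omega>. (\<integral>\<^sup>+y. f (X \<omega>, y) \<partial>gaussian (t - s)) \<partial>M)"
    by (rule nn_integral_distr) (simp_all cong: measurable_cong_sets sets_pair_measure_cong)
  finally show ?thesis .
qed

lemma increment_integral:
  fixes f :: "real^'d \<Rightarrow> real"
  assumes st: "0 \<le> s" "s < t" "t \<le> T" and [measurable]: "f \<in> borel_measurable borel"
  shows "integrable M (\<lambda>\<omega>. f (B t \<omega> - B s \<omega>)) \<longleftrightarrow> integrable (gaussian (t - s)) f"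
    and "(\<integral>\<omega>. f (B t \<omega> - B s \<omega>) \<partial>M) = (\<integral>y. f y \<partial>gaussian (t - s))"
proof -
  have [measurable]: "(\<lambda>\<omega>. B t \<omega> - B s \<omega>) \<in> borel_measurable M" using st by simp
  show "integrable M (\<lambda>\<omega>. f (B t \<omega> - B s \<omega>)) \<longleftrightarrow> integrable (gaussian (t - s)) f"
    unfolding distr_increment[OF st, symmetric] by (simp add: integrable_distr_eq)
  show "(\<integral>\<omega>. f (B t \<omega> - B s \<omega>) \<partial>M) = (\<integral>y. f y \<partial>gaussian (t - s))"
    unfolding distr_increment[OF st, symmetric] by (simp add: integral_distr)
qed

text \<open>The case s = t is included because a partition may have repeated points, while the law
  of an increment is given only for s < t.\<close>

lemma increment_moments:
  assumes st: "0 \<le> s" "s \<le> t" "t \<le> T"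
  shows "integrable M (\<lambda>\<omega>. (B t \<omega> - B s \<omega>) $ j)"
    and "integrable M (\<lambda>\<omega>. (B t \<omega> - B s \<omega>) $ j * (B t \<omega> - B s \<omega>) $ k)"
proof -
  have "integrable M (\<lambda>\<omega>. (B t \<omega> - B s \<omega>) $ j) \<and>
    integrable M (\<lambda>\<omega>. (B t \<omega> - B s \<omega>) $ j * (B t \<omega> - B s \<omega>) $ k)"
  proof (cases "s = t")
    case False
    then have st': "0 \<le> s" "s < t" "t \<le> T" using st by auto
    show ?thesis
      using increment_integral(1)[OF st', of "\<lambda>y. y $ j"] increment_integral(1)[OF st', of "\<lambda>y. y $ j * y $ k"]
        gaussian_moments(2)[of "t - s" j] gaussian_moments(4)[of "t - s" j k] st' by auto
  qed simp
  then show "integrable M (\<lambda>\<omega>. (B t \<omega> - B s \<omega>) $ j)"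
    and "integrable M (\<lambda>\<omega>. (B t \<omega> - B s \<omega>) $ j * (B t \<omega> - B s \<omega>) $ k)" by auto
qed

text \<open>Independence splits the expectation. Testing against weights known at time s takes the
  place of conditional expectations throughout.\<close>

lemma increment_mean:
  fixes \<xi> :: "'w \<Rightarrow> real"
  assumes st: "0 \<le> s" "s \<le> t" "t \<le> T" and \<xi>: "\<xi> \<in> borel_measurable (F s)" "integrable M \<xi>"
  shows "integrable M (\<lambda>\<omega>. \<xi> \<omega> * (B t \<omega> - B s \<omega>) $ j)"
    and "(\<integral>\<omega>. \<xi> \<omega> * (B t \<omega> - B s \<omega>) $ j \<partial>M) = 0"
proof -
  have "integrable M (\<lambda>\<omega>. \<xi> \<omega> * (B t \<omega> - B s \<omega>) $ j) \<and> (\<integral>\<omega>. \<xi> \<omega> * (B t \<omega> - B s \<omega>) $ j \<partial>M) = 0"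
  proof (cases "s = t")
    case False
    then have st': "0 \<le> s" "s < t" "t \<le> T" using st by auto
    have ind: "indep_var borel \<xi> borel (\<lambda>\<omega>. (B t \<omega> - B s \<omega>) $ j)"
      by (rule indep_var_increment[OF st' \<xi>(1)]) simp
    have "(\<integral>\<omega>. (B t \<omega> - B s \<omega>) $ j \<partial>M) = 0"
      using increment_integral(2)[OF st', of "\<lambda>y. y $ j"] gaussian_moments(3)[of "t - s" j] st' by simp
    then show ?thesis
      using indep_var_lebesgue_integral[OF ind \<xi>(2) increment_moments(1)[OF st]]
        indep_var_integrable[OF ind \<xi>(2) increment_moments(1)[OF st]] by simp
  qed simp
  then show "integrable M (\<lambda>\<omega>. \<xi> \<omega> * (B t \<omega> - B s \<omega>) $ j)"
    and "(\<integral>\<omega>. \<xi> \<omega> * (B t \<omega> - B s \<omega>) $ j \<partial>M) = 0" by auto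
qed

lemma increment_covariance:
  fixes \<xi> :: "'w \<Rightarrow> real"
  assumes st: "0 \<le> s" "s \<le> t" "t \<le> T" and \<xi>: "\<xi> \<in> borel_measurable (F s)" "integrable M \<xi>"
  shows "integrable M (\<lambda>\<omega>. \<xi> \<omega> * ((B t \<omega> - B s \<omega>) $ j * (B t \<omega> - B s \<omega>) $ k))"
    and "(\<integral>\<omega>. \<xi> \<omega> * ((B t \<omega> - B s \<omega>) $ j * (B t \<omega> - B s \<omega>) $ k) \<partial>M)
      = (if j = k then t - s else 0) * (\<integral>\<omega>. \<xi> \<omega> \<partial>M)"
proof -
  let ?X = "\<lambda>\<omega>. (B t \<omega> - B s \<omega>) $ j * (B t \<omega> - B s \<omega>) $ k"
  have "integrable M (\<lambda>\<omega>. \<xi> \<omega> * ?X \<omega>) \<and> (\<integral>\<omega>. \<xi> \<omega> * ?X \<omega> \<partial>M) = (if j = k then t - s else 0) * (\<integral>\<omega>. \<xi> \<omega> \<partial>M)"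
  proof (cases "s = t")
    case False
    then have st': "0 \<le> s" "s < t" "t \<le> T" using st by auto
    have ind: "indep_var borel \<xi> borel ?X"
      by (rule indep_var_increment[OF st' \<xi>(1)]) simp
    have "(\<integral>\<omega>. ?X \<omega> \<partial>M) = (if j = k then t - s else 0)"
      using increment_integral(2)[OF st', of "\<lambda>y. y $ j * y $ k"] gaussian_moments(5)[of "t - s" j k] st' by simp
    then show ?thesis
      using indep_var_lebesgue_integral[OF ind \<xi>(2) increment_moments(2)[OF st]]
        indep_var_integrable[OF ind \<xi>(2) increment_moments(2)[OF st]] by simp
  qed simp
  then show "integrable M (\<lambda>\<omega>. \<xi> \<omega> * ?X \<omega>)"
    and "(\<integral>\<omega>. \<xi> \<omega> * ?X \<omega> \<partial>M) = (if j = k then t - s else 0) * (\<integral>\<omega>. \<xi> \<omega> \<partial>M)" by auto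
qed

text \<open>Only bounded weights occur, so all products of weights and increments are integrable.\<close>

definition adapted_bounded :: "real \<Rightarrow> ('w \<Rightarrow> 'e :: {second_countable_topology, real_normed_vector}) \<Rightarrow> bool" where
  "adapted_bounded s H \<longleftrightarrow> H \<in> borel_measurable (F s) \<and> (\<exists>K. \<forall>\<omega>\<in>space M. norm (H \<omega>) \<le> K)"

lemma adapted_boundedD:
  assumes "adapted_bounded s H"
  shows "H \<in> borel_measurable (F s)" "H \<in> borel_measurable M"
  using assms by (auto simp: adapted_bounded_def intro: measurable_F_M)

lemma adapted_bounded_mono: "adapted_bounded s H \<Longrightarrow> s \<le> t \<Longrightarrow> adapted_bounded t H"
  by (auto simp: adapted_bounded_def intro: measurable_F_mono)

lemma adapted_bounded_mult_integrable:
  fixes \<xi> \<eta> :: "'w \<Rightarrow> real"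
  assumes "adapted_bounded s \<xi>" "integrable M \<eta>"
  shows "integrable M (\<lambda>\<omega>. \<xi> \<omega> * \<eta> \<omega>)"
proof -
  obtain K where K: "\<And>\<omega>. \<omega> \<in> space M \<Longrightarrow> \<bar>\<xi> \<omega>\<bar> \<le> K"
    using assms by (auto simp: adapted_bounded_def)
  have [measurable]: "\<xi> \<in> borel_measurable M" using assms adapted_boundedD by auto
  have [measurable]: "\<eta> \<in> borel_measurable M" using assms by auto
  show ?thesis
  proof (rule Bochner_Integration.integrable_bound[of M "\<lambda>\<omega>. K * \<eta> \<omega>"])
    have "\<bar>\<xi> \<omega>\<bar> * \<bar>\<eta> \<omega>\<bar> \<le> \<bar>K\<bar> * \<bar>\<eta> \<omega>\<bar>" if "\<omega> \<in> space M" for \<omega>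
      using K[OF that] by (intro mult_right_mono) auto
    then show "AE \<omega> in M. norm (\<xi> \<omega> * \<eta> \<omega>) \<le> norm (K * \<eta> \<omega>)"
      by (auto simp: abs_mult)
  qed (use assms in auto)
qed

lemma adapted_bounded_integrable:
  fixes \<xi> :: "'w \<Rightarrow> real"
  shows "adapted_bounded s \<xi> \<Longrightarrow> integrable M \<xi>"
  using adapted_bounded_mult_integrable[of s \<xi> "\<lambda>_. 1"] by simp

lemma adapted_bounded_mult:
  fixes \<xi> \<eta> :: "'w \<Rightarrow> real"
  assumes "adapted_bounded s \<xi>" "adapted_bounded s \<eta>"
  shows "adapted_bounded s (\<lambda>\<omega>. \<xi> \<omega> * \<eta> \<omega>)"
proof -
  obtain K L where "\<And>\<omega>. \<omega> \<in> space M \<Longrightarrow> \<bar>\<xi> \<omega>\<bar> \<le> K" "\<And>\<omega>. \<omega> \<in> space M \<Longrightarrow> \<bar>\<eta> \<omega>\<bar> \<le> L"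
    using assms by (auto simp: adapted_bounded_def)
  then have "\<forall>\<omega>\<in>space M. norm (\<xi> \<omega> * \<eta> \<omega>) \<le> K * L"
    by (auto simp: abs_mult intro!: mult_mono intro: order_trans[OF abs_ge_zero])
  then show ?thesis using assms unfolding adapted_bounded_def by auto
qed

end

section \<open>Isometry for simple integrals\<close>

lemma (in pair_sigma_finite) has_bochner_integral_product:
  fixes f :: "'a \<Rightarrow> real" and g :: "'b \<Rightarrow> real"
  assumes f: "integrable M1 f" and g: "integrable M2 g"
  shows "has_bochner_integral (M1 \<Otimes>\<^sub>M M2) (\<lambda>p. f (fst p) * g (snd p)) (integral\<^sup>L M1 f * integral\<^sup>L M2 g)"
proof -
  have [measurable]: "f \<in> borel_measurable M1" "g \<in> borel_measurable M2" using f g by auto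
  have int: "integrable (M1 \<Otimes>\<^sub>M M2) (\<lambda>p. f (fst p) * g (snd p))"
    by (rule Fubini_integrable) (use f g in \<open>auto simp: abs_mult\<close>)
  moreover have "integral\<^sup>L (M1 \<Otimes>\<^sub>M M2) (\<lambda>p. f (fst p) * g (snd p)) = integral\<^sup>L M1 f * integral\<^sup>L M2 g"
    using integral_fst'[OF int] f g by simp
  ultimately show ?thesis by (simp add: has_bochner_integral_iff)
qed

lemma norm_sum_power2: "(norm (\<Sum>a\<in>A. f a :: 'a :: real_inner))\<^sup>2 = (\<Sum>a\<in>A. \<Sum>b\<in>A. f a \<bullet> f b)"
  by (simp add: power2_norm_eq_inner inner_sum_left inner_sum_right) (rule sum.swap)

lemma integral_indicator_Ioc:
  "integrable lborel (indicat_real {a<..b})" "(\<integral>u. indicat_real {a<..b} u \<partial>lborel) = max 0 (b - a)"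
  by (cases "a \<le> b"; simp add: integrable_indicator_iff emeasure_lborel_Ioc)+

context filtered_brownian
begin

abbreviation inc :: "real \<Rightarrow> real \<Rightarrow> 'w \<Rightarrow> real^'d" where
  "inc s t \<omega> \<equiv> B t \<omega> - B s \<omega>"

text \<open>The earlier increment is known at time c, so it joins the weight, and the later
  increment has mean zero.\<close>

lemma increment_disjoint:
  fixes \<xi> :: "'w \<Rightarrow> real"
  assumes "0 \<le> a" "a \<le> b" "b \<le> c" "c \<le> e" "e \<le> T" and \<xi>: "adapted_bounded c \<xi>"
  shows "has_bochner_integral M (\<lambda>\<omega>. \<xi> \<omega> * (inc a b \<omega> $ j * inc c e \<omega> $ k)) 0"
proof -
  have [measurable]: "B a \<in> borel_measurable (F c)" "B b \<in> borel_measurable (F c)" "\<xi> \<in> borel_measurable (F c)"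
    using assms B_measurable_F[of a c] B_measurable_F[of b c] adapted_boundedD(1)[OF \<xi>] by auto
  have "(\<lambda>\<omega>. \<xi> \<omega> * inc a b \<omega> $ j) \<in> borel_measurable (F c)" by measurable
  moreover have "integrable M (\<lambda>\<omega>. \<xi> \<omega> * inc a b \<omega> $ j)"
    using assms by (intro adapted_bounded_mult_integrable[OF \<xi>] increment_moments) auto
  ultimately have "has_bochner_integral M (\<lambda>\<omega>. (\<xi> \<omega> * inc a b \<omega> $ j) * inc c e \<omega> $ k) 0"
    using increment_mean[of c e "\<lambda>\<omega>. \<xi> \<omega> * inc a b \<omega> $ j" k] assms by (simp add: has_bochner_integral_iff)
  then show ?thesis by (simp add: mult.assoc)
qed

text \<open>The intervals may overlap in any way, because integrals over different partitions are
  later subtracted from each other. Overlapping increments are cut at the common endpoints; only the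
  product over the common part has nonzero mean, which produces the length of the overlap.\<close>

lemma increment_pair_scalar:
  fixes \<xi> \<xi>' :: "'w \<Rightarrow> real"
  assumes pq: "0 \<le> p" "p \<le> q" "q \<le> T" and pq': "0 \<le> p'" "p' \<le> q'" "q' \<le> T"
    and \<xi>: "adapted_bounded p \<xi>" and \<xi>': "adapted_bounded p' \<xi>'"
  shows "has_bochner_integral M (\<lambda>\<omega>. (\<xi> \<omega> * inc p q \<omega> $ j) * (\<xi>' \<omega> * inc p' q' \<omega> $ k))
    ((if j = k then max 0 (min q q' - max p p') else 0) * (\<integral>\<omega>. \<xi> \<omega> * \<xi>' \<omega> \<partial>M))"
proof -
  \<comment> \<open>The case p <= p'; the general one follows by exchanging the two factors.\<close>
  have *: "has_bochner_integral M (\<lambda>\<omega>. (\<xi> \<omega> * inc p q \<omega> $ j) * (\<xi>' \<omega> * inc p' q' \<omega> $ k))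
    ((if j = k then max 0 (min q q' - max p p') else 0) * (\<integral>\<omega>. \<xi> \<omega> * \<xi>' \<omega> \<partial>M))"
    if pq: "0 \<le> p" "p \<le> q" "q \<le> T" and pq': "0 \<le> p'" "p' \<le> q'" "q' \<le> T"
    and \<xi>: "adapted_bounded p \<xi>" and \<xi>': "adapted_bounded p' \<xi>'" and le: "p \<le> p'"
    for p q p' q' and \<xi> \<xi>' :: "'w \<Rightarrow> real" and j k
  proof -
    have \<eta>: "adapted_bounded p' (\<lambda>\<omega>. \<xi> \<omega> * \<xi>' \<omega>)"
      by (rule adapted_bounded_mult[OF adapted_bounded_mono[OF \<xi> le] \<xi>'])
    let ?\<eta> = "\<lambda>\<omega>. \<xi> \<omega> * \<xi>' \<omega>"
    show ?thesis
    proof (cases "q \<le> p'")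
      case True
      then have "max 0 (min q q' - max p p') = 0" by auto
      moreover have "has_bochner_integral M (\<lambda>\<omega>. ?\<eta> \<omega> * (inc p q \<omega> $ j * inc p' q' \<omega> $ k)) 0"
        by (intro increment_disjoint \<eta>) (use that True in auto)
      moreover have "(\<xi> \<omega> * inc p q \<omega> $ j) * (\<xi>' \<omega> * inc p' q' \<omega> $ k)
          = ?\<eta> \<omega> * (inc p q \<omega> $ j * inc p' q' \<omega> $ k)" for \<omega>
        by (simp only: ac_simps)
      ultimately show ?thesis by (simp only: if_cancel mult_zero_left)
    next
      case False
      define m where "m = min q q'"
      have m: "p' \<le> m" "m \<le> q" "m \<le> q'" "m \<le> T" "q = m \<or> q' = m" using False that by (auto simp: m_def)
      have \<eta>m: "adapted_bounded m ?\<eta>" by (rule adapted_bounded_mono[OF \<eta> m(1)])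
      have 1: "has_bochner_integral M (\<lambda>\<omega>. ?\<eta> \<omega> * (inc p p' \<omega> $ j * inc p' m \<omega> $ k)) 0"
        by (intro increment_disjoint \<eta>) (use that m in auto)
      have 2: "has_bochner_integral M (\<lambda>\<omega>. ?\<eta> \<omega> * (inc p p' \<omega> $ j * inc m q' \<omega> $ k)) 0"
        by (intro increment_disjoint \<eta>m) (use that m in auto)
      have 3: "has_bochner_integral M (\<lambda>\<omega>. ?\<eta> \<omega> * (inc p' m \<omega> $ j * inc m q' \<omega> $ k)) 0"
        by (intro increment_disjoint \<eta>m) (use that m in auto)
      have 4: "has_bochner_integral M (\<lambda>\<omega>. ?\<eta> \<omega> * (inc p' m \<omega> $ k * inc m q \<omega> $ j)) 0"
        by (intro increment_disjoint \<eta>m) (use that m in auto)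
      have 5: "has_bochner_integral M (\<lambda>\<omega>. ?\<eta> \<omega> * (inc p' m \<omega> $ j * inc p' m \<omega> $ k))
          ((if j = k then m - p' else 0) * (\<integral>\<omega>. ?\<eta> \<omega> \<partial>M))"
        using increment_covariance[of p' m ?\<eta> j k] adapted_bounded_integrable[OF \<eta>] adapted_boundedD(1)[OF \<eta>] that m
        by (simp add: has_bochner_integral_iff)
      \<comment> \<open>One of the two intervals ends at m, so one of the parts beyond m is
        zero.\<close>
      have "inc m q \<omega> $ j * inc m q' \<omega> $ k = 0" for \<omega> using m(5) by auto
      then have eq: "(\<xi> \<omega> * inc p q \<omega> $ j) * (\<xi>' \<omega> * inc p' q' \<omega> $ k) =
          ?\<eta> \<omega> * (inc p p' \<omega> $ j * inc p' m \<omega> $ k) + ?\<eta> \<omega> * (inc p p' \<omega> $ j * inc m q' \<omega> $ k)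
          + ?\<eta> \<omega> * (inc p' m \<omega> $ j * inc m q' \<omega> $ k) + ?\<eta> \<omega> * (inc p' m \<omega> $ k * inc m q \<omega> $ j)
          + ?\<eta> \<omega> * (inc p' m \<omega> $ j * inc p' m \<omega> $ k)" for \<omega>
      proof -
        have "inc p q \<omega> $ j = inc p p' \<omega> $ j + inc p' m \<omega> $ j + inc m q \<omega> $ j"
          "inc p' q' \<omega> $ k = inc p' m \<omega> $ k + inc m q' \<omega> $ k" by simp_all
        then have "(\<xi> \<omega> * inc p q \<omega> $ j) * (\<xi>' \<omega> * inc p' q' \<omega> $ k) =
          ?\<eta> \<omega> * ((inc p p' \<omega> $ j + inc p' m \<omega> $ j + inc m q \<omega> $ j) * (inc p' m \<omega> $ k + inc m q' \<omega> $ k))"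
          by (simp only: ac_simps)
        also have "(inc p p' \<omega> $ j + inc p' m \<omega> $ j + inc m q \<omega> $ j) * (inc p' m \<omega> $ k + inc m q' \<omega> $ k)
          = inc p p' \<omega> $ j * inc p' m \<omega> $ k + inc p p' \<omega> $ j * inc m q' \<omega> $ k
           + inc p' m \<omega> $ j * inc m q' \<omega> $ k + inc p' m \<omega> $ k * inc m q \<omega> $ j + inc p' m \<omega> $ j * inc p' m \<omega> $ k"
          using \<open>inc m q \<omega> $ j * inc m q' \<omega> $ k = 0\<close>
          by (simp only: distrib_left distrib_right) (simp only: ac_simps add_0_right add_0_left)
        finally show ?thesis by (simp only: distrib_left)
      qed
      have val: "max 0 (min q q' - max p p') = m - p'" using m le False by (auto simp: m_def)
      show ?thesis
        unfolding eq val
        using has_bochner_integral_add[OF has_bochner_integral_add[OF has_bochner_integral_add[OF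
              has_bochner_integral_add[OF 1 2] 3] 4] 5] by (simp only: add_0_left)
    qed
  qed
  show ?thesis
  proof (cases "p \<le> p'")
    case True
    then show ?thesis by (intro * assms)
  next
    case False
    then have "has_bochner_integral M (\<lambda>\<omega>. (\<xi>' \<omega> * inc p' q' \<omega> $ k) * (\<xi> \<omega> * inc p q \<omega> $ j))
      ((if k = j then max 0 (min q' q - max p' p) else 0) * (\<integral>\<omega>. \<xi>' \<omega> * \<xi> \<omega> \<partial>M))"
      by (intro * assms) auto
    moreover have "max 0 (min q' q - max p' p) = max 0 (min q q' - max p p')"
      by (simp only: min.commute max.commute)
    ultimately show ?thesis
      by (simp only: mult.commute[of "\<xi>' _ * _"] mult.commute[of "\<xi>' _" "\<xi> _"] eq_commute[of k j])
  qed
qed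

lemma adapted_bounded_component:
  fixes H :: "'w \<Rightarrow> real^'d^'m"
  assumes "adapted_bounded s H"
  shows "adapted_bounded s (\<lambda>\<omega>. H \<omega> $ i $ j)"
proof -
  obtain K where K: "\<And>\<omega>. \<omega> \<in> space M \<Longrightarrow> norm (H \<omega>) \<le> K"
    using assms by (auto simp: adapted_bounded_def)
  have "\<bar>H \<omega> $ i $ j\<bar> \<le> K" if "\<omega> \<in> space M" for \<omega>
    using K[OF that] component_le_norm_cart[of "H \<omega> $ i" j] Finite_Cartesian_Product.norm_nth_le[of "H \<omega>" i]
    by linarith
  then show ?thesis
    using assms by (auto simp: adapted_bounded_def intro!: borel_measurable_vec_nth')
qed

lemma increment_pair:
  fixes H H' :: "'w \<Rightarrow> real^'d^'m"
  assumes pq: "0 \<le> p" "p \<le> q" "q \<le> T" and pq': "0 \<le> p'" "p' \<le> q'" "q' \<le> T"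
    and H: "adapted_bounded p H" and H': "adapted_bounded p' H'"
  shows "has_bochner_integral M (\<lambda>\<omega>. (H \<omega> *v inc p q \<omega>) \<bullet> (H' \<omega> *v inc p' q' \<omega>))
    (max 0 (min q q' - max p p') * (\<integral>\<omega>. H \<omega> \<bullet> H' \<omega> \<partial>M))" and "integrable M (\<lambda>\<omega>. H \<omega> \<bullet> H' \<omega>)"
proof -
  let ?o = "max 0 (min q q' - max p p')"
  have "has_bochner_integral M (\<lambda>\<omega>. \<Sum>i\<in>UNIV. \<Sum>j\<in>UNIV. \<Sum>k\<in>UNIV.
      (H \<omega> $ i $ j * inc p q \<omega> $ j) * (H' \<omega> $ i $ k * inc p' q' \<omega> $ k))
    (\<Sum>i\<in>UNIV. \<Sum>j\<in>UNIV. \<Sum>k\<in>UNIV. (if j = k then ?o else 0) * (\<integral>\<omega>. H \<omega> $ i $ j * H' \<omega> $ i $ k \<partial>M))"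
    by (intro has_bochner_integral_sum increment_pair_scalar adapted_bounded_component assms)
  moreover have "(\<Sum>j\<in>UNIV. \<Sum>k\<in>UNIV. (H \<omega> $ i $ j * inc p q \<omega> $ j) * (H' \<omega> $ i $ k * inc p' q' \<omega> $ k))
      = (H \<omega> *v inc p q \<omega>) $ i * (H' \<omega> *v inc p' q' \<omega>) $ i" for \<omega> i
    unfolding matrix_vector_mult_def by (simp add: sum_product del: vector_minus_component)
  moreover have int: "integrable M (\<lambda>\<omega>. H \<omega> $ i $ j * H' \<omega> $ i $ k)" for i j k
    by (rule adapted_bounded_integrable[of "max p p'"], rule adapted_bounded_mult; rule adapted_bounded_mono,
        rule adapted_bounded_component) (use H H' in auto)
  moreover have "(\<Sum>i\<in>UNIV. \<Sum>j\<in>UNIV. \<Sum>k\<in>UNIV. (if j = k then ?o else 0) * (\<integral>\<omega>. H \<omega> $ i $ j * H' \<omega> $ i $ k \<partial>M))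
      = ?o * (\<integral>\<omega>. H \<omega> \<bullet> H' \<omega> \<partial>M)"
  proof -
    have "(\<integral>\<omega>. H \<omega> \<bullet> H' \<omega> \<partial>M) = (\<Sum>i\<in>UNIV. \<Sum>j\<in>UNIV. \<integral>\<omega>. H \<omega> $ i $ j * H' \<omega> $ i $ j \<partial>M)"
      unfolding inner_vec_def using int by (simp add: Bochner_Integration.integral_sum)
    moreover have "(\<Sum>k\<in>UNIV. (if j = k then ?o else 0) * f k) = ?o * f j" for f :: "'d \<Rightarrow> real" and j
      by (simp add: if_distrib[of "\<lambda>c. c * _"] cong: if_cong)
    ultimately show ?thesis by (simp add: sum_distrib_left)
  qed
  ultimately show "has_bochner_integral M (\<lambda>\<omega>. (H \<omega> *v inc p q \<omega>) \<bullet> (H' \<omega> *v inc p' q' \<omega>))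
    (?o * (\<integral>\<omega>. H \<omega> \<bullet> H' \<omega> \<partial>M))"
    by (simp only: inner_vec_def inner_real_def)
  show "integrable M (\<lambda>\<omega>. H \<omega> \<bullet> H' \<omega>)" unfolding inner_vec_def using int by simp
qed

text \<open>Both sides expand to the same double sum V over pairs of summands: the overlap of two
  intervals is the covariance factor on one side and the Lebesgue measure of their intersection on
  the other. The intervals may overlap, so sums over different partitions can be combined without a
  common refinement.\<close>

lemma simple_isometry:
  fixes H :: "'i \<Rightarrow> 'w \<Rightarrow> real^'d^'m"
  assumes A: "finite A"
    and pq: "\<And>a. a \<in> A \<Longrightarrow> 0 \<le> p a \<and> p a \<le> q a \<and> q a \<le> T"
    and H: "\<And>a. a \<in> A \<Longrightarrow> adapted_bounded (p a) (H a)"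
  shows "integrable M (\<lambda>\<omega>. (norm (\<Sum>a\<in>A. H a \<omega> *v inc (p a) (q a) \<omega>))\<^sup>2)"
    and "integrable (M \<Otimes>\<^sub>M lborel) (\<lambda>z. (norm (\<Sum>a\<in>A. indicator {p a<..q a} (snd z) *\<^sub>R H a (fst z)))\<^sup>2)"
    and "(\<integral>\<omega>. (norm (\<Sum>a\<in>A. H a \<omega> *v inc (p a) (q a) \<omega>))\<^sup>2 \<partial>M)
      = (\<integral>z. (norm (\<Sum>a\<in>A. indicator {p a<..q a} (snd z) *\<^sub>R H a (fst z)))\<^sup>2 \<partial>(M \<Otimes>\<^sub>M lborel))"
proof -
  interpret P: pair_sigma_finite M "lborel :: real measure" ..
  define V where "V = (\<Sum>a\<in>A. \<Sum>b\<in>A. max 0 (min (q a) (q b) - max (p a) (p b)) * (\<integral>\<omega>. H a \<omega> \<bullet> H b \<omega> \<partial>M))"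
  have "has_bochner_integral M (\<lambda>\<omega>. \<Sum>a\<in>A. \<Sum>b\<in>A. (H a \<omega> *v inc (p a) (q a) \<omega>) \<bullet> (H b \<omega> *v inc (p b) (q b) \<omega>)) V"
    unfolding V_def using pq H by (intro has_bochner_integral_sum increment_pair) auto
  then have 1: "has_bochner_integral M (\<lambda>\<omega>. (norm (\<Sum>a\<in>A. H a \<omega> *v inc (p a) (q a) \<omega>))\<^sup>2) V"
    by (simp only: norm_sum_power2)
  have "has_bochner_integral (M \<Otimes>\<^sub>M lborel) (\<lambda>z. (H a (fst z) \<bullet> H b (fst z)) *
      (indicator {p a<..q a} (snd z) * indicator {p b<..q b} (snd z)))
      (max 0 (min (q a) (q b) - max (p a) (p b)) * (\<integral>\<omega>. H a \<omega> \<bullet> H b \<omega> \<partial>M))" if ab: "a \<in> A" "b \<in> A" for a b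
  proof -
    have eq: "indicator {p a<..q a} u * indicator {p b<..q b} u = indicat_real {max (p a) (p b)<..min (q a) (q b)} u" for u
      by (auto simp: indicator_def)
    have ii: "integrable lborel (\<lambda>u. indicator {p a<..q a} u * indicat_real {p b<..q b} u)"
      "(\<integral>u. indicator {p a<..q a} u * indicat_real {p b<..q b} u \<partial>lborel) = max 0 (min (q a) (q b) - max (p a) (p b))"
      unfolding eq by (rule integral_indicator_Ioc)+
    have "integrable M (\<lambda>\<omega>. H a \<omega> \<bullet> H b \<omega>)"
      using increment_pair(2)[of "p a" "q a" "p b" "q b" "H a" "H b"] pq H ab by auto
    from P.has_bochner_integral_product[OF this ii(1)] show ?thesis
      unfolding ii(2) mult.commute[of "max 0 (min (q a) (q b) - max (p a) (p b))"] .
  qed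
  then have "has_bochner_integral (M \<Otimes>\<^sub>M lborel) (\<lambda>z. \<Sum>a\<in>A. \<Sum>b\<in>A. (H a (fst z) \<bullet> H b (fst z)) *
      (indicator {p a<..q a} (snd z) * indicator {p b<..q b} (snd z))) V"
    unfolding V_def by (intro has_bochner_integral_sum) auto
  moreover have "(\<Sum>a\<in>A. \<Sum>b\<in>A. (H a (fst z) \<bullet> H b (fst z)) *
      (indicator {p a<..q a} (snd z) * indicator {p b<..q b} (snd z)))
    = (norm (\<Sum>a\<in>A. indicator {p a<..q a} (snd z) *\<^sub>R H a (fst z)))\<^sup>2" for z
    by (simp add: norm_sum_power2 ac_simps)
  ultimately have 2: "has_bochner_integral (M \<Otimes>\<^sub>M lborel)
      (\<lambda>z. (norm (\<Sum>a\<in>A. indicator {p a<..q a} (snd z) *\<^sub>R H a (fst z)))\<^sup>2) V"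
    by simp
  show "integrable M (\<lambda>\<omega>. (norm (\<Sum>a\<in>A. H a \<omega> *v inc (p a) (q a) \<omega>))\<^sup>2)"
    and "integrable (M \<Otimes>\<^sub>M lborel) (\<lambda>z. (norm (\<Sum>a\<in>A. indicator {p a<..q a} (snd z) *\<^sub>R H a (fst z)))\<^sup>2)"
    and "(\<integral>\<omega>. (norm (\<Sum>a\<in>A. H a \<omega> *v inc (p a) (q a) \<omega>))\<^sup>2 \<partial>M)
      = (\<integral>z. (norm (\<Sum>a\<in>A. indicator {p a<..q a} (snd z) *\<^sub>R H a (fst z)))\<^sup>2 \<partial>(M \<Otimes>\<^sub>M lborel))"
    using 1 2 by (auto simp: has_bochner_integral_iff)
qed

lemma simple_integral_mean:
  fixes H :: "'w \<Rightarrow> real^'d^'m"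
  assumes pq: "0 \<le> p" "p \<le> q" "q \<le> T" and H: "adapted_bounded p H"
  shows "has_bochner_integral M (\<lambda>\<omega>. (H \<omega> *v inc p q \<omega>) $ i) 0"
proof -
  have "has_bochner_integral M (\<lambda>\<omega>. \<Sum>j\<in>UNIV. H \<omega> $ i $ j * inc p q \<omega> $ j) (\<Sum>j\<in>(UNIV::'d set). 0)"
    using adapted_bounded_component[OF H]
    by (intro has_bochner_integral_sum has_bochner_integral_iff[THEN iffD2] conjI increment_mean[OF pq]
        adapted_bounded_integrable[of p] adapted_boundedD(1)[of p])
  then show ?thesis by (simp add: matrix_vector_mult_def)
qed

text \<open>Induction over the last interval: with the past frozen, the last summand is Gaussian,
  and the bound K on its coefficient gives a deterministic factor exp (K^2 |l|^2 / 2 times the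
  length). The factors multiply to an exponent proportional to the total length.\<close>

lemma simple_integral_exp_bound:
  fixes H :: "nat \<Rightarrow> 'w \<Rightarrow> real^'d^'m" and l :: "real^'m"
  assumes \<tau>: "0 \<le> \<tau> 0" "\<And>i. i < n \<Longrightarrow> \<tau> i \<le> \<tau> (Suc i)" "\<tau> n \<le> T"
    and H: "\<And>i. i < n \<Longrightarrow> H i \<in> borel_measurable (F (\<tau> i))"
    and K: "\<And>i \<omega>. i < n \<Longrightarrow> \<omega> \<in> space M \<Longrightarrow> norm (H i \<omega>) \<le> K"
  shows "(\<integral>\<^sup>+\<omega>. ennreal (exp (l \<bullet> (\<Sum>i<n. H i \<omega> *v inc (\<tau> i) (\<tau> (Suc i)) \<omega>))) \<partial>M)
    \<le> ennreal (exp (K\<^sup>2 * (norm l)\<^sup>2 * (\<tau> n - \<tau> 0) / 2))"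
  using \<tau> H K
proof (induction n)
  case 0
  then show ?case by (simp add: emeasure_space_1)
next
  case (Suc n)
  have mono: "\<tau> i \<le> \<tau> j" if "i \<le> j" "j \<le> Suc n" for i j
    using that(1,2)
  proof (induction j rule: dec_induct)
    case (step k)
    then show ?case using Suc.prems(2)[of k] by simp
  qed simp
  have nT: "\<tau> n \<le> T" using mono[of n "Suc n"] Suc.prems(3) by linarith
  let ?S = "\<lambda>n \<omega>. \<Sum>i<n. H i \<omega> *v inc (\<tau> i) (\<tau> (Suc i)) \<omega>"
  have IH: "(\<integral>\<^sup>+\<omega>. ennreal (exp (l \<bullet> ?S n \<omega>)) \<partial>M) \<le> ennreal (exp (K\<^sup>2 * (norm l)\<^sup>2 * (\<tau> n - \<tau> 0) / 2))"
    using Suc.prems nT by (intro Suc.IH) auto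
  show ?case
  proof (cases "\<tau> n = \<tau> (Suc n)")
    case True
    then show ?thesis using IH by simp
  next
    case False
    then have lt: "\<tau> n < \<tau> (Suc n)" using mono[of n "Suc n"] by simp
    have [measurable]: "B (\<tau> i) \<in> borel_measurable (F (\<tau> n))" if "i \<le> n" for i
      using that mono[of 0 i] mono[of i n] nT Suc.prems(1) by (intro B_measurable_F) auto
    have Sm [measurable]: "?S n \<in> borel_measurable (F (\<tau> n))"
    proof (intro borel_measurable_sum borel_measurable_matrix_vector_mult borel_measurable_diff)
      fix i assume "i \<in> {..<n}"
      then show "H i \<in> borel_measurable (F (\<tau> n))"
        using measurable_F_mono[OF Suc.prems(4)[of i] mono[of i n]] by auto
    qed auto
    have Hm [measurable]: "H n \<in> borel_measurable (F (\<tau> n))" using Suc.prems by auto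
    let ?f = "\<lambda>p :: ((real^'m) \<times> (real^'d^'m)) \<times> (real^'d). ennreal (exp (l \<bullet> (fst (fst p) + snd (fst p) *v snd p)))"
    have "(\<integral>\<^sup>+\<omega>. ennreal (exp (l \<bullet> ?S (Suc n) \<omega>)) \<partial>M)
        = (\<integral>\<^sup>+\<omega>. ?f ((?S n \<omega>, H n \<omega>), inc (\<tau> n) (\<tau> (Suc n)) \<omega>) \<partial>M)" by simp
    also have "\<dots> = (\<integral>\<^sup>+\<omega>. (\<integral>\<^sup>+y. ?f ((?S n \<omega>, H n \<omega>), y) \<partial>gaussian (\<tau> (Suc n) - \<tau> n)) \<partial>M)"
    proof (rule nn_integral_freeze[where N = "borel \<Otimes>\<^sub>M borel"])
      show "0 \<le> \<tau> n" using mono[of 0 n] Suc.prems by simp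
      show "(\<lambda>\<omega>. (?S n \<omega>, H n \<omega>)) \<in> F (\<tau> n) \<rightarrow>\<^sub>M borel \<Otimes>\<^sub>M borel" by measurable
    qed (use lt Suc.prems in \<open>auto, measurable\<close>)
    also have "\<dots> = (\<integral>\<^sup>+\<omega>. ennreal (exp (l \<bullet> ?S n \<omega>)) *
        ennreal (exp ((\<tau> (Suc n) - \<tau> n) * (norm (transpose (H n \<omega>) *v l))\<^sup>2 / 2)) \<partial>M)"
    proof (rule nn_integral_cong)
      fix \<omega>
      have "?f ((?S n \<omega>, H n \<omega>), y) = ennreal (exp (l \<bullet> ?S n \<omega>)) * ennreal (exp ((transpose (H n \<omega>) *v l) \<bullet> y))" for y
        by (simp add: ennreal_mult[symmetric] mult_exp_exp inner_add_right dot_lmul_matrix)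
      then show "(\<integral>\<^sup>+y. ?f ((?S n \<omega>, H n \<omega>), y) \<partial>gaussian (\<tau> (Suc n) - \<tau> n)) = ennreal (exp (l \<bullet> ?S n \<omega>)) *
        ennreal (exp ((\<tau> (Suc n) - \<tau> n) * (norm (transpose (H n \<omega>) *v l))\<^sup>2 / 2))"
        using lt by (simp only: nn_integral_cmult) (subst nn_integral_cmult, simp, subst gaussian_mgf, simp_all)
    qed
    also have "\<dots> \<le> (\<integral>\<^sup>+\<omega>. ennreal (exp (l \<bullet> ?S n \<omega>)) *
        ennreal (exp (K\<^sup>2 * (norm l)\<^sup>2 * (\<tau> (Suc n) - \<tau> n) / 2)) \<partial>M)"
    proof (intro nn_integral_mono mult_left_mono ennreal_leI)
      fix \<omega> assume \<omega>: "\<omega> \<in> space M"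
      have "norm (transpose (H n \<omega>) *v l) \<le> K * norm l"
        using norm_matrix_vector_mult_le[of "transpose (H n \<omega>)" l] Suc.prems(5)[OF _ \<omega>, of n]
        by (simp add: norm_transpose) (meson mult_right_mono norm_ge_zero order_trans)
      then have "(norm (transpose (H n \<omega>) *v l))\<^sup>2 \<le> (K * norm l)\<^sup>2" by (rule power_mono) simp
      then have "(\<tau> (Suc n) - \<tau> n) * (norm (transpose (H n \<omega>) *v l))\<^sup>2 \<le> (\<tau> (Suc n) - \<tau> n) * (K * norm l)\<^sup>2"
        using lt by (intro mult_left_mono) auto
      then show "exp ((\<tau> (Suc n) - \<tau> n) * (norm (transpose (H n \<omega>) *v l))\<^sup>2 / 2)
          \<le> exp (K\<^sup>2 * (norm l)\<^sup>2 * (\<tau> (Suc n) - \<tau> n) / 2)"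
        by (simp add: power_mult_distrib ac_simps)
    qed auto
    also have "\<dots> = (\<integral>\<^sup>+\<omega>. ennreal (exp (l \<bullet> ?S n \<omega>)) \<partial>M) * ennreal (exp (K\<^sup>2 * (norm l)\<^sup>2 * (\<tau> (Suc n) - \<tau> n) / 2))"
      by (intro nn_integral_multc measurable_compose[OF measurable_F_M[OF Sm], of "\<lambda>x. ennreal (exp (l \<bullet> x))"]) simp
    also have "\<dots> \<le> ennreal (exp (K\<^sup>2 * (norm l)\<^sup>2 * (\<tau> n - \<tau> 0) / 2)) * ennreal (exp (K\<^sup>2 * (norm l)\<^sup>2 * (\<tau> (Suc n) - \<tau> n) / 2))"
      by (intro mult_right_mono IH) auto
    also have "\<dots> = ennreal (exp (K\<^sup>2 * (norm l)\<^sup>2 * (\<tau> (Suc n) - \<tau> 0) / 2))"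
      by (simp add: ennreal_mult[symmetric] mult_exp_exp algebra_simps add_divide_distrib[symmetric] diff_divide_distrib)
    finally show ?thesis .
  qed
qed

end

section \<open>Increments of the stochastic integral\<close>

text \<open>The intervals are disjoint, so at most one summand is nonzero and any g with g 0 = 0,
  linear or not, commutes with the sum. It is applied to a truncation.\<close>

lemma sum_indicator_Ioc_commute:
  fixes \<tau> :: "nat \<Rightarrow> real" and H :: "nat \<Rightarrow> 'a :: real_vector" and g :: "'a \<Rightarrow> 'b :: real_vector"
  assumes \<tau>: "\<And>i. i < n \<Longrightarrow> \<tau> i \<le> \<tau> (Suc i)" and g0: "g 0 = 0"
  shows "(\<Sum>i<n. indicator {\<tau> i<..\<tau> (Suc i)} u *\<^sub>R g (H i)) = g (\<Sum>i<n. indicator {\<tau> i<..\<tau> (Suc i)} u *\<^sub>R H i)"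
  using \<tau>
proof (induction n)
  case (Suc n)
  show ?case
  proof (cases "u \<in> {\<tau> n<..\<tau> (Suc n)}")
    case True
    have le: "\<tau> i \<le> \<tau> j" if "i \<le> j" "j \<le> n" for i j
      using that
    proof (induction j rule: dec_induct)
      case (step l)
      then show ?case using Suc.prems[of l] by simp
    qed simp
    have "indicator {\<tau> i<..\<tau> (Suc i)} u = (0 :: real)" if "i < n" for i
      using le[of "Suc i" n] that True by (auto simp: indicator_def)
    then show ?thesis using True by simp
  next
    case False
    then show ?thesis using Suc by simp
  qed
qed (simp add: g0)

context filtered_brownian
begin

text \<open>Couples a simple integral with its integrand. Lists of triples, with no order imposed on
  the intervals, make the notion closed under addition by concatenation.\<close>

definition is_simple :: "('w \<Rightarrow> real^'m) \<Rightarrow> ('w \<times> real \<Rightarrow> real^'d^'m) \<Rightarrow> bool" where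
  "is_simple X P \<longleftrightarrow> (\<exists>L. (\<forall>(p, q, H)\<in>set L. 0 \<le> p \<and> p \<le> q \<and> q \<le> T \<and> adapted_bounded p H) \<and>
     X = (\<lambda>\<omega>. \<Sum>(p, q, H)\<leftarrow>L. H \<omega> *v inc p q \<omega>) \<and>
     P = (\<lambda>z. \<Sum>(p, q, H)\<leftarrow>L. indicator {p<..q} (snd z) *\<^sub>R H (fst z)))"

lemma is_simple_add:
  assumes "is_simple X P" "is_simple X' P'"
  shows "is_simple (\<lambda>\<omega>. X \<omega> + X' \<omega>) (\<lambda>z. P z + P' z)"
proof -
  obtain L L' where L: "\<forall>(p, q, H)\<in>set L. 0 \<le> p \<and> p \<le> q \<and> q \<le> T \<and> adapted_bounded p H"
    "X = (\<lambda>\<omega>. \<Sum>(p, q, H)\<leftarrow>L. H \<omega> *v inc p q \<omega>)" "P = (\<lambda>z. \<Sum>(p, q, H)\<leftarrow>L. indicator {p<..q} (snd z) *\<^sub>R H (fst z))"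
    "\<forall>(p, q, H)\<in>set L'. 0 \<le> p \<and> p \<le> q \<and> q \<le> T \<and> adapted_bounded p H"
    "X' = (\<lambda>\<omega>. \<Sum>(p, q, H)\<leftarrow>L'. H \<omega> *v inc p q \<omega>)" "P' = (\<lambda>z. \<Sum>(p, q, H)\<leftarrow>L'. indicator {p<..q} (snd z) *\<^sub>R H (fst z))"
    using assms unfolding is_simple_def by blast
  show ?thesis unfolding is_simple_def by (rule exI[of _ "L @ L'"]) (use L in auto)
qed

lemma adapted_bounded_matrix_mult:
  fixes W :: "'w \<Rightarrow> real^'m^'k" and H :: "'w \<Rightarrow> real^'n^'m"
  assumes "adapted_bounded s W" "adapted_bounded s H"
  shows "adapted_bounded s (\<lambda>\<omega>. W \<omega> ** H \<omega>)"
proof -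
  obtain K L where KL: "\<And>\<omega>. \<omega> \<in> space M \<Longrightarrow> norm (W \<omega>) \<le> K" "\<And>\<omega>. \<omega> \<in> space M \<Longrightarrow> norm (H \<omega>) \<le> L"
    using assms by (auto simp: adapted_bounded_def)
  have "norm (W \<omega> ** H \<omega>) \<le> K * L" if "\<omega> \<in> space M" for \<omega>
  proof -
    have "norm (W \<omega>) * norm (H \<omega>) \<le> K * L"
      using KL[OF that] by (intro mult_mono) (auto intro: order_trans[OF norm_ge_zero])
    then show ?thesis using norm_matrix_mult_le[of "W \<omega>" "H \<omega>"] by linarith
  qed
  then show ?thesis using assms by (auto simp: adapted_bounded_def)
qed

lemma is_simple_sum:
  fixes n :: nat
  assumes "\<And>i. i < n \<Longrightarrow> 0 \<le> p i \<and> p i \<le> q i \<and> q i \<le> T \<and> adapted_bounded (p i) (H i)"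
  shows "is_simple (\<lambda>\<omega>. \<Sum>i<n. H i \<omega> *v inc (p i) (q i) \<omega>) (\<lambda>z. \<Sum>i<n. indicator {p i<..q i} (snd z) *\<^sub>R H i (fst z))"
  unfolding is_simple_def
  by (rule exI[of _ "map (\<lambda>i. (p i, q i, H i)) [0..<n]"])
     (use assms in \<open>auto simp: o_def interv_sum_list_conv_sum_set_nat lessThan_atLeast0\<close>)

lemma is_simple_uminus:
  fixes X :: "'w \<Rightarrow> real^'m"
  assumes "is_simple X P"
  shows "is_simple (\<lambda>\<omega>. - X \<omega>) (\<lambda>z. - P z)"
proof -
  obtain L where L: "\<forall>(p, q, H)\<in>set L. 0 \<le> p \<and> p \<le> q \<and> q \<le> T \<and> adapted_bounded p H"
    "X = (\<lambda>\<omega>. \<Sum>(p, q, H)\<leftarrow>L. H \<omega> *v inc p q \<omega>)" "P = (\<lambda>z. \<Sum>(p, q, H)\<leftarrow>L. indicator {p<..q} (snd z) *\<^sub>R H (fst z))"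
    using assms unfolding is_simple_def by blast
  have "(\<Sum>(p, q, H)\<leftarrow>map (\<lambda>(p, q, H). (p, q, \<lambda>\<omega>. - H \<omega>)) L. H \<omega> *v inc p q \<omega>) = - (\<Sum>(p, q, H)\<leftarrow>L. H \<omega> *v inc p q \<omega>)" for \<omega>
    by (induction L) (auto simp: matrix_vector_mult_def vec_eq_iff sum_negf)
  moreover have "(\<Sum>(p, q, H)\<leftarrow>map (\<lambda>(p, q, H). (p, q, \<lambda>\<omega>. - H \<omega>)) L. indicator {p<..q} (snd z) *\<^sub>R H (fst z))
      = - (\<Sum>(p, q, H)\<leftarrow>L. indicator {p<..q} (snd z) *\<^sub>R H (fst z))" for z :: "'w \<times> real"
    by (induction L) auto
  moreover have "adapted_bounded p (\<lambda>\<omega>. - H \<omega>)" if "adapted_bounded p H" for p and H :: "'w \<Rightarrow> real^'d^'m"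
    using that by (auto simp: adapted_bounded_def)
  ultimately show ?thesis unfolding is_simple_def L(2,3)
    by (intro exI[of _ "map (\<lambda>(p, q, H). (p, q, \<lambda>\<omega>. - H \<omega>)) L"] conjI ext)
       (use L(1) in \<open>auto simp del: map_map\<close>)
qed

lemma is_simple_isometry:
  assumes "is_simple X P"
  shows "X \<in> borel_measurable M" "P \<in> borel_measurable (M \<Otimes>\<^sub>M lborel)"
    and "integrable M (\<lambda>\<omega>. (norm (X \<omega>))\<^sup>2)"
    and "integrable (M \<Otimes>\<^sub>M lborel) (\<lambda>z. (norm (P z))\<^sup>2)"
    and "(\<integral>\<omega>. (norm (X \<omega>))\<^sup>2 \<partial>M) = (\<integral>z. (norm (P z))\<^sup>2 \<partial>(M \<Otimes>\<^sub>M lborel))"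
    and "integrable M (\<lambda>\<omega>. X \<omega> $ i)" "(\<integral>\<omega>. X \<omega> $ i \<partial>M) = 0"
proof -
  obtain L where L: "\<forall>(p, q, H)\<in>set L. 0 \<le> p \<and> p \<le> q \<and> q \<le> T \<and> adapted_bounded p H"
    "X = (\<lambda>\<omega>. \<Sum>(p, q, H)\<leftarrow>L. H \<omega> *v inc p q \<omega>)" "P = (\<lambda>z. \<Sum>(p, q, H)\<leftarrow>L. indicator {p<..q} (snd z) *\<^sub>R H (fst z))"
    using assms unfolding is_simple_def by blast
  define n p q H where "n = length L" and "p i = fst (L ! i)" and "q i = fst (snd (L ! i))" and "H i = snd (snd (L ! i))" for i
  have el: "0 \<le> p i \<and> p i \<le> q i \<and> q i \<le> T \<and> adapted_bounded (p i) (H i)" if "i \<in> {..<n}" for i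
    using L(1) nth_mem[of i L] that unfolding p_def q_def H_def n_def by (cases "L ! i") fastforce
  have X: "X = (\<lambda>\<omega>. \<Sum>i<n. H i \<omega> *v inc (p i) (q i) \<omega>)"
    unfolding L(2) sum_list_sum_nth by (simp add: n_def p_def q_def H_def lessThan_atLeast0 split_beta)
  have P: "P = (\<lambda>z. \<Sum>i<n. indicator {p i<..q i} (snd z) *\<^sub>R H i (fst z))"
    unfolding L(3) sum_list_sum_nth by (simp add: n_def p_def q_def H_def lessThan_atLeast0 split_beta)
  have [measurable]: "H i \<in> borel_measurable M" "B (p i) \<in> borel_measurable M" "B (q i) \<in> borel_measurable M" if "i \<in> {..<n}" for i
    using el[OF that] by (auto intro: adapted_boundedD B_measurable)
  show "X \<in> borel_measurable M" unfolding X by measurable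
  show "P \<in> borel_measurable (M \<Otimes>\<^sub>M lborel)" unfolding P by measurable
  show "integrable M (\<lambda>\<omega>. (norm (X \<omega>))\<^sup>2)"
    and "integrable (M \<Otimes>\<^sub>M lborel) (\<lambda>z. (norm (P z))\<^sup>2)"
    and "(\<integral>\<omega>. (norm (X \<omega>))\<^sup>2 \<partial>M) = (\<integral>z. (norm (P z))\<^sup>2 \<partial>(M \<Otimes>\<^sub>M lborel))"
    unfolding X P by (intro simple_isometry; use el in auto)+
  have "has_bochner_integral M (\<lambda>\<omega>. \<Sum>k<n. (H k \<omega> *v inc (p k) (q k) \<omega>) $ i) (\<Sum>k<n. 0)"
    by (intro has_bochner_integral_sum simple_integral_mean) (use el in auto)
  then show "integrable M (\<lambda>\<omega>. X \<omega> $ i)" "(\<integral>\<omega>. X \<omega> $ i \<partial>M) = 0"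
    by (auto simp: X has_bochner_integral_iff)
qed

end

lemma square_integrable_triangle:
  fixes f g h :: "'a \<Rightarrow> 'b :: {banach, second_countable_topology}"
  assumes [measurable]: "h \<in> borel_measurable N"
    and f: "integrable N (\<lambda>x. (norm (f x))\<^sup>2)" and g: "integrable N (\<lambda>x. (norm (g x))\<^sup>2)"
    and le: "\<And>x. x \<in> space N \<Longrightarrow> norm (h x) \<le> norm (f x) + norm (g x)"
  shows "integrable N (\<lambda>x. (norm (h x))\<^sup>2)"
    and "(\<integral>x. (norm (h x))\<^sup>2 \<partial>N) \<le> 2 * (\<integral>x. (norm (f x))\<^sup>2 \<partial>N) + 2 * (\<integral>x. (norm (g x))\<^sup>2 \<partial>N)"
proof -
  have pw: "(norm (h x))\<^sup>2 \<le> 2 * (norm (f x))\<^sup>2 + 2 * (norm (g x))\<^sup>2" if "x \<in> space N" for x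
  proof -
    have "(norm (h x))\<^sup>2 \<le> (norm (f x) + norm (g x))\<^sup>2" using le[OF that] by (intro power_mono) auto
    also have "\<dots> \<le> 2 * (norm (f x))\<^sup>2 + 2 * (norm (g x))\<^sup>2"
      using sum_squares_bound[of "norm (f x)" "norm (g x)"] by (simp add: power2_sum)
    finally show ?thesis .
  qed
  show int: "integrable N (\<lambda>x. (norm (h x))\<^sup>2)"
    by (rule Bochner_Integration.integrable_bound[of N "\<lambda>x. 2 * (norm (f x))\<^sup>2 + 2 * (norm (g x))\<^sup>2"])
       (use f g pw in \<open>auto intro!: AE_I2\<close>)
  have "(\<integral>x. (norm (h x))\<^sup>2 \<partial>N) \<le> (\<integral>x. 2 * (norm (f x))\<^sup>2 + 2 * (norm (g x))\<^sup>2 \<partial>N)"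
    using int f g pw by (intro integral_mono) auto
  then show "(\<integral>x. (norm (h x))\<^sup>2 \<partial>N) \<le> 2 * (\<integral>x. (norm (f x))\<^sup>2 \<partial>N) + 2 * (\<integral>x. (norm (g x))\<^sup>2 \<partial>N)"
    using f g by simp
qed

lemma norm_le_diff_add: "norm y \<le> norm (x - y) + norm (x :: 'a :: real_normed_vector)"
  by (metis add.commute norm_minus_commute norm_triangle_sub)

lemma tendsto_0_of_nn_integral:
  fixes f :: "nat \<Rightarrow> 'a \<Rightarrow> real"
  assumes int: "\<And>k. integrable N (f k)" and nn: "\<And>k x. 0 \<le> f k x"
    and lim: "(\<lambda>k. \<integral>\<^sup>+x. ennreal (f k x) \<partial>N) \<longlonglongrightarrow> 0"
  shows "(\<lambda>k. \<integral>x. f k x \<partial>N) \<longlonglongrightarrow> 0"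
proof -
  have "(\<lambda>k. ennreal (\<integral>x. f k x \<partial>N)) \<longlonglongrightarrow> ennreal 0"
    using lim nn_integral_eq_integral[OF int] nn by simp
  then show ?thesis by (subst (asm) tendsto_ennreal_iff) (auto simp: nn integral_nonneg)
qed

section \<open>Approximation of the stochastic integral and of its increments\<close>

locale ito_process = filtered_brownian M F T B
  for M :: "'w measure" and F T and B :: "real \<Rightarrow> 'w \<Rightarrow> real^'d" +
  fixes \<Phi> :: "real \<Rightarrow> 'w \<Rightarrow> real^'d^'d" and I :: "real \<Rightarrow> 'w \<Rightarrow> real^'d" and K :: real
  assumes \<Phi>_measurable: "(\<lambda>z. \<Phi> (snd z) (fst z)) \<in> borel_measurable (M \<Otimes>\<^sub>M lborel)"
    and \<Phi>_bound: "\<And>u \<omega>. \<omega> \<in> space M \<Longrightarrow> norm (\<Phi> u \<omega>) \<le> K"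
    and ito: "\<And>t. t \<in> {0..T} \<Longrightarrow> has_ito_integral M F B \<Phi> t (I t)"
begin

abbreviation \<Psi> :: "real \<Rightarrow> real \<Rightarrow> 'w \<times> real \<Rightarrow> real^'d^'d" where
  "\<Psi> a b z \<equiv> indicator {a<..b} (snd z) *\<^sub>R \<Phi> (snd z) (fst z)"

lemma K_nonneg: "0 \<le> K"
  using \<Phi>_bound[of _ 0] not_empty by (meson all_not_in_conv norm_ge_zero order_trans)

lemma I_measurable [measurable]: "t \<in> {0..T} \<Longrightarrow> I t \<in> borel_measurable M"
  using ito by (auto simp: has_ito_integral_def)

lemma \<Psi>_measurable [measurable]: "\<Psi> a b \<in> borel_measurable (M \<Otimes>\<^sub>M lborel)"
  using \<Phi>_measurable by measurable

lemma indicator_Ioc_integrable: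
  fixes a b c :: real
  shows "integrable (M \<Otimes>\<^sub>M lborel) (\<lambda>z. c * indicat_real {a<..b} (snd z))"
proof -
  interpret P: pair_sigma_finite M "lborel :: real measure" ..
  show ?thesis
    using P.has_bochner_integral_product[of "\<lambda>_. c" "indicat_real {a<..b}"] integral_indicator_Ioc
    by (auto simp: has_bochner_integral_iff)
qed

lemma \<Psi>_square_integrable: "integrable (M \<Otimes>\<^sub>M lborel) (\<lambda>z. (norm (\<Psi> a b z))\<^sup>2)"
proof (rule Bochner_Integration.integrable_bound[OF indicator_Ioc_integrable[of "K\<^sup>2" a b]])
  show "AE z in M \<Otimes>\<^sub>M lborel. norm ((norm (\<Psi> a b z))\<^sup>2) \<le> norm (K\<^sup>2 * indicat_real {a<..b} (snd z))"
    using \<Phi>_bound by (intro AE_I2) (auto simp: space_pair_measure indicator_def intro!: power_mono)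
qed measurable

text \<open>The approximation demanded by \<open>has_ito_integral\<close>, restated on (a,b] with
  real integrals in place of nonnegative ones and with the integrand as one function on the product
  space.\<close>

definition approximates ::
  "real \<Rightarrow> real \<Rightarrow> ('w \<Rightarrow> real^'d) \<Rightarrow> (nat \<Rightarrow> nat \<Rightarrow> real) \<Rightarrow> (nat \<Rightarrow> nat) \<Rightarrow> (nat \<Rightarrow> nat \<Rightarrow> 'w \<Rightarrow> real^'d^'d) \<Rightarrow> bool"
  where "approximates a b D \<tau> n H \<longleftrightarrow>
    (\<forall>k. \<tau> k 0 = a \<and> \<tau> k (n k) = b \<and>
      (\<forall>i<n k. \<tau> k i \<le> \<tau> k (Suc i) \<and> adapted_bounded (\<tau> k i) (H k i)) \<and>
      integrable M (\<lambda>\<omega>. (norm (simple_integral (n k) (\<tau> k) (H k) B \<omega> - D \<omega>))\<^sup>2) \<and>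
      integrable (M \<Otimes>\<^sub>M lborel) (\<lambda>z. (norm (simple_process (n k) (\<tau> k) (H k) (snd z) (fst z) - \<Psi> a b z))\<^sup>2)) \<and>
    (\<lambda>k. \<integral>\<omega>. (norm (simple_integral (n k) (\<tau> k) (H k) B \<omega> - D \<omega>))\<^sup>2 \<partial>M) \<longlonglongrightarrow> 0 \<and>
    (\<lambda>k. \<integral>z. (norm (simple_process (n k) (\<tau> k) (H k) (snd z) (fst z) - \<Psi> a b z))\<^sup>2 \<partial>(M \<Otimes>\<^sub>M lborel)) \<longlonglongrightarrow> 0"

lemma approximatesD:
  assumes "approximates a b D \<tau> n H"
  shows "\<tau> k 0 = a" "\<tau> k (n k) = b" "i < n k \<Longrightarrow> \<tau> k i \<le> \<tau> k (Suc i)"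
    "i < n k \<Longrightarrow> adapted_bounded (\<tau> k i) (H k i)"
    "integrable M (\<lambda>\<omega>. (norm (simple_integral (n k) (\<tau> k) (H k) B \<omega> - D \<omega>))\<^sup>2)"
    "(\<lambda>k. \<integral>\<omega>. (norm (simple_integral (n k) (\<tau> k) (H k) B \<omega> - D \<omega>))\<^sup>2 \<partial>M) \<longlonglongrightarrow> 0"
    "integrable (M \<Otimes>\<^sub>M lborel) (\<lambda>z. (norm (simple_process (n k) (\<tau> k) (H k) (snd z) (fst z) - \<Psi> a b z))\<^sup>2)"
    "(\<lambda>k. \<integral>z. (norm (simple_process (n k) (\<tau> k) (H k) (snd z) (fst z) - \<Psi> a b z))\<^sup>2 \<partial>(M \<Otimes>\<^sub>M lborel)) \<longlonglongrightarrow> 0"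
  using assms unfolding approximates_def by (elim conjE allE; simp; fail)+

lemma approximates_bounds:
  assumes A: "approximates a b D \<tau> n H" and ab: "0 \<le> a" "b \<le> T" and i: "i < n k"
  shows "a \<le> \<tau> k i \<and> 0 \<le> \<tau> k i \<and> \<tau> k i \<le> \<tau> k (Suc i) \<and> \<tau> k (Suc i) \<le> b \<and> \<tau> k (Suc i) \<le> T"
proof -
  have mono: "\<tau> k i \<le> \<tau> k j" if "i \<le> j" "j \<le> n k" for i j
    using that
  proof (induction j rule: dec_induct)
    case (step l)
    then show ?case using approximatesD(3)[OF A, of l k] by simp
  qed simp
  show ?thesis
    using mono[of 0 i] mono[of "Suc i" "n k"] approximatesD(1,2)[OF A, of k] approximatesD(3)[OF A i] ab i by auto
qed

lemma approximates_is_simple: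
  assumes A: "approximates a b D \<tau> n H" and ab: "0 \<le> a" "b \<le> T"
  shows "is_simple (simple_integral (n k) (\<tau> k) (H k) B) (\<lambda>z. simple_process (n k) (\<tau> k) (H k) (snd z) (fst z))"
  unfolding simple_integral_def simple_process_def
  by (rule is_simple_sum) (use approximates_bounds[OF A ab] approximatesD(4)[OF A] in auto)

text \<open>Translates the definition of the Ito integral. Square integrability of
  \<open>I t\<close> is not stated there; it follows because the distance to some square integrable
  simple integral is finite.\<close>

lemma approx_origin:
  assumes t: "t \<in> {0..T}"
  shows "\<exists>\<tau> n H. approximates 0 t (I t) \<tau> n H"
proof -
  obtain n \<tau> H where si: "\<And>k. simple_integrand F t (n k) (\<tau> k) (H k)"
    and L1: "(\<lambda>k. \<integral>\<^sup>+ \<omega>. (\<integral>\<^sup>+ u\<in>{0..t}.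
            ennreal ((norm (\<Phi> u \<omega> - simple_process (n k) (\<tau> k) (H k) u \<omega>))\<^sup>2) \<partial>lborel) \<partial>M) \<longlonglongrightarrow> 0"
    and L2: "(\<lambda>k. \<integral>\<^sup>+ \<omega>. ennreal ((norm (I t \<omega> - simple_integral (n k) (\<tau> k) (H k) B \<omega>))\<^sup>2) \<partial>M) \<longlonglongrightarrow> 0"
    using ito[OF t] unfolding has_ito_integral_def by blast
  have \<tau>: "\<tau> k 0 = 0" "\<tau> k (n k) = t" "i < n k \<Longrightarrow> \<tau> k i \<le> \<tau> k (Suc i)" for k i
    using si[of k] by (auto simp: simple_integrand_def)
  have H: "adapted_bounded (\<tau> k i) (H k i)" if "i < n k" for k i
    using si[of k] that unfolding simple_integrand_def adapted_bounded_def by (force simp: bounded_iff)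
  have mono: "\<tau> k i \<le> \<tau> k j" if "i \<le> j" "j \<le> n k" for i j k
    using that
  proof (induction j rule: dec_induct)
    case (step l)
    then show ?case using \<tau>(3)[of l k] by simp
  qed simp
  have pq: "0 \<le> \<tau> k i \<and> \<tau> k i \<le> \<tau> k (Suc i) \<and> \<tau> k (Suc i) \<le> T \<and> \<tau> k (Suc i) \<le> t" if "i < n k" for k i
    using mono[of 0 i k] mono[of "Suc i" "n k" k] \<tau>(1,2)[of k] \<tau>(3)[OF that] t that by auto
  let ?X = "\<lambda>k. simple_integral (n k) (\<tau> k) (H k) B"
  let ?P = "\<lambda>k z. simple_process (n k) (\<tau> k) (H k) (snd z) (fst z)"
  have simp: "is_simple (?X k) (?P k)" for k
    unfolding simple_integral_def simple_process_def
    by (rule is_simple_sum) (use pq H in auto)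
  note [measurable] = is_simple_isometry(1,2)[OF simp]
  have PI: "integrable (M \<Otimes>\<^sub>M lborel) (\<lambda>z. (norm (?P k z - \<Psi> 0 t z))\<^sup>2)" for k
    by (rule square_integrable_triangle(1)[OF _ is_simple_isometry(4)[OF simp] \<Psi>_square_integrable])
       (measurable, rule norm_triangle_ineq4)
  have "(\<integral>\<^sup>+z. ennreal ((norm (?P k z - \<Psi> 0 t z))\<^sup>2) \<partial>(M \<Otimes>\<^sub>M lborel))
     = (\<integral>\<^sup>+ \<omega>. (\<integral>\<^sup>+ u\<in>{0..t}. ennreal ((norm (\<Phi> u \<omega> - simple_process (n k) (\<tau> k) (H k) u \<omega>))\<^sup>2) \<partial>lborel) \<partial>M)" for k
  proof -
    have "(\<integral>\<^sup>+z. ennreal ((norm (?P k z - \<Psi> 0 t z))\<^sup>2) \<partial>(M \<Otimes>\<^sub>M lborel))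
      = (\<integral>\<^sup>+\<omega>. (\<integral>\<^sup>+u. ennreal ((norm (?P k (\<omega>, u) - \<Psi> 0 t (\<omega>, u)))\<^sup>2) \<partial>lborel) \<partial>M)"
      by (rule sigma_finite_measure.nn_integral_fst[symmetric]) (auto intro: sigma_finite_lborel)
    also have "\<dots> = (\<integral>\<^sup>+ \<omega>. (\<integral>\<^sup>+ u\<in>{0..t}. ennreal ((norm (\<Phi> u \<omega> - simple_process (n k) (\<tau> k) (H k) u \<omega>))\<^sup>2) \<partial>lborel) \<partial>M)"
    proof (rule nn_integral_cong, rule nn_integral_cong_AE)
      fix \<omega>
      \<comment> \<open>The simple process and \<Psi> live on (0,t], while the definition integrates
        over [0,t]; the point 0 is a null set.\<close>
      have "simple_process (n k) (\<tau> k) (H k) u \<omega> = 0" if "u \<notin> {0<..t}" for u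
        unfolding simple_process_def using that pq[of _ k] by (intro sum.neutral) (force simp: indicator_def)
      then have "ennreal ((norm (?P k (\<omega>, u) - \<Psi> 0 t (\<omega>, u)))\<^sup>2)
         = ennreal ((norm (\<Phi> u \<omega> - simple_process (n k) (\<tau> k) (H k) u \<omega>))\<^sup>2) * indicator {0..t} u" if "u \<noteq> 0" for u
        using that by (auto simp: indicator_def norm_minus_commute)
      then show "AE u in lborel. ennreal ((norm (?P k (\<omega>, u) - \<Psi> 0 t (\<omega>, u)))\<^sup>2)
         = ennreal ((norm (\<Phi> u \<omega> - simple_process (n k) (\<tau> k) (H k) u \<omega>))\<^sup>2) * indicator {0..t} u"
        using AE_lborel_singleton[of "0 :: real"] by (auto elim: AE_mp)
    qed
    finally show ?thesis .
  qed
  then have PL: "(\<lambda>k. \<integral>z. (norm (?P k z - \<Psi> 0 t z))\<^sup>2 \<partial>(M \<Otimes>\<^sub>M lborel)) \<longlonglongrightarrow> 0"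
    using L1 by (intro tendsto_0_of_nn_integral PI) auto
  note [measurable] = I_measurable[OF t]
  have "eventually (\<lambda>k. (\<integral>\<^sup>+ \<omega>. ennreal ((norm (I t \<omega> - ?X k \<omega>))\<^sup>2) \<partial>M) < 1) sequentially"
    using L2 by (rule order_tendstoD) simp
  then obtain k0 where "(\<integral>\<^sup>+ \<omega>. ennreal ((norm (I t \<omega> - ?X k0 \<omega>))\<^sup>2) \<partial>M) < 1"
    by (auto simp: eventually_sequentially)
  then have "integrable M (\<lambda>\<omega>. (norm (I t \<omega> - ?X k0 \<omega>))\<^sup>2)"
    by (intro integrableI_bounded) (auto simp: order.strict_trans)
  then have I2: "integrable M (\<lambda>\<omega>. (norm (I t \<omega>))\<^sup>2)"
    by (rule square_integrable_triangle(1)[OF _ _ is_simple_isometry(3)[OF simp[of k0]], rotated])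
       (auto simp: norm_minus_commute[of "I t _"] norm_le_diff_add)
  have XI: "integrable M (\<lambda>\<omega>. (norm (?X k \<omega> - I t \<omega>))\<^sup>2)" for k
    by (rule square_integrable_triangle(1)[OF _ is_simple_isometry(3)[OF simp] I2])
       (measurable, rule norm_triangle_ineq4)
  have XL: "(\<lambda>k. \<integral>\<omega>. (norm (?X k \<omega> - I t \<omega>))\<^sup>2 \<partial>M) \<longlonglongrightarrow> 0"
    using L2 by (intro tendsto_0_of_nn_integral XI) (auto simp: norm_minus_commute)
  have "approximates 0 t (I t) \<tau> n H"
    unfolding approximates_def using \<tau> H XI XL PI PL by auto
  then show ?thesis by blast
qed

text \<open>The approximants of \<open>I b\<close> and of \<open>I a\<close> are unrelated, so
  additivity of the integral is not built in. Those of \<open>I b\<close> are cut to (a,b] and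
  truncated at K, and their integrands converge to \<open>\<Psi> a b\<close>. That their integrals
  converge to \<open>I b - I a\<close> follows from the isometry, applied to their combination with
  the two original sequences, whose integrand tends to 0. The uniform bound K on the coefficients is
  what the exponential moments need.\<close>

lemma approx_increment:
  assumes ab: "0 \<le> a" "a \<le> b" "b \<le> T"
  shows "\<exists>\<tau> n H. approximates a b (\<lambda>\<omega>. I b \<omega> - I a \<omega>) \<tau> n H \<and> (\<forall>k i \<omega>. norm (H k i \<omega>) \<le> K)"
proof -
  have bT: "b \<in> {0..T}" and aT: "a \<in> {0..T}" using ab by auto
  note [measurable] = I_measurable[OF aT] I_measurable[OF bT]
  obtain \<tau> n H where A: "approximates 0 b (I b) \<tau> n H" using approx_origin[OF bT] by blast
  obtain \<tau>' n' H' where A': "approximates 0 a (I a) \<tau>' n' H'" using approx_origin[OF aT] by blast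
  note \<tau> = approximatesD(1-3)[OF A] and H = approximatesD(4)[OF A]
    and X = approximatesD(5,6)[OF A] and P = approximatesD(7,8)[OF A]
    and X' = approximatesD(5,6)[OF A'] and P' = approximatesD(7,8)[OF A']
    and S = approximates_is_simple[OF A order_refl ab(3)]
  have S': "is_simple (simple_integral (n' k) (\<tau>' k) (H' k) B) (\<lambda>z. simple_process (n' k) (\<tau>' k) (H' k) (snd z) (fst z))" for k
    by (rule approximates_is_simple[OF A']) (use ab in auto)
  \<comment> \<open>Nearest-point projection onto the ball: it is 1-Lipschitz and fixes the values
    of \<Phi>, so truncation cannot worsen the approximation.\<close>
  define \<pi> where "\<pi> = closest_point (cball (0 :: real^'d^'d) K)"
  have \<pi>_bound: "norm (\<pi> x) \<le> K" for x
    using closest_point_in_set[of "cball (0 :: real^'d^'d) K" x] K_nonneg by (simp add: \<pi>_def)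
  have \<pi>_self: "\<pi> x = x" if "norm x \<le> K" for x
    unfolding \<pi>_def by (rule closest_point_self) (use that in simp)
  have \<pi>_lip: "norm (\<pi> x - \<pi> y) \<le> norm (x - y)" for x y
    unfolding \<pi>_def dist_norm[symmetric] using K_nonneg by (intro closest_point_lipschitz) auto
  have \<pi>_meas [measurable]: "\<pi> \<in> borel_measurable borel"
    unfolding \<pi>_def using K_nonneg by (intro borel_measurable_continuous_onI continuous_on_closest_point) auto
  \<comment> \<open>Partition points before a are moved to a, which empties the intervals to the
    left of a.\<close>
  define s where "s k i = max a (\<tau> k i)" for k i
  define G where "G k i \<omega> = \<pi> (H k i \<omega>)" for k i \<omega>
  have mono: "\<tau> k i \<le> \<tau> k j" if "i \<le> j" "j \<le> n k" for i j k
    using that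
  proof (induction j rule: dec_induct)
    case (step l)
    then show ?case using \<tau>(3)[of l k] by simp
  qed simp
  have s: "s k 0 = a" "s k (n k) = b" "i < n k \<Longrightarrow> s k i \<le> s k (Suc i)" for k i
    using \<tau>(1,2)[of k] \<tau>(3)[of i k] ab by (auto simp: s_def)
  have G: "adapted_bounded (s k i) (G k i)" if "i < n k" for k i
  proof -
    have "H k i \<in> borel_measurable (F (s k i))"
      using adapted_boundedD(1)[OF H[OF that]] by (rule measurable_F_mono) (simp add: s_def)
    then show ?thesis unfolding adapted_bounded_def G_def using \<pi>_bound by auto
  qed
  have sT: "0 \<le> s k i \<and> s k i \<le> s k (Suc i) \<and> s k (Suc i) \<le> T" if "i < n k" for k i
    using mono[of "Suc i" "n k" k] \<tau>(2)[of k] s(3)[OF that] ab that by (auto simp: s_def)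
  let ?X = "\<lambda>k. simple_integral (n k) (\<tau> k) (H k) B" and ?P = "\<lambda>k z. simple_process (n k) (\<tau> k) (H k) (snd z) (fst z)"
  let ?X' = "\<lambda>k. simple_integral (n' k) (\<tau>' k) (H' k) B" and ?P' = "\<lambda>k z. simple_process (n' k) (\<tau>' k) (H' k) (snd z) (fst z)"
  let ?Y = "\<lambda>k. simple_integral (n k) (s k) (G k) B" and ?Q = "\<lambda>k z. simple_process (n k) (s k) (G k) (snd z) (fst z)"
  let ?D = "\<lambda>\<omega>. I b \<omega> - I a \<omega>"
  have SY: "is_simple (?Y k) (?Q k)" for k
    unfolding simple_integral_def simple_process_def
    by (rule is_simple_sum) (use sT G in auto)
  note [measurable] = is_simple_isometry(1,2)[OF S] is_simple_isometry(1,2)[OF S'] is_simple_isometry(1,2)[OF SY]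
  have Q_eq: "?Q k z = indicator {a<..} (snd z) *\<^sub>R \<pi> (?P k z)" for k z
  proof -
    have "indicator {s k i<..s k (Suc i)} u = indicator {a<..} u * indicat_real {\<tau> k i<..\<tau> k (Suc i)} u" for i u
      by (auto simp: s_def indicator_def)
    then have "?Q k z = indicator {a<..} (snd z) *\<^sub>R (\<Sum>i<n k. indicator {\<tau> k i<..\<tau> k (Suc i)} (snd z) *\<^sub>R \<pi> (H k i (fst z)))"
      by (simp only: simple_process_def G_def scaleR_sum_right scaleR_scaleR)
    also have "(\<Sum>i<n k. indicator {\<tau> k i<..\<tau> k (Suc i)} (snd z) *\<^sub>R \<pi> (H k i (fst z))) = \<pi> (?P k z)"
      unfolding simple_process_def by (rule sum_indicator_Ioc_commute) (use \<tau>(3) \<pi>_self K_nonneg in auto)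
    finally show ?thesis .
  qed
  have Q_le: "norm (?Q k z - \<Psi> a b z) \<le> norm (?P k z - \<Psi> 0 b z)" if "z \<in> space (M \<Otimes>\<^sub>M lborel)" for k z
  proof (cases "a < snd z")
    case True
    have "\<pi> (\<Psi> 0 b z) = \<Psi> 0 b z"
      using \<Phi>_bound K_nonneg that by (intro \<pi>_self) (auto simp: indicator_def space_pair_measure)
    moreover have "\<Psi> a b z = \<Psi> 0 b z" using True ab by (auto simp: indicator_def)
    moreover have "?Q k z = \<pi> (?P k z)" using True by (simp add: Q_eq)
    ultimately show ?thesis using \<pi>_lip[of "?P k z" "\<Psi> 0 b z"] by (simp only:)
  qed (simp add: Q_eq)
  have Q1: "integrable (M \<Otimes>\<^sub>M lborel) (\<lambda>z. (norm (?Q k z - \<Psi> a b z))\<^sup>2)" for k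
    by (rule Bochner_Integration.integrable_bound[OF P(1)[of k]]) (measurable, use Q_le in \<open>auto intro!: AE_I2 power_mono\<close>)
  have Q2: "(\<lambda>k. \<integral>z. (norm (?Q k z - \<Psi> a b z))\<^sup>2 \<partial>(M \<Otimes>\<^sub>M lborel)) \<longlonglongrightarrow> 0"
  proof (rule tendsto_sandwich[OF _ _ tendsto_const P(2)])
    show "\<forall>\<^sub>F k in sequentially. (\<integral>z. (norm (?Q k z - \<Psi> a b z))\<^sup>2 \<partial>(M \<Otimes>\<^sub>M lborel))
      \<le> (\<integral>z. (norm (?P k z - \<Psi> 0 b z))\<^sup>2 \<partial>(M \<Otimes>\<^sub>M lborel))"
      using Q1 P(1) Q_le by (intro always_eventually allI integral_mono power_mono) auto
  qed auto
  \<comment> \<open>\<open>?R\<close> is itself a simple integral with integrand \<open>?V\<close>.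
    Since \<open>\<Psi> 0 b\<close> is the sum of \<open>\<Psi> 0 a\<close> and
    \<open>\<Psi> a b\<close>, the limits cancel and \<open>?V\<close> tends to 0 in L2.\<close>
  let ?R = "\<lambda>k \<omega>. ?Y k \<omega> + (?X' k \<omega> + - ?X k \<omega>)" and ?V = "\<lambda>k z. ?Q k z + (?P' k z + - ?P k z)"
  have SR: "is_simple (?R k) (?V k)" for k
    by (intro is_simple_add is_simple_uminus S S' SY)
  note [measurable] = is_simple_isometry(1,2)[OF SR]
  have \<Psi>_split: "\<Psi> 0 b z = \<Psi> 0 a z + \<Psi> a b z" for z using ab by (auto simp: indicator_def)
  have Z_le: "norm (?P' k z - ?P k z + \<Psi> a b z) \<le> norm (?P' k z - \<Psi> 0 a z) + norm (?P k z - \<Psi> 0 b z)" for k z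
  proof -
    have "?P' k z - ?P k z + \<Psi> a b z = (?P' k z - \<Psi> 0 a z) - (?P k z - \<Psi> 0 b z)" unfolding \<Psi>_split by simp
    then show ?thesis by (metis norm_triangle_ineq4)
  qed
  have Z1: "integrable (M \<Otimes>\<^sub>M lborel) (\<lambda>z. (norm (?P' k z - ?P k z + \<Psi> a b z))\<^sup>2)"
    and Z2: "(\<integral>z. (norm (?P' k z - ?P k z + \<Psi> a b z))\<^sup>2 \<partial>(M \<Otimes>\<^sub>M lborel))
      \<le> 2 * (\<integral>z. (norm (?P' k z - \<Psi> 0 a z))\<^sup>2 \<partial>(M \<Otimes>\<^sub>M lborel)) + 2 * (\<integral>z. (norm (?P k z - \<Psi> 0 b z))\<^sup>2 \<partial>(M \<Otimes>\<^sub>M lborel))" for k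
    by (rule square_integrable_triangle[OF _ P'(1) P(1) Z_le], measurable)+
  have V_le: "norm (?V k z) \<le> norm (?Q k z - \<Psi> a b z) + norm (?P' k z - ?P k z + \<Psi> a b z)" for k z
    by (rule order_trans[OF _ norm_triangle_ineq]) (simp add: algebra_simps)
  have R_le: "(\<integral>\<omega>. (norm (?R k \<omega>))\<^sup>2 \<partial>M) \<le> 2 * (\<integral>z. (norm (?Q k z - \<Psi> a b z))\<^sup>2 \<partial>(M \<Otimes>\<^sub>M lborel))
      + 2 * (2 * (\<integral>z. (norm (?P' k z - \<Psi> 0 a z))\<^sup>2 \<partial>(M \<Otimes>\<^sub>M lborel)) + 2 * (\<integral>z. (norm (?P k z - \<Psi> 0 b z))\<^sup>2 \<partial>(M \<Otimes>\<^sub>M lborel)))" for k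
    using square_integrable_triangle(2)[OF _ Q1 Z1 V_le, of k] Z2[of k] is_simple_isometry(5)[OF SR, of k] by simp
  have W_le: "norm (?X k \<omega> - ?X' k \<omega> - ?D \<omega>) \<le> norm (?X k \<omega> - I b \<omega>) + norm (?X' k \<omega> - I a \<omega>)" for k \<omega>
    by (rule order_trans[OF _ norm_triangle_ineq4]) (simp add: algebra_simps)
  have W1: "integrable M (\<lambda>\<omega>. (norm (?X k \<omega> - ?X' k \<omega> - ?D \<omega>))\<^sup>2)"
    and W2: "(\<integral>\<omega>. (norm (?X k \<omega> - ?X' k \<omega> - ?D \<omega>))\<^sup>2 \<partial>M) \<le> 2 * (\<integral>\<omega>. (norm (?X k \<omega> - I b \<omega>))\<^sup>2 \<partial>M) + 2 * (\<integral>\<omega>. (norm (?X' k \<omega> - I a \<omega>))\<^sup>2 \<partial>M)" for k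
    by (rule square_integrable_triangle[OF _ X(1) X'(1) W_le], measurable)+
  have Y_le: "norm (?Y k \<omega> - ?D \<omega>) \<le> norm (?R k \<omega>) + norm (?X k \<omega> - ?X' k \<omega> - ?D \<omega>)" for k \<omega>
    by (rule order_trans[OF _ norm_triangle_ineq]) (simp add: algebra_simps)
  have Y1: "integrable M (\<lambda>\<omega>. (norm (?Y k \<omega> - ?D \<omega>))\<^sup>2)"
    and Y2: "(\<integral>\<omega>. (norm (?Y k \<omega> - ?D \<omega>))\<^sup>2 \<partial>M) \<le> 2 * (\<integral>\<omega>. (norm (?R k \<omega>))\<^sup>2 \<partial>M) + 2 * (\<integral>\<omega>. (norm (?X k \<omega> - ?X' k \<omega> - ?D \<omega>))\<^sup>2 \<partial>M)" for k
    by (rule square_integrable_triangle[OF _ is_simple_isometry(3)[OF SR] W1 Y_le], measurable)+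
  have Y3: "(\<lambda>k. \<integral>\<omega>. (norm (?Y k \<omega> - ?D \<omega>))\<^sup>2 \<partial>M) \<longlonglongrightarrow> 0"
  proof (rule tendsto_sandwich[OF _ _ tendsto_const])
    let ?b = "\<lambda>k. 2 * (2 * (\<integral>z. (norm (?Q k z - \<Psi> a b z))\<^sup>2 \<partial>(M \<Otimes>\<^sub>M lborel))
      + 2 * (2 * (\<integral>z. (norm (?P' k z - \<Psi> 0 a z))\<^sup>2 \<partial>(M \<Otimes>\<^sub>M lborel)) + 2 * (\<integral>z. (norm (?P k z - \<Psi> 0 b z))\<^sup>2 \<partial>(M \<Otimes>\<^sub>M lborel))))
      + 2 * (2 * (\<integral>\<omega>. (norm (?X k \<omega> - I b \<omega>))\<^sup>2 \<partial>M) + 2 * (\<integral>\<omega>. (norm (?X' k \<omega> - I a \<omega>))\<^sup>2 \<partial>M))"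
    have "?b \<longlonglongrightarrow> 2 * (2 * 0 + 2 * (2 * 0 + 2 * 0)) + 2 * (2 * 0 + 2 * 0)"
      by (intro tendsto_intros Q2 P'(2) P(2) X(2) X'(2))
    then show "?b \<longlonglongrightarrow> 0" by simp
    show "\<forall>\<^sub>F k in sequentially. (\<integral>\<omega>. (norm (?Y k \<omega> - ?D \<omega>))\<^sup>2 \<partial>M) \<le> ?b k"
    proof (intro always_eventually allI)
      fix k show "(\<integral>\<omega>. (norm (?Y k \<omega> - ?D \<omega>))\<^sup>2 \<partial>M) \<le> ?b k"
        by (rule order_trans[OF Y2 add_mono[OF mult_left_mono[OF R_le] mult_left_mono[OF W2]]]) simp_all
    qed
  qed auto
  have "approximates a b (\<lambda>\<omega>. I b \<omega> - I a \<omega>) s n G"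
    unfolding approximates_def using s G Y1 Y3 Q1 Q2 by blast
  then show ?thesis using \<pi>_bound unfolding G_def by blast
qed

section \<open>Isometry and moments of increments\<close>

lemma increment_L2:
  assumes ab: "0 \<le> a" "a \<le> b" "b \<le> T"
  shows "integrable M (\<lambda>\<omega>. (norm (I b \<omega> - I a \<omega>))\<^sup>2)"
proof -
  have [measurable]: "I a \<in> borel_measurable M" "I b \<in> borel_measurable M" using ab by auto
  obtain \<tau> n H where A: "approximates a b (\<lambda>\<omega>. I b \<omega> - I a \<omega>) \<tau> n H" using approx_increment[OF ab] by blast
  note S = approximates_is_simple[OF A ab(1,3)]
  show ?thesis
    by (rule square_integrable_triangle(1)[OF _ approximatesD(5)[OF A] is_simple_isometry(3)[OF S]])
       (measurable, rule norm_le_diff_add)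
qed

text \<open>The weighted form of the isometry is a conditional isometry given \<open>F a\<close>.\<close>

lemma ito_isometry:
  fixes W :: "'w \<Rightarrow> real^'d^'d"
  assumes ab: "0 \<le> a" "a \<le> b" "b \<le> T" and W: "adapted_bounded a W"
  shows "integrable M (\<lambda>\<omega>. (norm (W \<omega> *v (I b \<omega> - I a \<omega>)))\<^sup>2)"
    and "integrable (M \<Otimes>\<^sub>M lborel) (\<lambda>z. (norm (W (fst z) ** \<Psi> a b z))\<^sup>2)"
    and "(\<integral>\<omega>. (norm (W \<omega> *v (I b \<omega> - I a \<omega>)))\<^sup>2 \<partial>M) = (\<integral>z. (norm (W (fst z) ** \<Psi> a b z))\<^sup>2 \<partial>(M \<Otimes>\<^sub>M lborel))"
    and "integrable M (\<lambda>\<omega>. (W \<omega> *v (I b \<omega> - I a \<omega>)) $ i)"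
    and "(\<integral>\<omega>. (W \<omega> *v (I b \<omega> - I a \<omega>)) $ i \<partial>M) = 0"
proof -
  let ?D = "\<lambda>\<omega>. I b \<omega> - I a \<omega>"
  have [measurable]: "I a \<in> borel_measurable M" "I b \<in> borel_measurable M" "W \<in> borel_measurable M"
    using ab adapted_boundedD(2)[OF W] by auto
  obtain w where w: "\<And>\<omega>. \<omega> \<in> space M \<Longrightarrow> norm (W \<omega>) \<le> w" using W by (auto simp: adapted_bounded_def)
  have w0: "0 \<le> w" using w not_empty by (meson all_not_in_conv norm_ge_zero order_trans)
  obtain \<tau> n H where A: "approximates a b ?D \<tau> n H" using approx_increment[OF ab] by blast
  let ?X = "\<lambda>k. simple_integral (n k) (\<tau> k) (H k) B" and ?P = "\<lambda>k z. simple_process (n k) (\<tau> k) (H k) (snd z) (fst z)"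
  note S = approximates_is_simple[OF A ab(1,3)]
  \<comment> \<open>W is known at time a and all partition points are at least a, so W can be
    absorbed into the coefficients.\<close>
  have SW: "is_simple (\<lambda>\<omega>. W \<omega> *v ?X k \<omega>) (\<lambda>z. W (fst z) ** ?P k z)" for k
  proof -
    have "is_simple (\<lambda>\<omega>. \<Sum>i<n k. (W \<omega> ** H k i \<omega>) *v inc (\<tau> k i) (\<tau> k (Suc i)) \<omega>)
      (\<lambda>z. \<Sum>i<n k. indicator {\<tau> k i<..\<tau> k (Suc i)} (snd z) *\<^sub>R (W (fst z) ** H k i (fst z)))"
    proof (rule is_simple_sum, intro conjI)
      fix i assume i: "i < n k"
      show "0 \<le> \<tau> k i" "\<tau> k i \<le> \<tau> k (Suc i)" "\<tau> k (Suc i) \<le> T" using approximates_bounds[OF A ab(1,3) i] by auto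
      show "adapted_bounded (\<tau> k i) (\<lambda>\<omega>. W \<omega> ** H k i \<omega>)"
        using approximates_bounds[OF A ab(1,3) i]
        by (intro adapted_bounded_matrix_mult approximatesD(4)[OF A i] adapted_bounded_mono[OF W]) auto
    qed
    moreover have "W \<omega> *v (\<Sum>i\<in>X. f i) = (\<Sum>i\<in>X. W \<omega> *v f i)" for \<omega> and f :: "nat \<Rightarrow> real^'d" and X
      by (rule linear_sum[OF matrix_vector_mul_linear])
    moreover have "W \<omega> ** (\<Sum>i\<in>X. f i) = (\<Sum>i\<in>X. W \<omega> ** f i)" for \<omega> and f :: "nat \<Rightarrow> real^'d^'d" and X
      by (rule bounded_bilinear.sum_right[OF bounded_bilinear_matrix_mult])
    ultimately show ?thesis
      by (simp only: simple_integral_def simple_process_def matrix_vector_mul_assoc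
          bounded_bilinear.scaleR_right[OF bounded_bilinear_matrix_mult])
  qed
  note [measurable] = is_simple_isometry(1,2)[OF S] is_simple_isometry(1,2)[OF SW]
  have X_le: "norm (W \<omega> *v ?X k \<omega> - W \<omega> *v ?D \<omega>) \<le> w * norm (?X k \<omega> - ?D \<omega>)" if "\<omega> \<in> space M" for \<omega> k
    using norm_matrix_vector_mult_le[of "W \<omega>" "?X k \<omega> - ?D \<omega>"] mult_right_mono[OF w[OF that] norm_ge_zero[of "?X k \<omega> - ?D \<omega>"]]
    by (simp only: matrix_vector_mult_diff_distrib[symmetric])
  have P_le: "norm (W (fst z) ** ?P k z - W (fst z) ** \<Psi> a b z) \<le> w * norm (?P k z - \<Psi> a b z)"
    if "z \<in> space (M \<Otimes>\<^sub>M lborel)" for z k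
  proof -
    have "norm (W (fst z)) \<le> w" using that w by (auto simp: space_pair_measure)
    then show ?thesis
      using norm_matrix_mult_le[of "W (fst z)" "?P k z - \<Psi> a b z"] mult_right_mono[of "norm (W (fst z))" w "norm (?P k z - \<Psi> a b z)"]
      by (simp only: bounded_bilinear.diff_right[OF bounded_bilinear_matrix_mult]) (meson norm_ge_zero order_trans)
  qed
  have X2: "(norm (W \<omega> *v ?X k \<omega> - W \<omega> *v ?D \<omega>))\<^sup>2 \<le> w\<^sup>2 * (norm (?X k \<omega> - ?D \<omega>))\<^sup>2" if "\<omega> \<in> space M" for \<omega> k
    using power_mono[OF X_le[OF that] norm_ge_zero, where n = 2] by (simp only: power_mult_distrib)
  have P2: "(norm (W (fst z) ** ?P k z - W (fst z) ** \<Psi> a b z))\<^sup>2 \<le> w\<^sup>2 * (norm (?P k z - \<Psi> a b z))\<^sup>2"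
    if "z \<in> space (M \<Otimes>\<^sub>M lborel)" for z k
    using power_mono[OF P_le[OF that] norm_ge_zero, where n = 2] by (simp only: power_mult_distrib)
  have XI: "integrable M (\<lambda>\<omega>. (norm (W \<omega> *v ?X k \<omega> - W \<omega> *v ?D \<omega>))\<^sup>2)" for k
    by (rule Bochner_Integration.integrable_bound[OF integrable_mult_right[OF approximatesD(5)[OF A, of k], of "w\<^sup>2"]])
       (measurable, use X2 in \<open>auto intro!: AE_I2\<close>)
  have PI: "integrable (M \<Otimes>\<^sub>M lborel) (\<lambda>z. (norm (W (fst z) ** ?P k z - W (fst z) ** \<Psi> a b z))\<^sup>2)" for k
    by (rule Bochner_Integration.integrable_bound[OF integrable_mult_right[OF approximatesD(7)[OF A, of k], of "w\<^sup>2"]])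
       (measurable, use P2 in \<open>auto intro!: AE_I2\<close>)
  have XL: "(\<lambda>k. \<integral>\<omega>. (norm (W \<omega> *v ?X k \<omega> - W \<omega> *v ?D \<omega>))\<^sup>2 \<partial>M) \<longlonglongrightarrow> 0"
  proof (rule tendsto_sandwich[OF _ _ tendsto_const])
    show "(\<lambda>k. w\<^sup>2 * (\<integral>\<omega>. (norm (?X k \<omega> - ?D \<omega>))\<^sup>2 \<partial>M)) \<longlonglongrightarrow> 0"
      using tendsto_mult_right_zero[OF approximatesD(6)[OF A]] .
    show "\<forall>\<^sub>F k in sequentially. (\<integral>\<omega>. (norm (W \<omega> *v ?X k \<omega> - W \<omega> *v ?D \<omega>))\<^sup>2 \<partial>M) \<le> w\<^sup>2 * (\<integral>\<omega>. (norm (?X k \<omega> - ?D \<omega>))\<^sup>2 \<partial>M)"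
      by (intro always_eventually allI order_trans[OF integral_mono[OF XI integrable_mult_right[OF approximatesD(5)[OF A]] X2]]) auto
  qed auto
  have PL: "(\<lambda>k. \<integral>z. (norm (W (fst z) ** ?P k z - W (fst z) ** \<Psi> a b z))\<^sup>2 \<partial>(M \<Otimes>\<^sub>M lborel)) \<longlonglongrightarrow> 0"
  proof (rule tendsto_sandwich[OF _ _ tendsto_const])
    show "(\<lambda>k. w\<^sup>2 * (\<integral>z. (norm (?P k z - \<Psi> a b z))\<^sup>2 \<partial>(M \<Otimes>\<^sub>M lborel))) \<longlonglongrightarrow> 0"
      using tendsto_mult_right_zero[OF approximatesD(8)[OF A]] .
    show "\<forall>\<^sub>F k in sequentially. (\<integral>z. (norm (W (fst z) ** ?P k z - W (fst z) ** \<Psi> a b z))\<^sup>2 \<partial>(M \<Otimes>\<^sub>M lborel))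
        \<le> w\<^sup>2 * (\<integral>z. (norm (?P k z - \<Psi> a b z))\<^sup>2 \<partial>(M \<Otimes>\<^sub>M lborel))"
      by (intro always_eventually allI order_trans[OF integral_mono[OF PI integrable_mult_right[OF approximatesD(7)[OF A]] P2]]) auto
  qed auto
  show DI: "integrable M (\<lambda>\<omega>. (norm (W \<omega> *v ?D \<omega>))\<^sup>2)"
    by (rule square_integrable_triangle(1)[OF _ XI[of 0] is_simple_isometry(3)[OF SW[of 0]]])
       (measurable, rule norm_le_diff_add)
  show \<Psi>I: "integrable (M \<Otimes>\<^sub>M lborel) (\<lambda>z. (norm (W (fst z) ** \<Psi> a b z))\<^sup>2)"
    by (rule square_integrable_triangle(1)[OF _ PI[of 0] is_simple_isometry(4)[OF SW[of 0]]])
       (measurable, rule norm_le_diff_add)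
  have "(\<lambda>k. \<integral>\<omega>. (norm (W \<omega> *v ?X k \<omega>))\<^sup>2 \<partial>M) \<longlonglongrightarrow> (\<integral>\<omega>. (norm (W \<omega> *v ?D \<omega>))\<^sup>2 \<partial>M)"
    by (rule integral_norm_power2_tendsto(2)[OF _ _ XI DI XL]) measurable
  moreover have "(\<lambda>k. \<integral>z. (norm (W (fst z) ** ?P k z))\<^sup>2 \<partial>(M \<Otimes>\<^sub>M lborel)) \<longlonglongrightarrow> (\<integral>z. (norm (W (fst z) ** \<Psi> a b z))\<^sup>2 \<partial>(M \<Otimes>\<^sub>M lborel))"
    by (rule integral_norm_power2_tendsto(2)[OF _ _ PI \<Psi>I PL]) measurable
  ultimately show "(\<integral>\<omega>. (norm (W \<omega> *v ?D \<omega>))\<^sup>2 \<partial>M) = (\<integral>z. (norm (W (fst z) ** \<Psi> a b z))\<^sup>2 \<partial>(M \<Otimes>\<^sub>M lborel))"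
    unfolding is_simple_isometry(5)[OF SW] by (rule LIMSEQ_unique)
  show int1: "integrable M (\<lambda>\<omega>. (W \<omega> *v ?D \<omega>) $ i)"
  proof (rule Bochner_Integration.integrable_bound[of M "\<lambda>\<omega>. 1 + (norm (W \<omega> *v ?D \<omega>))\<^sup>2"])
    have "\<bar>v $ i\<bar> \<le> 1 + (norm v)\<^sup>2" for v :: "real^'d"
      using component_le_norm_cart[of v i] sum_squares_bound[of "norm v" 1] norm_ge_zero[of v]
      by simp
    then show "AE \<omega> in M. norm ((W \<omega> *v ?D \<omega>) $ i) \<le> norm (1 + (norm (W \<omega> *v ?D \<omega>))\<^sup>2)"
      by (intro AE_I2) (simp add: abs_of_nonneg)
  qed (use DI in simp, measurable)
  show "(\<integral>\<omega>. (W \<omega> *v ?D \<omega>) $ i \<partial>M) = 0"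
  proof -
    let ?d = "\<lambda>k \<omega>. W \<omega> *v ?X k \<omega> - W \<omega> *v ?D \<omega>"
    \<comment> \<open>Convergence in mean square implies convergence of means; the bound x <= e / 2
      + x^2 / (2 e) does the work of the Cauchy-Schwarz inequality.\<close>
    have "\<bar>\<integral>\<omega>. (W \<omega> *v ?D \<omega>) $ i \<partial>M\<bar> \<le> e" if e: "e > 0" for e
    proof -
      have "\<forall>\<^sub>F k in sequentially. (\<integral>\<omega>. (norm (?d k \<omega>))\<^sup>2 \<partial>M) < e\<^sup>2"
        using XL by (rule order_tendstoD) (use e in simp)
      then obtain k where k: "(\<integral>\<omega>. (norm (?d k \<omega>))\<^sup>2 \<partial>M) < e\<^sup>2" by (auto simp: eventually_sequentially)
      have pw: "\<bar>?d k \<omega> $ i\<bar> \<le> e / 2 + (norm (?d k \<omega>))\<^sup>2 / (2 * e)" for \<omega>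
      proof -
        have *: "x \<le> e / 2 + x\<^sup>2 / (2 * e)" for x
        proof -
          have "0 \<le> (e - x)\<^sup>2 / (2 * e)" using e by simp
          also have "\<dots> = e / 2 + x\<^sup>2 / (2 * e) - x" using e by (simp add: power2_eq_square field_simps)
          finally show ?thesis by simp
        qed
        show ?thesis by (rule order_trans[OF component_le_norm_cart *])
      qed
      have dI: "integrable M (\<lambda>\<omega>. ?d k \<omega> $ i)" using int1 is_simple_isometry(6)[OF SW, of k i] by simp
      have "(\<integral>\<omega>. ?d k \<omega> $ i \<partial>M) = - (\<integral>\<omega>. (W \<omega> *v ?D \<omega>) $ i \<partial>M)"
        using int1 is_simple_isometry(6,7)[OF SW, of k i] by simp
      then have "\<bar>\<integral>\<omega>. (W \<omega> *v ?D \<omega>) $ i \<partial>M\<bar> = \<bar>\<integral>\<omega>. ?d k \<omega> $ i \<partial>M\<bar>" by simp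
      also have "\<dots> \<le> (\<integral>\<omega>. \<bar>?d k \<omega> $ i\<bar> \<partial>M)" by (rule integral_abs_bound)
      also have "\<dots> \<le> (\<integral>\<omega>. e / 2 + (norm (?d k \<omega>))\<^sup>2 / (2 * e) \<partial>M)"
        using XI[of k] dI by (intro integral_mono pw) (auto simp del: vector_minus_component)
      also have "\<dots> = e / 2 + (\<integral>\<omega>. (norm (?d k \<omega>))\<^sup>2 \<partial>M) / (2 * e)"
        using XI[of k] by (simp add: prob_space)
      also have "\<dots> \<le> e / 2 + e\<^sup>2 / (2 * e)" using k e by (intro add_left_mono divide_right_mono) auto
      also have "\<dots> = e" using e by (simp add: power2_eq_square)
      finally show ?thesis .
    qed
    then have "\<bar>\<integral>\<omega>. (W \<omega> *v ?D \<omega>) $ i \<partial>M\<bar> \<le> 0" by - (rule field_le_epsilon, simp)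
    then show ?thesis by simp
  qed
qed

text \<open>Fatou's lemma along an almost surely convergent subsequence of simple integrals whose
  coefficients are all bounded by the same K.\<close>

lemma ito_exp_bound:
  assumes ab: "0 \<le> a" "a \<le> b" "b \<le> T"
  shows "(\<integral>\<^sup>+\<omega>. ennreal (exp (l \<bullet> (I b \<omega> - I a \<omega>))) \<partial>M) \<le> ennreal (exp (K\<^sup>2 * (norm l)\<^sup>2 * (b - a) / 2))"
proof -
  let ?D = "\<lambda>\<omega>. I b \<omega> - I a \<omega>"
  obtain \<tau> n H where A: "approximates a b ?D \<tau> n H" and HK: "\<And>k i \<omega>. norm (H k i \<omega>) \<le> K"
    using approx_increment[OF ab] by blast
  let ?X = "\<lambda>k. simple_integral (n k) (\<tau> k) (H k) B"
  note S = approximates_is_simple[OF A ab(1,3)]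
  note [measurable] = is_simple_isometry(1)[OF S]
  obtain r where r: "strict_mono r" "AE \<omega> in M. (\<lambda>k. (norm (?X (r k) \<omega> - ?D \<omega>))\<^sup>2) \<longlonglongrightarrow> 0"
    using tendsto_L1_AE_subseq[where u = "\<lambda>k \<omega>. (norm (?X k \<omega> - ?D \<omega>))\<^sup>2" and M = M]
      approximatesD(5,6)[OF A] by auto
  have bound: "(\<integral>\<^sup>+\<omega>. ennreal (exp (l \<bullet> ?X k \<omega>)) \<partial>M) \<le> ennreal (exp (K\<^sup>2 * (norm l)\<^sup>2 * (b - a) / 2))" for k
  proof -
    have "(\<integral>\<^sup>+\<omega>. ennreal (exp (l \<bullet> (\<Sum>i<n k. H k i \<omega> *v inc (\<tau> k i) (\<tau> k (Suc i)) \<omega>))) \<partial>M)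
        \<le> ennreal (exp (K\<^sup>2 * (norm l)\<^sup>2 * (\<tau> k (n k) - \<tau> k 0) / 2))"
      by (rule simple_integral_exp_bound)
         (use ab approximatesD(1-3)[OF A] approximatesD(4)[OF A] HK in \<open>auto intro: adapted_boundedD(1)\<close>)
    then show ?thesis by (simp add: simple_integral_def approximatesD(1,2)[OF A])
  qed
  have "(\<integral>\<^sup>+\<omega>. ennreal (exp (l \<bullet> ?D \<omega>)) \<partial>M) \<le> (\<integral>\<^sup>+\<omega>. liminf (\<lambda>k. ennreal (exp (l \<bullet> ?X (r k) \<omega>))) \<partial>M)"
  proof (rule nn_integral_mono_AE)
    show "AE \<omega> in M. ennreal (exp (l \<bullet> ?D \<omega>)) \<le> liminf (\<lambda>k. ennreal (exp (l \<bullet> ?X (r k) \<omega>)))"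
      using r(2)
    proof (rule AE_mp, intro AE_I2 impI)
      fix \<omega> assume "(\<lambda>k. (norm (?X (r k) \<omega> - ?D \<omega>))\<^sup>2) \<longlonglongrightarrow> 0"
      then have "(\<lambda>k. sqrt ((norm (?X (r k) \<omega> - ?D \<omega>))\<^sup>2)) \<longlonglongrightarrow> sqrt 0" by (rule tendsto_real_sqrt)
      then have "(\<lambda>k. ?X (r k) \<omega> - ?D \<omega>) \<longlonglongrightarrow> 0" by (simp add: tendsto_norm_zero_iff)
      then have "(\<lambda>k. ?X (r k) \<omega>) \<longlonglongrightarrow> ?D \<omega>" by (simp only: LIM_zero_iff)
      then have "(\<lambda>k. ennreal (exp (l \<bullet> ?X (r k) \<omega>))) \<longlonglongrightarrow> ennreal (exp (l \<bullet> ?D \<omega>))"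
        by (intro tendsto_intros)
      from lim_imp_Liminf[OF _ this] show "ennreal (exp (l \<bullet> ?D \<omega>)) \<le> liminf (\<lambda>k. ennreal (exp (l \<bullet> ?X (r k) \<omega>)))"
        by simp
    qed
  qed
  also have "\<dots> \<le> liminf (\<lambda>k. \<integral>\<^sup>+\<omega>. ennreal (exp (l \<bullet> ?X (r k) \<omega>)) \<partial>M)"
    by (rule nn_integral_liminf) measurable
  also have "\<dots> \<le> limsup (\<lambda>k. \<integral>\<^sup>+\<omega>. ennreal (exp (l \<bullet> ?X (r k) \<omega>)) \<partial>M)"
    by (rule Liminf_le_Limsup) simp
  also have "\<dots> \<le> ennreal (exp (K\<^sup>2 * (norm l)\<^sup>2 * (b - a) / 2))"
    by (rule Limsup_bounded) (simp add: bound)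
  finally show ?thesis .
qed

text \<open>Scaling a coordinate direction by 1 / sqrt (b - a) makes the exponential moment bound
  independent of the length of the interval, which leaves exactly (b - a)^3. In the constant, 1440 =
  2 * 6! accounts for the two signs, and \<open>CARD('d) ^ 7\<close> for the sixth power of |v| <=
  CARD * max |v_i| and a sum over coordinates.\<close>

lemma ito_sixth_moment:
  assumes ab: "0 \<le> a" "a < b" "b \<le> T"
  shows "integrable M (\<lambda>\<omega>. norm (I b \<omega> - I a \<omega>) ^ 6)"
    and "(\<integral>\<omega>. norm (I b \<omega> - I a \<omega>) ^ 6 \<partial>M) \<le> 1440 * CARD('d) ^ 7 * exp (K\<^sup>2 / 2) * (b - a) ^ 3"
proof -
  let ?D = "\<lambda>\<omega>. I b \<omega> - I a \<omega>"
  define h where "h = b - a"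
  have h: "h > 0" using ab by (simp add: h_def)
  have [measurable]: "I a \<in> borel_measurable M" "I b \<in> borel_measurable M" using ab by auto
  let ?C = "1440 * exp (K\<^sup>2 / 2) * h ^ 3"
  have comp: "(\<integral>\<^sup>+\<omega>. ennreal ((?D \<omega> $ i) ^ 6) \<partial>M) \<le> ennreal ?C" for i
  proof -
    let ?l = "(1 / sqrt h) *\<^sub>R axis i 1 :: real^'d"
    have l: "?l \<bullet> v = v $ i / sqrt h" for v by (simp add: inner_axis inner_commute)
    have nl: "(norm ?l)\<^sup>2 = 1 / h" "norm (- ?l) = norm ?l" using h by (simp_all add: power_divide)
    have e: "(\<integral>\<^sup>+\<omega>. ennreal (exp (?D \<omega> $ i / sqrt h)) \<partial>M) \<le> ennreal (exp (K\<^sup>2 / 2))"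
      "(\<integral>\<^sup>+\<omega>. ennreal (exp (- (?D \<omega> $ i / sqrt h))) \<partial>M) \<le> ennreal (exp (K\<^sup>2 / 2))"
      using ito_exp_bound[of a b ?l] ito_exp_bound[of a b "- ?l"] ab h
      unfolding inner_minus_left l nl(2) nl(1) h_def[symmetric] by simp_all
    have pw: "ennreal ((?D \<omega> $ i) ^ 6) \<le> ennreal (720 * h ^ 3) * (ennreal (exp (?D \<omega> $ i / sqrt h)) + ennreal (exp (- (?D \<omega> $ i / sqrt h))))" for \<omega>
    proof -
      define x where "x = ?D \<omega> $ i / sqrt h"
      have "sqrt h ^ 6 = (sqrt h ^ 2) ^ 3" by (simp only: power_mult[symmetric]) simp
      then have s6: "sqrt h ^ 6 = h ^ 3" using h by simp
      have "(?D \<omega> $ i) ^ 6 = h ^ 3 * x ^ 6" using h by (simp add: x_def power_divide s6)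
      also have "\<dots> \<le> h ^ 3 * (720 * (exp x + exp (- x)))" using h by (intro mult_left_mono power6_le_exp) auto
      finally have "(?D \<omega> $ i) ^ 6 \<le> 720 * h ^ 3 * (exp x + exp (- x))" by (simp add: ac_simps)
      then show ?thesis unfolding x_def[symmetric] using h
        by (subst ennreal_plus[symmetric], simp, simp, subst ennreal_mult[symmetric]) (auto intro: ennreal_leI add_nonneg_nonneg)
    qed
    have "(\<integral>\<^sup>+\<omega>. ennreal ((?D \<omega> $ i) ^ 6) \<partial>M)
      \<le> (\<integral>\<^sup>+\<omega>. ennreal (720 * h ^ 3) * (ennreal (exp (?D \<omega> $ i / sqrt h)) + ennreal (exp (- (?D \<omega> $ i / sqrt h)))) \<partial>M)"
      by (intro nn_integral_mono pw)
    also have "\<dots> = ennreal (720 * h ^ 3) * ((\<integral>\<^sup>+\<omega>. ennreal (exp (?D \<omega> $ i / sqrt h)) \<partial>M) + (\<integral>\<^sup>+\<omega>. ennreal (exp (- (?D \<omega> $ i / sqrt h))) \<partial>M))"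
      by (subst nn_integral_cmult, measurable, subst nn_integral_add, measurable)
    also have "\<dots> \<le> ennreal (720 * h ^ 3) * (ennreal (exp (K\<^sup>2 / 2)) + ennreal (exp (K\<^sup>2 / 2)))"
      by (intro mult_left_mono add_mono e) auto
    also have "\<dots> = ennreal ?C"
      using h by (subst ennreal_plus[symmetric], simp, simp, subst ennreal_mult[symmetric]) auto
    finally show ?thesis .
  qed
  have ci: "integrable M (\<lambda>\<omega>. (?D \<omega> $ i) ^ 6)" for i
  proof (rule integrableI_bounded)
    show "(\<integral>\<^sup>+ \<omega>. ennreal (norm ((?D \<omega> $ i) ^ 6)) \<partial>M) < \<infinity>"
      using comp[of i] by (simp add: power_abs[symmetric] order.strict_trans1 del: vector_minus_component)
  qed measurable
  have cv: "(\<integral>\<omega>. (?D \<omega> $ i) ^ 6 \<partial>M) \<le> ?C" for i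
  proof -
    have "ennreal (\<integral>\<omega>. (?D \<omega> $ i) ^ 6 \<partial>M) \<le> ennreal ?C"
      using comp[of i] nn_integral_eq_integral[OF ci] by simp
    then show ?thesis using h by (subst (asm) ennreal_le_iff) auto
  qed
  have pw: "norm v ^ 6 \<le> CARD('d) ^ 6 * (\<Sum>i\<in>UNIV. (v $ i) ^ 6)" for v :: "real^'d"
  proof -
    define m where "m = Max (range (\<lambda>i. \<bar>v $ i\<bar>))"
    have mle: "\<bar>v $ i\<bar> \<le> m" for i unfolding m_def by (rule Max_ge) auto
    have "m \<in> range (\<lambda>i. \<bar>v $ i\<bar>)" unfolding m_def by (rule Max_in) auto
    then obtain j where j: "m = \<bar>v $ j\<bar>" by auto
    have "norm v \<le> (\<Sum>i\<in>UNIV. \<bar>v $ i\<bar>)" by (rule norm_le_l1_cart)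
    also have "\<dots> \<le> (\<Sum>i\<in>(UNIV::'d set). m)" by (intro sum_mono mle)
    finally have "norm v \<le> CARD('d) * m" by simp
    then have "norm v ^ 6 \<le> (CARD('d) * m) ^ 6" by (intro power_mono) auto
    also have "\<dots> = CARD('d) ^ 6 * (v $ j) ^ 6" by (simp add: j power_mult_distrib power_abs[symmetric])
    also have "\<dots> \<le> CARD('d) ^ 6 * (\<Sum>i\<in>UNIV. (v $ i) ^ 6)"
      by (intro mult_left_mono member_le_sum) auto
    finally show ?thesis by simp
  qed
  show int: "integrable M (\<lambda>\<omega>. norm (?D \<omega>) ^ 6)"
  proof (rule Bochner_Integration.integrable_bound)
    show "integrable M (\<lambda>\<omega>. CARD('d) ^ 6 * (\<Sum>i\<in>UNIV. (?D \<omega> $ i) ^ 6))"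
      using ci by (intro integrable_mult_right Bochner_Integration.integrable_sum) auto
    show "AE \<omega> in M. norm (norm (?D \<omega>) ^ 6) \<le> norm (CARD('d) ^ 6 * (\<Sum>i\<in>UNIV. (?D \<omega> $ i) ^ 6))"
    proof (intro AE_I2)
      fix \<omega>
      have "norm (norm (?D \<omega>) ^ 6) = norm (?D \<omega>) ^ 6" by simp
      also have "\<dots> \<le> norm (CARD('d) ^ 6 * (\<Sum>i\<in>UNIV. (?D \<omega> $ i) ^ 6))"
        unfolding real_norm_def by (rule order_trans[OF pw abs_ge_self])
      finally show "norm (norm (?D \<omega>) ^ 6) \<le> norm (CARD('d) ^ 6 * (\<Sum>i\<in>UNIV. (?D \<omega> $ i) ^ 6))" .
    qed
  qed measurable
  have "(\<integral>\<omega>. norm (?D \<omega>) ^ 6 \<partial>M) \<le> (\<integral>\<omega>. CARD('d) ^ 6 * (\<Sum>i\<in>UNIV. (?D \<omega> $ i) ^ 6) \<partial>M)"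
    by (intro integral_mono int pw integrable_mult_right Bochner_Integration.integrable_sum ci)
  also have "\<dots> = CARD('d) ^ 6 * (\<Sum>i\<in>UNIV. \<integral>\<omega>. (?D \<omega> $ i) ^ 6 \<partial>M)"
    by (subst integral_mult_right_zero, subst Bochner_Integration.integral_sum) (use ci in auto)
  also have "\<dots> \<le> CARD('d) ^ 6 * (\<Sum>i\<in>(UNIV::'d set). ?C)"
    by (intro mult_left_mono sum_mono cv) auto
  also have "\<dots> = 1440 * CARD('d) ^ 7 * exp (K\<^sup>2 / 2) * (b - a) ^ 3"
    by (simp add: h_def eval_nat_numeral)
  finally show "(\<integral>\<omega>. norm (?D \<omega>) ^ 6 \<partial>M) \<le> 1440 * CARD('d) ^ 7 * exp (K\<^sup>2 / 2) * (b - a) ^ 3" .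
qed

end

section \<open>Moments of diffusions with Lipschitz drift\<close>

lemma set_integrable_const_Icc:
  fixes a b :: real and c :: "'b :: {banach, second_countable_topology}"
  shows "set_integrable lborel {a..b} (\<lambda>_. c)"
  unfolding set_integrable_def
  by (intro integrable_scaleR_left integrable_real_indicator) (auto simp: emeasure_lborel_Icc_eq)

text \<open>Expand the integral of (f - c)^2 with c the mean of f; the degenerate interval has no
  mean and is treated apart.\<close>

lemma set_integral_Cauchy_Schwarz:
  fixes f :: "real \<Rightarrow> real"
  assumes ab: "a \<le> b" and f: "set_integrable lborel {a..b} f" and f2: "set_integrable lborel {a..b} (\<lambda>u. (f u)\<^sup>2)"
  shows "(LINT u:{a..b}|lborel. f u)\<^sup>2 \<le> (b - a) * (LINT u:{a..b}|lborel. (f u)\<^sup>2)"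
proof (cases "a = b")
  case True
  have "(LINT u:{a..b}|lborel. f u) = (\<integral>u. 0 \<partial>(lborel :: real measure))"
    unfolding set_lebesgue_integral_def
  proof (rule integral_cong_AE)
    show "AE x in lborel. indicator {a..b} x *\<^sub>R f x = 0"
      by (rule AE_mp[OF AE_lborel_singleton[of b]]) (use True in \<open>auto simp: indicator_def intro!: AE_I2\<close>)
  qed (use f in \<open>auto simp: set_integrable_def\<close>)
  then show ?thesis using True by simp
next
  case False
  then have h: "b - a > 0" using ab by simp
  define J where "J = (LINT u:{a..b}|lborel. f u)"
  define J2 where "J2 = (LINT u:{a..b}|lborel. (f u)\<^sup>2)"
  define c where "c = J / (b - a)"
  note ci = set_integrable_const_Icc[of a b]
  have "0 \<le> (LINT u:{a..b}|lborel. (f u - c)\<^sup>2)"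
    unfolding set_lebesgue_integral_def by (intro Bochner_Integration.integral_nonneg) auto
  also have "\<dots> = (LINT u:{a..b}|lborel. (f u)\<^sup>2 - 2 * c * f u + c\<^sup>2)"
    by (intro set_lebesgue_integral_cong) (auto simp: power2_eq_square algebra_simps)
  also have "\<dots> = J2 - 2 * c * J + c\<^sup>2 * (b - a)"
  proof -
    have "(LINT u:{a..b}|lborel. c\<^sup>2) = c\<^sup>2 * (b - a)"
      using ab by (simp add: set_lebesgue_integral_def)
    then show ?thesis
      using f f2 ci[of "c\<^sup>2"] set_integrable_mult_right[of "2 * c" lborel "{a..b}" f]
      by (simp add: set_integral_add set_integral_diff J_def J2_def)
  qed
  also have "\<dots> = J2 - J\<^sup>2 / (b - a)"
  proof -
    have "c * (b - a) = J" using h by (simp add: c_def)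
    then have "c\<^sup>2 * (b - a) = c * J" by (simp add: power2_eq_square mult.assoc)
    moreover have "J\<^sup>2 / (b - a) = c * J" by (simp add: c_def power2_eq_square)
    ultimately show ?thesis by simp
  qed
  finally have "J\<^sup>2 / (b - a) \<le> J2" by simp
  then show ?thesis using h by (simp add: J_def J2_def field_simps)
qed

lemma set_integrable_bounded:
  fixes f :: "real \<Rightarrow> 'b :: {banach, second_countable_topology}"
  assumes [measurable]: "f \<in> borel_measurable borel" and "\<And>u. u \<in> {a..b} \<Longrightarrow> norm (f u) \<le> C"
  shows "set_integrable lborel {a..b} f"
  unfolding set_integrable_def
proof (rule Bochner_Integration.integrable_bound[of lborel "\<lambda>u. indicator {a..b} u * C"])
  show "AE u in lborel. norm (indicat_real {a..b} u *\<^sub>R f u) \<le> norm (indicat_real {a..b} u * C)"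
    using assms(2) by (intro AE_I2) (auto simp: indicator_def intro: order_trans[OF _ abs_ge_self])
qed (use set_integrable_const_Icc[of a b C] in \<open>auto simp: set_integrable_def\<close>)

lemma set_integral_split_Icc:
  fixes f :: "real \<Rightarrow> 'b :: {banach, second_countable_topology}"
  assumes "a \<le> b" "b \<le> c" "set_integrable lborel {a..c} f"
  shows "(LINT u:{a..c}|lborel. f u) = (LINT u:{a..b}|lborel. f u) + (LINT u:{b..c}|lborel. f u)"
proof -
  have i: "set_integrable lborel {a..b} f" "set_integrable lborel {b..c} f"
    using assms by (auto intro: set_integrable_subset)
  have "(LINT u:{a..c}|lborel. f u) = (LINT u|lborel. indicator {a..b} u *\<^sub>R f u + indicator {b..c} u *\<^sub>R f u)"
    unfolding set_lebesgue_integral_def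
  proof (rule integral_cong_AE)
    have "indicator {a..c} u *\<^sub>R f u = indicator {a..b} u *\<^sub>R f u + indicator {b..c} u *\<^sub>R f u" if "u \<noteq> b" for u
      using that assms by (auto simp: indicator_def)
    then show "AE u in lborel. indicator {a..c} u *\<^sub>R f u = indicator {a..b} u *\<^sub>R f u + indicator {b..c} u *\<^sub>R f u"
      using AE_lborel_singleton[of b] by (auto elim: AE_mp)
  qed (use assms(3) i in \<open>auto simp: set_integrable_def\<close>)
  then show ?thesis using i unfolding set_integrable_def set_lebesgue_integral_def by simp
qed

lemma set_integral_le_superset:
  fixes f :: "real \<Rightarrow> real"
  assumes "set_integrable lborel {a..b} f" "\<And>u. u \<in> {a..b} \<Longrightarrow> 0 \<le> f u" "a \<le> c" "d \<le> b"
  shows "(LINT u:{c..d}|lborel. f u) \<le> (LINT u:{a..b}|lborel. f u)"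
  unfolding set_lebesgue_integral_def
proof (rule integral_mono)
  show "integrable lborel (\<lambda>u. indicat_real {c..d} u *\<^sub>R f u)"
    using set_integrable_subset[OF assms(1), of "{c..d}"] assms(3,4) by (auto simp: set_integrable_def)
qed (use assms in \<open>auto simp: set_integrable_def indicator_def\<close>)

text \<open>The law is frozen into the drift: \<beta> depends on time and space only, so a
  McKean-Vlasov solution becomes an ordinary diffusion with Lipschitz drift. The drift at the origin
  is not assumed bounded in time.\<close>

locale diffusion = ito_process M F T B \<Phi> I K
  for M :: "'w measure" and F T and B :: "real \<Rightarrow> 'w \<Rightarrow> real^'d" and \<Phi> I K +
  fixes X :: "real \<Rightarrow> 'w \<Rightarrow> real^'d" and \<beta> :: "real \<Rightarrow> real^'d \<Rightarrow> real^'d" and L m :: real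
  assumes T_pos: "0 < T" and L_pos: "0 < L" and m_pos: "0 < m"
    and X_adapted: "\<And>t. t \<in> {0..T} \<Longrightarrow> X t \<in> borel_measurable (F t)"
    and X_joint [measurable]: "(\<lambda>z. X (snd z) (fst z)) \<in> borel_measurable (M \<Otimes>\<^sub>M lborel)"
    and X_cont: "\<And>\<omega>. \<omega> \<in> space M \<Longrightarrow> continuous_on {0..T} (\<lambda>u. X u \<omega>)"
    and \<beta>_measurable [measurable]: "(\<lambda>z. \<beta> (fst z) (snd z)) \<in> borel_measurable (lborel \<Otimes>\<^sub>M borel)"
    and \<beta>_lipschitz: "\<And>u x y. u \<in> {0..T} \<Longrightarrow> norm (\<beta> u x - \<beta> u y) \<le> L * norm (x - y)"
    and \<beta>_path: "AE \<omega> in M. set_integrable lborel {0..T} (\<lambda>u. \<beta> u (X u \<omega>))"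
    and I_eq: "\<And>t \<omega>. t \<in> {0..T} \<Longrightarrow> \<omega> \<in> space M \<Longrightarrow>
       I t \<omega> = X t \<omega> - X 0 \<omega> - (LINT u:{0..t}|lborel. \<beta> u (X u \<omega>))"
    and elliptic: "\<And>u \<omega> y. u \<in> {0..T} \<Longrightarrow> \<omega> \<in> space M \<Longrightarrow>
       m\<^sup>2 * (norm y)\<^sup>2 \<le> (norm (transpose (\<Phi> u \<omega>) *v y))\<^sup>2"
    and X0_square: "integrable M (\<lambda>\<omega>. (norm (X 0 \<omega>))\<^sup>2)"
begin

lemma X_measurable [measurable]: "X t \<in> borel_measurable M"
  using measurable_compose[OF measurable_Pair2'[of t lborel M] X_joint] by simp

lemma X_path_measurable [measurable]: "\<omega> \<in> space M \<Longrightarrow> (\<lambda>u. X u \<omega>) \<in> borel_measurable borel"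
  using measurable_compose[OF measurable_Pair1'[of \<omega> M lborel] X_joint] by simp

lemma X_bounded_path:
  assumes "\<omega> \<in> space M"
  shows "\<exists>C. \<forall>u\<in>{0..T}. norm (X u \<omega>) \<le> C"
proof -
  have "bounded ((\<lambda>u. X u \<omega>) ` {0..T})"
    by (intro compact_imp_bounded compact_continuous_image X_cont assms) simp
  then show ?thesis by (simp add: bounded_iff)
qed

lemma \<beta>_at_measurable [measurable]: "(\<lambda>u. \<beta> u x) \<in> borel_measurable borel"
  using measurable_compose[OF measurable_Pair2'[of x borel lborel] \<beta>_measurable] by simp

lemma \<beta>_path_measurable [measurable]:
  assumes "\<omega> \<in> space M"
  shows "(\<lambda>u. \<beta> u (X u \<omega>)) \<in> borel_measurable borel"
proof -
  have "(\<lambda>u. (u, X u \<omega>)) \<in> lborel \<rightarrow>\<^sub>M lborel \<Otimes>\<^sub>M borel" using assms by simp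
  from measurable_compose[OF this \<beta>_measurable] show ?thesis by simp
qed

lemma \<beta>_growth: "u \<in> {0..T} \<Longrightarrow> norm (\<beta> u x) \<le> norm (\<beta> u 0) + L * norm x"
  using \<beta>_lipschitz[of u x 0] norm_triangle_sub[of "\<beta> u x" "\<beta> u 0"] by simp

text \<open>One path with integrable drift suffices, since the drift at \<open>0\<close> is deterministic.\<close>

lemma \<beta>_origin_integrable: "set_integrable lborel {0..T} (\<lambda>u. \<beta> u 0)"
proof -
  obtain \<omega> where \<omega>: "\<omega> \<in> space M" "set_integrable lborel {0..T} (\<lambda>u. \<beta> u (X u \<omega>))"
  proof -
    have "\<exists>\<omega>\<in>space M. set_integrable lborel {0..T} (\<lambda>u. \<beta> u (X u \<omega>))"
    proof (rule ccontr)
      assume "\<not> ?thesis"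
      then have "AE \<omega> in M. False" using \<beta>_path by (auto elim!: AE_mp intro!: AE_I2)
      then show False by simp
    qed
    then show ?thesis using that by blast
  qed
  obtain C where C: "\<And>u. u \<in> {0..T} \<Longrightarrow> norm (X u \<omega>) \<le> C" using X_bounded_path[OF \<omega>(1)] by blast
  have [measurable]: "(\<lambda>u. X u \<omega>) \<in> borel_measurable borel" using \<omega>(1) by simp
  have "set_integrable lborel {0..T} (\<lambda>u. norm (\<beta> u (X u \<omega>)) + L * C)"
    using \<omega>(2) by (intro set_integral_add set_integrable_norm set_integrable_const_Icc)
  then show ?thesis
    unfolding set_integrable_def
  proof (rule Bochner_Integration.integrable_bound)
    have "norm (\<beta> u 0) \<le> norm (\<beta> u (X u \<omega>)) + L * C" if u: "u \<in> {0..T}" for u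
    proof -
      have "norm (\<beta> u 0) \<le> norm (\<beta> u (X u \<omega>)) + L * norm (X u \<omega>)"
        using \<beta>_lipschitz[OF u, of 0 "X u \<omega>"] norm_triangle_sub[of "\<beta> u 0" "\<beta> u (X u \<omega>)"] by simp
      moreover have "L * norm (X u \<omega>) \<le> L * C" using C[OF u] L_pos by simp
      ultimately show ?thesis by linarith
    qed
    then show "AE u in lborel. norm (indicator {0..T} u *\<^sub>R \<beta> u 0) \<le> norm (indicat_real {0..T} u *\<^sub>R (norm (\<beta> u (X u \<omega>)) + L * C))"
      by (intro AE_I2) (auto simp: indicator_def intro: order_trans[OF _ abs_ge_self])
  qed measurable
qed

lemma \<beta>_path_integrable:
  assumes \<omega>: "\<omega> \<in> space M"
  shows "set_integrable lborel {0..T} (\<lambda>u. \<beta> u (X u \<omega>))"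
proof -
  have [measurable]: "(\<lambda>u. X u \<omega>) \<in> borel_measurable borel" using \<omega> by simp
  obtain C where C: "\<And>u. u \<in> {0..T} \<Longrightarrow> norm (X u \<omega>) \<le> C" using X_bounded_path[OF \<omega>] by blast
  have "set_integrable lborel {0..T} (\<lambda>u. norm (\<beta> u 0) + L * C)"
    using \<beta>_origin_integrable by (intro set_integral_add set_integrable_norm set_integrable_const_Icc)
  then show ?thesis
    unfolding set_integrable_def
  proof (rule Bochner_Integration.integrable_bound)
    have "norm (\<beta> u (X u \<omega>)) \<le> norm (\<beta> u 0) + L * C" if u: "u \<in> {0..T}" for u
      using \<beta>_growth[OF u, of "X u \<omega>"] mult_left_mono[OF C[OF u] less_imp_le[OF L_pos]] by linarith
    then show "AE u in lborel. norm (indicator {0..T} u *\<^sub>R \<beta> u (X u \<omega>)) \<le> norm (indicat_real {0..T} u *\<^sub>R (norm (\<beta> u 0) + L * C))"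
      by (intro AE_I2) (auto simp: indicator_def intro: order_trans[OF _ abs_ge_self])
  qed (use \<beta>_path_measurable[OF \<omega>] in simp)
qed

lemma X_norm_path_integrable:
  assumes \<omega>: "\<omega> \<in> space M" and "0 \<le> a" "b \<le> T"
  shows "set_integrable lborel {a..b} (\<lambda>u. norm (X u \<omega>))"
proof -
  have [measurable]: "(\<lambda>u. X u \<omega>) \<in> borel_measurable borel" using \<omega> by simp
  obtain C where "\<And>u. u \<in> {0..T} \<Longrightarrow> norm (X u \<omega>) \<le> C" using X_bounded_path[OF \<omega>] by blast
  then show ?thesis using assms by (intro set_integrable_bounded[of _ _ _ C]) auto
qed

lemma norm_set_integral_le:
  fixes f :: "real \<Rightarrow> 'b :: {banach, second_countable_topology}"
  assumes "set_integrable lborel A f" "set_integrable lborel A g" "\<And>u. u \<in> A \<Longrightarrow> norm (f u) \<le> g u" "A \<in> sets borel"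
  shows "norm (LINT u:A|lborel. f u) \<le> (LINT u:A|lborel. g u)"
proof -
  have "norm (LINT u:A|lborel. f u) \<le> (LINT u:A|lborel. norm (f u))"
    using assms(1) by (intro set_integral_norm_bound)
  also have "\<dots> \<le> (LINT u:A|lborel. g u)"
    using assms by (intro set_integral_mono set_integrable_norm) auto
  finally show ?thesis .
qed

text \<open>\<open>I\<close> itself is known to be measurable only at each fixed time; the explicit
  expression that it equals on [0,T] is jointly measurable, as Fubini requires.\<close>

lemma I_joint_measurable: "(\<lambda>z. X (snd z) (fst z) - X 0 (fst z) - (LINT u:{0..snd z}|lborel. \<beta> u (X u (fst z))))
    \<in> borel_measurable (M \<Otimes>\<^sub>M lborel)"
proof -
  have [measurable]: "(\<lambda>p. indicator {0..snd (fst p)} (snd p) *\<^sub>R \<beta> (snd p) (X (snd p) (fst (fst p))))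
      \<in> borel_measurable ((M \<Otimes>\<^sub>M lborel) \<Otimes>\<^sub>M lborel)"
  proof (intro borel_measurable_scaleR)
    show "(\<lambda>p. indicat_real {0..snd (fst p)} (snd p)) \<in> borel_measurable ((M \<Otimes>\<^sub>M (lborel :: real measure)) \<Otimes>\<^sub>M (lborel :: real measure))"
    proof -
      let ?N = "(M \<Otimes>\<^sub>M (lborel :: real measure)) \<Otimes>\<^sub>M (lborel :: real measure)"
      have m: "snd \<in> borel_measurable ?N" "(\<lambda>p. snd (fst p)) \<in> borel_measurable ?N"
        using measurable_snd[of "M \<Otimes>\<^sub>M lborel" "lborel :: real measure"]
          measurable_compose[OF measurable_fst measurable_snd, of "M" "lborel :: real measure" "lborel :: real measure"] by simp_all
      have "{p \<in> space ?N. 0 \<le> snd p} \<inter> {p \<in> space ?N. snd p \<le> snd (fst p)} \<in> sets ?N"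
        by (intro sets.Int borel_measurable_le m borel_measurable_const)
      moreover have "{p \<in> space ?N. 0 \<le> snd p} \<inter> {p \<in> space ?N. snd p \<le> snd (fst p)}
          = {p \<in> space ?N. snd p \<in> {0..snd (fst p)}}" by auto
      ultimately show ?thesis by (intro borel_measurable_indicator') (simp only:)
    qed
    have "(\<lambda>p. (snd p, X (snd p) (fst (fst p)))) \<in> (M \<Otimes>\<^sub>M lborel) \<Otimes>\<^sub>M lborel \<rightarrow>\<^sub>M lborel \<Otimes>\<^sub>M borel"
    proof (rule measurable_Pair)
      have "(\<lambda>p. (fst (fst p), snd p)) \<in> (M \<Otimes>\<^sub>M lborel) \<Otimes>\<^sub>M (lborel :: real measure) \<rightarrow>\<^sub>M M \<Otimes>\<^sub>M lborel" by measurable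
      from measurable_compose[OF this X_joint] show "(\<lambda>p. X (snd p) (fst (fst p))) \<in> borel_measurable ((M \<Otimes>\<^sub>M lborel) \<Otimes>\<^sub>M lborel)"
        by simp
    qed measurable
    from measurable_compose[OF this \<beta>_measurable]
    show "(\<lambda>p. \<beta> (snd p) (X (snd p) (fst (fst p)))) \<in> borel_measurable ((M \<Otimes>\<^sub>M lborel) \<Otimes>\<^sub>M lborel)" by simp
  qed
  have "(\<lambda>z. LINT u:{0..snd z}|lborel. \<beta> u (X u (fst z))) \<in> borel_measurable (M \<Otimes>\<^sub>M lborel)"
    unfolding set_lebesgue_integral_def
    by (rule sigma_finite_measure.borel_measurable_lebesgue_integral[OF sigma_finite_lborel]) simp
  moreover have "(\<lambda>z. X 0 (fst z)) \<in> borel_measurable (M \<Otimes>\<^sub>M lborel)" by measurable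
  ultimately show ?thesis using X_joint by (intro borel_measurable_diff)
qed

lemma I_zero: "\<omega> \<in> space M \<Longrightarrow> I 0 \<omega> = 0"
proof -
  assume \<omega>: "\<omega> \<in> space M"
  have "(LINT u:{0..0}|lborel. \<beta> u (X u \<omega>)) = (\<integral>u. 0 \<partial>(lborel :: real measure))"
    unfolding set_lebesgue_integral_def
  proof (rule integral_cong_AE)
    show "(\<lambda>u. indicat_real {0..0} u *\<^sub>R \<beta> u (X u \<omega>)) \<in> borel_measurable lborel"
      using \<beta>_path_measurable[OF \<omega>] by simp
    show "AE u in lborel. indicat_real {0..0} u *\<^sub>R \<beta> u (X u \<omega>) = 0"
      by (rule AE_mp[OF AE_lborel_singleton[of "0::real"]]) (auto simp: indicator_def intro!: AE_I2)
  qed simp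
  then show ?thesis using I_eq[of 0 \<omega>] T_pos \<omega> by simp
qed

lemma increment_square_le:
  assumes ab: "0 \<le> a" "a \<le> b" "b \<le> T"
  shows "(\<integral>\<omega>. (norm (I b \<omega> - I a \<omega>))\<^sup>2 \<partial>M) \<le> K\<^sup>2 * (b - a)"
proof -
  interpret P: pair_sigma_finite M "lborel :: real measure" ..
  have W: "adapted_bounded a (\<lambda>_. mat 1 :: real^'d^'d)" by (auto simp: adapted_bounded_def)
  have "(\<integral>\<omega>. (norm (I b \<omega> - I a \<omega>))\<^sup>2 \<partial>M) = (\<integral>z. (norm (\<Psi> a b z))\<^sup>2 \<partial>(M \<Otimes>\<^sub>M lborel))"
    using ito_isometry(3)[OF ab W] by simp
  also have "\<dots> \<le> (\<integral>z. K\<^sup>2 * indicat_real {a<..b} (snd z) \<partial>(M \<Otimes>\<^sub>M lborel))"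
    using \<Phi>_bound by (intro integral_mono_AE \<Psi>_square_integrable indicator_Ioc_integrable AE_I2)
      (auto simp: space_pair_measure indicator_def intro!: power_mono)
  also have "\<dots> = K\<^sup>2 * (b - a)"
    using P.has_bochner_integral_product[of "\<lambda>_. K\<^sup>2" "indicat_real {a<..b}"] integral_indicator_Ioc ab
    by (simp add: has_bochner_integral_iff prob_space)
  finally show ?thesis .
qed

lemma increment_norm_le:
  assumes ab: "0 \<le> a" "a \<le> b" "b \<le> T"
  shows "integrable M (\<lambda>\<omega>. norm (I b \<omega> - I a \<omega>))"
    and "(\<integral>\<omega>. norm (I b \<omega> - I a \<omega>) \<partial>M) \<le> K * sqrt (b - a)"
proof -
  have [measurable]: "I a \<in> borel_measurable M" "I b \<in> borel_measurable M" using ab by auto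
  show int: "integrable M (\<lambda>\<omega>. norm (I b \<omega> - I a \<omega>))"
    using square_integrable_imp_integrable[OF _ increment_L2[OF ab]] by simp
  have "(\<integral>\<omega>. norm (I b \<omega> - I a \<omega>) \<partial>M)\<^sup>2 \<le> (\<integral>\<omega>. (norm (I b \<omega> - I a \<omega>))\<^sup>2 \<partial>M)"
    using variance_positive[of "\<lambda>\<omega>. norm (I b \<omega> - I a \<omega>)"] variance_eq[OF int increment_L2[OF ab]] by simp
  also have "\<dots> \<le> (K * sqrt (b - a))\<^sup>2"
    using increment_square_le[OF ab] ab by (simp add: power_mult_distrib)
  finally show "(\<integral>\<omega>. norm (I b \<omega> - I a \<omega>) \<partial>M) \<le> K * sqrt (b - a)"
    using K_nonneg ab by (rule_tac power2_le_imp_le) auto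
qed


lemma I_square_le:
  assumes t: "t \<in> {0..T}"
  shows "integrable M (\<lambda>\<omega>. (norm (I t \<omega>))\<^sup>2)" "(\<integral>\<omega>. (norm (I t \<omega>))\<^sup>2 \<partial>M) \<le> K\<^sup>2 * t"
proof -
  have e: "integrable M (\<lambda>\<omega>. (norm (I t \<omega>))\<^sup>2) \<longleftrightarrow> integrable M (\<lambda>\<omega>. (norm (I t \<omega> - I 0 \<omega>))\<^sup>2)"
    "(\<integral>\<omega>. (norm (I t \<omega>))\<^sup>2 \<partial>M) = (\<integral>\<omega>. (norm (I t \<omega> - I 0 \<omega>))\<^sup>2 \<partial>M)"
    using I_zero by (auto intro!: Bochner_Integration.integrable_cong Bochner_Integration.integral_cong)
  show "integrable M (\<lambda>\<omega>. (norm (I t \<omega>))\<^sup>2)" "(\<integral>\<omega>. (norm (I t \<omega>))\<^sup>2 \<partial>M) \<le> K\<^sup>2 * t"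
    unfolding e using increment_L2[of 0 t] increment_square_le[of 0 t] t by auto
qed

text \<open>Fubini for time integrals along paths: a bound C on the means, uniform over the
  interval, gives integrability on the product space.\<close>

lemma mean_path_integral:
  fixes Z :: "'w \<Rightarrow> real \<Rightarrow> real"
  assumes Z [measurable]: "(\<lambda>z. Z (fst z) (snd z)) \<in> borel_measurable (M \<Otimes>\<^sub>M lborel)"
    and nn: "\<And>\<omega> u. 0 \<le> Z \<omega> u"
    and C: "\<And>u. u \<in> {a..b} \<Longrightarrow> integrable M (\<lambda>\<omega>. Z \<omega> u) \<and> (\<integral>\<omega>. Z \<omega> u \<partial>M) \<le> C"
  shows "AE \<omega> in M. set_integrable lborel {a..b} (Z \<omega>)"
    and "integrable M (\<lambda>\<omega>. LINT u:{a..b}|lborel. Z \<omega> u)"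
    and "set_integrable lborel {a..b} (\<lambda>u. \<integral>\<omega>. Z \<omega> u \<partial>M)"
    and "(\<integral>\<omega>. (LINT u:{a..b}|lborel. Z \<omega> u) \<partial>M) = (LINT u:{a..b}|lborel. (\<integral>\<omega>. Z \<omega> u \<partial>M))"
proof -
  interpret P: pair_sigma_finite M "lborel :: real measure" ..
  let ?f = "\<lambda>\<omega> u. indicat_real {a..b} u * Z \<omega> u"
  have [measurable]: "(\<lambda>(\<omega>, u). ?f \<omega> u) \<in> borel_measurable (M \<Otimes>\<^sub>M lborel)"
    using Z by (simp add: split_beta)
  have "(\<integral>\<^sup>+z. ennreal (norm (case_prod ?f z)) \<partial>(M \<Otimes>\<^sub>M lborel)) = (\<integral>\<^sup>+u. (\<integral>\<^sup>+\<omega>. ennreal (norm (?f \<omega> u)) \<partial>M) \<partial>lborel)"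
    by (subst P.nn_integral_snd[symmetric]) auto
  also have "\<dots> \<le> (\<integral>\<^sup>+u. ennreal C * indicator {a..b} u \<partial>lborel)"
  proof (rule nn_integral_mono)
    fix u :: real
    show "(\<integral>\<^sup>+\<omega>. ennreal (norm (?f \<omega> u)) \<partial>M) \<le> ennreal C * indicator {a..b} u"
    proof (cases "u \<in> {a..b}")
      case True
      then have "(\<integral>\<^sup>+\<omega>. ennreal (norm (?f \<omega> u)) \<partial>M) = ennreal (\<integral>\<omega>. Z \<omega> u \<partial>M)"
        using nn C[OF True] by (simp add: nn_integral_eq_integral)
      then show ?thesis using True C[OF True] by (simp add: ennreal_leI)
    qed simp
  qed
  also have "\<dots> < \<infinity>"
    by (simp add: nn_integral_cmult emeasure_lborel_Icc_eq ennreal_mult_less_top)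
  finally have int: "integrable (M \<Otimes>\<^sub>M lborel) (case_prod ?f)"
    by (intro integrableI_bounded) auto
  show "AE \<omega> in M. set_integrable lborel {a..b} (Z \<omega>)"
    using P.AE_integrable_fst[OF int] by (simp add: set_integrable_def)
  show "integrable M (\<lambda>\<omega>. LINT u:{a..b}|lborel. Z \<omega> u)"
    using P.integrable_fst[OF int] by (simp add: set_lebesgue_integral_def)
  show "set_integrable lborel {a..b} (\<lambda>u. \<integral>\<omega>. Z \<omega> u \<partial>M)"
    using P.integrable_snd[OF int] by (simp add: set_integrable_def)
  show "(\<integral>\<omega>. (LINT u:{a..b}|lborel. Z \<omega> u) \<partial>M) = (LINT u:{a..b}|lborel. (\<integral>\<omega>. Z \<omega> u \<partial>M))"
    using P.integral_fst[OF int] P.integral_snd[OF int] by (simp add: set_lebesgue_integral_def)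
qed

lemma norm_X_le:
  assumes \<omega>: "\<omega> \<in> space M" and t: "t \<in> {0..T}"
  shows "norm (X t \<omega>) \<le> norm (X 0 \<omega>) + norm (I t \<omega>) + (LINT u:{0..t}|lborel. norm (\<beta> u 0)) + L * (LINT u:{0..t}|lborel. norm (X u \<omega>))"
    and "norm (X t \<omega> - X 0 \<omega>) \<le> norm (I t \<omega>) + (LINT u:{0..t}|lborel. norm (\<beta> u 0)) + L * (LINT u:{0..t}|lborel. norm (X u \<omega>))"
proof -
  have i: "set_integrable lborel {0..t} (\<lambda>u. \<beta> u (X u \<omega>))" "set_integrable lborel {0..t} (\<lambda>u. norm (\<beta> u 0))"
    "set_integrable lborel {0..t} (\<lambda>u. L * norm (X u \<omega>))"
  proof -
    show "set_integrable lborel {0..t} (\<lambda>u. \<beta> u (X u \<omega>))"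
      using t by (intro set_integrable_subset[OF \<beta>_path_integrable[OF \<omega>]]) auto
    show "set_integrable lborel {0..t} (\<lambda>u. norm (\<beta> u 0))"
      using t by (intro set_integrable_norm set_integrable_subset[OF \<beta>_origin_integrable]) auto
    show "set_integrable lborel {0..t} (\<lambda>u. L * norm (X u \<omega>))"
      using t by (intro set_integrable_mult_right X_norm_path_integrable \<omega>) auto
  qed
  have "norm (LINT u:{0..t}|lborel. \<beta> u (X u \<omega>)) \<le> (LINT u:{0..t}|lborel. norm (\<beta> u 0) + L * norm (X u \<omega>))"
    using t by (intro norm_set_integral_le i set_integral_add(1) \<beta>_growth) auto
  also have "\<dots> = (LINT u:{0..t}|lborel. norm (\<beta> u 0)) + L * (LINT u:{0..t}|lborel. norm (X u \<omega>))"
    using i by (simp add: set_integral_add)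
  finally have 1: "norm (LINT u:{0..t}|lborel. \<beta> u (X u \<omega>)) \<le> (LINT u:{0..t}|lborel. norm (\<beta> u 0)) + L * (LINT u:{0..t}|lborel. norm (X u \<omega>))" .
  have X: "X t \<omega> - X 0 \<omega> = I t \<omega> + (LINT u:{0..t}|lborel. \<beta> u (X u \<omega>))"
    using I_eq[OF t \<omega>] by simp
  show 2: "norm (X t \<omega> - X 0 \<omega>) \<le> norm (I t \<omega>) + (LINT u:{0..t}|lborel. norm (\<beta> u 0)) + L * (LINT u:{0..t}|lborel. norm (X u \<omega>))"
    unfolding X using norm_triangle_ineq[of "I t \<omega>" "LINT u:{0..t}|lborel. \<beta> u (X u \<omega>)"] 1 by linarith
  show "norm (X t \<omega>) \<le> norm (X 0 \<omega>) + norm (I t \<omega>) + (LINT u:{0..t}|lborel. norm (\<beta> u 0)) + L * (LINT u:{0..t}|lborel. norm (X u \<omega>))"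
    using 2 norm_triangle_sub[of "X t \<omega>" "X 0 \<omega>"] by linarith
qed

text \<open>Gronwall cannot be applied to second moments while their finiteness is unknown. It is
  applied path by path to the integral N of |X|, finite by continuity of the path. The resulting
  bound involves only |X 0|, |I t|, the constant G and the square root of Q, whose squares are
  integrable with means bounded in t.\<close>

lemma X_square_bounded:
  shows "\<exists>C. \<forall>t\<in>{0..T}. integrable M (\<lambda>\<omega>. (norm (X t \<omega>))\<^sup>2) \<and> (\<integral>\<omega>. (norm (X t \<omega>))\<^sup>2 \<partial>M) \<le> C"
proof -
  define G where "G = (LINT u:{0..T}|lborel. norm (\<beta> u 0))"
  define e where "e = exp (2 * L * T)"
  \<comment> \<open>Equal to the norm of \<open>I t\<close> on [0,T], but jointly measurable in path
    and time.\<close>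
  define J where "J \<omega> t = norm (X t \<omega> - X 0 \<omega> - (LINT u:{0..t}|lborel. \<beta> u (X u \<omega>)))" for \<omega> t
  define Q where "Q \<omega> = (LINT u:{0..T}|lborel. (J \<omega> u)\<^sup>2)" for \<omega>
  have J: "J \<omega> t = norm (I t \<omega>)" if "\<omega> \<in> space M" "t \<in> {0..T}" for \<omega> t
    using I_eq[OF that(2,1)] by (simp add: J_def)
  have J_joint [measurable]: "(\<lambda>z. J (fst z) (snd z)) \<in> borel_measurable (M \<Otimes>\<^sub>M lborel)"
    unfolding J_def by (rule measurable_compose[OF I_joint_measurable borel_measurable_norm])
  have nb: "set_integrable lborel {0..T} (\<lambda>u. norm (\<beta> u 0))" by (intro set_integrable_norm \<beta>_origin_integrable)
  have G0: "0 \<le> G" unfolding G_def set_lebesgue_integral_def by (intro Bochner_Integration.integral_nonneg) auto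
  have Gle: "(LINT u:{0..t}|lborel. norm (\<beta> u 0)) \<le> G" if "t \<in> {0..T}" for t
    unfolding G_def using that by (intro set_integral_le_superset nb) auto
  define c where "c = 1 + 2 * L * e * T"
  have e0: "e > 0" by (simp add: e_def)
  have c0: "c \<ge> 0" using L_pos T_pos e0 by (simp add: c_def)
  have path: "norm (X t \<omega>) \<le> c * norm (X 0 \<omega>) + norm (I t \<omega>) + c * G + 2 * L * e * sqrt (T * Q \<omega>)"
    if \<omega>: "\<omega> \<in> space M" and t: "t \<in> {0..T}" for \<omega> t
  proof -
    have [measurable]: "(\<lambda>u. X u \<omega>) \<in> borel_measurable borel" using \<omega> by simp
    have Jm [measurable]: "J \<omega> \<in> borel_measurable borel"
      using measurable_compose[OF measurable_Pair1'[OF \<omega>, of lborel] J_joint] by simp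
    obtain C where C: "\<And>u. u \<in> {0..T} \<Longrightarrow> norm (X u \<omega>) \<le> C" using X_bounded_path[OF \<omega>] by blast
    have C0: "0 \<le> C" using C[of 0] T_pos by (meson atLeastAtMost_iff less_imp_le norm_ge_zero order_refl order_trans)
    define N where "N t = (LINT u:{0..t}|lborel. norm (X u \<omega>))" for t
    have N0: "0 \<le> N t" for t
      unfolding N_def set_lebesgue_integral_def by (intro Bochner_Integration.integral_nonneg) auto
    have NC: "N t \<le> T * C" if "t \<in> {0..T}" for t
    proof -
      have "N t \<le> (LINT u:{0..T}|lborel. norm (X u \<omega>))"
        unfolding N_def using that by (intro set_integral_le_superset X_norm_path_integrable \<omega>) auto
      also have "\<dots> \<le> (LINT u:{0..T}|lborel. C)"
        by (intro set_integral_mono X_norm_path_integrable \<omega> set_integrable_const_Icc C) auto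
      also have "\<dots> = T * C" using T_pos by (simp add: set_lebesgue_integral_def)
      finally show ?thesis .
    qed
    have Nmono: "N s \<le> N t" if "0 \<le> s" "s \<le> t" "t \<le> T" for s t
      unfolding N_def using that by (intro set_integral_le_superset X_norm_path_integrable \<omega>) auto
    have JC: "J \<omega> u \<le> C + C + (LINT u:{0..T}|lborel. norm (\<beta> u (X u \<omega>)))" if u: "u \<in> {0..T}" for u
    proof -
      have "J \<omega> u \<le> norm (X u \<omega>) + norm (X 0 \<omega>) + norm (LINT u:{0..u}|lborel. \<beta> u (X u \<omega>))"
        unfolding J_def by (meson add_right_mono norm_triangle_ineq4 order_trans)
      moreover have "norm (LINT u:{0..u}|lborel. \<beta> u (X u \<omega>)) \<le> (LINT u:{0..u}|lborel. norm (\<beta> u (X u \<omega>)))"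
        using u by (intro set_integral_norm_bound set_integrable_subset[OF \<beta>_path_integrable[OF \<omega>]]) auto
      moreover have "\<dots> \<le> (LINT u:{0..T}|lborel. norm (\<beta> u (X u \<omega>)))"
        using u by (intro set_integral_le_superset set_integrable_norm \<beta>_path_integrable \<omega>) auto
      ultimately show ?thesis using C[OF u] C[of 0] T_pos by simp
    qed
    have J0: "0 \<le> J \<omega> u" for u by (simp add: J_def)
    have Ji: "set_integrable lborel {0..T} (J \<omega>)"
      by (rule set_integrable_bounded[where C = "C + C + (LINT u:{0..T}|lborel. norm (\<beta> u (X u \<omega>)))"])
         (use JC J0 in auto)
    have J2i: "set_integrable lborel {0..T} (\<lambda>u. (J \<omega> u)\<^sup>2)"
      by (rule set_integrable_bounded[where C = "(C + C + (LINT u:{0..T}|lborel. norm (\<beta> u (X u \<omega>))))\<^sup>2"])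
         (use JC J0 in \<open>auto intro!: power_mono\<close>)
    define S where "S = (LINT u:{0..T}|lborel. J \<omega> u)"
    have S: "S \<le> sqrt (T * Q \<omega>)"
      using set_integral_Cauchy_Schwarz[OF _ Ji J2i] T_pos by (simp add: S_def Q_def real_le_rsqrt)
    have S0: "0 \<le> S" unfolding S_def set_lebesgue_integral_def by (intro Bochner_Integration.integral_nonneg) (auto simp: J_def)
    have X_le: "norm (X t \<omega>) \<le> (norm (X 0 \<omega>) + G) + J \<omega> t + L * N t" if "t \<in> {0..T}" for t
      using norm_X_le(1)[OF \<omega> that] Gle[OF that] J[OF \<omega> that] by (simp add: N_def)
    \<comment> \<open>Monotone functions are measurable; clamping the time extends N monotonically
      to the whole line.\<close>
    have N_meas: "set_integrable lborel {0..T} N"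
    proof -
      have "set_integrable lborel {0..T} (\<lambda>t. N (max 0 (min T t)))"
      proof (rule set_integrable_bounded[where C = "T * C"])
        show "(\<lambda>t. N (max 0 (min T t))) \<in> borel_measurable borel"
          by (rule borel_measurable_mono) (use T_pos in \<open>auto intro!: monoI Nmono\<close>)
        show "norm (N (max 0 (min T u))) \<le> T * C" if "u \<in> {0..T}" for u
          using NC[of "max 0 (min T u)"] N0 that by auto
      qed
      then show ?thesis by (rule set_integrable_cong[THEN iffD1, rotated -1]) auto
    qed
    define A where "A = T * (norm (X 0 \<omega>) + G) + S"
    have A0: "0 \<le> A" using T_pos G0 S0 by (simp add: A_def)
    have N_le: "N t \<le> A + L * (LINT u:{0..t}|lborel. N u)" if t: "t \<in> {0..T}" for t
    proof -
      have Ni: "set_integrable lborel {0..t} N" "set_integrable lborel {0..t} (J \<omega>)"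
        using t by (auto intro: set_integrable_subset[OF N_meas] set_integrable_subset[OF Ji])
      have "N t \<le> (LINT u:{0..t}|lborel. (norm (X 0 \<omega>) + G) + J \<omega> u + L * N u)"
        unfolding N_def[of t] using t X_le
        by (intro set_integral_mono X_norm_path_integrable \<omega> set_integral_add(1) set_integrable_const_Icc Ni set_integrable_mult_right) auto
      also have "\<dots> = t * (norm (X 0 \<omega>) + G) + (LINT u:{0..t}|lborel. J \<omega> u) + L * (LINT u:{0..t}|lborel. N u)"
      proof -
        have "(LINT u:{0..t}|lborel. (norm (X 0 \<omega>) + G)) = t * (norm (X 0 \<omega>) + G)"
          using t by (simp add: set_lebesgue_integral_def)
        then show ?thesis
          using Ni by (simp add: set_integral_add set_integrable_const_Icc)
      qed
      also have "\<dots> \<le> T * (norm (X 0 \<omega>) + G) + S + L * (LINT u:{0..t}|lborel. N u)"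
        unfolding S_def using t G0 by (intro add_mono mult_right_mono order_refl set_integral_le_superset[OF Ji]) (auto simp: J_def)
      finally show ?thesis by (simp add: A_def)
    qed
    have "N t \<le> 2 * A * e"
      unfolding e_def by (rule gronwall_bounded[OF L_pos A0 N0 NC N_meas N_le t])
    then have "norm (X t \<omega>) \<le> (norm (X 0 \<omega>) + G) + norm (I t \<omega>) + L * (2 * A * e)"
      using X_le[OF t] J[OF \<omega> t] mult_left_mono[of "N t" "2 * A * e" L] L_pos by linarith
    also have "L * (2 * A * e) = 2 * L * e * T * (norm (X 0 \<omega>) + G) + 2 * L * e * S"
      by (simp add: A_def algebra_simps)
    also have "\<dots> \<le> 2 * L * e * T * (norm (X 0 \<omega>) + G) + 2 * L * e * sqrt (T * Q \<omega>)"
      using S L_pos e0 by (intro add_left_mono mult_left_mono) auto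
    finally show ?thesis by (simp add: c_def algebra_simps)
  qed
  have mQ: "integrable M Q" "(\<integral>\<omega>. Q \<omega> \<partial>M) \<le> T * (K\<^sup>2 * T)"
  proof -
    have b: "integrable M (\<lambda>\<omega>. (J \<omega> u)\<^sup>2) \<and> (\<integral>\<omega>. (J \<omega> u)\<^sup>2 \<partial>M) \<le> K\<^sup>2 * T" if u: "u \<in> {0..T}" for u
    proof -
      have "integrable M (\<lambda>\<omega>. (J \<omega> u)\<^sup>2) \<longleftrightarrow> integrable M (\<lambda>\<omega>. (norm (I u \<omega>))\<^sup>2)"
        "(\<integral>\<omega>. (J \<omega> u)\<^sup>2 \<partial>M) = (\<integral>\<omega>. (norm (I u \<omega>))\<^sup>2 \<partial>M)"
        using J u by (auto intro!: Bochner_Integration.integrable_cong Bochner_Integration.integral_cong)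
      moreover have "K\<^sup>2 * u \<le> K\<^sup>2 * T" using u by (intro mult_left_mono) auto
      ultimately show ?thesis using I_square_le[OF u] by simp
    qed
    have "(\<lambda>z. (J (fst z) (snd z))\<^sup>2) \<in> borel_measurable (M \<Otimes>\<^sub>M lborel)" by measurable
    note mp = mean_path_integral[of "\<lambda>\<omega> u. (J \<omega> u)\<^sup>2", OF this zero_le_power2 b]
    show "integrable M Q" unfolding Q_def by (rule mp(2))
    have "(\<integral>\<omega>. Q \<omega> \<partial>M) = (LINT u:{0..T}|lborel. (\<integral>\<omega>. (J \<omega> u)\<^sup>2 \<partial>M))" unfolding Q_def by (rule mp(4))
    also have "\<dots> \<le> (LINT u:{0..T}|lborel. K\<^sup>2 * T)"
      by (intro set_integral_mono mp(3) set_integrable_const_Icc) (use b in auto)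
    also have "\<dots> = T * (K\<^sup>2 * T)" using T_pos by (simp add: set_lebesgue_integral_def)
    finally show "(\<integral>\<omega>. Q \<omega> \<partial>M) \<le> T * (K\<^sup>2 * T)" .
  qed
  have Q0: "0 \<le> Q \<omega>" for \<omega>
    unfolding Q_def set_lebesgue_integral_def by (intro Bochner_Integration.integral_nonneg) auto
  let ?R = "\<lambda>t \<omega>. 4 * (c\<^sup>2 * (norm (X 0 \<omega>))\<^sup>2 + (norm (I t \<omega>))\<^sup>2 + c\<^sup>2 * G\<^sup>2 + (2 * L * e)\<^sup>2 * T * Q \<omega>)"
  have sq: "(norm (X t \<omega>))\<^sup>2 \<le> ?R t \<omega>" if "\<omega> \<in> space M" "t \<in> {0..T}" for \<omega> t
  proof -
    have four: "(x + y + z + w)\<^sup>2 \<le> 4 * (x\<^sup>2 + y\<^sup>2 + z\<^sup>2 + w\<^sup>2)" for x y z w :: real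
    proof -
      have "4 * (x\<^sup>2 + y\<^sup>2 + z\<^sup>2 + w\<^sup>2) - (x + y + z + w)\<^sup>2
        = (x - y)\<^sup>2 + (x - z)\<^sup>2 + (x - w)\<^sup>2 + (y - z)\<^sup>2 + (y - w)\<^sup>2 + (z - w)\<^sup>2"
        by (simp add: power2_eq_square algebra_simps)
      also have "\<dots> \<ge> 0" by simp
      finally show ?thesis by simp
    qed
    have "(norm (X t \<omega>))\<^sup>2 \<le> (c * norm (X 0 \<omega>) + norm (I t \<omega>) + c * G + 2 * L * e * sqrt (T * Q \<omega>))\<^sup>2"
      using path[OF that] by (intro power_mono) auto
    also have "\<dots> \<le> 4 * ((c * norm (X 0 \<omega>))\<^sup>2 + (norm (I t \<omega>))\<^sup>2 + (c * G)\<^sup>2 + (2 * L * e * sqrt (T * Q \<omega>))\<^sup>2)"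
      by (rule four)
    finally show ?thesis using Q0[of \<omega>] T_pos by (simp add: power_mult_distrib)
  qed
  have "integrable M (\<lambda>\<omega>. (norm (X t \<omega>))\<^sup>2) \<and> (\<integral>\<omega>. (norm (X t \<omega>))\<^sup>2 \<partial>M)
     \<le> 4 * (c\<^sup>2 * (\<integral>\<omega>. (norm (X 0 \<omega>))\<^sup>2 \<partial>M) + K\<^sup>2 * T + c\<^sup>2 * G\<^sup>2 + (2 * L * e)\<^sup>2 * T * (T * (K\<^sup>2 * T)))"
    if t: "t \<in> {0..T}" for t
  proof
    have Ri: "integrable M (?R t)" using X0_square I_square_le(1)[OF t] mQ(1) by simp
    show i: "integrable M (\<lambda>\<omega>. (norm (X t \<omega>))\<^sup>2)"
      by (rule Bochner_Integration.integrable_bound[OF Ri])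
         (measurable, use sq t in \<open>auto intro!: AE_I2 order_trans[OF _ abs_ge_self]\<close>)
    have "(\<integral>\<omega>. (norm (X t \<omega>))\<^sup>2 \<partial>M) \<le> (\<integral>\<omega>. ?R t \<omega> \<partial>M)" using i Ri sq t by (intro integral_mono) auto
    also have "\<dots> = 4 * (c\<^sup>2 * (\<integral>\<omega>. (norm (X 0 \<omega>))\<^sup>2 \<partial>M) + (\<integral>\<omega>. (norm (I t \<omega>))\<^sup>2 \<partial>M) + c\<^sup>2 * G\<^sup>2 + (2 * L * e)\<^sup>2 * T * (\<integral>\<omega>. Q \<omega> \<partial>M))"
      using X0_square I_square_le(1)[OF t] mQ(1) by (simp add: prob_space)
    also have "\<dots> \<le> 4 * (c\<^sup>2 * (\<integral>\<omega>. (norm (X 0 \<omega>))\<^sup>2 \<partial>M) + K\<^sup>2 * T + c\<^sup>2 * G\<^sup>2 + (2 * L * e)\<^sup>2 * T * (T * (K\<^sup>2 * T)))"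
    proof -
      have "K\<^sup>2 * t \<le> K\<^sup>2 * T" using t by (intro mult_left_mono) auto
      then show ?thesis
        using I_square_le(2)[OF t] mQ(2) T_pos by (intro mult_left_mono add_mono order_refl) auto
    qed
    finally show "(\<integral>\<omega>. (norm (X t \<omega>))\<^sup>2 \<partial>M)
     \<le> 4 * (c\<^sup>2 * (\<integral>\<omega>. (norm (X 0 \<omega>))\<^sup>2 \<partial>M) + K\<^sup>2 * T + c\<^sup>2 * G\<^sup>2 + (2 * L * e)\<^sup>2 * T * (T * (K\<^sup>2 * T)))" .
  qed
  then show ?thesis by blast
qed

end

lemma borel_measurable_indefinite_integral:
  fixes f :: "real \<Rightarrow> 'b :: {banach, second_countable_topology}"
  assumes [measurable]: "f \<in> borel_measurable borel"
  shows "(\<lambda>t. LINT u:{0..t}|lborel. f u) \<in> borel_measurable borel"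
proof -
  let ?N = "(borel :: real measure) \<Otimes>\<^sub>M (lborel :: real measure)"
  have m: "snd \<in> borel_measurable ?N" "fst \<in> borel_measurable ?N"
    using measurable_snd[of borel "lborel :: real measure"] by simp_all
  have "{p \<in> space ?N. 0 \<le> snd p} \<inter> {p \<in> space ?N. snd p \<le> fst p} \<in> sets ?N"
    by (intro sets.Int borel_measurable_le m borel_measurable_const)
  moreover have "{p \<in> space ?N. 0 \<le> snd p} \<inter> {p \<in> space ?N. snd p \<le> fst p} = {p \<in> space ?N. snd p \<in> {0..fst p}}" by auto
  ultimately have "(\<lambda>p. indicat_real {0..fst p} (snd p)) \<in> borel_measurable ?N"
    by (intro borel_measurable_indicator') (simp only:)
  moreover have "(\<lambda>p. f (snd p)) \<in> borel_measurable ?N" using measurable_compose[OF m(1) assms] by simp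
  ultimately have "(\<lambda>(t, u). indicat_real {0..t} u *\<^sub>R f u) \<in> borel_measurable ?N"
    unfolding split_beta by (rule borel_measurable_scaleR)
  then show ?thesis
    unfolding set_lebesgue_integral_def
    by (rule sigma_finite_measure.borel_measurable_lebesgue_integral[OF sigma_finite_lborel])
qed

section \<open>First moments of the diffusion\<close>

context diffusion
begin

definition mX :: "real \<Rightarrow> real" where "mX t = (\<integral>\<omega>. norm (X t \<omega>) \<partial>M)"

lemma X_norm_integrable: "t \<in> {0..T} \<Longrightarrow> integrable M (\<lambda>\<omega>. norm (X t \<omega>))"
  using square_integrable_imp_integrable[of "\<lambda>\<omega>. norm (X t \<omega>)"] X_square_bounded by auto

lemma mX_nonneg: "0 \<le> mX t"
  by (simp add: mX_def)

lemma mX_bounded: "\<exists>C. \<forall>t\<in>{0..T}. mX t \<le> C"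
proof -
  obtain C where C: "\<And>t. t \<in> {0..T} \<Longrightarrow> integrable M (\<lambda>\<omega>. (norm (X t \<omega>))\<^sup>2) \<and> (\<integral>\<omega>. (norm (X t \<omega>))\<^sup>2 \<partial>M) \<le> C"
    using X_square_bounded by blast
  have "mX t \<le> 1 + C" if t: "t \<in> {0..T}" for t
  proof -
    have "x \<le> 1 + x\<^sup>2" for x :: real
      using sum_squares_bound[of x 1] zero_le_power2[of x] unfolding mult_1_right one_power2 by linarith
    then have "mX t \<le> (\<integral>\<omega>. 1 + (norm (X t \<omega>))\<^sup>2 \<partial>M)"
      unfolding mX_def using X_norm_integrable[OF t] C[OF t] by (intro integral_mono) auto
    also have "\<dots> \<le> 1 + C" using C[OF t] by (simp add: prob_space)
    finally show ?thesis .
  qed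
  then show ?thesis by blast
qed

lemma mX_path:
  assumes ab: "0 \<le> a" "b \<le> T"
  shows "integrable M (\<lambda>\<omega>. LINT u:{a..b}|lborel. norm (X u \<omega>))"
    and "set_integrable lborel {a..b} mX"
    and "(\<integral>\<omega>. (LINT u:{a..b}|lborel. norm (X u \<omega>)) \<partial>M) = (LINT u:{a..b}|lborel. mX u)"
proof -
  obtain C where C: "\<And>t. t \<in> {0..T} \<Longrightarrow> mX t \<le> C" using mX_bounded by blast
  have m: "(\<lambda>z. norm (X (snd z) (fst z))) \<in> borel_measurable (M \<Otimes>\<^sub>M lborel)" by measurable
  have c: "integrable M (\<lambda>\<omega>. norm (X u \<omega>)) \<and> (\<integral>\<omega>. norm (X u \<omega>) \<partial>M) \<le> C" if "u \<in> {a..b}" for u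
    using that ab C[of u] X_norm_integrable[of u] by (auto simp: mX_def)
  note mp = mean_path_integral[of "\<lambda>\<omega> u. norm (X u \<omega>)", OF m norm_ge_zero c]
  show "integrable M (\<lambda>\<omega>. LINT u:{a..b}|lborel. norm (X u \<omega>))" by (rule mp(2))
  show "set_integrable lborel {a..b} mX" unfolding mX_def by (rule mp(3))
  show "(\<integral>\<omega>. (LINT u:{a..b}|lborel. norm (X u \<omega>)) \<partial>M) = (LINT u:{a..b}|lborel. mX u)"
    unfolding mX_def by (rule mp(4))
qed

lemma X_displacement:
  assumes t: "t \<in> {0..T}"
  shows "integrable M (\<lambda>\<omega>. norm (X t \<omega> - X 0 \<omega>))"
    and "(\<integral>\<omega>. norm (X t \<omega> - X 0 \<omega>) \<partial>M)
      \<le> K * sqrt t + (LINT u:{0..t}|lborel. norm (\<beta> u 0)) + L * (LINT u:{0..t}|lborel. mX u)"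
proof -
  let ?G = "LINT u:{0..t}|lborel. norm (\<beta> u 0)"
  have Ii: "integrable M (\<lambda>\<omega>. norm (I t \<omega>))" "(\<integral>\<omega>. norm (I t \<omega>) \<partial>M) \<le> K * sqrt t"
  proof -
    have e: "integrable M (\<lambda>\<omega>. norm (I t \<omega>)) \<longleftrightarrow> integrable M (\<lambda>\<omega>. norm (I t \<omega> - I 0 \<omega>))"
      "(\<integral>\<omega>. norm (I t \<omega>) \<partial>M) = (\<integral>\<omega>. norm (I t \<omega> - I 0 \<omega>) \<partial>M)"
      using I_zero by (auto intro!: Bochner_Integration.integrable_cong Bochner_Integration.integral_cong)
    show "integrable M (\<lambda>\<omega>. norm (I t \<omega>))" "(\<integral>\<omega>. norm (I t \<omega>) \<partial>M) \<le> K * sqrt t"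
      unfolding e using increment_norm_le[of 0 t] t by auto
  qed
  have p: "integrable M (\<lambda>\<omega>. LINT u:{0..t}|lborel. norm (X u \<omega>))"
    "(\<integral>\<omega>. (LINT u:{0..t}|lborel. norm (X u \<omega>)) \<partial>M) = (LINT u:{0..t}|lborel. mX u)"
    using mX_path[of 0 t] t by auto
  show i: "integrable M (\<lambda>\<omega>. norm (X t \<omega> - X 0 \<omega>))"
    by (rule Bochner_Integration.integrable_bound[of M "\<lambda>\<omega>. norm (X t \<omega>) + norm (X 0 \<omega>)"])
       (use X_norm_integrable[OF t] X_norm_integrable[of 0] T_pos in \<open>auto simp: norm_triangle_ineq4\<close>)
  have "(\<integral>\<omega>. norm (X t \<omega> - X 0 \<omega>) \<partial>M) \<le> (\<integral>\<omega>. norm (I t \<omega>) + ?G + L * (LINT u:{0..t}|lborel. norm (X u \<omega>)) \<partial>M)"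
    using i Ii(1) p(1) norm_X_le(2)[OF _ t] by (intro integral_mono) auto
  also have "\<dots> = (\<integral>\<omega>. norm (I t \<omega>) \<partial>M) + ?G + L * (LINT u:{0..t}|lborel. mX u)"
    using Ii(1) p by (simp add: prob_space)
  finally show "(\<integral>\<omega>. norm (X t \<omega> - X 0 \<omega>) \<partial>M) \<le> K * sqrt t + ?G + L * (LINT u:{0..t}|lborel. mX u)"
    using Ii(2) by linarith
qed

text \<open>The drift at the origin depends on the law of X and so may grow with the mean
  \<open>mX\<close>; this doubles the Lipschitz constant in Gronwall and explains the exponent 4 L
  T. The bound involves only a, L, K, T and the initial mean; the finiteness that Gronwall
  presupposes comes from the non-quantitative bound on second moments.\<close>

lemma mX_bound:
  assumes a: "set_integrable lborel {0..T} a" and a_nonneg: "\<And>u. u \<in> {0..T} \<Longrightarrow> 0 \<le> a u"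
    and le: "\<And>u. u \<in> {0..T} \<Longrightarrow> norm (\<beta> u 0) \<le> a u + L * mX u" and t: "t \<in> {0..T}"
  shows "mX t \<le> 2 * (mX 0 + K * sqrt T + (LINT u:{0..T}|lborel. a u)) * exp (4 * L * T)"
proof -
  obtain C where C: "\<And>t. t \<in> {0..T} \<Longrightarrow> mX t \<le> C" using mX_bounded by blast
  let ?A = "LINT u:{0..T}|lborel. a u"
  have A0: "0 \<le> ?A" unfolding set_lebesgue_integral_def
    by (intro Bochner_Integration.integral_nonneg) (use a_nonneg in \<open>auto simp: indicator_def\<close>)
  have "mX t \<le> (mX 0 + K * sqrt T + ?A) + (2 * L) * (LINT u:{0..t}|lborel. mX u)" if t: "t \<in> {0..T}" for t
  proof -
    have at: "set_integrable lborel {0..t} a" using t by (intro set_integrable_subset[OF a]) auto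
    have mt: "set_integrable lborel {0..t} mX" using t by (intro mX_path) auto
    have bt: "set_integrable lborel {0..t} (\<lambda>u. norm (\<beta> u 0))"
      using t by (intro set_integrable_norm set_integrable_subset[OF \<beta>_origin_integrable]) auto
    have "(LINT u:{0..t}|lborel. norm (\<beta> u 0)) \<le> (LINT u:{0..t}|lborel. a u + L * mX u)"
      using t le by (intro set_integral_mono bt set_integral_add(1) at set_integrable_mult_right mt) auto
    also have "\<dots> = (LINT u:{0..t}|lborel. a u) + L * (LINT u:{0..t}|lborel. mX u)"
      using at mt by (simp add: set_integral_add)
    also have "\<dots> \<le> ?A + L * (LINT u:{0..t}|lborel. mX u)"
      using t a_nonneg by (intro add_right_mono set_integral_le_superset[OF a]) auto
    finally have 1: "(LINT u:{0..t}|lborel. norm (\<beta> u 0)) \<le> ?A + L * (LINT u:{0..t}|lborel. mX u)" .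
    have "mX t \<le> (\<integral>\<omega>. norm (X 0 \<omega>) + norm (X t \<omega> - X 0 \<omega>) \<partial>M)"
      unfolding mX_def using X_norm_integrable[OF t] X_norm_integrable[of 0] X_displacement(1)[OF t] T_pos
      by (intro integral_mono) (auto simp: norm_triangle_sub)
    also have "\<dots> = mX 0 + (\<integral>\<omega>. norm (X t \<omega> - X 0 \<omega>) \<partial>M)"
      unfolding mX_def using X_norm_integrable[of 0] X_displacement(1)[OF t] T_pos by simp
    finally have 2: "mX t \<le> mX 0 + (\<integral>\<omega>. norm (X t \<omega> - X 0 \<omega>) \<partial>M)" .
    have "K * sqrt t \<le> K * sqrt T" using t K_nonneg by (intro mult_left_mono) auto
    then show ?thesis using 1 2 X_displacement(2)[OF t] by simp
  qed
  then have "mX t \<le> 2 * (mX 0 + K * sqrt T + ?A) * exp (2 * (2 * L) * T)"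
    using L_pos T_pos K_nonneg A0 mX_nonneg C mX_path(2)[of 0 T] t
    by (intro gronwall_bounded[where f = mX and B = C]) auto
  then show ?thesis by simp
qed

end

section \<open>Lower bounds for the probability of staying in a tube\<close>

text \<open>
  The curve \<open>\<gamma>\<close> follows the drift at the origin, which need not be bounded in time, plus a
  constant velocity \<open>v\<close>; relative to \<open>\<gamma>\<close> the drift has linear growth with constant \<open>K1\<close>.
\<close>

locale diffusion_tube = diffusion M F T B \<Phi> I K X \<beta> L m
  for M :: "'w measure" and F T and B :: "real \<Rightarrow> 'w \<Rightarrow> real^'d" and \<Phi> I K X \<beta> L m +
  fixes x0 v :: "real^'d" and K1 \<delta> :: real
  assumes \<delta>: "0 < \<delta>" "\<delta> \<le> T"
    and tube: "\<And>u. u \<in> {0..\<delta>} \<Longrightarrow> L * norm (x0 + (LINT w:{0..u}|lborel. \<beta> w 0) + u *\<^sub>R v) + norm v + L \<le> K1"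
begin

definition \<gamma> :: "real \<Rightarrow> real^'d" where "\<gamma> t = x0 + (LINT u:{0..t}|lborel. \<beta> u 0) + t *\<^sub>R v"
definition Y :: "real \<Rightarrow> 'w \<Rightarrow> real^'d" where "Y t \<omega> = X t \<omega> - \<gamma> t"
text \<open>The drift of Y. Subtracting the curve removes the drift at the origin, the only part
  that is not controlled pointwise in time.\<close>

definition \<kappa> :: "real \<Rightarrow> 'w \<Rightarrow> real^'d" where "\<kappa> u \<omega> = \<beta> u (X u \<omega>) - \<beta> u 0 - v"

lemma K1_pos: "0 < K1"
proof -
  have "L \<le> K1" using tube[of 0] \<delta> L_pos by (smt (verit) atLeastAtMost_iff mult_nonneg_nonneg norm_ge_zero)
  then show ?thesis using L_pos by linarith
qed

lemma \<gamma>_bound: "u \<in> {0..\<delta>} \<Longrightarrow> norm (\<gamma> u) \<le> K1 / L"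
proof -
  assume "u \<in> {0..\<delta>}"
  then have "L * norm (\<gamma> u) \<le> K1" using tube[of u] L_pos norm_ge_zero[of v] unfolding \<gamma>_def by linarith
  then show ?thesis using L_pos by (simp add: pos_le_divide_eq mult.commute)
qed

lemma \<gamma>_measurable [measurable]: "\<gamma> \<in> borel_measurable borel"
proof -
  have "(\<lambda>t. LINT u:{0..t}|lborel. \<beta> u 0) \<in> borel_measurable borel"
    by (rule borel_measurable_indefinite_integral) measurable
  then show ?thesis unfolding \<gamma>_def by simp
qed

lemma \<kappa>_bound:
  assumes u: "u \<in> {0..\<delta>}"
  shows "norm (\<kappa> u \<omega>) \<le> K1 * (1 + norm (Y u \<omega>))"
proof -
  have uT: "u \<in> {0..T}" using u \<delta> by auto
  have "norm (\<kappa> u \<omega>) \<le> norm (\<beta> u (X u \<omega>) - \<beta> u 0) + norm v"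
    unfolding \<kappa>_def by (rule norm_triangle_ineq4)
  also have "\<dots> \<le> L * norm (X u \<omega>) + norm v" using \<beta>_lipschitz[OF uT, of "X u \<omega>" 0] by simp
  also have "L * norm (X u \<omega>) \<le> L * (norm (\<gamma> u) + norm (Y u \<omega>))"
    unfolding Y_def using L_pos by (intro mult_left_mono norm_triangle_sub) auto
  finally have 1: "norm (\<kappa> u \<omega>) \<le> L * norm (\<gamma> u) + norm v + L * norm (Y u \<omega>)"
    by (simp add: algebra_simps)
  have t: "L * norm (\<gamma> u) + norm v + L \<le> K1" using tube[OF u] by (simp add: \<gamma>_def)
  have "0 \<le> L * norm (\<gamma> u) + norm v" using L_pos by simp
  then have "L \<le> K1" "L * norm (\<gamma> u) + norm v \<le> K1" using t L_pos by linarith+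
  then have "L * norm (Y u \<omega>) \<le> K1 * norm (Y u \<omega>)" by (intro mult_right_mono) auto
  then show ?thesis using 1 \<open>L * norm (\<gamma> u) + norm v \<le> K1\<close> by (simp add: algebra_simps)
qed

lemma Y_joint [measurable]: "(\<lambda>z. Y (snd z) (fst z)) \<in> borel_measurable (M \<Otimes>\<^sub>M lborel)"
proof -
  have "(\<lambda>z. \<gamma> (snd z)) \<in> borel_measurable (M \<Otimes>\<^sub>M lborel)"
    using measurable_compose[OF measurable_snd, of \<gamma> "lborel :: real measure" borel M] by simp
  then show ?thesis unfolding Y_def using X_joint by (intro borel_measurable_diff)
qed

lemma \<kappa>_joint [measurable]: "(\<lambda>z. \<kappa> (snd z) (fst z)) \<in> borel_measurable (M \<Otimes>\<^sub>M lborel)"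
proof -
  have "(\<lambda>z. (snd z, X (snd z) (fst z))) \<in> M \<Otimes>\<^sub>M lborel \<rightarrow>\<^sub>M lborel \<Otimes>\<^sub>M borel"
    using X_joint by (intro measurable_Pair) auto
  from measurable_compose[OF this \<beta>_measurable]
  have "(\<lambda>z. \<beta> (snd z) (X (snd z) (fst z))) \<in> borel_measurable (M \<Otimes>\<^sub>M lborel)" by simp
  moreover have "(\<lambda>z. \<beta> (snd z) 0) \<in> borel_measurable (M \<Otimes>\<^sub>M lborel)"
    using measurable_compose[OF measurable_snd, of "\<lambda>u. \<beta> u 0" "lborel :: real measure" borel M] by simp
  ultimately show ?thesis unfolding \<kappa>_def by (intro borel_measurable_diff borel_measurable_const)
qed

lemma Y_measurable [measurable]: "Y t \<in> borel_measurable M"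
  unfolding Y_def by measurable

lemma Y_adapted: "t \<in> {0..T} \<Longrightarrow> Y t \<in> borel_measurable (F t)"
  unfolding Y_def using X_adapted by simp

lemma \<kappa>_path_integrable:
  assumes \<omega>: "\<omega> \<in> space M" and ab: "0 \<le> a" "b \<le> \<delta>"
  shows "set_integrable lborel {a..b} (\<lambda>u. \<kappa> u \<omega>)" "set_integrable lborel {a..b} (\<lambda>u. (norm (\<kappa> u \<omega>))\<^sup>2)"
    "set_integrable lborel {a..b} (\<lambda>u. norm (Y u \<omega> - Y a \<omega>))"
proof -
  obtain C where C: "\<And>u. u \<in> {0..T} \<Longrightarrow> norm (X u \<omega>) \<le> C" using X_bounded_path[OF \<omega>] by blast
  have Yb: "norm (Y u \<omega>) \<le> C + K1 / L" if "u \<in> {0..\<delta>}" for u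
    unfolding Y_def using C[of u] \<gamma>_bound[OF that] that \<delta> norm_triangle_ineq4[of "X u \<omega>" "\<gamma> u"] by auto
  have \<kappa>b: "norm (\<kappa> u \<omega>) \<le> K1 * (1 + (C + K1 / L))" if "u \<in> {0..\<delta>}" for u
    using \<kappa>_bound[OF that, of \<omega>] mult_left_mono[OF add_left_mono[OF Yb[OF that]] less_imp_le[OF K1_pos]] by (rule order_trans)
  have [measurable]: "(\<lambda>u. \<kappa> u \<omega>) \<in> borel_measurable borel" "(\<lambda>u. Y u \<omega>) \<in> borel_measurable borel"
    using measurable_compose[OF measurable_Pair1'[OF \<omega>, of lborel] \<kappa>_joint]
      measurable_compose[OF measurable_Pair1'[OF \<omega>, of lborel] Y_joint] by simp_all
  show "set_integrable lborel {a..b} (\<lambda>u. \<kappa> u \<omega>)"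
    by (rule set_integrable_bounded[where C = "K1 * (1 + (C + K1 / L))"]) (use \<kappa>b ab in auto)
  show "set_integrable lborel {a..b} (\<lambda>u. (norm (\<kappa> u \<omega>))\<^sup>2)"
    by (rule set_integrable_bounded[where C = "(K1 * (1 + (C + K1 / L)))\<^sup>2"]) (use \<kappa>b ab in \<open>auto intro!: power_mono\<close>)
  show "set_integrable lborel {a..b} (\<lambda>u. norm (Y u \<omega> - Y a \<omega>))"
  proof (rule set_integrable_bounded[where C = "(C + K1 / L) + norm (Y a \<omega>)"])
    fix u assume "u \<in> {a..b}"
    then have "norm (Y u \<omega>) \<le> C + K1 / L" using ab by (intro Yb) auto
    then show "norm (norm (Y u \<omega> - Y a \<omega>)) \<le> (C + K1 / L) + norm (Y a \<omega>)"
      using norm_triangle_ineq4[of "Y u \<omega>" "Y a \<omega>"] by simp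
  qed simp
qed

lemma Y_increment:
  assumes \<omega>: "\<omega> \<in> space M" and ab: "0 \<le> a" "a \<le> b" "b \<le> \<delta>"
  shows "Y b \<omega> - Y a \<omega> = (I b \<omega> - I a \<omega>) + (LINT u:{a..b}|lborel. \<kappa> u \<omega>)"
proof -
  have bT: "b \<in> {0..T}" "a \<in> {0..T}" using ab \<delta> by auto
  have i: "set_integrable lborel {0..b} (\<lambda>u. \<beta> u (X u \<omega>))" "set_integrable lborel {0..b} (\<lambda>u. \<beta> u 0)"
    using bT by (auto intro: set_integrable_subset[OF \<beta>_path_integrable[OF \<omega>]] set_integrable_subset[OF \<beta>_origin_integrable])
  have i': "set_integrable lborel {a..b} (\<lambda>u. \<beta> u (X u \<omega>))" "set_integrable lborel {a..b} (\<lambda>u. \<beta> u 0)"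
    using bT ab by (auto intro: set_integrable_subset[OF i(1)] set_integrable_subset[OF i(2)])
  have "(LINT u:{a..b}|lborel. \<kappa> u \<omega>) = (LINT u:{a..b}|lborel. \<beta> u (X u \<omega>)) - (LINT u:{a..b}|lborel. \<beta> u 0) - (b - a) *\<^sub>R v"
  proof -
    have "(LINT u:{a..b}|lborel. v) = (b - a) *\<^sub>R v" using ab by (simp add: set_lebesgue_integral_def)
    then show ?thesis unfolding \<kappa>_def using i' by (simp add: set_integral_diff set_integrable_const_Icc)
  qed
  moreover have "I b \<omega> - I a \<omega> = X b \<omega> - X a \<omega> - (LINT u:{a..b}|lborel. \<beta> u (X u \<omega>))"
    using I_eq[OF bT(1) \<omega>] I_eq[OF bT(2) \<omega>] set_integral_split_Icc[OF ab(1,2) i(1)] by simp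
  moreover have "\<gamma> b - \<gamma> a = (LINT u:{a..b}|lborel. \<beta> u 0) + (b - a) *\<^sub>R v"
    using set_integral_split_Icc[OF ab(1,2) i(2)] by (simp add: \<gamma>_def scaleR_diff_left)
  moreover have "Y b \<omega> - Y a \<omega> = (X b \<omega> - X a \<omega>) - (\<gamma> b - \<gamma> a)" by (simp add: Y_def)
  ultimately show ?thesis by simp
qed

text \<open>A single constant serves all subintervals. It may depend on the individual diffusion,
  since it only multiplies errors that vanish with the step size.\<close>

lemma Y_moments:
  shows "\<exists>C\<ge>0. \<forall>a b. 0 \<le> a \<and> a \<le> b \<and> b \<le> \<delta> \<longrightarrow>
      integrable M (\<lambda>\<omega>. (norm (LINT u:{a..b}|lborel. \<kappa> u \<omega>))\<^sup>2) \<and>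
      (\<integral>\<omega>. (norm (LINT u:{a..b}|lborel. \<kappa> u \<omega>))\<^sup>2 \<partial>M) \<le> C\<^sup>2 * (b - a)\<^sup>2 \<and>
      integrable M (\<lambda>\<omega>. (norm (Y a \<omega>))\<^sup>2)"
proof -
  obtain C where C: "\<And>t. t \<in> {0..T} \<Longrightarrow> integrable M (\<lambda>\<omega>. (norm (X t \<omega>))\<^sup>2) \<and> (\<integral>\<omega>. (norm (X t \<omega>))\<^sup>2 \<partial>M) \<le> C"
    using X_square_bounded by blast
  have sq: "(x + y)\<^sup>2 \<le> 2 * x\<^sup>2 + 2 * y\<^sup>2" for x y :: real
    using sum_squares_bound[of x y] by (simp add: power2_sum)
  have C0: "0 \<le> C"
  proof -
    have "0 \<le> (\<integral>\<omega>. (norm (X 0 \<omega>))\<^sup>2 \<partial>M)" by (rule Bochner_Integration.integral_nonneg) simp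
    also have "\<dots> \<le> C" using C[of 0] T_pos by simp
    finally show ?thesis .
  qed
  have YI: "integrable M (\<lambda>\<omega>. (norm (Y u \<omega>))\<^sup>2)" "(\<integral>\<omega>. (norm (Y u \<omega>))\<^sup>2 \<partial>M) \<le> 2 * C + 2 * (K1 / L)\<^sup>2"
    if u: "u \<in> {0..\<delta>}" for u
  proof -
    have uT: "u \<in> {0..T}" using u \<delta> by auto
    have pw: "(norm (Y u \<omega>))\<^sup>2 \<le> 2 * (norm (X u \<omega>))\<^sup>2 + 2 * (K1 / L)\<^sup>2" for \<omega>
    proof -
      have "norm (Y u \<omega>) \<le> norm (X u \<omega>) + K1 / L"
        unfolding Y_def using \<gamma>_bound[OF u] norm_triangle_ineq4[of "X u \<omega>" "\<gamma> u"] by linarith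
      then have "(norm (Y u \<omega>))\<^sup>2 \<le> (norm (X u \<omega>) + K1 / L)\<^sup>2" by (intro power_mono) auto
      then show ?thesis using sq[of "norm (X u \<omega>)" "K1 / L"] by linarith
    qed
    show i: "integrable M (\<lambda>\<omega>. (norm (Y u \<omega>))\<^sup>2)"
      by (rule Bochner_Integration.integrable_bound[of M "\<lambda>\<omega>. 2 * (norm (X u \<omega>))\<^sup>2 + 2 * (K1 / L)\<^sup>2"])
         (use C[OF uT] pw in \<open>auto intro!: AE_I2 order_trans[OF pw abs_ge_self]\<close>)
    have "(\<integral>\<omega>. (norm (Y u \<omega>))\<^sup>2 \<partial>M) \<le> (\<integral>\<omega>. 2 * (norm (X u \<omega>))\<^sup>2 + 2 * (K1 / L)\<^sup>2 \<partial>M)"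
      using C[OF uT] i pw by (intro integral_mono) auto
    also have "\<dots> \<le> 2 * C + 2 * (K1 / L)\<^sup>2" using C[OF uT] by (simp add: prob_space)
    finally show "(\<integral>\<omega>. (norm (Y u \<omega>))\<^sup>2 \<partial>M) \<le> 2 * C + 2 * (K1 / L)\<^sup>2" .
  qed
  define D where "D = K1\<^sup>2 * (2 + 2 * (2 * C + 2 * (K1 / L)\<^sup>2))"
  have D0: "0 \<le> D" using C0 by (simp add: D_def)
  have \<kappa>I: "integrable M (\<lambda>\<omega>. (norm (\<kappa> u \<omega>))\<^sup>2) \<and> (\<integral>\<omega>. (norm (\<kappa> u \<omega>))\<^sup>2 \<partial>M) \<le> D" if u: "u \<in> {0..\<delta>}" for u
  proof -
    have [measurable]: "\<kappa> u \<in> borel_measurable M"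
      using measurable_compose[OF measurable_Pair2'[of u lborel M] \<kappa>_joint] by simp
    have pw: "(norm (\<kappa> u \<omega>))\<^sup>2 \<le> K1\<^sup>2 * (2 + 2 * (norm (Y u \<omega>))\<^sup>2)" for \<omega>
    proof -
      have "(norm (\<kappa> u \<omega>))\<^sup>2 \<le> (K1 * (1 + norm (Y u \<omega>)))\<^sup>2" by (intro power_mono \<kappa>_bound u) auto
      also have "\<dots> \<le> K1\<^sup>2 * (2 + 2 * (norm (Y u \<omega>))\<^sup>2)"
        unfolding power_mult_distrib using sq[of 1 "norm (Y u \<omega>)"] by (intro mult_left_mono) auto
      finally show ?thesis .
    qed
    have i: "integrable M (\<lambda>\<omega>. (norm (\<kappa> u \<omega>))\<^sup>2)"
      by (rule Bochner_Integration.integrable_bound[of M "\<lambda>\<omega>. K1\<^sup>2 * (2 + 2 * (norm (Y u \<omega>))\<^sup>2)"])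
         (use YI[OF u] pw in \<open>auto intro!: AE_I2 order_trans[OF pw abs_ge_self]\<close>)
    have "(\<integral>\<omega>. (norm (\<kappa> u \<omega>))\<^sup>2 \<partial>M) \<le> (\<integral>\<omega>. K1\<^sup>2 * (2 + 2 * (norm (Y u \<omega>))\<^sup>2) \<partial>M)"
      using YI[OF u] i pw by (intro integral_mono) auto
    also have "\<dots> = K1\<^sup>2 * (2 + 2 * (\<integral>\<omega>. (norm (Y u \<omega>))\<^sup>2 \<partial>M))" using YI[OF u] by (simp add: prob_space)
    also have "\<dots> \<le> D" unfolding D_def using YI(2)[OF u] by (intro mult_left_mono add_left_mono) auto
    finally show ?thesis using i by simp
  qed
  have "integrable M (\<lambda>\<omega>. (norm (LINT u:{a..b}|lborel. \<kappa> u \<omega>))\<^sup>2) \<and>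
      (\<integral>\<omega>. (norm (LINT u:{a..b}|lborel. \<kappa> u \<omega>))\<^sup>2 \<partial>M) \<le> D * (b - a)\<^sup>2"
    if ab: "0 \<le> a" "a \<le> b" "b \<le> \<delta>" for a b
  proof -
    have m: "(\<lambda>z. (norm (\<kappa> (snd z) (fst z)))\<^sup>2) \<in> borel_measurable (M \<Otimes>\<^sub>M lborel)" by measurable
    have c: "integrable M (\<lambda>\<omega>. (norm (\<kappa> u \<omega>))\<^sup>2) \<and> (\<integral>\<omega>. (norm (\<kappa> u \<omega>))\<^sup>2 \<partial>M) \<le> D" if "u \<in> {a..b}" for u
      using that ab by (intro \<kappa>I) auto
    note mp = mean_path_integral[of "\<lambda>\<omega> u. (norm (\<kappa> u \<omega>))\<^sup>2", OF m zero_le_power2 c]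
    have wm [measurable]: "(\<lambda>\<omega>. LINT u:{a..b}|lborel. \<kappa> u \<omega>) \<in> borel_measurable M"
      unfolding set_lebesgue_integral_def
      by (rule sigma_finite_measure.borel_measurable_lebesgue_integral[OF sigma_finite_lborel])
         (use \<kappa>_joint in \<open>simp add: split_beta\<close>)
    have pw: "(norm (LINT u:{a..b}|lborel. \<kappa> u \<omega>))\<^sup>2 \<le> (b - a) * (LINT u:{a..b}|lborel. (norm (\<kappa> u \<omega>))\<^sup>2)" if \<omega>: "\<omega> \<in> space M" for \<omega>
    proof -
      have "norm (LINT u:{a..b}|lborel. \<kappa> u \<omega>) \<le> (LINT u:{a..b}|lborel. norm (\<kappa> u \<omega>))"
        using \<kappa>_path_integrable(1)[OF \<omega> ab(1,3)] by (rule set_integral_norm_bound)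
      then have "(norm (LINT u:{a..b}|lborel. \<kappa> u \<omega>))\<^sup>2 \<le> (LINT u:{a..b}|lborel. norm (\<kappa> u \<omega>))\<^sup>2"
        by (intro power_mono) auto
      also have "\<dots> \<le> (b - a) * (LINT u:{a..b}|lborel. (norm (\<kappa> u \<omega>))\<^sup>2)"
        using ab \<kappa>_path_integrable[OF \<omega> ab(1,3)] by (intro set_integral_Cauchy_Schwarz set_integrable_norm) auto
      finally show ?thesis .
    qed
    have i2: "integrable M (\<lambda>\<omega>. (b - a) * (LINT u:{a..b}|lborel. (norm (\<kappa> u \<omega>))\<^sup>2))" using mp(2) by simp
    have i: "integrable M (\<lambda>\<omega>. (norm (LINT u:{a..b}|lborel. \<kappa> u \<omega>))\<^sup>2)"
      by (rule Bochner_Integration.integrable_bound[OF i2])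
         (measurable, use pw in \<open>auto intro!: AE_I2 order_trans[OF pw abs_ge_self]\<close>)
    have "(\<integral>\<omega>. (norm (LINT u:{a..b}|lborel. \<kappa> u \<omega>))\<^sup>2 \<partial>M) \<le> (\<integral>\<omega>. (b - a) * (LINT u:{a..b}|lborel. (norm (\<kappa> u \<omega>))\<^sup>2) \<partial>M)"
      using i i2 pw by (intro integral_mono) auto
    also have "\<dots> = (b - a) * (LINT u:{a..b}|lborel. (\<integral>\<omega>. (norm (\<kappa> u \<omega>))\<^sup>2 \<partial>M))" using mp(4) by simp
    also have "\<dots> \<le> (b - a) * (LINT u:{a..b}|lborel. D)"
      using ab c by (intro mult_left_mono set_integral_mono mp(3) set_integrable_const_Icc) auto
    also have "\<dots> = D * (b - a)\<^sup>2" using ab by (simp add: set_lebesgue_integral_def power2_eq_square)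
    finally show ?thesis using i by simp
  qed
  moreover have "integrable M (\<lambda>\<omega>. (norm (Y a \<omega>))\<^sup>2)" if "0 \<le> a" "a \<le> b" "b \<le> \<delta>" for a b
    using that by (intro YI) auto
  ultimately show ?thesis using D0 by (intro exI[of _ "sqrt D"]) auto
qed

end

section \<open>Decay of the Gaussian barrier along the tube\<close>

context diffusion_tube
begin

definition barrier :: "real \<Rightarrow> real \<Rightarrow> real" where
  "barrier \<alpha> t = (\<integral>\<omega>. exp (- (\<alpha> * (norm (Y t \<omega>))\<^sup>2)) \<partial>M)"

text \<open>The isometry takes matrix weights. Placing the weighted vector Y in one row, with zeros
  elsewhere, produces the scalar product of Y with an increment; a multiple of the identity produces
  the norm of the increment.\<close>

lemma gaussian_weight_adapted:
  fixes i0 :: 'd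
  assumes \<alpha>: "\<alpha> > 0" and t: "t \<in> {0..T}"
  shows "adapted_bounded t (\<lambda>\<omega>. \<chi> i. if i = i0 then exp (- (\<alpha> * (norm (Y t \<omega>))\<^sup>2)) *\<^sub>R Y t \<omega> else (0 :: real^'d))"
    and "adapted_bounded t (\<lambda>\<omega>. exp (- (\<alpha> * (norm (Y t \<omega>))\<^sup>2)) *\<^sub>R mat 1 :: real^'d^'d)"
proof -
  note [measurable] = Y_adapted[OF t]
  have n: "norm (\<chi> i. if i = i0 then r else (0 :: real^'d)) = norm r" for r :: "real^'d"
    unfolding norm_vec_def[of "\<chi> i. if i = i0 then r else 0"]
    by (simp add: L2_set_def if_distrib[of "\<lambda>x. (norm x)\<^sup>2"] cong: if_cong)
  have m: "(\<lambda>\<omega>. \<chi> i. if i = i0 then g \<omega> else 0) \<in> borel_measurable (F t)"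
    if [measurable]: "g \<in> borel_measurable (F t)" for g :: "'w \<Rightarrow> real^'d"
  proof (rule borel_measurable_continuous_on[OF linear_continuous_on that])
    show "bounded_linear (\<lambda>x. (\<chi> i. if i = i0 then x else 0) :: real^'d^'d)"
      by (rule bounded_linear_intro[where K = 1]) (auto simp: n vec_eq_iff)
  qed
  show "adapted_bounded t (\<lambda>\<omega>. \<chi> i. if i = i0 then exp (- (\<alpha> * (norm (Y t \<omega>))\<^sup>2)) *\<^sub>R Y t \<omega> else (0 :: real^'d))"
    unfolding adapted_bounded_def
  proof (intro conjI exI[of _ "1 + 2 / \<alpha>\<^sup>2"] ballI)
    show "norm (\<chi> i. if i = i0 then exp (- (\<alpha> * (norm (Y t \<omega>))\<^sup>2)) *\<^sub>R Y t \<omega> else 0) \<le> 1 + 2 / \<alpha>\<^sup>2" for \<omega>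
      using gaussian_moment_bound[OF \<alpha>, of "norm (Y t \<omega>)" 1] by (simp add: n)
  qed (intro m, measurable)
  show "adapted_bounded t (\<lambda>\<omega>. exp (- (\<alpha> * (norm (Y t \<omega>))\<^sup>2)) *\<^sub>R mat 1 :: real^'d^'d)"
    unfolding adapted_bounded_def
  proof (intro conjI exI[of _ "norm (mat 1 :: real^'d^'d)"] ballI)
    show "norm (exp (- (\<alpha> * (norm (Y t \<omega>))\<^sup>2)) *\<^sub>R (mat 1 :: real^'d^'d)) \<le> norm (mat 1 :: real^'d^'d)" for \<omega>
      using \<alpha> by (simp add: mult_left_le_one_le)
  qed measurable
qed

text \<open>The conditional mean, an upper bound for the conditional variance and a lower bound for
  its part in the direction of Y, all tested against the Gaussian weight at time a. The lower bound
  is where ellipticity enters.\<close>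

lemma weighted_increment_moments:
  assumes \<alpha>: "\<alpha> > 0" and ab: "0 \<le> a" "a \<le> b" "b \<le> T"
  defines "g \<equiv> \<lambda>\<omega>. exp (- (\<alpha> * (norm (Y a \<omega>))\<^sup>2))" and "x \<equiv> \<lambda>\<omega>. I b \<omega> - I a \<omega>"
  shows "integrable M (\<lambda>\<omega>. g \<omega> * (Y a \<omega> \<bullet> x \<omega>))" "(\<integral>\<omega>. g \<omega> * (Y a \<omega> \<bullet> x \<omega>) \<partial>M) = 0"
    and "integrable M (\<lambda>\<omega>. g \<omega> * (norm (x \<omega>))\<^sup>2)"
    and "(\<integral>\<omega>. g \<omega> * (norm (x \<omega>))\<^sup>2 \<partial>M) \<le> K\<^sup>2 * (b - a) * (\<integral>\<omega>. g \<omega> \<partial>M)"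
    and "integrable M (\<lambda>\<omega>. g \<omega> * (Y a \<omega> \<bullet> x \<omega>)\<^sup>2)"
    and "(\<integral>\<omega>. g \<omega> * (Y a \<omega> \<bullet> x \<omega>)\<^sup>2 \<partial>M) \<ge> m\<^sup>2 * (b - a) * (\<integral>\<omega>. g \<omega> * (norm (Y a \<omega>))\<^sup>2 \<partial>M)"
    and "\<And>k. k \<le> 4 \<Longrightarrow> integrable M (\<lambda>\<omega>. g \<omega> * norm (Y a \<omega>) ^ k)"
proof -
  interpret P: pair_sigma_finite M "lborel :: real measure" ..
  have aT: "a \<in> {0..T}" using ab by auto
  obtain i0 :: 'd where True by simp
  let ?row = "\<lambda>r. \<chi> i. if i = i0 then r else (0 :: real^'d)"
  have row_mult: "(?row r *v y) = axis i0 (r \<bullet> y)" for r y :: "real^'d"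
    by (simp add: vec_eq_iff axis_def matrix_vector_mult_def inner_vec_def)
  have n: "norm (?row r) = norm r" for r :: "real^'d"
    unfolding norm_vec_def[of "?row r"]
    by (simp add: L2_set_def if_distrib[of "\<lambda>x. (norm x)\<^sup>2"] cong: if_cong)
  have row_mat: "?row r ** A = ?row (transpose A *v r)" for r :: "real^'d" and A :: "real^'d^'d"
    by (simp add: vec_eq_iff matrix_matrix_mult_def matrix_vector_mult_def transpose_def mult.commute
        del: transpose_matrix_vector)
  show gk: "integrable M (\<lambda>\<omega>. g \<omega> * norm (Y a \<omega>) ^ k)" if "k \<le> 4" for k
    by (rule integrable_const_bound[where B = "1 + 2 / \<alpha>\<^sup>2"])
       (use gaussian_moment_bound[OF \<alpha> _ that] in \<open>auto simp: g_def intro!: AE_I2\<close>)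
  have W1: "adapted_bounded a (\<lambda>\<omega>. ?row (g \<omega> *\<^sub>R Y a \<omega>))"
    unfolding g_def by (rule gaussian_weight_adapted(1)[OF \<alpha> aT])
  show "integrable M (\<lambda>\<omega>. g \<omega> * (Y a \<omega> \<bullet> x \<omega>))" "(\<integral>\<omega>. g \<omega> * (Y a \<omega> \<bullet> x \<omega>) \<partial>M) = 0"
    using ito_isometry(4,5)[OF ab W1, of i0] by (simp_all add: row_mult x_def)
  \<comment> \<open>The square root of g, hence \<alpha> / 2 in place of \<alpha>: the isometry
    squares its weight.\<close>
  define q where "q \<omega> = exp (- (\<alpha> / 2 * (norm (Y a \<omega>))\<^sup>2))" for \<omega>
  have q2: "(q \<omega>)\<^sup>2 = g \<omega>" for \<omega> unfolding q_def g_def power2_eq_square mult_exp_exp by simp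
  have \<alpha>2: "\<alpha> / 2 > 0" using \<alpha> by simp
  have W2: "adapted_bounded a (\<lambda>\<omega>. q \<omega> *\<^sub>R mat 1 :: real^'d^'d)"
    unfolding q_def by (rule gaussian_weight_adapted(2)[OF \<alpha>2 aT])
  have W3: "adapted_bounded a (\<lambda>\<omega>. ?row (q \<omega> *\<^sub>R Y a \<omega>))"
    unfolding q_def by (rule gaussian_weight_adapted(1)[OF \<alpha>2 aT])
  have na: "norm (axis i0 c :: real^'d) = \<bar>c\<bar>" for c :: real
  proof -
    have "axis i0 c = c *\<^sub>R (axis i0 1 :: real^'d)" by (simp add: axis_def vec_eq_iff)
    then show ?thesis by simp
  qed
  have e2: "(norm ((q \<omega> *\<^sub>R mat 1 :: real^'d^'d) *v y))\<^sup>2 = g \<omega> * (norm y)\<^sup>2" for \<omega> y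
    by (simp add: scaleR_matrix_vector_assoc[symmetric] power_mult_distrib q2)
  have e3: "(norm (?row (q \<omega> *\<^sub>R Y a \<omega>) *v y))\<^sup>2 = g \<omega> * (Y a \<omega> \<bullet> y)\<^sup>2" for \<omega> y
    by (simp add: row_mult na power_mult_distrib q2)
  note i2 = ito_isometry(1-3)[OF ab W2, unfolded e2] and i3 = ito_isometry(1-3)[OF ab W3, unfolded e3]
  show "integrable M (\<lambda>\<omega>. g \<omega> * (norm (x \<omega>))\<^sup>2)" unfolding x_def by (rule i2(1))
  show "integrable M (\<lambda>\<omega>. g \<omega> * (Y a \<omega> \<bullet> x \<omega>)\<^sup>2)" unfolding x_def by (rule i3(1))
  have hb: "has_bochner_integral (M \<Otimes>\<^sub>M lborel) (\<lambda>p. f (fst p) * indicat_real {a<..b} (snd p)) (integral\<^sup>L M f * (b - a))"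
    if "integrable M f" for f :: "'w \<Rightarrow> real"
    using P.has_bochner_integral_product[OF that integral_indicator_Ioc(1)[of a b]] ab
    unfolding integral_indicator_Ioc(2) by simp
  have "(\<integral>\<omega>. g \<omega> * (norm (x \<omega>))\<^sup>2 \<partial>M) \<le> (\<integral>z. (K\<^sup>2 * g (fst z)) * indicat_real {a<..b} (snd z) \<partial>(M \<Otimes>\<^sub>M lborel))"
    unfolding x_def i2(3)
  proof (rule integral_mono[OF i2(2)])
    show "integrable (M \<Otimes>\<^sub>M lborel) (\<lambda>z. K\<^sup>2 * g (fst z) * indicat_real {a<..b} (snd z))"
      using hb[of "\<lambda>\<omega>. K\<^sup>2 * g \<omega>"] gk[of 0] by (simp add: has_bochner_integral_iff)
    show "(norm ((q (fst z) *\<^sub>R mat 1 :: real^'d^'d) ** \<Psi> a b z))\<^sup>2 \<le> K\<^sup>2 * g (fst z) * indicat_real {a<..b} (snd z)"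
      if "z \<in> space (M \<Otimes>\<^sub>M lborel)" for z
    proof -
      have "(q (fst z) *\<^sub>R mat 1 :: real^'d^'d) ** \<Psi> a b z = q (fst z) *\<^sub>R \<Psi> a b z"
        by (simp add: bounded_bilinear.scaleR_left[OF bounded_bilinear_matrix_mult])
      then have "(norm ((q (fst z) *\<^sub>R mat 1 :: real^'d^'d) ** \<Psi> a b z))\<^sup>2 = g (fst z) * (norm (\<Psi> a b z))\<^sup>2"
        by (simp add: power_mult_distrib q2)
      also have "\<dots> \<le> g (fst z) * (K\<^sup>2 * indicat_real {a<..b} (snd z))"
        using \<Phi>_bound that by (intro mult_left_mono) (auto simp: space_pair_measure indicator_def g_def intro!: power_mono)
      finally show ?thesis by (simp add: ac_simps)
    qed
  qed
  also have "\<dots> = K\<^sup>2 * (b - a) * (\<integral>\<omega>. g \<omega> \<partial>M)"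
    using hb[of "\<lambda>\<omega>. K\<^sup>2 * g \<omega>"] gk[of 0]
    by (simp add: has_bochner_integral_iff)
  finally show "(\<integral>\<omega>. g \<omega> * (norm (x \<omega>))\<^sup>2 \<partial>M) \<le> K\<^sup>2 * (b - a) * (\<integral>\<omega>. g \<omega> \<partial>M)" .
  have "m\<^sup>2 * (b - a) * (\<integral>\<omega>. g \<omega> * (norm (Y a \<omega>))\<^sup>2 \<partial>M)
      = (\<integral>z. (m\<^sup>2 * (g (fst z) * (norm (Y a (fst z)))\<^sup>2)) * indicat_real {a<..b} (snd z) \<partial>(M \<Otimes>\<^sub>M lborel))"
    using hb[of "\<lambda>\<omega>. m\<^sup>2 * (g \<omega> * (norm (Y a \<omega>))\<^sup>2)"] gk[of 2]
    by (simp add: has_bochner_integral_iff)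
  also have "\<dots> \<le> (\<integral>\<omega>. g \<omega> * (Y a \<omega> \<bullet> x \<omega>)\<^sup>2 \<partial>M)"
    unfolding x_def i3(3)
  proof (rule integral_mono[OF _ i3(2)])
    show "integrable (M \<Otimes>\<^sub>M lborel) (\<lambda>z. m\<^sup>2 * (g (fst z) * (norm (Y a (fst z)))\<^sup>2) * indicat_real {a<..b} (snd z))"
      using hb[of "\<lambda>\<omega>. m\<^sup>2 * (g \<omega> * (norm (Y a \<omega>))\<^sup>2)"] gk[of 2]
      by (simp add: has_bochner_integral_iff)
    show "m\<^sup>2 * (g (fst z) * (norm (Y a (fst z)))\<^sup>2) * indicat_real {a<..b} (snd z)
        \<le> (norm (?row (q (fst z) *\<^sub>R Y a (fst z)) ** \<Psi> a b z))\<^sup>2"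
      if "z \<in> space (M \<Otimes>\<^sub>M lborel)" for z
    proof (cases "snd z \<in> {a<..b}")
      case True
      have "(norm (?row (q (fst z) *\<^sub>R Y a (fst z)) ** \<Psi> a b z))\<^sup>2 = (norm (transpose (\<Phi> (snd z) (fst z)) *v (q (fst z) *\<^sub>R Y a (fst z))))\<^sup>2"
        using True by (simp add: row_mat n del: transpose_matrix_vector)
      also have "\<dots> \<ge> m\<^sup>2 * (norm (q (fst z) *\<^sub>R Y a (fst z)))\<^sup>2"
        using True ab that by (intro elliptic) (auto simp: space_pair_measure)
      finally show ?thesis using True by (simp add: power_mult_distrib q2)
    qed simp
  qed
  finally show "(\<integral>\<omega>. g \<omega> * (Y a \<omega> \<bullet> x \<omega>)\<^sup>2 \<partial>M) \<ge> m\<^sup>2 * (b - a) * (\<integral>\<omega>. g \<omega> * (norm (Y a \<omega>))\<^sup>2 \<partial>M)" .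
qed

text \<open>Expectation of the Taylor bound, with h the step size. The linear stochastic term has
  mean zero; the quadratic ones give a loss \<alpha> K^2 h and a gain 2 \<alpha>^2 m^2 h |Y|^2, and
  the drift costs 2 \<alpha> K1 h (|Y| + |Y|^2). For 2 K1 <= \<alpha> m^2 the gain covers the drift
  up to K1^2 h / m^2. The constant C collects errors of order h^(3/2) and leaves the rate
  untouched.\<close>

lemma barrier_step:
  assumes \<alpha>: "\<alpha> > 0" and \<alpha>K: "2 * K1 \<le> \<alpha> * m\<^sup>2"
  shows "\<exists>C\<ge>0. \<forall>a b. 0 \<le> a \<and> a < b \<and> b \<le> \<delta> \<and> b - a \<le> 1 \<longrightarrow>
    (1 - (\<alpha> * K\<^sup>2 + K1\<^sup>2 / m\<^sup>2) * (b - a)) * barrier \<alpha> a - C * ((b - a) * sqrt (b - a)) \<le> barrier \<alpha> b"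
proof -
  obtain C0 where C0: "0 \<le> C0" and taylor: "\<And>y x w :: real^'d.
    exp (- (\<alpha> * (norm y)\<^sup>2)) * (1 - 2 * \<alpha> * (y \<bullet> x) - \<alpha> * (norm x)\<^sup>2 + 2 * \<alpha>\<^sup>2 * (y \<bullet> x)\<^sup>2)
      - 2 * \<alpha> * exp (- (\<alpha> * (norm y)\<^sup>2)) * (y \<bullet> w)
      - C0 * (norm x ^ 3 + norm x ^ 6 + norm x * norm w + (norm w)\<^sup>2)
    \<le> exp (- (\<alpha> * (norm (y + x + w))\<^sup>2))"
    using gaussian_barrier_taylor[OF \<alpha>] by blast
  obtain C1 where C1: "0 \<le> C1" and mom: "\<And>a b. 0 \<le> a \<Longrightarrow> a \<le> b \<Longrightarrow> b \<le> \<delta> \<Longrightarrow>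
      integrable M (\<lambda>\<omega>. (norm (LINT u:{a..b}|lborel. \<kappa> u \<omega>))\<^sup>2) \<and>
      (\<integral>\<omega>. (norm (LINT u:{a..b}|lborel. \<kappa> u \<omega>))\<^sup>2 \<partial>M) \<le> C1\<^sup>2 * (b - a)\<^sup>2 \<and>
      integrable M (\<lambda>\<omega>. (norm (Y a \<omega>))\<^sup>2)"
    using Y_moments by metis
  define c0 where "c0 = 1 + 2 / \<alpha>\<^sup>2"
  define C6 where "C6 = 1440 * CARD('d) ^ 7 * exp (K\<^sup>2 / 2)"
  have c0: "0 \<le> c0" and C6: "0 \<le> C6" by (simp_all add: c0_def C6_def)
  \<comment> \<open>The coefficients of h^(3/2) in the bound for the mean of R below, one summand
    for each term of R.\<close>
  define C where "C = 2 * \<alpha> * K1 * c0 * (K + C1) + C0 * (1/2 + C6 / 2 + C6 + K\<^sup>2 / 2 + C1\<^sup>2 / 2 + C1\<^sup>2)"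
  have Cnn: "0 \<le> C" using \<alpha> K1_pos c0 K_nonneg C1 C0 C6 by (simp add: C_def)
  have "(1 - (\<alpha> * K\<^sup>2 + K1\<^sup>2 / m\<^sup>2) * (b - a)) * barrier \<alpha> a - C * ((b - a) * sqrt (b - a)) \<le> barrier \<alpha> b"
    if ab: "0 \<le> a" "a < b" "b \<le> \<delta>" "b - a \<le> 1" for a b
  proof -
    define h z where "h = b - a" and "z = sqrt (b - a)"
    have z: "0 < z" "z \<le> 1" "h = z\<^sup>2" "0 < h" "h \<le> 1" using ab by (auto simp: h_def z_def)
    have bT: "b \<le> T" "a \<le> b" using ab \<delta> by auto
    define g where "g \<omega> = exp (- (\<alpha> * (norm (Y a \<omega>))\<^sup>2))" for \<omega>
    define x where "x \<omega> = I b \<omega> - I a \<omega>" for \<omega>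
    define w where "w \<omega> = (LINT u:{a..b}|lborel. \<kappa> u \<omega>)" for \<omega>
    \<comment> \<open>Variation of Y within the step: the drift is controlled through Y at the
      running time, the weight through Y at time a. Its mean is of order h^(3/2).\<close>
    define S where "S \<omega> = (LINT u:{a..b}|lborel. norm (Y u \<omega> - Y a \<omega>))" for \<omega>
    have g0: "0 \<le> g \<omega>" for \<omega> by (simp add: g_def)
    note wm = weighted_increment_moments[OF \<alpha> ab(1) bT(2,1), folded g_def x_def]
    have xi: "integrable M (\<lambda>\<omega>. (norm (x \<omega>))\<^sup>2)" "(\<integral>\<omega>. (norm (x \<omega>))\<^sup>2 \<partial>M) \<le> K\<^sup>2 * h"
      using increment_L2[OF ab(1) bT(2,1)] increment_square_le[OF ab(1) bT(2,1)] by (simp_all add: x_def h_def)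
    have x6: "integrable M (\<lambda>\<omega>. norm (x \<omega>) ^ 6)" "(\<integral>\<omega>. norm (x \<omega>) ^ 6 \<partial>M) \<le> C6 * h ^ 3"
      using ito_sixth_moment[OF ab(1,2) bT(1)] by (simp_all add: x_def h_def C6_def)
    have wi: "integrable M (\<lambda>\<omega>. (norm (w \<omega>))\<^sup>2)" "(\<integral>\<omega>. (norm (w \<omega>))\<^sup>2 \<partial>M) \<le> C1\<^sup>2 * h\<^sup>2"
      using mom[OF ab(1) bT(2) ab(3)] by (simp_all add: w_def h_def)
    have Si: "integrable M S" "(\<integral>\<omega>. S \<omega> \<partial>M) \<le> (K + C1) * z * h"
    proof -
      have c: "integrable M (\<lambda>\<omega>. norm (Y u \<omega> - Y a \<omega>)) \<and> (\<integral>\<omega>. norm (Y u \<omega> - Y a \<omega>) \<partial>M) \<le> (K + C1) * z"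
        if u: "u \<in> {a..b}" for u
      proof -
        have u': "a \<le> u" "u \<le> \<delta>" "u \<le> T" "u - a \<le> h" using u ab bT by (auto simp: h_def)
        let ?w = "\<lambda>\<omega>. LINT r:{a..u}|lborel. \<kappa> r \<omega>"
        have wI: "integrable M (\<lambda>\<omega>. (norm (?w \<omega>))\<^sup>2)" "(\<integral>\<omega>. (norm (?w \<omega>))\<^sup>2 \<partial>M) \<le> C1\<^sup>2 * (u - a)\<^sup>2"
          using mom[OF ab(1) u'(1,2)] by auto
        have wmeas: "?w \<in> borel_measurable M"
          unfolding set_lebesgue_integral_def
          by (rule sigma_finite_measure.borel_measurable_lebesgue_integral[OF sigma_finite_lborel])
             (use \<kappa>_joint in \<open>simp add: split_beta\<close>)
        have w1: "integrable M (\<lambda>\<omega>. norm (?w \<omega>))"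
          using square_integrable_imp_integrable[of "\<lambda>\<omega>. norm (?w \<omega>)"] wI(1) wmeas by simp
        have "(\<integral>\<omega>. norm (?w \<omega>) \<partial>M)\<^sup>2 \<le> (\<integral>\<omega>. (norm (?w \<omega>))\<^sup>2 \<partial>M)"
          using variance_positive[of "\<lambda>\<omega>. norm (?w \<omega>)"] variance_eq[OF w1 wI(1)] by simp
        also have "\<dots> \<le> (C1 * (u - a))\<^sup>2" using wI(2) by (simp add: power_mult_distrib)
        finally have w2: "(\<integral>\<omega>. norm (?w \<omega>) \<partial>M) \<le> C1 * (u - a)" using C1 u' by (rule_tac power2_le_imp_le) auto
        note I1 = increment_norm_le[OF ab(1) u'(1,3)]
        have le: "norm (Y u \<omega> - Y a \<omega>) \<le> norm (I u \<omega> - I a \<omega>) + norm (?w \<omega>)" if "\<omega> \<in> space M" for \<omega>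
          unfolding Y_increment[OF that ab(1) u'(1,2)] by (rule norm_triangle_ineq)
        have i: "integrable M (\<lambda>\<omega>. norm (Y u \<omega> - Y a \<omega>))"
          by (rule Bochner_Integration.integrable_bound[OF Bochner_Integration.integrable_add[OF I1(1) w1]])
             (use le in \<open>auto intro!: AE_I2\<close>)
        have "(\<integral>\<omega>. norm (Y u \<omega> - Y a \<omega>) \<partial>M) \<le> (\<integral>\<omega>. norm (I u \<omega> - I a \<omega>) + norm (?w \<omega>) \<partial>M)"
          using i I1(1) w1 le by (intro integral_mono) auto
        also have "\<dots> \<le> K * sqrt (u - a) + C1 * (u - a)" using I1 w1 w2 by simp
        also have "\<dots> \<le> K * z + C1 * z"
        proof (intro add_mono mult_left_mono K_nonneg C1)
          show "sqrt (u - a) \<le> z" using u by (simp add: z_def)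
          have "z * z \<le> z * 1" using z by (intro mult_left_mono) auto
          then show "u - a \<le> z" using u'(4) unfolding z(3) power2_eq_square by linarith
        qed
        finally show ?thesis using i by (simp add: algebra_simps)
      qed
      have m: "(\<lambda>z. norm (Y (snd z) (fst z) - Y a (fst z))) \<in> borel_measurable (M \<Otimes>\<^sub>M lborel)" by measurable
      note mp = mean_path_integral[of "\<lambda>\<omega> u. norm (Y u \<omega> - Y a \<omega>)", OF m norm_ge_zero c]
      show "integrable M S" unfolding S_def by (rule mp(2))
      have "(\<integral>\<omega>. S \<omega> \<partial>M) = (LINT u:{a..b}|lborel. (\<integral>\<omega>. norm (Y u \<omega> - Y a \<omega>) \<partial>M))" unfolding S_def by (rule mp(4))
      also have "\<dots> \<le> (LINT u:{a..b}|lborel. (K + C1) * z)"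
        using c by (intro set_integral_mono mp(3) set_integrable_const_Icc) auto
      also have "\<dots> = (K + C1) * z * h" using ab by (simp add: set_lebesgue_integral_def h_def)
      finally show "(\<integral>\<omega>. S \<omega> \<partial>M) \<le> (K + C1) * z * h" .
    qed
    \<comment> \<open>R gathers the terms with mean of order h^(3/2), A below the main
      terms.\<close>
    define R where "R \<omega> = 2 * \<alpha> * K1 * c0 * S \<omega> + C0 * (h * z / 2 + norm (x \<omega>) ^ 6 / (2 * (h * z)) + norm (x \<omega>) ^ 6
       + z * (norm (x \<omega>))\<^sup>2 / 2 + (norm (w \<omega>))\<^sup>2 / (2 * z) + (norm (w \<omega>))\<^sup>2)" for \<omega>
    define A where "A \<omega> = g \<omega> - 2 * \<alpha> * (g \<omega> * (Y a \<omega> \<bullet> x \<omega>)) - \<alpha> * (g \<omega> * (norm (x \<omega>))\<^sup>2)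
       + 2 * \<alpha>\<^sup>2 * (g \<omega> * (Y a \<omega> \<bullet> x \<omega>)\<^sup>2) - 2 * \<alpha> * K1 * h * (g \<omega> * norm (Y a \<omega>) ^ 1 + g \<omega> * norm (Y a \<omega>) ^ 2)" for \<omega>
    have pw: "A \<omega> - R \<omega> \<le> exp (- (\<alpha> * (norm (Y b \<omega>))\<^sup>2))" if \<omega>: "\<omega> \<in> space M" for \<omega>
    proof -
      define r p q where "r = norm (Y a \<omega>)" and "p = norm (x \<omega>)" and "q = norm (w \<omega>)"
      have nn: "0 \<le> r" "0 \<le> p" "0 \<le> q" by (auto simp: r_def p_def q_def)
      have Yb: "Y b \<omega> = Y a \<omega> + x \<omega> + w \<omega>"
        using Y_increment[OF \<omega> ab(1) bT(2) ab(3)] by (simp add: x_def w_def algebra_simps)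
      have q_le: "q \<le> K1 * (h * (1 + r) + S \<omega>)"
      proof -
        have k1: "norm (\<kappa> u \<omega>) \<le> K1 * ((1 + r) + norm (Y u \<omega> - Y a \<omega>))" if u: "u \<in> {a..b}" for u
        proof -
          have "norm (\<kappa> u \<omega>) \<le> K1 * (1 + norm (Y u \<omega>))" using u ab by (intro \<kappa>_bound) auto
          also have "\<dots> \<le> K1 * ((1 + r) + norm (Y u \<omega> - Y a \<omega>))"
            using K1_pos norm_triangle_sub[of "Y u \<omega>" "Y a \<omega>"] by (intro mult_left_mono) (auto simp: r_def)
          finally show ?thesis .
        qed
        note pi = \<kappa>_path_integrable[OF \<omega> ab(1,3)]
        have "q \<le> (LINT u:{a..b}|lborel. K1 * ((1 + r) + norm (Y u \<omega> - Y a \<omega>)))"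
          unfolding q_def w_def
          by (intro norm_set_integral_le pi k1 set_integrable_mult_right set_integral_add(1) set_integrable_const_Icc) auto
        also have "\<dots> = K1 * ((LINT u:{a..b}|lborel. (1 + r)) + S \<omega>)"
          unfolding S_def using pi(3) by (simp only: set_integral_mult_right set_integral_add(2) set_integrable_const_Icc)
        also have "(LINT u:{a..b}|lborel. (1 + r)) = h * (1 + r)"
          using ab by (simp add: set_lebesgue_integral_def h_def)
        finally show ?thesis .
      qed
      have S0: "0 \<le> S \<omega>" unfolding S_def set_lebesgue_integral_def by (intro Bochner_Integration.integral_nonneg) auto
      have gr: "g \<omega> * r \<le> c0"
        using gaussian_moment_bound[OF \<alpha> nn(1), of 1] by (simp add: g_def r_def c0_def)
      have yw: "g \<omega> * (Y a \<omega> \<bullet> w \<omega>) \<le> K1 * h * (g \<omega> * r ^ 1 + g \<omega> * r ^ 2) + K1 * c0 * S \<omega>"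
      proof -
        have "Y a \<omega> \<bullet> w \<omega> \<le> r * q" unfolding r_def q_def by (rule norm_cauchy_schwarz)
        also have "\<dots> \<le> r * (K1 * (h * (1 + r) + S \<omega>))" using q_le nn by (intro mult_left_mono)
        finally have "g \<omega> * (Y a \<omega> \<bullet> w \<omega>) \<le> g \<omega> * (r * (K1 * (h * (1 + r) + S \<omega>)))" using g0 by (intro mult_left_mono)
        also have "\<dots> = K1 * h * (g \<omega> * r ^ 1 + g \<omega> * r ^ 2) + K1 * (g \<omega> * r) * S \<omega>"
          by (simp add: algebra_simps power2_eq_square)
        also have "\<dots> \<le> K1 * h * (g \<omega> * r ^ 1 + g \<omega> * r ^ 2) + K1 * c0 * S \<omega>"
          using gr K1_pos S0 by (intro add_left_mono mult_right_mono mult_left_mono) auto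
        finally show ?thesis .
      qed
      \<comment> \<open>The weights h z and z used below balance both halves: |x|^6 has mean of
        order h^3, while |x|^2 and |w|^2 have means of order h and h^2, so every summand comes out
        of order h z = h^(3/2).\<close>
      have amgm: "s * t \<le> s\<^sup>2 * e / 2 + t\<^sup>2 / (2 * e)" if e: "e > 0" for s t e :: real
      proof -
        have "0 \<le> (s * e - t)\<^sup>2 / (2 * e)" using e by simp
        also have "\<dots> = s\<^sup>2 * e / 2 + t\<^sup>2 / (2 * e) - s * t" using e by (simp add: power2_eq_square field_simps)
        finally show ?thesis by simp
      qed
      have hz: "0 < h * z" using z by simp
      have p3: "p ^ 3 \<le> h * z / 2 + p ^ 6 / (2 * (h * z))"
        using amgm[OF hz, of 1 "p ^ 3"] by (simp add: power_mult[symmetric])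
      have pq: "p * q \<le> z * p\<^sup>2 / 2 + q\<^sup>2 / (2 * z)"
        using amgm[OF z(1), of p q] by (simp add: mult.commute)
      have "C0 * (p ^ 3 + p ^ 6 + p * q + q\<^sup>2) \<le> C0 * (h * z / 2 + p ^ 6 / (2 * (h * z)) + p ^ 6 + z * p\<^sup>2 / 2 + q\<^sup>2 / (2 * z) + q\<^sup>2)"
        using p3 pq C0 by (intro mult_left_mono) auto
      moreover have "2 * \<alpha> * (g \<omega> * (Y a \<omega> \<bullet> w \<omega>)) \<le> 2 * \<alpha> * (K1 * h * (g \<omega> * r ^ 1 + g \<omega> * r ^ 2) + K1 * c0 * S \<omega>)"
        using yw \<alpha> by (intro mult_left_mono) auto
      moreover have "2 * \<alpha> * (K1 * h * (g \<omega> * r ^ 1 + g \<omega> * r ^ 2) + K1 * c0 * S \<omega>)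
          = 2 * \<alpha> * K1 * h * (g \<omega> * r ^ 1 + g \<omega> * r ^ 2) + 2 * \<alpha> * K1 * c0 * S \<omega>"
        by (simp add: algebra_simps)
      moreover have "g \<omega> * (1 - 2 * \<alpha> * (Y a \<omega> \<bullet> x \<omega>) - \<alpha> * (norm (x \<omega>))\<^sup>2 + 2 * \<alpha>\<^sup>2 * (Y a \<omega> \<bullet> x \<omega>)\<^sup>2)
          - 2 * \<alpha> * g \<omega> * (Y a \<omega> \<bullet> w \<omega>) - C0 * (p ^ 3 + p ^ 6 + p * q + q\<^sup>2) \<le> exp (- (\<alpha> * (norm (Y b \<omega>))\<^sup>2))"
        unfolding Yb g_def p_def q_def by (rule taylor)
      moreover have "g \<omega> * (1 - 2 * \<alpha> * (Y a \<omega> \<bullet> x \<omega>) - \<alpha> * (norm (x \<omega>))\<^sup>2 + 2 * \<alpha>\<^sup>2 * (Y a \<omega> \<bullet> x \<omega>)\<^sup>2)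
          = g \<omega> - 2 * \<alpha> * (g \<omega> * (Y a \<omega> \<bullet> x \<omega>)) - \<alpha> * (g \<omega> * (norm (x \<omega>))\<^sup>2) + 2 * \<alpha>\<^sup>2 * (g \<omega> * (Y a \<omega> \<bullet> x \<omega>)\<^sup>2)"
        by (simp add: algebra_simps)
      moreover have "2 * \<alpha> * g \<omega> * (Y a \<omega> \<bullet> w \<omega>) = 2 * \<alpha> * (g \<omega> * (Y a \<omega> \<bullet> w \<omega>))" by simp
      ultimately show ?thesis
        unfolding A_def R_def r_def[symmetric] p_def[symmetric] q_def[symmetric] by linarith
    qed
    have gi: "integrable M g" using wm(7)[of 0] by simp
    have Ri: "integrable M R" unfolding R_def using Si(1) x6(1) xi(1) wi(1) by (intro Bochner_Integration.integrable_add integrable_mult_right integrable_divide) auto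
    have Ai: "integrable M A" unfolding A_def
      by (intro Bochner_Integration.integrable_add Bochner_Integration.integrable_diff integrable_mult_right gi wm) auto
    have EA: "(\<integral>\<omega>. A \<omega> \<partial>M) = (\<integral>\<omega>. g \<omega> \<partial>M) - \<alpha> * (\<integral>\<omega>. g \<omega> * (norm (x \<omega>))\<^sup>2 \<partial>M)
       + 2 * \<alpha>\<^sup>2 * (\<integral>\<omega>. g \<omega> * (Y a \<omega> \<bullet> x \<omega>)\<^sup>2 \<partial>M) - 2 * \<alpha> * K1 * h * ((\<integral>\<omega>. g \<omega> * norm (Y a \<omega>) ^ 1 \<partial>M) + (\<integral>\<omega>. g \<omega> * norm (Y a \<omega>) ^ 2 \<partial>M))"
      unfolding A_def using gi wm(1-3,5) wm(7)[of 1] wm(7)[of 2] by simp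
    define e0 e1 e2 where "e0 = (\<integral>\<omega>. g \<omega> \<partial>M)" and "e1 = (\<integral>\<omega>. g \<omega> * norm (Y a \<omega>) ^ 1 \<partial>M)" and "e2 = (\<integral>\<omega>. g \<omega> * norm (Y a \<omega>) ^ 2 \<partial>M)"
    have e: "2 * \<alpha>\<^sup>2 * m\<^sup>2 * e2 - 2 * \<alpha> * K1 * (e1 + e2) \<ge> - (K1\<^sup>2 / m\<^sup>2) * e0"
    proof -
      \<comment> \<open>Half of the gain absorbs the quadratic drift term by the choice of \<alpha>;
        the other half absorbs the linear one by completing the square in \<alpha> m |Y| - K1 /
        m.\<close>
      have pt: "- (K1\<^sup>2 / m\<^sup>2) * g \<omega> \<le> 2 * \<alpha>\<^sup>2 * m\<^sup>2 * (g \<omega> * norm (Y a \<omega>) ^ 2) - 2 * \<alpha> * K1 * (g \<omega> * norm (Y a \<omega>) ^ 1 + g \<omega> * norm (Y a \<omega>) ^ 2)" for \<omega>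
      proof -
        define r where "r = norm (Y a \<omega>)"
        have "2 * \<alpha> * K1 * r\<^sup>2 \<le> \<alpha>\<^sup>2 * m\<^sup>2 * r\<^sup>2"
          using mult_right_mono[OF mult_left_mono[OF \<alpha>K less_imp_le[OF \<alpha>]], of "r\<^sup>2"] by (simp add: power2_eq_square algebra_simps)
        moreover have "0 \<le> (\<alpha> * m * r - K1 / m)\<^sup>2" by simp
        moreover have "(\<alpha> * m * r - K1 / m)\<^sup>2 = \<alpha>\<^sup>2 * m\<^sup>2 * r\<^sup>2 - 2 * \<alpha> * K1 * r + K1\<^sup>2 / m\<^sup>2"
          using m_pos by (simp add: power2_diff power_mult_distrib power_divide)
        ultimately have "- (K1\<^sup>2 / m\<^sup>2) \<le> 2 * \<alpha>\<^sup>2 * m\<^sup>2 * r\<^sup>2 - 2 * \<alpha> * K1 * r - 2 * \<alpha> * K1 * r\<^sup>2" by linarith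
        then have "g \<omega> * (- (K1\<^sup>2 / m\<^sup>2)) \<le> g \<omega> * (2 * \<alpha>\<^sup>2 * m\<^sup>2 * r\<^sup>2 - 2 * \<alpha> * K1 * r - 2 * \<alpha> * K1 * r\<^sup>2)"
          using g0 by (intro mult_left_mono)
        then show ?thesis unfolding r_def[symmetric] by (simp add: algebra_simps)
      qed
      have "(\<integral>\<omega>. - (K1\<^sup>2 / m\<^sup>2) * g \<omega> \<partial>M) \<le> (\<integral>\<omega>. 2 * \<alpha>\<^sup>2 * m\<^sup>2 * (g \<omega> * norm (Y a \<omega>) ^ 2) - 2 * \<alpha> * K1 * (g \<omega> * norm (Y a \<omega>) ^ 1 + g \<omega> * norm (Y a \<omega>) ^ 2) \<partial>M)"
        using wm(7)[of 1] wm(7)[of 2] gi by (intro integral_mono pt) auto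
      also have "\<dots> = 2 * \<alpha>\<^sup>2 * m\<^sup>2 * e2 - 2 * \<alpha> * K1 * (e1 + e2)"
        unfolding e1_def e2_def using wm(7)[of 1] wm(7)[of 2] by simp
      finally show ?thesis using gi by (simp add: e0_def)
    qed
    have "(1 - (\<alpha> * K\<^sup>2 + K1\<^sup>2 / m\<^sup>2) * h) * e0 \<le> (\<integral>\<omega>. A \<omega> \<partial>M)"
    proof -
      have "\<alpha> * (\<integral>\<omega>. g \<omega> * (norm (x \<omega>))\<^sup>2 \<partial>M) \<le> \<alpha> * (K\<^sup>2 * h * e0)"
        using wm(4) \<alpha> by (intro mult_left_mono) (auto simp: h_def e0_def)
      moreover have "2 * \<alpha>\<^sup>2 * (m\<^sup>2 * h * e2) \<le> 2 * \<alpha>\<^sup>2 * (\<integral>\<omega>. g \<omega> * (Y a \<omega> \<bullet> x \<omega>)\<^sup>2 \<partial>M)"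
        using wm(6) by (intro mult_left_mono) (auto simp: h_def e2_def)
      moreover have "h * (- (K1\<^sup>2 / m\<^sup>2) * e0) \<le> h * (2 * \<alpha>\<^sup>2 * m\<^sup>2 * e2 - 2 * \<alpha> * K1 * (e1 + e2))"
        using e z by (intro mult_left_mono) auto
      ultimately show ?thesis
        unfolding EA e0_def[symmetric] e1_def[symmetric] e2_def[symmetric] by (simp add: algebra_simps)
    qed
    moreover have "(\<integral>\<omega>. R \<omega> \<partial>M) \<le> C * (h * z)"
    proof -
      have "(\<integral>\<omega>. R \<omega> \<partial>M) = 2 * \<alpha> * K1 * c0 * (\<integral>\<omega>. S \<omega> \<partial>M) + C0 * (h * z / 2 + (\<integral>\<omega>. norm (x \<omega>) ^ 6 \<partial>M) / (2 * (h * z))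
        + (\<integral>\<omega>. norm (x \<omega>) ^ 6 \<partial>M) + z * (\<integral>\<omega>. (norm (x \<omega>))\<^sup>2 \<partial>M) / 2 + (\<integral>\<omega>. (norm (w \<omega>))\<^sup>2 \<partial>M) / (2 * z) + (\<integral>\<omega>. (norm (w \<omega>))\<^sup>2 \<partial>M))"
        unfolding R_def using Si(1) x6(1) xi(1) wi(1) by (simp add: prob_space)
      also have "\<dots> \<le> 2 * \<alpha> * K1 * c0 * ((K + C1) * z * h) + C0 * (h * z / 2 + (C6 * h ^ 3) / (2 * (h * z))
        + C6 * h ^ 3 + z * (K\<^sup>2 * h) / 2 + (C1\<^sup>2 * h\<^sup>2) / (2 * z) + C1\<^sup>2 * h\<^sup>2)"
        using Si(2) x6(2) xi(2) wi(2) \<alpha> K1_pos c0 C0 z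
        by (intro add_mono mult_left_mono divide_right_mono order_refl) auto
      also have "\<dots> \<le> 2 * \<alpha> * K1 * c0 * ((K + C1) * z * h) + C0 * (h * z / 2 + C6 / 2 * (h * z)
        + C6 * (h * z) + K\<^sup>2 / 2 * (h * z) + C1\<^sup>2 / 2 * (h * z) + C1\<^sup>2 * (h * z))"
      proof -
        have zz: "z ^ 3 \<le> 1" "z \<le> 1" using z by (auto intro: power_le_one)
        have h3: "h ^ 3 = (h * z) * z ^ 3" "h\<^sup>2 = (h * z) * z" unfolding z(3) by (simp_all add: eval_nat_numeral)
        have i1: "(C6 * h ^ 3) / (2 * (h * z)) \<le> C6 / 2 * (h * z)"
          unfolding z(3) using z by (simp add: field_simps eval_nat_numeral)
        have "(h * z) * z ^ 3 \<le> (h * z) * 1" using z zz by (intro mult_left_mono) auto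
        then have i2: "C6 * h ^ 3 \<le> C6 * (h * z)" unfolding h3 using C6 by (intro mult_left_mono) auto
        have i3: "z * (K\<^sup>2 * h) / 2 \<le> K\<^sup>2 / 2 * (h * z)" by simp
        have i4: "(C1\<^sup>2 * h\<^sup>2) / (2 * z) \<le> C1\<^sup>2 / 2 * (h * z)"
          unfolding z(3) using z by (simp add: field_simps eval_nat_numeral)
        have "(h * z) * z \<le> (h * z) * 1" using z by (intro mult_left_mono) auto
        then have i5: "C1\<^sup>2 * h\<^sup>2 \<le> C1\<^sup>2 * (h * z)" unfolding h3 by (intro mult_left_mono) auto
        show ?thesis
          by (intro add_left_mono mult_left_mono[OF _ C0])
             (rule add_mono[OF add_mono[OF add_mono[OF add_mono[OF add_mono[OF order_refl i1] i2] i3] i4] i5])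
      qed
      also have "\<dots> = C * (h * z)" by (simp add: C_def algebra_simps)
      finally show ?thesis .
    qed
    moreover have "(\<integral>\<omega>. A \<omega> - R \<omega> \<partial>M) \<le> barrier \<alpha> b"
      unfolding barrier_def
    proof (rule integral_mono)
      show "integrable M (\<lambda>\<omega>. exp (- (\<alpha> * (norm (Y b \<omega>))\<^sup>2)))"
        by (rule integrable_const_bound[where B = 1]) (use \<alpha> in auto)
    qed (use Ai Ri pw in auto)
    ultimately show ?thesis
      using Ai Ri by (simp add: barrier_def g_def[symmetric] e0_def h_def z_def)
  qed
  then show ?thesis using Cnn by blast
qed

text \<open>The one-step bound is iterated over n steps of length h = t / n. The accumulated error n
  C h^(3/2) is of order n^(-1/2), and (1 - lam t / n)^n tends to the exponential. The constant C,
  which may depend on the diffusion, disappears in the limit.\<close>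

lemma barrier_ge:
  assumes \<alpha>: "\<alpha> > 0" and \<alpha>K: "2 * K1 \<le> \<alpha> * m\<^sup>2" and t: "0 \<le> t" "t \<le> \<delta>"
  shows "exp (- ((\<alpha> * K\<^sup>2 + K1\<^sup>2 / m\<^sup>2) * t)) * barrier \<alpha> 0 \<le> barrier \<alpha> t"
proof (cases "t = 0")
  case False
  then have t0: "t > 0" using t by simp
  define lam where "lam = \<alpha> * K\<^sup>2 + K1\<^sup>2 / m\<^sup>2"
  have lam0: "0 \<le> lam" using \<alpha> by (simp add: lam_def)
  obtain C where C: "0 \<le> C" "\<And>a b. 0 \<le> a \<Longrightarrow> a < b \<Longrightarrow> b \<le> \<delta> \<Longrightarrow> b - a \<le> 1 \<Longrightarrow>
      (1 - lam * (b - a)) * barrier \<alpha> a - C * ((b - a) * sqrt (b - a)) \<le> barrier \<alpha> b"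
    using barrier_step[OF \<alpha> \<alpha>K] unfolding lam_def by blast
  have it: "(1 - lam * h) ^ k * barrier \<alpha> 0 - k * (C * (h * sqrt h)) \<le> barrier \<alpha> (k * h)"
    if h: "0 < h" "h \<le> 1" "lam * h \<le> 1" and k: "k * h \<le> t" for k :: nat and h :: real
    using k
  proof (induction k)
    case (Suc k)
    have kh: "k * h \<le> t" using Suc.prems h by (simp add: algebra_simps)
    have pos: "0 \<le> 1 - lam * h" "1 - lam * h \<le> 1" using h lam0 by auto
    have step: "(1 - lam * h) * barrier \<alpha> (k * h) - C * (h * sqrt h) \<le> barrier \<alpha> (Suc k * h)"
    proof -
      have "Suc k * h - k * h = h" by (simp add: algebra_simps)
      then show ?thesis
        using C(2)[of "k * h" "Suc k * h"] h Suc.prems t by simp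
    qed
    have "(1 - lam * h) ^ Suc k * barrier \<alpha> 0 - Suc k * (C * (h * sqrt h))
        \<le> (1 - lam * h) * ((1 - lam * h) ^ k * barrier \<alpha> 0 - k * (C * (h * sqrt h))) - C * (h * sqrt h)"
    proof -
      have "(1 - lam * h) * (k * (C * (h * sqrt h))) \<le> 1 * (k * (C * (h * sqrt h)))"
        using pos C(1) h by (intro mult_right_mono) auto
      then show ?thesis by (simp add: algebra_simps)
    qed
    also have "\<dots> \<le> (1 - lam * h) * barrier \<alpha> (k * h) - C * (h * sqrt h)"
      using Suc.IH[OF kh] pos by (intro diff_right_mono mult_left_mono) auto
    also note step
    finally show ?case .
  qed simp
  have lim: "(\<lambda>n. (1 + - (lam * t) / real n) ^ n * barrier \<alpha> 0 - C * t * sqrt (t * inverse (real n)))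
      \<longlonglongrightarrow> exp (- (lam * t)) * barrier \<alpha> 0 - C * t * sqrt (t * 0)"
    by (intro tendsto_intros tendsto_exp_limit_sequentially LIMSEQ_inverse_real_of_nat[THEN filterlim_sequentially_Suc[THEN iffD1, of "\<lambda>n. inverse (real n)"]]
        lim_inverse_n)
  have "\<forall>\<^sub>F n in sequentially. (1 + - (lam * t) / real n) ^ n * barrier \<alpha> 0 - C * t * sqrt (t * inverse (real n)) \<le> barrier \<alpha> t"
  proof -
    obtain N :: nat where N: "max t (lam * t) + 1 \<le> N" using real_arch_simple by blast
    show ?thesis unfolding eventually_sequentially
    proof (intro exI[of _ N] allI impI)
      fix n assume "N \<le> n"
      then have n: "t + 1 \<le> n" "lam * t + 1 \<le> n" using N by (auto simp: max_def split: if_splits)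
      then have n0: "0 < real n" using t0 by linarith
      define h where "h = t / n"
      have h: "0 < h" "h \<le> 1" "lam * h \<le> 1" "n * h = t"
        using n n0 t0 by (auto simp: h_def field_simps)
      have "(1 - lam * h) ^ n * barrier \<alpha> 0 - n * (C * (h * sqrt h)) \<le> barrier \<alpha> t"
        using it[OF h(1-3), of n] h(4) by simp
      moreover have "n * (C * (h * sqrt h)) = C * t * sqrt (t * inverse (real n))"
      proof -
        have "n * (C * (h * sqrt h)) = C * (n * h) * sqrt h" by (simp add: ac_simps)
        then show ?thesis unfolding h(4) by (simp add: h_def divide_inverse)
      qed
      moreover have "1 - lam * h = 1 + - (lam * t) / real n" by (simp add: h_def)
      ultimately show "(1 + - (lam * t) / real n) ^ n * barrier \<alpha> 0 - C * t * sqrt (t * inverse (real n)) \<le> barrier \<alpha> t"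
        by simp
    qed
  qed
  then have "exp (- (lam * t)) * barrier \<alpha> 0 - C * t * sqrt (t * 0) \<le> barrier \<alpha> t"
    by (rule tendsto_upperbound[OF lim]) simp
  then show ?thesis by (simp add: lam_def)
qed simp

text \<open>The barrier at time t is at most the probability of the tube plus exp (-\<alpha> r^2),
  and at least its decayed initial value, itself at least exp (-\<alpha> r^2 / 4) times the initial
  mass. By the smallness of \<delta> the noise costs at most another exp (-\<alpha> r^2 / 4), so exp
  (-\<alpha> r^2 / 2) factors out and the bound is positive once \<alpha> is large.\<close>

lemma tube_probability:
  assumes r: "0 < r" and small: "4 * K\<^sup>2 * \<delta> \<le> r\<^sup>2"
    and \<alpha>: "\<alpha> > 0" and \<alpha>K: "2 * K1 \<le> \<alpha> * m\<^sup>2" and t: "0 \<le> t" "t \<le> \<delta>"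
  shows "exp (- (\<alpha> * r\<^sup>2 / 2)) * (prob {\<omega> \<in> space M. norm (X 0 \<omega> - x0) \<le> r / 2} * exp (- (K1\<^sup>2 / m\<^sup>2 * \<delta>)) - exp (- (\<alpha> * r\<^sup>2 / 2)))
    \<le> prob {\<omega> \<in> space M. norm (X t \<omega> - \<gamma> t) < r}"
proof -
  let ?q = "prob {\<omega> \<in> space M. norm (X 0 \<omega> - x0) \<le> r / 2}"
  have \<gamma>0: "\<gamma> 0 = x0"
  proof -
    have "(LINT u:{0..0}|lborel. \<beta> u 0) = (\<integral>u. 0 \<partial>(lborel :: real measure))"
      unfolding set_lebesgue_integral_def
    proof (rule integral_cong_AE)
      show "AE u in lborel. indicat_real {0..0} u *\<^sub>R \<beta> u 0 = 0"
        by (rule AE_mp[OF AE_lborel_singleton[of "0::real"]]) (auto simp: indicator_def intro!: AE_I2)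
    qed measurable
    then show ?thesis by (simp add: \<gamma>_def)
  qed
  have int: "integrable M (\<lambda>\<omega>. exp (- (\<alpha> * (norm (Y t \<omega>))\<^sup>2)))" for t
    by (rule integrable_const_bound[where B = 1]) (use \<alpha> in auto)
  define S0 St where "S0 = {\<omega> \<in> space M. norm (X 0 \<omega> - x0) \<le> r / 2}" and "St = {\<omega> \<in> space M. norm (X t \<omega> - \<gamma> t) < r}"
  have s0: "S0 \<in> sets M" and st: "St \<in> sets M"
    unfolding S0_def St_def by measurable
  have is0: "integrable M (indicat_real S0)" "integrable M (indicat_real St)"
    using s0 st by (auto intro!: integrable_real_indicator simp: emeasure_eq_measure)
  have "exp (- (\<alpha> * (r / 2)\<^sup>2)) * ?q = (\<integral>\<omega>. exp (- (\<alpha> * (r / 2)\<^sup>2)) * indicat_real S0 \<omega> \<partial>M)"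
    using s0 by (simp add: S0_def)
  also have "\<dots> \<le> barrier \<alpha> 0"
    unfolding barrier_def
  proof (rule integral_mono[OF _ int])
    fix \<omega> assume "\<omega> \<in> space M"
    show "exp (- (\<alpha> * (r / 2)\<^sup>2)) * indicat_real S0 \<omega> \<le> exp (- (\<alpha> * (norm (Y 0 \<omega>))\<^sup>2))"
      using \<alpha> by (auto simp: indicator_def Y_def \<gamma>0 S0_def intro!: mult_left_mono power_mono)
  qed (use is0 in simp)
  finally have b0: "exp (- (\<alpha> * (r / 2)\<^sup>2)) * ?q \<le> barrier \<alpha> 0" .
  have "barrier \<alpha> t \<le> (\<integral>\<omega>. indicat_real St \<omega> + exp (- (\<alpha> * r\<^sup>2)) \<partial>M)"
    unfolding barrier_def
  proof (rule integral_mono[OF int])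
    fix \<omega> assume \<omega>: "\<omega> \<in> space M"
    show "exp (- (\<alpha> * (norm (Y t \<omega>))\<^sup>2)) \<le> indicat_real St \<omega> + exp (- (\<alpha> * r\<^sup>2))"
    proof (cases "norm (X t \<omega> - \<gamma> t) < r")
      case True
      have "exp (- (\<alpha> * (norm (Y t \<omega>))\<^sup>2)) \<le> 1" using \<alpha> by simp
      then show ?thesis using True \<omega> by (simp add: add_increasing2 St_def)
    next
      case False
      then have "r\<^sup>2 \<le> (norm (Y t \<omega>))\<^sup>2" using r by (intro power_mono) (auto simp: Y_def)
      then show ?thesis using False \<alpha> by (simp add: St_def)
    qed
  qed (use is0 in simp)
  also have "\<dots> = prob St + exp (- (\<alpha> * r\<^sup>2))"
    using st is0 by (simp add: prob_space)
  finally have bt: "barrier \<alpha> t \<le> prob St + exp (- (\<alpha> * r\<^sup>2))" .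
  have "(\<alpha> * K\<^sup>2 + K1\<^sup>2 / m\<^sup>2) * t + \<alpha> * (r / 2)\<^sup>2 \<le> \<alpha> * r\<^sup>2 / 2 + K1\<^sup>2 / m\<^sup>2 * \<delta>"
  proof -
    have "(\<alpha> * K\<^sup>2 + K1\<^sup>2 / m\<^sup>2) * t \<le> (\<alpha> * K\<^sup>2 + K1\<^sup>2 / m\<^sup>2) * \<delta>"
      using t \<alpha> by (intro mult_left_mono) auto
    moreover have "\<alpha> * (4 * K\<^sup>2 * \<delta>) \<le> \<alpha> * r\<^sup>2" using small \<alpha> by (intro mult_left_mono) auto
    moreover have "\<alpha> * (4 * K\<^sup>2 * \<delta>) = 4 * (\<alpha> * K\<^sup>2 * \<delta>)" "(\<alpha> * K\<^sup>2 + K1\<^sup>2 / m\<^sup>2) * \<delta> = \<alpha> * K\<^sup>2 * \<delta> + K1\<^sup>2 / m\<^sup>2 * \<delta>"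
      "\<alpha> * (r / 2)\<^sup>2 = \<alpha> * r\<^sup>2 / 4" by (simp_all add: power_divide algebra_simps)
    ultimately show ?thesis by linarith
  qed
  then have "exp (- (\<alpha> * r\<^sup>2 / 2 + K1\<^sup>2 / m\<^sup>2 * \<delta>)) \<le> exp (- ((\<alpha> * K\<^sup>2 + K1\<^sup>2 / m\<^sup>2) * t + \<alpha> * (r / 2)\<^sup>2))" by (simp only: exp_le_cancel_iff neg_le_iff_le)
  then have "exp (- (\<alpha> * r\<^sup>2 / 2)) * exp (- (K1\<^sup>2 / m\<^sup>2 * \<delta>)) \<le> exp (- ((\<alpha> * K\<^sup>2 + K1\<^sup>2 / m\<^sup>2) * t)) * exp (- (\<alpha> * (r / 2)\<^sup>2))"
    by (simp only: mult_exp_exp minus_add_distrib)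
  then have "exp (- (\<alpha> * r\<^sup>2 / 2)) * exp (- (K1\<^sup>2 / m\<^sup>2 * \<delta>)) * ?q \<le> exp (- ((\<alpha> * K\<^sup>2 + K1\<^sup>2 / m\<^sup>2) * t)) * exp (- (\<alpha> * (r / 2)\<^sup>2)) * ?q"
    by (intro mult_right_mono) auto
  also have "\<dots> = exp (- ((\<alpha> * K\<^sup>2 + K1\<^sup>2 / m\<^sup>2) * t)) * (exp (- (\<alpha> * (r / 2)\<^sup>2)) * ?q)" by simp
  also have "\<dots> \<le> exp (- ((\<alpha> * K\<^sup>2 + K1\<^sup>2 / m\<^sup>2) * t)) * barrier \<alpha> 0"
    using b0 by (intro mult_left_mono) auto
  also have "\<dots> \<le> barrier \<alpha> t" by (rule barrier_ge[OF \<alpha> \<alpha>K t])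
  finally have "exp (- (\<alpha> * r\<^sup>2 / 2)) * exp (- (K1\<^sup>2 / m\<^sup>2 * \<delta>)) * ?q \<le> barrier \<alpha> t" .
  moreover have "exp (- (\<alpha> * r\<^sup>2)) = exp (- (\<alpha> * r\<^sup>2 / 2)) * exp (- (\<alpha> * r\<^sup>2 / 2))" by (simp add: mult_exp_exp)
  ultimately show ?thesis using bt by (simp add: algebra_simps St_def)
qed

end

section \<open>The Wasserstein distance of laws on a common probability space\<close>

text \<open>Two random vectors on one space form a coupling of their laws. Every upper bound on a
  Wasserstein distance that is proved below goes through this coupling.\<close>

lemma (in prob_space) W1_distr_le:
  fixes X Y :: "'a \<Rightarrow> real^'d"
  assumes [measurable]: "X \<in> borel_measurable M" "Y \<in> borel_measurable M"
    and int: "integrable M (\<lambda>\<omega>. norm (X \<omega> - Y \<omega>))" and c: "(\<integral>\<omega>. norm (X \<omega> - Y \<omega>) \<partial>M) \<le> c"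
  shows "W1 (distr M borel X) (distr M borel Y) \<le> c"
proof -
  let ?\<gamma> = "distr M borel (\<lambda>\<omega>. (X \<omega>, Y \<omega>))"
  have m [measurable]: "(\<lambda>\<omega>. (X \<omega>, Y \<omega>)) \<in> borel_measurable M" by (intro borel_measurable_Pair assms)
  have [measurable]: "(fst :: (real^'d) \<times> (real^'d) \<Rightarrow> _) \<in> borel_measurable borel" "(snd :: (real^'d) \<times> (real^'d) \<Rightarrow> _) \<in> borel_measurable borel"
    by (auto intro!: borel_measurable_continuous_onI continuous_intros)
  have cpl: "?\<gamma> \<in> couplings (distr M borel X) (distr M borel Y)"
    unfolding couplings_def by (simp add: space_prob_algebra prob_space_distr distr_distr o_def)
  have "(\<integral>\<^sup>+ z. ennreal (dist (fst z) (snd z)) \<partial>?\<gamma>) = (\<integral>\<^sup>+\<omega>. ennreal (norm (X \<omega> - Y \<omega>)) \<partial>M)"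
    by (subst nn_integral_distr) (auto simp: dist_norm)
  also have "\<dots> = ennreal (\<integral>\<omega>. norm (X \<omega> - Y \<omega>) \<partial>M)"
    by (rule nn_integral_eq_integral[OF int]) simp
  finally have "(INF \<gamma>\<in>couplings (distr M borel X) (distr M borel Y). \<integral>\<^sup>+ z. ennreal (dist (fst z) (snd z)) \<partial>\<gamma>)
      \<le> ennreal (\<integral>\<omega>. norm (X \<omega> - Y \<omega>) \<partial>M)"
    by (intro INF_lower2[OF cpl]) simp
  then have "W1 (distr M borel X) (distr M borel Y) \<le> enn2real (ennreal (\<integral>\<omega>. norm (X \<omega> - Y \<omega>) \<partial>M))"
    unfolding W1_def by (intro enn2real_mono) auto
  then show ?thesis using c by simp
qed

lemma W1_self_le: "\<nu> \<in> P_mom 1 \<Longrightarrow> W1 \<nu> \<nu> \<le> 0"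
proof -
  assume "\<nu> \<in> P_mom 1"
  then have "prob_space \<nu>" and \<nu>: "sets \<nu> = sets borel" by (auto simp: P_mom_def space_prob_algebra)
  then interpret \<nu>: prob_space \<nu> by simp
  have "W1 (distr \<nu> borel (\<lambda>x. x)) (distr \<nu> borel (\<lambda>x. x)) \<le> 0"
    by (rule \<nu>.W1_distr_le) (simp_all add: measurable_cong_sets[OF \<nu> refl])
  moreover have "distr \<nu> borel (\<lambda>x. x) = \<nu>" using \<nu> by (metis distr_id2)
  ultimately show ?thesis by simp
qed

lemma return_0_P_mom: "0 < r \<Longrightarrow> return borel 0 \<in> P_mom r"
  by (simp add: P_mom_def space_prob_algebra prob_space_return nn_integral_return)

lemma moment_return_0: "0 < r \<Longrightarrow> moment r (return borel 0) = 0"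
  by (simp add: moment_def integral_return)

section \<open>Joint measurability of continuous processes\<close>

text \<open>Approximation from the left by times on a grid of mesh 1 / (n + 1); the grid is
  countable, so each approximant is a countable patchwork of measurable functions.\<close>

lemma joint_measurable_of_continuous_paths:
  fixes X :: "real \<Rightarrow> 'w \<Rightarrow> 'b :: {metric_space, second_countable_topology}"
  assumes X: "\<And>t. X t \<in> borel_measurable M"
    and cont: "\<And>\<omega>. \<omega> \<in> space M \<Longrightarrow> continuous_on UNIV (\<lambda>t. X t \<omega>)"
  shows "(\<lambda>z. X (snd z) (fst z)) \<in> borel_measurable (M \<Otimes>\<^sub>M lborel)"
proof -
  let ?g = "\<lambda>n (z :: 'w \<times> real). \<lfloor>real (Suc n) * snd z\<rfloor>"
  show ?thesis
  proof (rule borel_measurable_LIMSEQ_metric[where f = "\<lambda>n z. X (real_of_int (?g n z) / real (Suc n)) (fst z)"])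
  show "(\<lambda>z. X (real_of_int (?g n z) / real (Suc n)) (fst z)) \<in> borel_measurable (M \<Otimes>\<^sub>M lborel)" for n
  proof (rule measurable_compose_countable[where f = "\<lambda>i z. X (real_of_int i / real (Suc n)) (fst z)" and g = "?g n"])
    show "?g n \<in> M \<Otimes>\<^sub>M lborel \<rightarrow>\<^sub>M count_space UNIV"
      using measurable_snd[of M "lborel :: real measure"] by measurable
    show "(\<lambda>z. X (real_of_int i / real (Suc n)) (fst z)) \<in> borel_measurable (M \<Otimes>\<^sub>M lborel)" for i :: int
      using measurable_compose[OF measurable_fst X] .
  qed
  fix z assume "z \<in> space (M \<Otimes>\<^sub>M (lborel :: real measure))"
  then have \<omega>: "fst z \<in> space M" by (auto simp: space_pair_measure)
  have "(\<lambda>n. real_of_int (?g n z) / real (Suc n)) \<longlonglongrightarrow> snd z"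
  proof (rule tendsto_sandwich)
    show "\<forall>\<^sub>F n in sequentially. snd z - inverse (real (Suc n)) \<le> real_of_int (?g n z) / real (Suc n)"
    proof (intro always_eventually allI)
      fix n
      have "(real (Suc n) * snd z - 1) / real (Suc n) \<le> real_of_int (?g n z) / real (Suc n)"
        by (intro divide_right_mono) linarith+
      moreover have "(real (Suc n) * snd z - 1) / real (Suc n) = snd z - inverse (real (Suc n))"
        by (simp only: diff_divide_distrib) (simp add: inverse_eq_divide)
      ultimately show "snd z - inverse (real (Suc n)) \<le> real_of_int (?g n z) / real (Suc n)" by simp
    qed
    show "\<forall>\<^sub>F n in sequentially. real_of_int (?g n z) / real (Suc n) \<le> snd z"
    proof (intro always_eventually allI)
      fix n
      have "real_of_int (?g n z) / real (Suc n) \<le> (real (Suc n) * snd z) / real (Suc n)"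
        by (intro divide_right_mono) linarith+
      then show "real_of_int (?g n z) / real (Suc n) \<le> snd z" by simp
    qed
    have "(\<lambda>n. snd z - inverse (real (Suc n))) \<longlonglongrightarrow> snd z - 0"
      by (intro tendsto_intros LIMSEQ_inverse_real_of_nat)
    then show "(\<lambda>n. snd z - inverse (real (Suc n))) \<longlonglongrightarrow> snd z" by simp
  qed simp
  moreover have "isCont (\<lambda>t. X t (fst z)) (snd z)"
    using cont[OF \<omega>] by (simp add: continuous_on_eq_continuous_at)
  ultimately show "(\<lambda>n. X (real_of_int (?g n z) / real (Suc n)) (fst z)) \<longlonglongrightarrow> X (snd z) (fst z)"
    by (rule isCont_tendsto_compose[rotated])
  qed
qed

section \<open>The law of a McKean--Vlasov diffusion as a diffusion with Lipschitz drift\<close>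

text \<open>The data are controlled only on [0,T], while time integrals run over
  \<open>lborel\<close>. Clamping extends functions of time to the whole line and keeps
  measurability and continuity.\<close>

definition time_clamp :: "real \<Rightarrow> real \<Rightarrow> real" where "time_clamp T u = max 0 (min T u)"

lemma time_clamp_in: "0 \<le> T \<Longrightarrow> time_clamp T u \<in> {0..T}"
  and time_clamp_id: "u \<in> {0..T} \<Longrightarrow> time_clamp T u = u"
  by (auto simp: time_clamp_def)

lemma time_clamp_measurable [measurable]: "time_clamp T \<in> borel_measurable borel"
  unfolding time_clamp_def[abs_def] by measurable

lemma time_clamp_restrict: "0 \<le> T \<Longrightarrow> time_clamp T \<in> lborel \<rightarrow>\<^sub>M restrict_space borel {0..T}"
  by (rule measurable_restrict_space2) (use time_clamp_in[of T] in blast, simp)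

locale path_law = prob_space M for M :: "(real \<Rightarrow> real^'d) measure" and T :: real +
  assumes T_nonneg: "0 \<le> T" and sets_M: "sets M = sets (path_space T)"
    and marginal_P1: "\<And>t. t \<in> {0..T} \<Longrightarrow> marginal M t \<in> P_mom 1"
begin

definition path :: "real \<Rightarrow> (real \<Rightarrow> real^'d) \<Rightarrow> real^'d" where "path u \<omega> = \<omega> (time_clamp T u)"

lemma path_eq: "u \<in> {0..T} \<Longrightarrow> path u = (\<lambda>\<omega>. \<omega> u)"
  by (simp add: path_def time_clamp_id fun_eq_iff)

lemma path_measurable [measurable]: "path u \<in> borel_measurable M"
proof -
  have "(\<lambda>\<omega>. \<omega> (time_clamp T u)) \<in> borel_measurable (path_space T)"
    unfolding path_space_def
    by (intro measurable_restrict_space1 measurable_component_singleton time_clamp_in T_nonneg)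
  then show ?thesis unfolding path_def[abs_def] by (simp add: measurable_cong_sets[OF sets_M refl])
qed

lemma path_cont: "\<omega> \<in> space M \<Longrightarrow> continuous_on {0..T} \<omega>"
  using sets_eq_imp_space_eq[OF sets_M] by (auto simp: path_space_def space_restrict_space)

lemma path_cont_UNIV: "\<omega> \<in> space M \<Longrightarrow> continuous_on UNIV (\<lambda>u. path u \<omega>)"
  unfolding path_def
  by (rule continuous_on_compose2[OF path_cont])
     (auto intro!: continuous_intros simp: time_clamp_in T_nonneg time_clamp_def[abs_def])

lemma path_joint [measurable]: "(\<lambda>z. path (snd z) (fst z)) \<in> borel_measurable (M \<Otimes>\<^sub>M lborel)"
  by (intro joint_measurable_of_continuous_paths path_cont_UNIV) auto

lemma marginal_eq: "t \<in> {0..T} \<Longrightarrow> marginal M t = distr M borel (path t)"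
  by (simp add: marginal_def path_eq)

text \<open>The drift takes the law as a measurable argument, so the flow of marginals must itself
  be a measurable map into the space of measures.\<close>

lemma marginal_measurable:
  "(\<lambda>u. marginal M (time_clamp T u)) \<in> lborel \<rightarrow>\<^sub>M restrict_space (prob_algebra borel) (P_mom 1)"
proof (rule measurable_restrict_space2)
  show "(\<lambda>u. marginal M (time_clamp T u)) \<in> space lborel \<rightarrow> P_mom 1"
    using marginal_P1 time_clamp_in[OF T_nonneg] by auto
  have "(\<lambda>u. distr M borel (path u)) \<in> lborel \<rightarrow>\<^sub>M prob_algebra borel"
  proof (rule measurable_distr_prob_space2)
    show "(\<lambda>_. M) \<in> lborel \<rightarrow>\<^sub>M prob_algebra M"
      by (intro measurable_const) (simp add: space_prob_algebra prob_space_axioms)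
    have "(\<lambda>p. (snd p, fst p)) \<in> (lborel :: real measure) \<Otimes>\<^sub>M M \<rightarrow>\<^sub>M M \<Otimes>\<^sub>M lborel" by measurable
    from measurable_compose[OF this path_joint] show "(\<lambda>(u, \<omega>). path u \<omega>) \<in> borel_measurable (lborel \<Otimes>\<^sub>M M)"
      by (simp add: split_beta)
  qed
  moreover have "marginal M (time_clamp T u) = distr M borel (path u)" for u
    by (simp add: marginal_def path_def[abs_def])
  ultimately show "(\<lambda>u. marginal M (time_clamp T u)) \<in> lborel \<rightarrow>\<^sub>M prob_algebra borel" by simp
qed

end

lemma drift_along_marginals_measurable:
  fixes f :: "real^'p \<Rightarrow> real \<Rightarrow> real^'d \<Rightarrow> (real^'d) measure \<Rightarrow> 'v :: {second_countable_topology, real_normed_vector}"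
  assumes law: "path_law M T"
    and f: "(\<lambda>(\<theta>, t, x, \<nu>). f \<theta> t x \<nu>) \<in> borel_measurable
        (restrict_space borel \<Theta> \<Otimes>\<^sub>M restrict_space borel {0..T} \<Otimes>\<^sub>M borel \<Otimes>\<^sub>M
         restrict_space (prob_algebra borel) (P_mom 1))"
    and h: "h \<in> N \<rightarrow>\<^sub>M restrict_space borel \<Theta>" and t: "t \<in> N \<rightarrow>\<^sub>M lborel" and x: "x \<in> borel_measurable N"
  shows "(\<lambda>z. f (h z) (time_clamp T (t z)) (x z) (marginal M (time_clamp T (t z)))) \<in> borel_measurable N"
proof -
  interpret path_law M T by (rule law)
  have "(\<lambda>z. (h z, time_clamp T (t z), x z, marginal M (time_clamp T (t z)))) \<in> N \<rightarrow>\<^sub>M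
      restrict_space borel \<Theta> \<Otimes>\<^sub>M restrict_space borel {0..T} \<Otimes>\<^sub>M borel \<Otimes>\<^sub>M restrict_space (prob_algebra borel) (P_mom 1)"
    by (intro measurable_Pair h x measurable_compose[OF t time_clamp_restrict] measurable_compose[OF t marginal_measurable] T_nonneg)
  from measurable_compose[OF this f] show ?thesis by simp
qed

text \<open>Fixing the flow of marginals turns the McKean-Vlasov equation into a classical diffusion
  with time-dependent drift. Both coefficients are set to 0 outside [0,T], so that measurability,
  and the bound on \<Phi>, hold for all times.\<close>

lemma mckean_vlasov_diffusion:
  fixes \<mu>\<^sub>0 :: "(real^'d) measure" and \<sigma> :: "real \<Rightarrow> real^'d \<Rightarrow> real^'d^'d"
    and b :: "real^'p \<Rightarrow> real \<Rightarrow> real^'d \<Rightarrow> (real^'d) measure \<Rightarrow> real^'d" and m p L T :: real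
  assumes T: "0 < T" and \<theta>: "\<theta> \<in> \<Theta>"
    and \<mu>0: "\<mu>\<^sub>0 \<in> P_mom 2"
    and \<sigma>: "(\<lambda>(t, x). \<sigma> t x) \<in> borel_measurable (restrict_space borel {0..T} \<Otimes>\<^sub>M borel)"
    and m: "0 < m" and ell: "\<And>t x y. t \<in> {0..T} \<Longrightarrow> m\<^sup>2 * (norm y)\<^sup>2 \<le> (cmat \<sigma> t x *v y) \<bullet> y"
    and ell': "\<And>t x y. t \<in> {0..T} \<Longrightarrow> (cmat \<sigma> t x *v y) \<bullet> y \<le> p\<^sup>2 * (norm y)\<^sup>2"
    and b: "(\<lambda>(\<theta>, t, x, \<nu>). b \<theta> t x \<nu>) \<in> borel_measurable
        (restrict_space borel \<Theta> \<Otimes>\<^sub>M restrict_space borel {0..T} \<Otimes>\<^sub>M borel \<Otimes>\<^sub>M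
         restrict_space (prob_algebra borel) (P_mom 1))"
    and L: "0 < L" and lip: "\<And>t x x' \<nu>. t \<in> {0..T} \<Longrightarrow> \<nu> \<in> P_mom 1 \<Longrightarrow> norm (b \<theta> t x' \<nu> - b \<theta> t x \<nu>) \<le> L * norm (x' - x)"
    and law: "mckean_vlasov_law T \<mu>\<^sub>0 \<sigma> (b \<theta>) M"
  shows "path_law M T"
    and "\<exists>F B \<Phi> I. diffusion M F T B \<Phi> I (sqrt (CARD('d) * p\<^sup>2)) (path_law.path T)
        (\<lambda>u x. if u \<in> {0..T} then b \<theta> u x (marginal M u) else 0) L m"
proof -
  from law have pM: "prob_space M" and sM: "sets M = sets (path_space T)" and m0: "marginal M 0 = \<mu>\<^sub>0"
    and P1: "\<And>t. t \<in> {0..T} \<Longrightarrow> marginal M t \<in> P_mom 1"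
    unfolding mckean_vlasov_law_def by auto
  from law obtain F B where FB: "filtration (space M) F" "\<And>t. subalgebra M (F t)" "brownian_motion M F T B"
    and ad: "\<And>t. t \<in> {0..T} \<Longrightarrow> (\<lambda>\<omega>. \<omega> t) \<in> borel_measurable (F t)"
    and pint: "AE \<omega> in M. set_integrable lborel {0..T} (\<lambda>u. b \<theta> u (\<omega> u) (marginal M u))"
    and ito: "\<And>t. t \<in> {0..T} \<Longrightarrow> has_ito_integral M F B (\<lambda>u \<omega>. \<sigma> u (\<omega> u)) t
           (\<lambda>\<omega>. \<omega> t - \<omega> 0 - (LINT u:{0..t}|lborel. b \<theta> u (\<omega> u) (marginal M u)))"
    unfolding mckean_vlasov_law_def by blast
  show pl: "path_law M T"
    using pM sM P1 T by (simp add: path_law_def path_law_axioms_def)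
  interpret path_law M T by (rule pl)
  define \<beta> where "\<beta> u x = (if u \<in> {0..T} then b \<theta> u x (marginal M u) else 0)" for u x
  define \<Phi> where "\<Phi> u \<omega> = (if u \<in> {0..T} then \<sigma> u (\<omega> u) else 0)" for u and \<omega> :: "real \<Rightarrow> real^'d"
  define I where "I t \<omega> = \<omega> t - \<omega> 0 - (LINT u:{0..t}|lborel. b \<theta> u (\<omega> u) (marginal M u))" for t and \<omega> :: "real \<Rightarrow> real^'d"
  have \<sigma>_bound: "norm (\<sigma> u x) \<le> sqrt (CARD('d) * p\<^sup>2)" if "u \<in> {0..T}" for u x
    using elliptic_norm_le[of "\<sigma> u x" p] ell'[OF that] by (intro real_le_rsqrt) (simp add: cmat_def)
  have "diffusion M F T B \<Phi> I (sqrt (CARD('d) * p\<^sup>2)) path \<beta> L m"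
  proof (unfold_locales)
    show "space (F i) = space M" for i by (rule filtration.space_F[OF FB(1)])
    show "sets (F i) \<subseteq> sets (F j)" if "i \<le> j" for i j by (rule filtration.sets_F_mono[OF FB(1) that])
    show "\<And>t. subalgebra M (F t)" "brownian_motion M F T B" by (fact FB)+
    show "(\<lambda>z. \<Phi> (snd z) (fst z)) \<in> borel_measurable (M \<Otimes>\<^sub>M lborel)"
    proof -
      have "(\<lambda>z. (time_clamp T (snd z), path (snd z) (fst z))) \<in> M \<Otimes>\<^sub>M lborel \<rightarrow>\<^sub>M restrict_space borel {0..T} \<Otimes>\<^sub>M borel"
        by (intro measurable_Pair path_joint measurable_compose[OF measurable_snd time_clamp_restrict] T_nonneg)
      from measurable_compose[OF this \<sigma>]
      have "(\<lambda>z. \<sigma> (time_clamp T (snd z)) (path (snd z) (fst z))) \<in> borel_measurable (M \<Otimes>\<^sub>M lborel)" by simp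
      moreover have "{z \<in> space (M \<Otimes>\<^sub>M lborel). snd z \<in> {0..T}} \<in> sets (M \<Otimes>\<^sub>M (lborel :: real measure))"
        by (rule measurable_sets_Collect[OF measurable_snd]) simp_all
      ultimately have "(\<lambda>z. if snd z \<in> {0..T} then \<sigma> (time_clamp T (snd z)) (path (snd z) (fst z)) else 0) \<in> borel_measurable (M \<Otimes>\<^sub>M lborel)"
        by (intro measurable_If) auto
      moreover have "(if snd z \<in> {0..T} then \<sigma> (time_clamp T (snd z)) (path (snd z) (fst z)) else 0) = \<Phi> (snd z) (fst z)" for z
        by (auto simp: \<Phi>_def time_clamp_id path_eq)
      ultimately show ?thesis by simp
    qed
    show "norm (\<Phi> u \<omega>) \<le> sqrt (CARD('d) * p\<^sup>2)" for u \<omega>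
      using \<sigma>_bound by (auto simp: \<Phi>_def)
    show "has_ito_integral M F B \<Phi> t (I t)" if t: "t \<in> {0..T}" for t
    proof -
      have "(\<integral>\<^sup>+ u\<in>{0..t}. ennreal ((norm (\<Phi> u \<omega> - G u))\<^sup>2) \<partial>lborel)
         = (\<integral>\<^sup>+ u\<in>{0..t}. ennreal ((norm (\<sigma> u (\<omega> u) - G u))\<^sup>2) \<partial>lborel)" for \<omega> G
        using t by (intro nn_integral_cong) (auto simp: \<Phi>_def indicator_def)
      then show ?thesis using ito[OF t] unfolding has_ito_integral_def I_def[abs_def] by simp
    qed
    show "0 < T" "0 < L" "0 < m" by (fact T L m)+
    show "path t \<in> borel_measurable (F t)" if "t \<in> {0..T}" for t using ad[OF that] path_eq[OF that] by simp
    show "(\<lambda>z. path (snd z) (fst z)) \<in> borel_measurable (M \<Otimes>\<^sub>M lborel)" by (fact path_joint)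
    show "continuous_on {0..T} (\<lambda>u. path u \<omega>)" if "\<omega> \<in> space M" for \<omega>
      using path_cont_UNIV[OF that] by (rule continuous_on_subset) simp
    show "(\<lambda>z. \<beta> (fst z) (snd z)) \<in> borel_measurable (lborel \<Otimes>\<^sub>M borel)"
    proof -
      have "(\<lambda>z. b \<theta> (time_clamp T (fst z)) (snd z) (marginal M (time_clamp T (fst z)))) \<in> borel_measurable ((lborel :: real measure) \<Otimes>\<^sub>M borel)"
        by (rule drift_along_marginals_measurable[OF pl b, where h = "\<lambda>_. \<theta>" and t = fst and x = snd])
           (use \<theta> in \<open>auto simp: space_restrict_space\<close>)
      moreover have "{z \<in> space ((lborel :: real measure) \<Otimes>\<^sub>M (borel :: (real^'d) measure)). fst z \<in> {0..T}} \<in> sets (lborel \<Otimes>\<^sub>M borel)"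
        by (rule measurable_sets_Collect[OF measurable_fst]) simp_all
      ultimately have "(\<lambda>z. if fst z \<in> {0..T} then b \<theta> (time_clamp T (fst z)) (snd z) (marginal M (time_clamp T (fst z))) else 0)
          \<in> borel_measurable ((lborel :: real measure) \<Otimes>\<^sub>M borel)"
        by (intro measurable_If) auto
      moreover have "(if fst z \<in> {0..T} then b \<theta> (time_clamp T (fst z)) (snd z) (marginal M (time_clamp T (fst z))) else 0) = \<beta> (fst z) (snd z)" for z
        by (auto simp: \<beta>_def time_clamp_id)
      ultimately show ?thesis by simp
    qed
    show "norm (\<beta> u x - \<beta> u y) \<le> L * norm (x - y)" if "u \<in> {0..T}" for u x y
      using lip[OF that P1[OF that]] that by (simp add: \<beta>_def)
    have \<beta>_path: "\<beta> u (path u \<omega>) = b \<theta> u (\<omega> u) (marginal M u)" if "u \<in> {0..T}" for u \<omega>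
      using that by (simp add: \<beta>_def path_eq)
    have "set_integrable lborel {0..T} (\<lambda>u. \<beta> u (path u \<omega>)) \<longleftrightarrow> set_integrable lborel {0..T} (\<lambda>u. b \<theta> u (\<omega> u) (marginal M u))" for \<omega>
      by (intro set_integrable_cong) (auto simp: \<beta>_path)
    then show "AE \<omega> in M. set_integrable lborel {0..T} (\<lambda>u. \<beta> u (path u \<omega>))" using pint by simp
    show "I t \<omega> = path t \<omega> - path 0 \<omega> - (LINT u:{0..t}|lborel. \<beta> u (path u \<omega>))" if t: "t \<in> {0..T}" for t \<omega>
    proof -
      have "(LINT u:{0..t}|lborel. \<beta> u (path u \<omega>)) = (LINT u:{0..t}|lborel. b \<theta> u (\<omega> u) (marginal M u))"
        using t by (intro set_lebesgue_integral_cong) (auto simp: \<beta>_path)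
      moreover have "path 0 \<omega> = \<omega> 0" using T by (simp add: path_eq)
      ultimately show ?thesis using t by (simp add: I_def path_eq)
    qed
    show "m\<^sup>2 * (norm y)\<^sup>2 \<le> (norm (transpose (\<Phi> u \<omega>) *v y))\<^sup>2" if "u \<in> {0..T}" for u \<omega> y
      using ell[OF that, of y "\<omega> u"] that unfolding norm_transpose_mult_power2 by (simp add: \<Phi>_def cmat_def)
    show "integrable M (\<lambda>\<omega>. (norm (path 0 \<omega>))\<^sup>2)"
    proof (rule integrableI_bounded)
      have "(\<integral>\<^sup>+\<omega>. ennreal (norm ((norm (path 0 \<omega>))\<^sup>2)) \<partial>M) = (\<integral>\<^sup>+y. ennreal (norm y powr 2) \<partial>distr M borel (path 0))"
        by (subst nn_integral_distr) auto
      also have "distr M borel (path 0) = \<mu>\<^sub>0" using marginal_eq[of 0] m0 T by simp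
      finally show "(\<integral>\<^sup>+\<omega>. ennreal (norm ((norm (path 0 \<omega>))\<^sup>2)) \<partial>M) < \<infinity>" using \<mu>0 by (simp add: P_mom_def)
    qed simp
  qed
  then show "\<exists>F B \<Phi> I. diffusion M F T B \<Phi> I (sqrt (CARD('d) * p\<^sup>2)) path
        (\<lambda>u x. if u \<in> {0..T} then b \<theta> u x (marginal M u) else 0) L m"
    unfolding \<beta>_def[abs_def] by blast
qed

text \<open>Uniform continuity of the indefinite integral on a compact interval. It serves the bound
  of the drift at the origin, which is integrable in time but possibly unbounded.\<close>

lemma set_integral_small_interval:
  fixes f :: "real \<Rightarrow> real"
  assumes f: "set_integrable lborel {0..T} f" and e: "0 < e"
  shows "\<exists>\<eta>>0. \<forall>s t. 0 \<le> s \<and> s \<le> t \<and> t \<le> T \<and> t - s \<le> \<eta> \<longrightarrow> (LINT u:{s..t}|lborel. f u) \<le> e"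
proof -
  let ?G = "\<lambda>t. LINT u:{0..t}|lborel. f u"
  have "continuous_on {0..T} (\<lambda>t. integral {0..t} f)"
    by (intro indefinite_integral_continuous_1 set_borel_integral_eq_integral(1) f)
  moreover have "integral {0..t} f = ?G t" if "t \<in> {0..T}" for t
    using that by (intro set_borel_integral_eq_integral(2)[symmetric] set_integrable_subset[OF f]) auto
  ultimately have "continuous_on {0..T} ?G" by (rule continuous_on_eq)
  then have "uniformly_continuous_on {0..T} ?G" by (rule compact_uniformly_continuous) simp
  then obtain d where d: "d > 0" "\<And>s t. s \<in> {0..T} \<Longrightarrow> t \<in> {0..T} \<Longrightarrow> dist t s < d \<Longrightarrow> dist (?G t) (?G s) < e"
    using e unfolding uniformly_continuous_on_def by metis
  have "(LINT u:{s..t}|lborel. f u) \<le> e" if st: "0 \<le> s" "s \<le> t" "t \<le> T" "t - s \<le> d / 2" for s t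
  proof -
    have "set_integrable lborel {0..t} f" using st by (intro set_integrable_subset[OF f]) auto
    then have "?G t = ?G s + (LINT u:{s..t}|lborel. f u)" using st by (intro set_integral_split_Icc) auto
    moreover have "dist (?G t) (?G s) < e" using st d(1) by (intro d(2)) (auto simp: dist_real_def)
    ultimately show ?thesis by (simp add: dist_real_def)
  qed
  then show ?thesis using d(1) by (intro exI[of _ "d / 2"]) auto
qed

section \<open>Uniform consequences of the assumptions\<close>

text \<open>All constants are uniform in the parameter. Continuity in the parameter is demanded of b
  only at the origin and the Dirac mass there, and of db only at the initial law; other arguments
  are reached through the Lipschitz bounds. So marginals for different parameters are never compared
  with each other directly.\<close>

locale mkv_regular =
  fixes T :: real and \<Theta> :: "(real^'p) set" and \<mu>\<^sub>0 :: "(real^'d) measure"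
    and \<sigma> s :: "real \<Rightarrow> real^'d \<Rightarrow> real^'d^'d"
    and b :: "real^'p \<Rightarrow> real \<Rightarrow> real^'d \<Rightarrow> (real^'d) measure \<Rightarrow> real^'d"
    and db :: "real^'p \<Rightarrow> real \<Rightarrow> real^'d \<Rightarrow> (real^'d) measure \<Rightarrow> real^'p^'d"
    and P :: "real^'p \<Rightarrow> (real \<Rightarrow> real^'d) measure"
    and m p L C K :: real
  assumes K_eq: "K = sqrt (CARD('d) * p\<^sup>2)" and T_pos: "0 < T" and compact: "compact \<Theta>"
    and \<mu>0: "\<mu>\<^sub>0 \<in> P_mom 1" "\<mu>\<^sub>0 \<in> P_mom 2"
    and \<sigma>_measurable: "(\<lambda>(t, x). \<sigma> t x) \<in> borel_measurable (restrict_space borel {0..T} \<Otimes>\<^sub>M borel)"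
    and m_pos: "0 < m" and p_pos: "0 < p"
    and elliptic: "\<And>t x y. t \<in> {0..T} \<Longrightarrow> m\<^sup>2 * (norm y)\<^sup>2 \<le> (cmat \<sigma> t x *v y) \<bullet> y"
      "\<And>t x y. t \<in> {0..T} \<Longrightarrow> (cmat \<sigma> t x *v y) \<bullet> y \<le> p\<^sup>2 * (norm y)\<^sup>2"
    and s_measurable: "(\<lambda>(t, x). s t x) \<in> borel_measurable (restrict_space borel {0..T} \<Otimes>\<^sub>M borel)"
    and s_inv: "\<And>t x. t \<in> {0..T} \<Longrightarrow> transpose (s t x) ** s t x = matrix_inv (cmat \<sigma> t x)"
    and L_pos: "0 < L" and C_pos: "0 < C"
    and b_measurable: "(\<lambda>(\<theta>, t, x, \<nu>). b \<theta> t x \<nu>) \<in> borel_measurable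
        (restrict_space borel \<Theta> \<Otimes>\<^sub>M restrict_space borel {0..T} \<Otimes>\<^sub>M borel \<Otimes>\<^sub>M
         restrict_space (prob_algebra borel) (P_mom 1))"
    and b_lipschitz: "\<And>\<theta> t x x' \<nu> \<nu>'. \<theta> \<in> \<Theta> \<Longrightarrow> t \<in> {0..T} \<Longrightarrow> \<nu> \<in> P_mom 1 \<Longrightarrow> \<nu>' \<in> P_mom 1 \<Longrightarrow>
        norm (b \<theta> t x' \<nu>' - b \<theta> t x \<nu>) \<le> L * (norm (x' - x) + W1 \<nu>' \<nu>)"
    and b_modulus: "\<And>\<theta> e. \<theta> \<in> \<Theta> \<Longrightarrow> 0 < e \<Longrightarrow>
        \<exists>\<rho>>0. \<forall>\<eta>\<in>\<Theta>. dist \<eta> \<theta> < \<rho> \<longrightarrow> (\<forall>t\<in>{0..T}. norm (b \<eta> t 0 (return borel 0) - b \<theta> t 0 (return borel 0)) \<le> e)"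
    and db_measurable: "(\<lambda>(\<theta>, t, x, \<nu>). db \<theta> t x \<nu>) \<in> borel_measurable
        (restrict_space borel \<Theta> \<Otimes>\<^sub>M restrict_space borel {0..T} \<Otimes>\<^sub>M borel \<Otimes>\<^sub>M
         restrict_space (prob_algebra borel) (P_mom 1))"
    and db_lipschitz: "\<And>\<theta> t x x' \<nu> \<nu>'. \<theta> \<in> \<Theta> \<Longrightarrow> t \<in> {0..T} \<Longrightarrow> \<nu> \<in> P_mom 1 \<Longrightarrow> \<nu>' \<in> P_mom 1 \<Longrightarrow>
        norm (db \<theta> t x' \<nu>' - db \<theta> t x \<nu>) \<le> C * (norm (x' - x) + W1 \<nu>' \<nu>)"
    and db_origin: "\<And>\<theta> t. \<theta> \<in> \<Theta> \<Longrightarrow> t \<in> {0..T} \<Longrightarrow> norm (db \<theta> t 0 (return borel 0)) \<le> C"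
    and db_modulus: "\<And>\<theta> x e. \<theta> \<in> \<Theta> \<Longrightarrow> 0 < e \<Longrightarrow>
        \<exists>\<rho>>0. \<forall>\<eta>\<in>\<Theta>. dist \<eta> \<theta> < \<rho> \<longrightarrow> (\<forall>t\<in>{0..T}. norm (db \<eta> t x \<mu>\<^sub>0 - db \<theta> t x \<mu>\<^sub>0) \<le> e)"
    and law: "\<And>\<theta>. \<theta> \<in> \<Theta> \<Longrightarrow> mckean_vlasov_law T \<mu>\<^sub>0 \<sigma> (b \<theta>) (P \<theta>)"
begin

abbreviation \<mu> :: "real^'p \<Rightarrow> real \<Rightarrow> (real^'d) measure" where "\<mu> \<theta> t \<equiv> marginal (P \<theta>) t"
abbreviation \<beta> :: "real^'p \<Rightarrow> real \<Rightarrow> real^'d \<Rightarrow> real^'d" where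
  "\<beta> \<theta> \<equiv> \<lambda>u x. if u \<in> {0..T} then b \<theta> u x (marginal (P \<theta>) u) else 0"
abbreviation \<delta>\<^sub>0 :: "(real^'d) measure" where "\<delta>\<^sub>0 \<equiv> return borel 0"

lemma K_pos: "0 < K" using p_pos by (simp add: K_eq)

lemma path_law: "\<theta> \<in> \<Theta> \<Longrightarrow> path_law (P \<theta>) T"
  and diffusion: "\<theta> \<in> \<Theta> \<Longrightarrow> \<exists>F B \<Phi> I. diffusion (P \<theta>) F T B \<Phi> I K (path_law.path T) (\<beta> \<theta>) L m"
proof -
  assume \<theta>: "\<theta> \<in> \<Theta>"
  have lip: "norm (b \<theta> t x' \<nu> - b \<theta> t x \<nu>) \<le> L * norm (x' - x)" if "t \<in> {0..T}" "\<nu> \<in> P_mom 1" for t x x' \<nu>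
  proof -
    have "norm (x' - x) + W1 \<nu> \<nu> \<le> norm (x' - x)" using W1_self_le[OF that(2)] by simp
    then show ?thesis using b_lipschitz[OF \<theta> that(1,2,2), of x' x] L_pos by (meson less_imp_le mult_left_mono order_trans)
  qed
  show "path_law (P \<theta>) T"
    by (rule mckean_vlasov_diffusion(1)[OF T_pos \<theta> \<mu>0(2) \<sigma>_measurable m_pos elliptic b_measurable L_pos lip law[OF \<theta>]])
  show "\<exists>F B \<Phi> I. diffusion (P \<theta>) F T B \<Phi> I K (path_law.path T) (\<beta> \<theta>) L m"
    unfolding K_eq
    by (rule mckean_vlasov_diffusion(2)[OF T_pos \<theta> \<mu>0(2) \<sigma>_measurable m_pos elliptic b_measurable L_pos lip law[OF \<theta>]])
qed

lemma marginal_0: "\<theta> \<in> \<Theta> \<Longrightarrow> \<mu> \<theta> 0 = \<mu>\<^sub>0"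
  and marginal_P1: "\<theta> \<in> \<Theta> \<Longrightarrow> t \<in> {0..T} \<Longrightarrow> \<mu> \<theta> t \<in> P_mom 1"
  using law unfolding mckean_vlasov_law_def by blast+

lemma \<delta>0: "\<delta>\<^sub>0 \<in> P_mom 1"
  by (rule return_0_P_mom) simp

definition mean :: "real^'p \<Rightarrow> real \<Rightarrow> real" where "mean \<theta> t = (\<integral>y. norm y \<partial>\<mu> \<theta> t)"

text \<open>The distances to the Dirac mass at 0 are bounded by coupling the path with a constant
  random vector.\<close>

lemma mean_eq:
  assumes \<theta>: "\<theta> \<in> \<Theta>" and D: "diffusion (P \<theta>) F T B \<Phi> I K (path_law.path T) (\<beta> \<theta>) L m" and t: "t \<in> {0..T}"
  shows "diffusion.mX (P \<theta>) (path_law.path T) t = mean \<theta> t"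
    and "W1 (\<mu> \<theta> t) \<delta>\<^sub>0 \<le> mean \<theta> t" and "W1 \<delta>\<^sub>0 (\<mu> \<theta> t) \<le> mean \<theta> t"
    and "integrable (\<mu> \<theta> t) (\<lambda>y. (norm y)\<^sup>2)"
proof -
  interpret pl: path_law "P \<theta>" T by (rule path_law[OF \<theta>])
  interpret D: diffusion "P \<theta>" F T B \<Phi> I K "path_law.path T" "\<beta> \<theta>" L m by (rule D)
  have X: "integrable (P \<theta>) (\<lambda>\<omega>. norm (pl.path t \<omega>))" by (rule D.X_norm_integrable[OF t])
  show e: "D.mX t = mean \<theta> t"
    unfolding D.mX_def mean_def pl.marginal_eq[OF t] by (subst integral_distr) auto
  have d: "distr (P \<theta>) borel (\<lambda>_. 0 :: real^'d) = \<delta>\<^sub>0" by (rule pl.distr_const) simp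
  have "W1 (distr (P \<theta>) borel (pl.path t)) (distr (P \<theta>) borel (\<lambda>_. 0)) \<le> D.mX t"
    using X by (intro pl.W1_distr_le) (auto simp: D.mX_def)
  then show "W1 (\<mu> \<theta> t) \<delta>\<^sub>0 \<le> mean \<theta> t" by (simp add: e d pl.marginal_eq[OF t])
  have "W1 (distr (P \<theta>) borel (\<lambda>_. 0)) (distr (P \<theta>) borel (pl.path t)) \<le> D.mX t"
    using X by (intro pl.W1_distr_le) (auto simp: D.mX_def)
  then show "W1 \<delta>\<^sub>0 (\<mu> \<theta> t) \<le> mean \<theta> t" by (simp add: e d pl.marginal_eq[OF t])
  have "integrable (P \<theta>) (\<lambda>\<omega>. (norm (pl.path t \<omega>))\<^sup>2)" using D.X_square_bounded t by blast
  then show "integrable (\<mu> \<theta> t) (\<lambda>y. (norm y)\<^sup>2)" unfolding pl.marginal_eq[OF t] by (subst integrable_distr_eq) auto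
qed

text \<open>Integrability is extracted from the law itself: the drift along its paths is integrable,
  hence so is the drift at the origin under the marginals, and the Dirac mass is reached through the
  Lipschitz bound in the measure.\<close>

lemma drift_origin_integrable:
  assumes \<theta>: "\<theta> \<in> \<Theta>"
  shows "set_integrable lborel {0..T} (\<lambda>t. norm (b \<theta> t 0 \<delta>\<^sub>0))"
proof -
  obtain F B \<Phi> I where D: "diffusion (P \<theta>) F T B \<Phi> I K (path_law.path T) (\<beta> \<theta>) L m" using diffusion[OF \<theta>] by blast
  interpret pl: path_law "P \<theta>" T by (rule path_law[OF \<theta>])
  interpret D: diffusion "P \<theta>" F T B \<Phi> I K "path_law.path T" "\<beta> \<theta>" L m by (rule D)
  have m: "(\<lambda>t. b \<theta> (time_clamp T t) 0 \<delta>\<^sub>0) \<in> borel_measurable lborel"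
  proof -
    have "(\<lambda>t. (\<theta>, time_clamp T t, 0, \<delta>\<^sub>0)) \<in> lborel \<rightarrow>\<^sub>M
        restrict_space borel \<Theta> \<Otimes>\<^sub>M restrict_space borel {0..T} \<Otimes>\<^sub>M borel \<Otimes>\<^sub>M restrict_space (prob_algebra borel) (P_mom 1)"
      using \<theta> T_pos \<delta>0 by (intro measurable_Pair measurable_const time_clamp_restrict)
        (auto simp: space_restrict_space space_prob_algebra P_mom_def)
    from measurable_compose[OF this b_measurable] show ?thesis by simp
  qed
  have i: "set_integrable lborel {0..T} (\<lambda>t. norm (\<beta> \<theta> t 0) + L * D.mX t)"
    using D.mX_path(2)[of 0 T] by (intro set_integral_add(1) set_integrable_norm D.\<beta>_origin_integrable set_integrable_mult_right) auto
  have "integrable lborel (\<lambda>t. indicator {0..T} t *\<^sub>R norm (b \<theta> (time_clamp T t) 0 \<delta>\<^sub>0))"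
  proof (rule Bochner_Integration.integrable_bound[OF i[unfolded set_integrable_def]])
    have "norm (b \<theta> t 0 \<delta>\<^sub>0) \<le> norm (\<beta> \<theta> t 0) + L * D.mX t" if t: "t \<in> {0..T}" for t
    proof -
      have "norm (b \<theta> t 0 \<delta>\<^sub>0 - b \<theta> t 0 (\<mu> \<theta> t)) \<le> L * (norm (0 - 0 :: real^'d) + W1 \<delta>\<^sub>0 (\<mu> \<theta> t))"
        by (rule b_lipschitz[OF \<theta> t marginal_P1[OF \<theta> t] \<delta>0])
      also have "\<dots> \<le> L * D.mX t"
        using mean_eq(1,3)[OF \<theta> D t] L_pos by (intro mult_left_mono) auto
      finally show ?thesis
        using norm_triangle_sub[of "b \<theta> t 0 \<delta>\<^sub>0" "b \<theta> t 0 (\<mu> \<theta> t)"] t by simp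
    qed
    then show "AE t in lborel. norm (indicator {0..T} t *\<^sub>R norm (b \<theta> (time_clamp T t) 0 \<delta>\<^sub>0))
        \<le> norm (indicat_real {0..T} t *\<^sub>R (norm (\<beta> \<theta> t 0) + L * D.mX t))"
      by (intro AE_I2) (auto simp: indicator_def time_clamp_id intro: order_trans[OF _ abs_ge_self])
  qed (use m in simp)
  moreover have "indicator {0..T} t *\<^sub>R norm (b \<theta> (time_clamp T t) 0 \<delta>\<^sub>0) = indicat_real {0..T} t *\<^sub>R norm (b \<theta> t 0 \<delta>\<^sub>0)" for t
    by (auto simp: indicator_def time_clamp_id)
  ultimately show ?thesis unfolding set_integrable_def by (simp only:)
qed

text \<open>
  The drift at the origin need not be bounded in time, nor \<open>\<Theta>\<close> connected, so that \<open>\<theta>\<^sub>0\<close> controls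
  nothing elsewhere; compactness still gives an integrable bound that is uniform in the parameter.
\<close>

lemma drift_origin_dominated:
  "\<exists>a. set_integrable lborel {0..T} a \<and> (\<forall>t. 0 \<le> a t) \<and> (\<forall>\<theta>\<in>\<Theta>. \<forall>t\<in>{0..T}. norm (b \<theta> t 0 \<delta>\<^sub>0) \<le> a t)"
proof -
  obtain \<rho> where \<rho>: "\<And>\<theta>. \<theta> \<in> \<Theta> \<Longrightarrow> 0 < \<rho> \<theta> \<and> (\<forall>\<eta>\<in>\<Theta>. dist \<eta> \<theta> < \<rho> \<theta> \<longrightarrow> (\<forall>t\<in>{0..T}. norm (b \<eta> t 0 \<delta>\<^sub>0 - b \<theta> t 0 \<delta>\<^sub>0) \<le> 1))"
    using b_modulus[of _ 1] by (metis zero_less_one)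
  have cover: "\<Theta> \<subseteq> (\<Union>\<theta>\<in>\<Theta>. ball \<theta> (\<rho> \<theta>))" using \<rho> by fastforce
  obtain J where J: "J \<subseteq> \<Theta>" "finite J" "\<Theta> \<subseteq> (\<Union>\<theta>\<in>J. ball \<theta> (\<rho> \<theta>))"
    using compactE_image[OF compact _ cover] by (metis open_ball)
  \<comment> \<open>Near each centre of a finite subcover the drift at the origin varies by at most
    1, uniformly in time; the sum over the centres dominates the maximum.\<close>
  define a where "a t = 1 + (\<Sum>\<theta>\<in>J. norm (b \<theta> t 0 \<delta>\<^sub>0))" for t
  have "set_integrable lborel {0..T} a"
  proof -
    have "integrable lborel (\<lambda>t. \<Sum>\<theta>\<in>J. indicator {0..T} t *\<^sub>R norm (b \<theta> t 0 \<delta>\<^sub>0))"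
      using J drift_origin_integrable by (intro Bochner_Integration.integrable_sum) (auto simp: set_integrable_def)
    then have "set_integrable lborel {0..T} (\<lambda>t. \<Sum>\<theta>\<in>J. norm (b \<theta> t 0 \<delta>\<^sub>0))"
      by (simp add: set_integrable_def scaleR_sum_right sum_distrib_left)
    then show ?thesis unfolding a_def by (intro set_integral_add(1) set_integrable_const_Icc)
  qed
  moreover have "0 \<le> a t" for t unfolding a_def by (intro add_nonneg_nonneg sum_nonneg) auto
  moreover have "norm (b \<eta> t 0 \<delta>\<^sub>0) \<le> a t" if \<eta>: "\<eta> \<in> \<Theta>" and t: "t \<in> {0..T}" for \<eta> t
  proof -
    obtain \<theta> where \<theta>: "\<theta> \<in> J" "dist \<eta> \<theta> < \<rho> \<theta>" using J(3) \<eta> by (auto simp: dist_commute)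
    then have "norm (b \<eta> t 0 \<delta>\<^sub>0 - b \<theta> t 0 \<delta>\<^sub>0) \<le> 1" using \<rho>[of \<theta>] J(1) \<eta> t by blast
    moreover have "norm (b \<theta> t 0 \<delta>\<^sub>0) \<le> (\<Sum>\<theta>\<in>J. norm (b \<theta> t 0 \<delta>\<^sub>0))"
      using \<theta> J by (intro member_le_sum) auto
    ultimately show ?thesis using norm_triangle_sub[of "b \<eta> t 0 \<delta>\<^sub>0" "b \<theta> t 0 \<delta>\<^sub>0"] by (simp add: a_def)
  qed
  ultimately show ?thesis by blast
qed

text \<open>The drift at the origin under \<open>\<mu> \<theta> t\<close> depends on the mean of
  that law, and the mean on the drift; \<open>mX_bound\<close> breaks this circle with constants
  free of \<theta>.\<close>

lemma uniform_bounds: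
  obtains A Mb where "set_integrable lborel {0..T} A" "\<And>t. 0 \<le> A t" "0 \<le> Mb"
    "\<And>\<theta> t. \<theta> \<in> \<Theta> \<Longrightarrow> t \<in> {0..T} \<Longrightarrow> mean \<theta> t \<le> Mb"
    "\<And>\<theta> t. \<theta> \<in> \<Theta> \<Longrightarrow> t \<in> {0..T} \<Longrightarrow> norm (b \<theta> t 0 (\<mu> \<theta> t)) \<le> A t"
proof -
  obtain a where a: "set_integrable lborel {0..T} a" "\<And>t. 0 \<le> a t"
    "\<And>\<theta> t. \<theta> \<in> \<Theta> \<Longrightarrow> t \<in> {0..T} \<Longrightarrow> norm (b \<theta> t 0 \<delta>\<^sub>0) \<le> a t"
    using drift_origin_dominated by blast
  define Mb where "Mb = 2 * ((\<integral>y. norm y \<partial>\<mu>\<^sub>0) + K * sqrt T + (LINT u:{0..T}|lborel. a u)) * exp (4 * L * T)"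
  have bl: "norm (b \<theta> t 0 (\<mu> \<theta> t)) \<le> a t + L * mean \<theta> t" if \<theta>: "\<theta> \<in> \<Theta>" and t: "t \<in> {0..T}" for \<theta> t
  proof -
    obtain F B \<Phi> I where D: "diffusion (P \<theta>) F T B \<Phi> I K (path_law.path T) (\<beta> \<theta>) L m" using diffusion[OF \<theta>] by blast
    have "norm (b \<theta> t 0 (\<mu> \<theta> t) - b \<theta> t 0 \<delta>\<^sub>0) \<le> L * (norm (0 - 0 :: real^'d) + W1 (\<mu> \<theta> t) \<delta>\<^sub>0)"
      by (rule b_lipschitz[OF \<theta> t \<delta>0 marginal_P1[OF \<theta> t]])
    also have "\<dots> \<le> L * mean \<theta> t" using mean_eq(2)[OF \<theta> D t] L_pos by (intro mult_left_mono) auto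
    finally show ?thesis using norm_triangle_sub[of "b \<theta> t 0 (\<mu> \<theta> t)" "b \<theta> t 0 \<delta>\<^sub>0"] a(3)[OF \<theta> t] by simp
  qed
  have mb: "mean \<theta> t \<le> Mb" if \<theta>: "\<theta> \<in> \<Theta>" and t: "t \<in> {0..T}" for \<theta> t
  proof -
    obtain F B \<Phi> I where D: "diffusion (P \<theta>) F T B \<Phi> I K (path_law.path T) (\<beta> \<theta>) L m" using diffusion[OF \<theta>] by blast
    interpret D: diffusion "P \<theta>" F T B \<Phi> I K "path_law.path T" "\<beta> \<theta>" L m by (rule D)
    have "norm (\<beta> \<theta> u 0) \<le> a u + L * D.mX u" if "u \<in> {0..T}" for u
      using bl[OF \<theta> that] mean_eq(1)[OF \<theta> D that] that by simp
    from D.mX_bound[OF a(1,2) this t] have "D.mX t \<le> 2 * (D.mX 0 + K * sqrt T + (LINT u:{0..T}|lborel. a u)) * exp (4 * L * T)" .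
    then show ?thesis
      using mean_eq(1)[OF \<theta> D t] mean_eq(1)[OF \<theta> D, of 0] T_pos marginal_0[OF \<theta>] by (simp add: Mb_def mean_def)
  qed
  have "0 \<le> Mb"
    unfolding Mb_def set_lebesgue_integral_def using K_pos T_pos a(2)
    by (intro mult_nonneg_nonneg add_nonneg_nonneg Bochner_Integration.integral_nonneg) auto
  moreover have "norm (b \<theta> t 0 (\<mu> \<theta> t)) \<le> a t + L * Mb" if "\<theta> \<in> \<Theta>" "t \<in> {0..T}" for \<theta> t
    using bl[OF that] mult_left_mono[OF mb[OF that] less_imp_le[OF L_pos]] by linarith
  moreover have "set_integrable lborel {0..T} (\<lambda>t. a t + L * Mb)"
    by (intro set_integral_add(1) a set_integrable_const_Icc)
  ultimately show ?thesis using that[of "\<lambda>t. a t + L * Mb" Mb] mb a(2) L_pos by simp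
qed

text \<open>The path at times t and 0 is a coupling. The stochastic integral, the drift at the
  origin and the Lipschitz part of the drift get e / 3 each, which explains the three entries of
  \<delta> other than T.\<close>

lemma W1_initial_small:
  assumes e: "0 < e"
  shows "\<exists>\<delta>>0. \<delta> \<le> T \<and> (\<forall>\<theta>\<in>\<Theta>. \<forall>t\<in>{0..\<delta>}. W1 (\<mu> \<theta> t) \<mu>\<^sub>0 \<le> e)"
proof -
  obtain A Mb where A: "set_integrable lborel {0..T} A" "\<And>t. 0 \<le> A t" "0 \<le> Mb"
    "\<And>\<theta> t. \<theta> \<in> \<Theta> \<Longrightarrow> t \<in> {0..T} \<Longrightarrow> mean \<theta> t \<le> Mb"
    "\<And>\<theta> t. \<theta> \<in> \<Theta> \<Longrightarrow> t \<in> {0..T} \<Longrightarrow> norm (b \<theta> t 0 (\<mu> \<theta> t)) \<le> A t"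
    by (rule uniform_bounds) (rule that)
  obtain \<eta> where \<eta>: "0 < \<eta>" "\<And>s t. 0 \<le> s \<Longrightarrow> s \<le> t \<Longrightarrow> t \<le> T \<Longrightarrow> t - s \<le> \<eta> \<Longrightarrow> (LINT u:{s..t}|lborel. A u) \<le> e / 3"
    using set_integral_small_interval[OF A(1), of "e / 3"] e by auto
  define \<delta> where "\<delta> = min T (min \<eta> (min (e / (3 * (L * Mb + 1))) ((e / (3 * K))\<^sup>2)))"
  have LM: "0 \<le> L * Mb" using A(3) L_pos by simp
  have d: "0 < \<delta>" "\<delta> \<le> T" "\<delta> \<le> \<eta>" "\<delta> \<le> e / (3 * (L * Mb + 1))" "\<delta> \<le> (e / (3 * K))\<^sup>2"
    using T_pos \<eta>(1) e K_pos LM by (auto simp: \<delta>_def)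
  have "W1 (\<mu> \<theta> t) \<mu>\<^sub>0 \<le> e" if \<theta>: "\<theta> \<in> \<Theta>" and t: "t \<in> {0..\<delta>}" for \<theta> t
  proof -
    have tT: "t \<in> {0..T}" using t d by auto
    obtain F B \<Phi> I where D: "diffusion (P \<theta>) F T B \<Phi> I K (path_law.path T) (\<beta> \<theta>) L m" using diffusion[OF \<theta>] by blast
    interpret pl: path_law "P \<theta>" T by (rule path_law[OF \<theta>])
    interpret D: diffusion "P \<theta>" F T B \<Phi> I K "path_law.path T" "\<beta> \<theta>" L m by (rule D)
    have "W1 (distr (P \<theta>) borel (pl.path t)) (distr (P \<theta>) borel (pl.path 0))
        \<le> K * sqrt t + (LINT u:{0..t}|lborel. norm (\<beta> \<theta> u 0)) + L * (LINT u:{0..t}|lborel. D.mX u)"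
      using D.X_displacement[OF tT] by (intro pl.W1_distr_le) auto
    also have "K * sqrt t \<le> e / 3"
    proof -
      have "sqrt t \<le> e / (3 * K)" using t d(5) e K_pos by (intro real_le_lsqrt) auto
      then show ?thesis using K_pos by (simp add: field_simps)
    qed
    also have "(LINT u:{0..t}|lborel. norm (\<beta> \<theta> u 0)) \<le> (LINT u:{0..t}|lborel. A u)"
      using tT A(5)[OF \<theta>] by (intro set_integral_mono set_integrable_norm set_integrable_subset[OF D.\<beta>_origin_integrable] set_integrable_subset[OF A(1)]) auto
    also have "\<dots> \<le> e / 3" using t d tT by (intro \<eta>(2)) auto
    also have "L * (LINT u:{0..t}|lborel. D.mX u) \<le> e / 3"
    proof -
      have "(LINT u:{0..t}|lborel. D.mX u) \<le> (LINT u:{0..t}|lborel. Mb)"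
        using tT A(4)[OF \<theta>] mean_eq(1)[OF \<theta> D] by (intro set_integral_mono D.mX_path(2) set_integrable_const_Icc) auto
      also have "\<dots> = Mb * t" using tT by (simp add: set_lebesgue_integral_def)
      finally have "L * (LINT u:{0..t}|lborel. D.mX u) \<le> L * (Mb * t)" using L_pos by simp
      also have "\<dots> \<le> (L * Mb + 1) * \<delta>" unfolding mult.assoc[symmetric] using t LM by (intro mult_mono) auto
      also have "\<dots> \<le> e / 3" using d(4) LM by (simp add: field_simps)
      finally show ?thesis .
    qed
    finally show ?thesis
      using pl.marginal_eq[OF tT] pl.marginal_eq[of 0] marginal_0[OF \<theta>] T_pos by simp
  qed
  then show ?thesis using d by blast
qed

text \<open>Countably many balls with dense centres cover the space, so they cannot all be null
  sets.\<close>

lemma initial_ball: "\<exists>x0. 0 < r \<longrightarrow> 0 < measure \<mu>\<^sub>0 (cball x0 r)"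
proof (cases "0 < r")
  case True
  interpret prob_space \<mu>\<^sub>0 using \<mu>0 by (auto simp: P_mom_def space_prob_algebra)
  have sb: "sets \<mu>\<^sub>0 = sets borel" "space \<mu>\<^sub>0 = UNIV"
    using \<mu>0 by (auto simp: P_mom_def space_prob_algebra dest: sets_eq_imp_space_eq)
  obtain Q :: "(real^'d) set" where Q: "countable Q" "\<And>U. open U \<Longrightarrow> U \<noteq> {} \<Longrightarrow> \<exists>q\<in>Q. q \<in> U"
    using countable_dense_setE by blast
  show ?thesis
  proof (rule ccontr)
    assume "\<not> ?thesis"
    then have z: "measure \<mu>\<^sub>0 (cball x r) = 0" for x
      using True by (auto simp: not_less intro: order_antisym measure_nonneg)
    have "(\<Union>q\<in>Q. cball q r) \<in> null_sets \<mu>\<^sub>0"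
      using Q(1) z by (intro null_sets_UN') (auto simp: null_sets_def emeasure_eq_measure sb)
    moreover have "(\<Union>q\<in>Q. cball q r) = UNIV"
    proof safe
      fix y :: "real^'d"
      obtain q where "q \<in> Q" "q \<in> ball y r" using Q(2)[of "ball y r"] True by auto
      then show "y \<in> (\<Union>q\<in>Q. cball q r)" by (auto simp: dist_commute intro!: bexI[of _ q])
    qed simp
    ultimately show False using sb emeasure_space_1 by (auto simp: null_sets_def)
  qed
qed simp

text \<open>The curve follows the drift of each law at the origin, so the curve and its velocity v
  depend on \<theta>; their bounds V and K1 do not, and hence neither do \<alpha> and \<kappa>.
  Close to time \<delta> the curve is within r of x1, and the process is within r of the curve with
  probability at least \<kappa>.\<close>

lemma marginal_ball_ge:
  assumes r: "0 < r" and \<delta>: "0 < \<delta>" "\<delta> \<le> T" and small: "4 * K\<^sup>2 * \<delta> \<le> r\<^sup>2"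
  shows "\<exists>\<kappa>>0. \<exists>\<eta>>0. \<eta> \<le> \<delta> \<and> (\<forall>\<theta>\<in>\<Theta>. \<forall>t\<in>{\<delta> - \<eta>..\<delta>}. \<kappa> \<le> measure (\<mu> \<theta> t) (ball x1 (2 * r)))"
proof -
  obtain A Mb where A: "set_integrable lborel {0..T} A" "\<And>t. 0 \<le> A t" "0 \<le> Mb"
    "\<And>\<theta> t. \<theta> \<in> \<Theta> \<Longrightarrow> t \<in> {0..T} \<Longrightarrow> mean \<theta> t \<le> Mb"
    "\<And>\<theta> t. \<theta> \<in> \<Theta> \<Longrightarrow> t \<in> {0..T} \<Longrightarrow> norm (b \<theta> t 0 (\<mu> \<theta> t)) \<le> A t"
    by (rule uniform_bounds) (rule that)
  obtain x0 where x0: "0 < measure \<mu>\<^sub>0 (cball x0 (r / 2))" using initial_ball[of "r / 2"] r by auto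
  define q where "q = measure \<mu>\<^sub>0 (cball x0 (r / 2))"
  define G where "G = (LINT u:{0..T}|lborel. A u)"
  have G0: "0 \<le> G" unfolding G_def set_lebesgue_integral_def using A(2) by (intro Bochner_Integration.integral_nonneg) auto
  \<comment> \<open>Bounds the velocity that leads from x0 to x1 in time \<delta> when the drift at
    the origin displaces the curve by at most G.\<close>
  define V where "V = (norm x1 + norm x0 + G) / \<delta>"
  have V0: "0 \<le> V" using G0 \<delta> by (simp add: V_def)
  define K1 where "K1 = L * (norm x0 + G + \<delta> * V) + V + L"
  have K1: "0 < K1" using L_pos G0 V0 \<delta> by (auto simp: K1_def intro!: add_nonneg_pos add_nonneg_nonneg mult_nonneg_nonneg)
  obtain \<eta> where \<eta>: "0 < \<eta>" "\<And>s t. 0 \<le> s \<Longrightarrow> s \<le> t \<Longrightarrow> t \<le> T \<Longrightarrow> t - s \<le> \<eta> \<Longrightarrow> (LINT u:{s..t}|lborel. A u) \<le> r / 2"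
    using set_integral_small_interval[OF A(1), of "r / 2"] r by auto
  \<comment> \<open>During the remaining time the drift at the origin and the constant velocity move
    the curve by at most r / 2 each.\<close>
  define \<eta>' where "\<eta>' = min \<delta> (min \<eta> (r / (2 * (V + 1))))"
  have e': "0 < \<eta>'" "\<eta>' \<le> \<delta>" "\<eta>' \<le> \<eta>" "\<eta>' * V \<le> r / 2"
  proof -
    show "0 < \<eta>'" "\<eta>' \<le> \<delta>" "\<eta>' \<le> \<eta>" using \<delta> \<eta>(1) r V0 by (auto simp: \<eta>'_def)
    have "\<eta>' * V \<le> (r / (2 * (V + 1))) * (V + 1)" using V0 r \<open>0 < \<eta>'\<close> by (intro mult_mono) (auto simp: \<eta>'_def)
    also have "\<dots> = r / 2" using V0 by (simp add: field_simps)
    finally show "\<eta>' * V \<le> r / 2" .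
  qed
  define c where "c = q * exp (- (K1\<^sup>2 / m\<^sup>2 * \<delta>))"
  have c: "0 < c" using x0 by (simp add: c_def q_def)
  obtain \<alpha> where \<alpha>: "0 < \<alpha>" "2 * K1 \<le> \<alpha> * m\<^sup>2" "exp (- (\<alpha> * r\<^sup>2 / 2)) < c"
  proof -
    \<comment> \<open>The first entry satisfies the drift condition of the barrier; the second makes
      exp (-\<alpha> r^2 / 2) smaller than c, hence \<kappa> positive.\<close>
    define \<alpha> where "\<alpha> = max (2 * K1 / m\<^sup>2) (2 * (\<bar>ln c\<bar> + 1) / r\<^sup>2)"
    have "2 * K1 / m\<^sup>2 \<le> \<alpha>" "2 * (\<bar>ln c\<bar> + 1) / r\<^sup>2 \<le> \<alpha>" by (auto simp: \<alpha>_def)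
    then have 1: "2 * K1 \<le> \<alpha> * m\<^sup>2" "2 * (\<bar>ln c\<bar> + 1) \<le> \<alpha> * r\<^sup>2" using m_pos r by (simp_all add: pos_divide_le_eq)
    have "0 < 2 * K1 / m\<^sup>2" using K1 m_pos by simp
    then have 2: "0 < \<alpha>" using \<open>2 * K1 / m\<^sup>2 \<le> \<alpha>\<close> by linarith
    have "\<bar>ln c\<bar> + 1 \<le> \<alpha> * r\<^sup>2 / 2" using 1(2) by simp
    then have "- (\<alpha> * r\<^sup>2 / 2) < ln c" using abs_ge_minus_self[of "ln c"] by linarith
    then have "exp (- (\<alpha> * r\<^sup>2 / 2)) < c" using c by (metis exp_less_cancel_iff exp_ln)
    then show ?thesis using that 1 2 by blast
  qed
  define \<kappa> where "\<kappa> = exp (- (\<alpha> * r\<^sup>2 / 2)) * (c - exp (- (\<alpha> * r\<^sup>2 / 2)))"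
  have \<kappa>: "0 < \<kappa>" using \<alpha>(3) by (simp add: \<kappa>_def)
  have "\<kappa> \<le> measure (\<mu> \<theta> t) (ball x1 (2 * r))" if \<theta>: "\<theta> \<in> \<Theta>" and t: "t \<in> {\<delta> - \<eta>'..\<delta>}" for \<theta> t
  proof -
    have t': "0 \<le> t" "t \<le> \<delta>" "t \<in> {0..T}" using t e' \<delta> by auto
    obtain F B \<Phi> I where D: "diffusion (P \<theta>) F T B \<Phi> I K (path_law.path T) (\<beta> \<theta>) L m" using diffusion[OF \<theta>] by blast
    interpret pl: path_law "P \<theta>" T by (rule path_law[OF \<theta>])
    interpret D: diffusion "P \<theta>" F T B \<Phi> I K "path_law.path T" "\<beta> \<theta>" L m by (rule D)
    define g where "g u = (LINT w:{0..u}|lborel. \<beta> \<theta> w 0)" for u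
    have gd: "norm (LINT w:{u..u'}|lborel. \<beta> \<theta> w 0) \<le> (LINT w:{u..u'}|lborel. A w)" if "0 \<le> u" "u' \<le> T" for u u'
      using that A(5)[OF \<theta>]
      by (intro D.norm_set_integral_le set_integrable_subset[OF D.\<beta>_origin_integrable] set_integrable_subset[OF A(1)]) auto
    have gb: "norm (g u) \<le> G" if "u \<in> {0..T}" for u
    proof -
      have "norm (g u) \<le> (LINT w:{0..u}|lborel. A w)" unfolding g_def using that by (intro gd) auto
      also have "\<dots> \<le> G" unfolding G_def using that A(2) by (intro set_integral_le_superset[OF A(1)]) auto
      finally show ?thesis .
    qed
    \<comment> \<open>Chosen so that the curve is at x1 exactly at time \<delta>.\<close>
    define v where "v = (1 / \<delta>) *\<^sub>R (x1 - x0 - g \<delta>)"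
    have v: "norm v \<le> V"
    proof -
      have "norm (x1 - x0 - g \<delta>) \<le> norm x1 + norm x0 + norm (g \<delta>)"
        by (meson add_right_mono norm_triangle_ineq4 order_trans)
      also have "\<dots> \<le> norm x1 + norm x0 + G" using gb[of \<delta>] \<delta> by simp
      finally show ?thesis using \<delta> by (simp add: v_def V_def divide_right_mono)
    qed
    have tube: "L * norm (x0 + g u + u *\<^sub>R v) + norm v + L \<le> K1" if u: "u \<in> {0..\<delta>}" for u
    proof -
      have "norm (x0 + g u + u *\<^sub>R v) \<le> norm x0 + norm (g u) + u * norm v"
        using norm_triangle_ineq[of "x0 + g u" "u *\<^sub>R v"] norm_triangle_ineq[of x0 "g u"] u by simp
      also have "\<dots> \<le> norm x0 + G + \<delta> * V"
        using u \<delta> v gb[of u] V0 by (intro add_mono mult_mono) auto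
      finally have "L * norm (x0 + g u + u *\<^sub>R v) \<le> L * (norm x0 + G + \<delta> * V)" using L_pos by simp
      then show ?thesis using v by (simp add: K1_def)
    qed
    interpret Tu: diffusion_tube "P \<theta>" F T B \<Phi> I K "path_law.path T" "\<beta> \<theta>" L m x0 v K1 \<delta>
      by unfold_locales (use \<delta> tube in \<open>auto simp: g_def\<close>)
    have p0: "pl.prob {\<omega> \<in> space (P \<theta>). norm (pl.path 0 \<omega> - x0) \<le> r / 2} = q"
    proof -
      have "q = measure (distr (P \<theta>) borel (pl.path 0)) (cball x0 (r / 2))"
        using pl.marginal_eq[of 0] marginal_0[OF \<theta>] T_pos by (simp add: q_def)
      also have "\<dots> = pl.prob (pl.path 0 -` cball x0 (r / 2) \<inter> space (P \<theta>))"
        by (rule measure_distr) auto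
      also have "pl.path 0 -` cball x0 (r / 2) \<inter> space (P \<theta>) = {\<omega> \<in> space (P \<theta>). norm (pl.path 0 \<omega> - x0) \<le> r / 2}"
        by (auto simp: dist_norm norm_minus_commute)
      finally show ?thesis by simp
    qed
    have "\<kappa> \<le> pl.prob {\<omega> \<in> space (P \<theta>). norm (pl.path t \<omega> - Tu.\<gamma> t) < r}"
      using Tu.tube_probability[OF r small \<alpha>(1,2) t'(1,2)] unfolding p0 by (simp add: \<kappa>_def c_def)
    also have "\<dots> \<le> pl.prob (pl.path t -` ball x1 (2 * r) \<inter> space (P \<theta>))"
    proof (rule pl.finite_measure_mono)
      have \<gamma>_diff: "norm (x1 - Tu.\<gamma> t) \<le> r"
      proof -
        have \<gamma>t: "Tu.\<gamma> t = x0 + g t + t *\<^sub>R v" unfolding Tu.\<gamma>_def g_def by (rule refl)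
        have i: "set_integrable lborel {0..\<delta>} (\<lambda>u. \<beta> \<theta> u 0)" using \<delta> by (intro set_integrable_subset[OF D.\<beta>_origin_integrable]) auto
        have "x1 = x0 + g \<delta> + \<delta> *\<^sub>R v" using \<delta> by (simp add: v_def)
        moreover have "g \<delta> = g t + (LINT w:{t..\<delta>}|lborel. \<beta> \<theta> w 0)"
          unfolding g_def using t' by (intro set_integral_split_Icc i) auto
        ultimately have "x1 - Tu.\<gamma> t = (LINT w:{t..\<delta>}|lborel. \<beta> \<theta> w 0) + (\<delta> - t) *\<^sub>R v"
          unfolding \<gamma>t by (simp only: scaleR_diff_left) simp
        then have "norm (x1 - Tu.\<gamma> t) \<le> norm (LINT w:{t..\<delta>}|lborel. \<beta> \<theta> w 0) + norm ((\<delta> - t) *\<^sub>R v)"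
          by (simp only: norm_triangle_ineq)
        also have "norm (LINT w:{t..\<delta>}|lborel. \<beta> \<theta> w 0) \<le> r / 2"
        proof (rule order_trans[OF gd \<eta>(2)])
          show "0 \<le> t" "0 \<le> t" "t \<le> \<delta>" "\<delta> \<le> T" "\<delta> \<le> T" "\<delta> - t \<le> \<eta>" using t t' \<delta> e' by auto
        qed
        also have "norm ((\<delta> - t) *\<^sub>R v) \<le> \<eta>' * V" unfolding norm_scaleR using t t' v e' V0 by (intro mult_mono) auto
        also have "\<dots> \<le> r / 2" by (rule e')
        finally show ?thesis by simp
      qed
      show "{\<omega> \<in> space (P \<theta>). norm (pl.path t \<omega> - Tu.\<gamma> t) < r} \<subseteq> pl.path t -` ball x1 (2 * r) \<inter> space (P \<theta>)"
      proof
        fix \<omega> assume w: "\<omega> \<in> {\<omega> \<in> space (P \<theta>). norm (pl.path t \<omega> - Tu.\<gamma> t) < r}"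
        have "dist x1 (pl.path t \<omega>) < r + r"
          using dist_triangle[of x1 "pl.path t \<omega>" "Tu.\<gamma> t"] \<gamma>_diff w by (simp add: dist_norm norm_minus_commute)
        then show "\<omega> \<in> pl.path t -` ball x1 (2 * r) \<inter> space (P \<theta>)" using w by simp
      qed
    qed (rule measurable_sets[OF pl.path_measurable], simp)
    also have "\<dots> = measure (\<mu> \<theta> t) (ball x1 (2 * r))"
      unfolding pl.marginal_eq[OF t'(3)] by (rule measure_distr[symmetric]) auto
    finally show ?thesis .
  qed
  then show ?thesis using \<kappa> e' by blast
qed

end

section \<open>Outer products, segments and null sets\<close>

lemma norm_outer_product: "norm (\<chi> k l. (v :: real^'p) $ k * v $ l) = (norm v)\<^sup>2"
proof -
  have "norm (\<chi> k l. v $ k * v $ l) = L2_set (\<lambda>k. norm (v $ k *\<^sub>R v)) UNIV"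
    unfolding norm_vec_def[of "\<chi> k l. v $ k * v $ l"] by (intro L2_set_cong refl arg_cong[of _ _ norm]) (simp add: vec_eq_iff)
  also have "\<dots> = L2_set (\<lambda>k. norm (v $ k) * norm v) UNIV" by simp
  also have "\<dots> = L2_set (\<lambda>k. norm (v $ k)) UNIV * norm v" by (rule L2_set_left_distrib[symmetric]) simp
  finally show ?thesis by (simp add: norm_vec_def power2_eq_square)
qed

lemma outer_product_quadratic: "z \<bullet> ((\<chi> k l. (v :: real^'p) $ k * v $ l) *v z) = (v \<bullet> z)\<^sup>2"
proof -
  have "z \<bullet> ((\<chi> k l. v $ k * v $ l) *v z) = (\<Sum>k\<in>UNIV. z $ k * (v $ k * (\<Sum>l\<in>UNIV. v $ l * z $ l)))"
    by (simp add: inner_vec_def matrix_vector_mult_def sum_distrib_left mult.assoc)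
  also have "\<dots> = (\<Sum>k\<in>UNIV. v $ k * z $ k) * (\<Sum>l\<in>UNIV. v $ l * z $ l)"
    by (simp add: sum_distrib_right mult_ac)
  finally show ?thesis by (simp add: inner_vec_def power2_eq_square)
qed

lemma bounded_linear_quadratic_form: "bounded_linear (\<lambda>A :: real^'p^'p. z \<bullet> (A *v z))"
  by (intro bounded_linear_compose[OF bounded_linear_inner_right]
      bounded_bilinear.bounded_linear_left[OF bounded_bilinear_matrix_vector_mult])

lemma norm_set_integral_unit_diff_le:
  fixes f g :: "real \<Rightarrow> 'b :: {banach, second_countable_topology}"
  assumes f: "set_integrable lborel {0..1} f" and g: "set_integrable lborel {0..1} g"
    and c: "\<And>l. l \<in> {0..1} \<Longrightarrow> norm (f l - g l) \<le> c"
  shows "norm ((LINT l:{0..1}|lborel. f l) - (LINT l:{0..1}|lborel. g l)) \<le> c"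
proof -
  have "(LINT l:{0..1}|lborel. f l) - (LINT l:{0..1}|lborel. g l) = (LINT l:{0..1}|lborel. f l - g l)"
    by (rule set_integral_diff(2)[OF f g, symmetric])
  also have "norm \<dots> \<le> (LINT l:{0..1}|lborel. norm (f l - g l))"
    by (rule set_integral_norm_bound[OF set_integral_diff(1)[OF f g]])
  also have "\<dots> \<le> (LINT l:{0..1::real}|lborel. c)"
    using c by (intro set_integral_mono set_integrable_norm set_integral_diff(1)[OF f g] set_integrable_const_Icc)
  also have "\<dots> = c" by (simp add: set_lebesgue_integral_def)
  finally show ?thesis .
qed

lemma segment_point: "l \<in> {0..1} \<Longrightarrow> closed_segment \<theta> \<theta>' \<subseteq> \<Theta> \<Longrightarrow> \<theta> + l *\<^sub>R (\<theta>' - \<theta>) \<in> \<Theta>"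
  by (erule subsetD) (auto simp: in_segment algebra_simps)

text \<open>For each fixed position l on the segment the condition is closed, and an intersection of
  closed conditions is closed.\<close>

lemma compact_segments:
  fixes \<Theta> :: "'a :: real_normed_vector set"
  assumes "compact \<Theta>"
  shows "compact {(\<theta>, \<theta>'). closed_segment \<theta> \<theta>' \<subseteq> \<Theta>}"
proof -
  let ?F = "\<lambda>l p. fst p + l *\<^sub>R (snd p - fst p :: 'a)"
  have "{(\<theta>, \<theta>'). closed_segment \<theta> \<theta>' \<subseteq> \<Theta>} = (\<Theta> \<times> \<Theta>) \<inter> (\<Inter>l\<in>{0..1::real}. ?F l -` \<Theta>)" (is "?A = ?B")
  proof safe
    fix \<theta> \<theta>' assume *: "closed_segment \<theta> \<theta>' \<subseteq> \<Theta>"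
    then show "\<theta> \<in> \<Theta>" "\<theta>' \<in> \<Theta>" using ends_in_segment[of \<theta> \<theta>'] by blast+
    show "(\<theta>, \<theta>') \<in> ?F l -` \<Theta>" if "l \<in> {0..1}" for l using segment_point[OF that *] by simp
  next
    fix \<theta> \<theta>' y assume *: "(\<theta>, \<theta>') \<in> (\<Inter>l\<in>{0..1::real}. ?F l -` \<Theta>)" and "y \<in> closed_segment \<theta> \<theta>'"
    then obtain l where "l \<in> {0..1}" "y = \<theta> + l *\<^sub>R (\<theta>' - \<theta>)" by (auto simp: in_segment algebra_simps)
    then show "y \<in> \<Theta>" using * by auto
  qed
  moreover have "closed (\<Inter>l\<in>{0..1::real}. ?F l -` \<Theta>)"
    using compact_imp_closed[OF assms] by (intro closed_INT ballI closed_vimage) (auto intro!: continuous_intros)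
  ultimately show ?thesis using assms by (simp add: compact_Int_closed compact_Times)
qed

text \<open>A nonempty open set is not negligible. It serves to move from a point where the averaged
  gradient does not vanish to a nearby one where continuity at time 0 holds.\<close>

lemma AE_lborel_meets_open:
  fixes U :: "'a :: euclidean_space set"
  assumes "open U" "U \<noteq> {}" "AE x in lborel. R x"
  shows "\<exists>x\<in>U. R x"
proof (rule ccontr)
  assume "\<not> ?thesis"
  moreover obtain N where N: "{x \<in> space lborel. \<not> R x} \<subseteq> N" "N \<in> null_sets lborel"
    using assms(3) by (auto simp: eventually_ae_filter)
  ultimately have "U \<subseteq> N" by auto
  then have "negligible U" using N(2) by (meson negligible_iff_null_sets negligible_subset null_sets_completionI)
  then show False using assms open_not_negligible by blast
qed

context mkv_regular begin

section \<open>Averaged gradients along segments\<close>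

text \<open>The average of the Jacobian alone. Unlike \<open>seg_grad\<close> it inherits the
  Lipschitz bound in x, because \<open>s\<close> need not be regular in x.\<close>

definition W :: "real^'p \<Rightarrow> real^'p \<Rightarrow> real \<Rightarrow> real^'d \<Rightarrow> (real^'d) measure \<Rightarrow> real^'p^'d" where
  "W \<theta> \<theta>' t x \<nu> = (LINT l:{0..1}|lborel. db (\<theta> + l *\<^sub>R (\<theta>' - \<theta>)) t x \<nu>)"

lemma db_growth:
  assumes "\<theta> \<in> \<Theta>" "t \<in> {0..T}" "\<nu> \<in> P_mom 1"
  shows "norm (db \<theta> t x \<nu>) \<le> C * (1 + norm x + W1 \<nu> \<delta>\<^sub>0)"
proof -
  have "norm (db \<theta> t x \<nu> - db \<theta> t 0 \<delta>\<^sub>0) \<le> C * (norm (x - 0) + W1 \<nu> \<delta>\<^sub>0)"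
    by (rule db_lipschitz) (use assms \<delta>0 in auto)
  then show ?thesis
    using db_origin[OF assms(1,2)] norm_triangle_sub[of "db \<theta> t x \<nu>" "db \<theta> t 0 \<delta>\<^sub>0"] by (simp add: algebra_simps)
qed

lemma db_segment_integrable:
  assumes seg: "closed_segment \<theta> \<theta>' \<subseteq> \<Theta>" and t: "t \<in> {0..T}" and \<nu>: "\<nu> \<in> P_mom 1"
  shows "set_integrable lborel {0..1} (\<lambda>l. db (\<theta> + l *\<^sub>R (\<theta>' - \<theta>)) t x \<nu>)"
proof -
  let ?f = "\<lambda>l. db (\<theta> + time_clamp 1 l *\<^sub>R (\<theta>' - \<theta>)) t x \<nu>"
  have in\<Theta>: "\<theta> + time_clamp 1 l *\<^sub>R (\<theta>' - \<theta>) \<in> \<Theta>" for l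
    by (rule segment_point[OF time_clamp_in seg]) simp
  have "(\<lambda>l. (\<theta> + time_clamp 1 l *\<^sub>R (\<theta>' - \<theta>), t, x, \<nu>)) \<in> borel \<rightarrow>\<^sub>M
      restrict_space borel \<Theta> \<Otimes>\<^sub>M restrict_space borel {0..T} \<Otimes>\<^sub>M borel \<Otimes>\<^sub>M restrict_space (prob_algebra borel) (P_mom 1)"
    using t \<nu> in\<Theta> by (intro measurable_Pair measurable_const measurable_restrict_space2)
        (auto simp: space_restrict_space space_prob_algebra P_mom_def)
  from measurable_compose[OF this db_measurable] have m: "?f \<in> borel_measurable borel" by simp
  have "set_integrable lborel {0..1} ?f"
    by (rule set_integrable_bounded[OF m, of _ _ "C * (1 + norm x + W1 \<nu> \<delta>\<^sub>0)"]) (rule db_growth[OF in\<Theta> t \<nu>])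
  then show ?thesis
    by (subst set_integrable_cong[OF refl refl, of _ _ ?f]) (simp_all add: time_clamp_id)
qed

lemma W_lipschitz:
  assumes seg: "closed_segment \<theta> \<theta>' \<subseteq> \<Theta>" and t: "t \<in> {0..T}" and \<nu>: "\<nu> \<in> P_mom 1" "\<nu>' \<in> P_mom 1"
  shows "norm (W \<theta> \<theta>' t x' \<nu>' - W \<theta> \<theta>' t x \<nu>) \<le> C * (norm (x' - x) + W1 \<nu>' \<nu>)"
  unfolding W_def
  by (intro norm_set_integral_unit_diff_le db_segment_integrable[OF seg t] db_lipschitz segment_point[OF _ seg] t \<nu>)

lemma W_growth:
  assumes seg: "closed_segment \<theta> \<theta>' \<subseteq> \<Theta>" and t: "t \<in> {0..T}" and \<nu>: "\<nu> \<in> P_mom 1"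
  shows "norm (W \<theta> \<theta>' t x \<nu>) \<le> C * (1 + norm x + W1 \<nu> \<delta>\<^sub>0)"
proof -
  have "norm (W \<theta> \<theta>' t x \<nu> - (LINT l:{0..1::real}|lborel. 0)) \<le> C * (1 + norm x + W1 \<nu> \<delta>\<^sub>0)"
    unfolding W_def
    using db_growth[OF segment_point[OF _ seg] t \<nu>]
    by (intro norm_set_integral_unit_diff_le db_segment_integrable[OF seg t \<nu>] set_integrable_const_Icc) simp
  then show ?thesis by (simp add: set_lebesgue_integral_def)
qed

text \<open>A Lebesgue number for the cover by the local balls turns radii depending on the centre
  into a common one; two nearby parameters are compared through the centre of a ball containing
  both.\<close>

lemma db_uniform_modulus:
  assumes e: "0 < e"
  shows "\<exists>\<rho>>0. \<forall>\<theta>\<in>\<Theta>. \<forall>\<eta>\<in>\<Theta>. dist \<eta> \<theta> < \<rho> \<longrightarrow> (\<forall>t\<in>{0..T}. norm (db \<eta> t x \<mu>\<^sub>0 - db \<theta> t x \<mu>\<^sub>0) \<le> e)"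
proof -
  obtain \<rho> where \<rho>: "\<And>\<theta>. \<theta> \<in> \<Theta> \<Longrightarrow> 0 < \<rho> \<theta> \<and> (\<forall>\<eta>\<in>\<Theta>. dist \<eta> \<theta> < \<rho> \<theta> \<longrightarrow> (\<forall>t\<in>{0..T}. norm (db \<eta> t x \<mu>\<^sub>0 - db \<theta> t x \<mu>\<^sub>0) \<le> e / 2))"
    using db_modulus[of _ "e / 2" x] e by (metis half_gt_zero)
  have "\<exists>d>0. \<forall>\<theta>\<in>\<Theta>. \<exists>\<zeta>\<in>\<Theta>. ball \<theta> d \<subseteq> ball \<zeta> (\<rho> \<zeta>)"
  proof (rule Heine_Borel_lemma[OF compact])
    show "\<Theta> \<subseteq> \<Union>((\<lambda>\<theta>. ball \<theta> (\<rho> \<theta>)) ` \<Theta>)" using \<rho> by fastforce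
    fix d assume "0 < d" "\<And>\<theta>. \<theta> \<in> \<Theta> \<Longrightarrow> \<exists>G\<in>(\<lambda>\<theta>. ball \<theta> (\<rho> \<theta>)) ` \<Theta>. ball \<theta> d \<subseteq> G"
    then show ?thesis by (intro exI[of _ d]) auto
  qed auto
  then obtain d where d: "0 < d" "\<And>\<theta>. \<theta> \<in> \<Theta> \<Longrightarrow> \<exists>\<zeta>\<in>\<Theta>. ball \<theta> d \<subseteq> ball \<zeta> (\<rho> \<zeta>)" by blast
  have "norm (db \<eta> t x \<mu>\<^sub>0 - db \<theta> t x \<mu>\<^sub>0) \<le> e"
    if h: "\<theta> \<in> \<Theta>" "\<eta> \<in> \<Theta>" "dist \<eta> \<theta> < d" "t \<in> {0..T}" for \<theta> \<eta> t
  proof -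
    obtain \<zeta> where \<zeta>: "\<zeta> \<in> \<Theta>" "ball \<theta> d \<subseteq> ball \<zeta> (\<rho> \<zeta>)" using d(2)[OF h(1)] by blast
    then have "dist \<theta> \<zeta> < \<rho> \<zeta>" "dist \<eta> \<zeta> < \<rho> \<zeta>" using h d(1) by (auto simp: subset_iff dist_commute)
    then have "norm (db \<theta> t x \<mu>\<^sub>0 - db \<zeta> t x \<mu>\<^sub>0) \<le> e / 2" "norm (db \<eta> t x \<mu>\<^sub>0 - db \<zeta> t x \<mu>\<^sub>0) \<le> e / 2"
      using \<rho>[OF \<zeta>(1)] h by auto
    then show ?thesis using norm_triangle_ineq4[of "db \<eta> t x \<mu>\<^sub>0 - db \<zeta> t x \<mu>\<^sub>0" "db \<theta> t x \<mu>\<^sub>0 - db \<zeta> t x \<mu>\<^sub>0"] by simp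
  qed
  then show ?thesis using d(1) by blast
qed

lemma W_modulus:
  assumes seg: "closed_segment \<theta> \<theta>' \<subseteq> \<Theta>" and e: "0 < e"
  shows "\<exists>\<rho>>0. \<forall>\<eta> \<eta>'. closed_segment \<eta> \<eta>' \<subseteq> \<Theta> \<longrightarrow> dist \<eta> \<theta> < \<rho> \<longrightarrow> dist \<eta>' \<theta>' < \<rho> \<longrightarrow>
    (\<forall>t\<in>{0..T}. norm (W \<eta> \<eta>' t x \<mu>\<^sub>0 - W \<theta> \<theta>' t x \<mu>\<^sub>0) \<le> e)"
proof -
  obtain \<rho> where \<rho>: "0 < \<rho>" "\<And>\<theta> \<eta> t. \<theta> \<in> \<Theta> \<Longrightarrow> \<eta> \<in> \<Theta> \<Longrightarrow> dist \<eta> \<theta> < \<rho> \<Longrightarrow> t \<in> {0..T} \<Longrightarrow> norm (db \<eta> t x \<mu>\<^sub>0 - db \<theta> t x \<mu>\<^sub>0) \<le> e"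
    using db_uniform_modulus[OF e, of x] by blast
  have "norm (W \<eta> \<eta>' t x \<mu>\<^sub>0 - W \<theta> \<theta>' t x \<mu>\<^sub>0) \<le> e"
    if h: "closed_segment \<eta> \<eta>' \<subseteq> \<Theta>" "dist \<eta> \<theta> < \<rho> / 2" "dist \<eta>' \<theta>' < \<rho> / 2" "t \<in> {0..T}" for \<eta> \<eta>' t
    unfolding W_def
  proof (intro norm_set_integral_unit_diff_le db_segment_integrable h(1,4) seg \<mu>0(1) \<rho>(2) segment_point)
    fix l :: real assume l: "l \<in> {0..1}"
    have "\<eta> + l *\<^sub>R (\<eta>' - \<eta>) - (\<theta> + l *\<^sub>R (\<theta>' - \<theta>)) = (1 - l) *\<^sub>R (\<eta> - \<theta>) + l *\<^sub>R (\<eta>' - \<theta>')" by (simp add: algebra_simps)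
    also have "norm \<dots> \<le> norm ((1 - l) *\<^sub>R (\<eta> - \<theta>)) + norm (l *\<^sub>R (\<eta>' - \<theta>'))" by (rule norm_triangle_ineq)
    also have "\<dots> \<le> 1 * norm (\<eta> - \<theta>) + 1 * norm (\<eta>' - \<theta>')"
      unfolding norm_scaleR using l by (intro add_mono mult_right_mono) auto
    finally show "dist (\<eta> + l *\<^sub>R (\<eta>' - \<eta>)) (\<theta> + l *\<^sub>R (\<theta>' - \<theta>)) < \<rho>" using h(2,3) by (simp add: dist_norm)
  qed
  then show ?thesis using \<rho>(1) by (intro exI[of _ "\<rho> / 2"]) auto
qed

lemma s_bounds:
  assumes "t \<in> {0..T}"
  shows "norm (s t x *v v) \<le> norm v / m" and "norm v / p \<le> norm (s t x *v v)"
  using elliptic_inv_sqrt_bounds[OF m_pos p_pos, of "\<sigma> t x" "s t x" v] elliptic[OF assms] s_inv[OF assms]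
  by (simp_all add: cmat_def)

lemma seg_grad_eq:
  assumes "closed_segment \<theta> \<theta>' \<subseteq> \<Theta>" and "t \<in> {0..T}" and "\<nu> \<in> P_mom 1"
  shows "seg_grad s db j \<theta> \<theta>' t x \<nu> = (s t x ** W \<theta> \<theta>' t x \<nu>) $ j"
proof -
  interpret bounded_linear "\<lambda>A. (s t x ** A) $ j"
    by (intro bounded_linear_compose[OF bounded_linear_vec_nth] bounded_bilinear.bounded_linear_right[OF bounded_bilinear_matrix_mult])
  show ?thesis
    unfolding seg_grad_def grad_sb_def W_def set_lebesgue_integral_def
    using db_segment_integrable[OF assms, of x] unfolding set_integrable_def
    by (subst integral_bounded_linear[OF bounded_linear_axioms, symmetric]) (simp_all add: scaleR)
qed

lemma seg_grad_inner:
  assumes "closed_segment \<theta> \<theta>' \<subseteq> \<Theta>" and "t \<in> {0..T}" and "\<nu> \<in> P_mom 1"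
  shows "seg_grad s db j \<theta> \<theta>' t x \<nu> \<bullet> z = (s t x *v (W \<theta> \<theta>' t x \<nu> *v z)) $ j"
  unfolding seg_grad_eq[OF assms] matrix_vector_mul_assoc matrix_vector_mul_component ..

text \<open>Test the scalar product formula with the averaged gradient itself as z.\<close>

lemma norm_seg_grad_le:
  assumes "closed_segment \<theta> \<theta>' \<subseteq> \<Theta>" and t: "t \<in> {0..T}" and "\<nu> \<in> P_mom 1"
  shows "norm (seg_grad s db j \<theta> \<theta>' t x \<nu>) \<le> norm (W \<theta> \<theta>' t x \<nu>) / m"
proof -
  let ?v = "seg_grad s db j \<theta> \<theta>' t x \<nu>"
  have "norm ?v * norm ?v = \<bar>(s t x *v (W \<theta> \<theta>' t x \<nu> *v ?v)) $ j\<bar>"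
    unfolding seg_grad_inner[OF assms, symmetric] by (simp add: dot_square_norm power2_eq_square)
  also have "\<dots> \<le> norm (s t x *v (W \<theta> \<theta>' t x \<nu> *v ?v))" by (rule component_le_norm_cart)
  also have "\<dots> \<le> norm (W \<theta> \<theta>' t x \<nu> *v ?v) / m" by (rule s_bounds[OF t])
  also have "\<dots> \<le> norm (W \<theta> \<theta>' t x \<nu>) * norm ?v / m"
    using m_pos by (intro divide_right_mono norm_matrix_vector_mult_le) simp
  finally have "norm ?v * norm ?v \<le> (norm (W \<theta> \<theta>' t x \<nu>) / m) * norm ?v" by simp
  then show ?thesis using m_pos by (cases "?v = 0") (simp_all only: mult_le_cancel_right, simp_all)
qed

end

context mkv_regular begin

section \<open>The information matrix as a quadratic form\<close>

text \<open>Stated for arbitrary measurable arguments, since it is applied both at a fixed time in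
  the space variable and jointly in path and time.\<close>

lemma seg_grad_measurable:
  assumes seg: "closed_segment \<theta> \<theta>' \<subseteq> \<Theta>"
    and t: "t \<in> N \<rightarrow>\<^sub>M restrict_space borel {0..T}" and x: "x \<in> borel_measurable N"
    and \<nu>: "\<nu> \<in> N \<rightarrow>\<^sub>M restrict_space (prob_algebra borel) (P_mom 1)"
  shows "(\<lambda>q. seg_grad s db j \<theta> \<theta>' (t q) (x q) (\<nu> q)) \<in> borel_measurable N"
proof -
  have tq: "t q \<in> {0..T}" "\<nu> q \<in> P_mom 1" if "q \<in> space N" for q
    using measurable_space[OF t that] measurable_space[OF \<nu> that] by (auto simp: space_restrict_space)
  have "(\<lambda>w. indicator {0..1} (snd w) *\<^sub>R db (\<theta> + time_clamp 1 (snd w) *\<^sub>R (\<theta>' - \<theta>)) (t (fst w)) (x (fst w)) (\<nu> (fst w)))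
      \<in> borel_measurable (N \<Otimes>\<^sub>M lborel)"
  proof (intro borel_measurable_scaleR)
    have "(\<lambda>w. time_clamp 1 (snd w)) \<in> borel_measurable (N \<Otimes>\<^sub>M lborel)"
      using measurable_compose[OF measurable_snd, of "time_clamp 1" lborel borel N] by simp
    then have "(\<lambda>w. \<theta> + time_clamp 1 (snd w) *\<^sub>R (\<theta>' - \<theta>)) \<in> N \<Otimes>\<^sub>M lborel \<rightarrow>\<^sub>M restrict_space borel \<Theta>"
      using segment_point[OF time_clamp_in seg]
      by (intro measurable_restrict_space2 borel_measurable_add borel_measurable_scaleR) auto
    then have "(\<lambda>w. (\<theta> + time_clamp 1 (snd w) *\<^sub>R (\<theta>' - \<theta>), t (fst w), x (fst w), \<nu> (fst w))) \<in> N \<Otimes>\<^sub>M lborel \<rightarrow>\<^sub>M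
      restrict_space borel \<Theta> \<Otimes>\<^sub>M restrict_space borel {0..T} \<Otimes>\<^sub>M borel \<Otimes>\<^sub>M restrict_space (prob_algebra borel) (P_mom 1)"
      by (intro measurable_Pair measurable_compose[OF measurable_fst t] measurable_compose[OF measurable_fst x]
          measurable_compose[OF measurable_fst \<nu>])
    from measurable_compose[OF this db_measurable]
    show "(\<lambda>w. db (\<theta> + time_clamp 1 (snd w) *\<^sub>R (\<theta>' - \<theta>)) (t (fst w)) (x (fst w)) (\<nu> (fst w))) \<in> borel_measurable (N \<Otimes>\<^sub>M lborel)"
      by simp
    show "(\<lambda>w. indicator {0..1} (snd w) :: real) \<in> borel_measurable (N \<Otimes>\<^sub>M (lborel :: real measure))"
      by (rule measurable_compose[OF measurable_snd]) simp
  qed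
  then have "(\<lambda>q. \<integral>l. indicator {0..1} l *\<^sub>R db (\<theta> + time_clamp 1 l *\<^sub>R (\<theta>' - \<theta>)) (t q) (x q) (\<nu> q) \<partial>lborel) \<in> borel_measurable N"
    by (intro lborel.borel_measurable_lebesgue_integral) (simp add: split_beta)
  moreover have "(\<integral>l. indicator {0..1} l *\<^sub>R db (\<theta> + time_clamp 1 l *\<^sub>R (\<theta>' - \<theta>)) (t q) (x q) (\<nu> q) \<partial>lborel)
      = W \<theta> \<theta>' (t q) (x q) (\<nu> q)" for q
    unfolding W_def set_lebesgue_integral_def
    by (intro Bochner_Integration.integral_cong) (auto simp: indicator_def time_clamp_id)
  ultimately have mW: "(\<lambda>q. W \<theta> \<theta>' (t q) (x q) (\<nu> q)) \<in> borel_measurable N" by (simp only:)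
  from measurable_compose[OF measurable_Pair[OF t x] s_measurable]
  have ms: "(\<lambda>q. s (t q) (x q)) \<in> borel_measurable N" by simp
  have "(\<lambda>q. (s (t q) (x q) ** W \<theta> \<theta>' (t q) (x q) (\<nu> q)) $ j) \<in> borel_measurable N"
    using mW ms by measurable
  then show ?thesis
    by (subst measurable_cong[OF seg_grad_eq[OF seg tq]]) simp_all
qed

text \<open>Bochner integrals default to 0 when integrability fails, so it must be secured before
  the matrix can be bounded below. The measure changes with t; measurability in t is therefore
  obtained on path space, where Fubini applies with the fixed measure \<open>P \<theta>\<close>. The
  integrand grows quadratically, and second moments are bounded in time.\<close>

lemma information_integrable:
  fixes j :: 'd
  assumes seg: "closed_segment \<theta> \<theta>' \<subseteq> \<Theta>"
  defines "Q \<equiv> \<lambda>t x. (\<chi> k l. seg_grad s db j \<theta> \<theta>' t x (\<mu> \<theta> t) $ k * seg_grad s db j \<theta> \<theta>' t x (\<mu> \<theta> t) $ l)"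
  shows "\<And>t. t \<in> {0..T} \<Longrightarrow> integrable (\<mu> \<theta> t) (Q t)"
    and "set_integrable lborel {0..T} (\<lambda>t. \<integral>x. Q t x \<partial>\<mu> \<theta> t)"
proof -
  have \<theta>: "\<theta> \<in> \<Theta>" using seg by auto
  obtain F B \<Phi> I where D: "diffusion (P \<theta>) F T B \<Phi> I K (path_law.path T) (\<beta> \<theta>) L m" using diffusion[OF \<theta>] by blast
  interpret pl: path_law "P \<theta>" T by (rule path_law[OF \<theta>])
  interpret D: diffusion "P \<theta>" F T B \<Phi> I K "path_law.path T" "\<beta> \<theta>" L m by (rule D)
  obtain A Mb where Mb: "0 \<le> Mb" "\<And>\<theta> t. \<theta> \<in> \<Theta> \<Longrightarrow> t \<in> {0..T} \<Longrightarrow> mean \<theta> t \<le> Mb"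
    by (rule uniform_bounds) (rule that)
  obtain S where S: "\<And>t. t \<in> {0..T} \<Longrightarrow> integrable (P \<theta>) (\<lambda>\<omega>. (norm (pl.path t \<omega>))\<^sup>2)"
      "\<And>t. t \<in> {0..T} \<Longrightarrow> (\<integral>\<omega>. (norm (pl.path t \<omega>))\<^sup>2 \<partial>P \<theta>) \<le> S"
    using D.X_square_bounded by blast
  let ?\<tau> = "time_clamp T"
  let ?v = "\<lambda>t x. seg_grad s db j \<theta> \<theta>' t x (\<mu> \<theta> t)"
  let ?R = "\<lambda>x :: real^'d. (C / m)\<^sup>2 * (2 * ((1 + Mb)\<^sup>2 + (norm x)\<^sup>2))"
  have c: "?\<tau> u \<in> {0..T}" for u using T_pos by (intro time_clamp_in) simp
  have Q: "norm (Q t x) \<le> ?R x" if t: "t \<in> {0..T}" for t x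
  proof -
    have "norm (W \<theta> \<theta>' t x (\<mu> \<theta> t)) \<le> C * (1 + norm x + W1 (\<mu> \<theta> t) \<delta>\<^sub>0)"
      by (rule W_growth[OF seg t marginal_P1[OF \<theta> t]])
    also have "\<dots> \<le> C * (1 + Mb + norm x)"
      using mean_eq(2)[OF \<theta> D t] Mb(2)[OF \<theta> t] C_pos by (intro mult_left_mono) auto
    finally have W: "norm (W \<theta> \<theta>' t x (\<mu> \<theta> t)) / m \<le> C / m * (1 + Mb + norm x)"
      using m_pos by (simp add: divide_right_mono)
    have "norm (Q t x) = (norm (?v t x))\<^sup>2" unfolding Q_def by (rule norm_outer_product)
    also have "\<dots> \<le> (C / m * (1 + Mb + norm x))\<^sup>2"
      using norm_seg_grad_le[OF seg t marginal_P1[OF \<theta> t], of j x] W by (intro power_mono) auto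
    also have "\<dots> \<le> ?R x"
      unfolding power_mult_distrib[of "C / m"] using sum_squares_bound[of "1 + Mb" "norm x"]
      by (intro mult_left_mono) (simp_all add: power2_sum[of "1 + Mb"])
    finally show ?thesis .
  qed
  have op: "(\<lambda>v :: real^'p. \<chi> k l. v $ k * v $ l) \<in> borel_measurable borel"
    by (intro borel_measurable_continuous_onI continuous_intros)
  show 1: "integrable (\<mu> \<theta> t) (Q t)" if t: "t \<in> {0..T}" for t
  proof -
    have "\<mu> \<theta> t \<in> space (restrict_space (prob_algebra borel) (P_mom 1))"
      using marginal_P1[OF \<theta> t] by (auto simp: space_restrict_space P_mom_def)
    then have "(\<lambda>x. ?v t x) \<in> borel_measurable borel"
      using t by (intro seg_grad_measurable[OF seg]) (auto simp: space_restrict_space)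
    from measurable_compose[OF this op] have "Q t \<in> borel_measurable borel" unfolding Q_def .
    moreover have "integrable (P \<theta>) (\<lambda>\<omega>. Q t (pl.path t \<omega>))"
    proof (rule Bochner_Integration.integrable_bound)
      show "integrable (P \<theta>) (\<lambda>\<omega>. ?R (pl.path t \<omega>))"
        using S(1)[OF t] by (intro integrable_mult_right Bochner_Integration.integrable_add) auto
      show "(\<lambda>\<omega>. Q t (pl.path t \<omega>)) \<in> borel_measurable (P \<theta>)"
        by (rule measurable_compose[OF pl.path_measurable \<open>Q t \<in> _\<close>])
      show "AE \<omega> in P \<theta>. norm (Q t (pl.path t \<omega>)) \<le> norm (?R (pl.path t \<omega>))"
        using Q[OF t] by (intro AE_I2) (auto intro: order_trans[OF _ abs_ge_self])
    qed
    ultimately show ?thesis unfolding pl.marginal_eq[OF t] by (subst integrable_distr_eq) auto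
  qed
  have E: "(\<integral>x. Q t x \<partial>\<mu> \<theta> t) = (\<integral>\<omega>. Q t (pl.path t \<omega>) \<partial>P \<theta>)" if t: "t \<in> {0..T}" for t
    using borel_measurable_integrable[OF 1[OF t]] unfolding pl.marginal_eq[OF t] by (subst integral_distr) simp_all
  have "(\<lambda>q. ?v (?\<tau> (snd q)) (pl.path (snd q) (fst q))) \<in> borel_measurable (P \<theta> \<Otimes>\<^sub>M lborel)"
    using T_pos
    by (intro seg_grad_measurable[OF seg] pl.path_joint measurable_compose[OF measurable_snd time_clamp_restrict]
        measurable_compose[OF measurable_snd pl.marginal_measurable]) simp
  from measurable_compose[OF this op]
  have "(\<lambda>q. Q (?\<tau> (snd q)) (pl.path (snd q) (fst q))) \<in> borel_measurable (P \<theta> \<Otimes>\<^sub>M lborel)" unfolding Q_def .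
  then have "(\<lambda>(t, \<omega>). Q (?\<tau> t) (pl.path t \<omega>)) \<in> borel_measurable (lborel \<Otimes>\<^sub>M P \<theta>)"
    by (subst (asm) measurable_pair_swap_iff) (simp add: split_beta)
  then have "(\<lambda>t. \<integral>\<omega>. Q (?\<tau> t) (pl.path t \<omega>) \<partial>P \<theta>) \<in> borel_measurable lborel"
    by (rule pl.borel_measurable_lebesgue_integral)
  then have m: "(\<lambda>t. \<integral>\<omega>. Q (?\<tau> t) (pl.path t \<omega>) \<partial>P \<theta>) \<in> borel_measurable borel" by simp
  have "set_integrable lborel {0..T} (\<lambda>t. \<integral>\<omega>. Q (?\<tau> t) (pl.path t \<omega>) \<partial>P \<theta>)"
  proof (rule set_integrable_bounded[OF m])
    fix t assume t: "t \<in> {0..T}"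
    have "norm (\<integral>\<omega>. Q t (pl.path t \<omega>) \<partial>P \<theta>) \<le> (\<integral>\<omega>. norm (Q t (pl.path t \<omega>)) \<partial>P \<theta>)" by (rule integral_norm_bound)
    also have "\<dots> \<le> (\<integral>\<omega>. ?R (pl.path t \<omega>) \<partial>P \<theta>)"
      using S(1)[OF t] Q[OF t] by (intro integral_mono_AE') (auto intro!: AE_I2)
    also have "\<dots> = (C / m)\<^sup>2 * (2 * ((1 + Mb)\<^sup>2 + (\<integral>\<omega>. (norm (pl.path t \<omega>))\<^sup>2 \<partial>P \<theta>)))"
      using S(1)[OF t] by (simp add: pl.prob_space)
    also have "\<dots> \<le> (C / m)\<^sup>2 * (2 * ((1 + Mb)\<^sup>2 + S))"
      using S(2)[OF t] by (intro mult_left_mono add_left_mono) auto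
    finally show "norm (\<integral>\<omega>. Q (?\<tau> t) (pl.path t \<omega>) \<partial>P \<theta>) \<le> (C / m)\<^sup>2 * (2 * ((1 + Mb)\<^sup>2 + S))"
      by (simp only: time_clamp_id[OF t])
  qed
  then show "set_integrable lborel {0..T} (\<lambda>t. \<integral>x. Q t x \<partial>\<mu> \<theta> t)"
    by (subst set_integrable_cong[OF refl refl]) (simp_all add: time_clamp_id E)
qed

text \<open>The quadratic form is a bounded linear functional of the matrix, so it passes inside
  both integrals, and the sum over j becomes |s W z|^2. Restricting this nonnegative integrand to a
  ball and a time window leaves c^2 times mass times duration.\<close>

lemma information_quadratic_ge:
  assumes seg: "closed_segment \<theta> \<theta>' \<subseteq> \<Theta>" and c: "0 \<le> c" and ab: "0 \<le> a" "a \<le> \<delta>" "\<delta> \<le> T"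
    and low: "\<And>t x. t \<in> {a..\<delta>} \<Longrightarrow> x \<in> ball x1 r \<Longrightarrow> c \<le> norm (s t x *v (W \<theta> \<theta>' t x (\<mu> \<theta> t) *v z))"
    and mass: "\<And>t. t \<in> {a..\<delta>} \<Longrightarrow> \<kappa> \<le> measure (\<mu> \<theta> t) (ball x1 r)"
  shows "c\<^sup>2 * \<kappa> * (\<delta> - a) \<le> z \<bullet> (info_matrix T s db P \<theta> \<theta>' *v z)"
proof -
  have \<theta>: "\<theta> \<in> \<Theta>" using seg by auto
  define Q where "Q j t x = (\<chi> k l. seg_grad s db j \<theta> \<theta>' t x (\<mu> \<theta> t) $ k * seg_grad s db j \<theta> \<theta>' t x (\<mu> \<theta> t) $ l)" for j t x
  note iQ = information_integrable[OF seg, folded Q_def]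
  interpret L: bounded_linear "\<lambda>A :: real^'p^'p. z \<bullet> (A *v z)" by (rule bounded_linear_quadratic_form)
  let ?f = "\<lambda>j t x. (seg_grad s db j \<theta> \<theta>' t x (\<mu> \<theta> t) \<bullet> z)\<^sup>2"
  have LQ: "z \<bullet> (Q j t x *v z) = ?f j t x" for j t x unfolding Q_def by (rule outer_product_quadratic)
  have ix: "integrable (\<mu> \<theta> t) (?f j t)" if "t \<in> {0..T}" for j t
    using integrable_bounded_linear[OF L.bounded_linear_axioms iQ(1)[OF that, of j]] by (simp only: LQ)
  have ex: "z \<bullet> ((\<integral>x. Q j t x \<partial>\<mu> \<theta> t) *v z) = (\<integral>x. ?f j t x \<partial>\<mu> \<theta> t)" if "t \<in> {0..T}" for j t
    using integral_bounded_linear[OF L.bounded_linear_axioms iQ(1)[OF that, of j]] by (simp only: LQ)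
  have it: "set_integrable lborel {0..T} (\<lambda>t. \<integral>x. ?f j t x \<partial>\<mu> \<theta> t)" for j
  proof -
    have "set_integrable lborel {0..T} (\<lambda>t. z \<bullet> ((\<integral>x. Q j t x \<partial>\<mu> \<theta> t) *v z))"
      using integrable_bounded_linear[OF L.bounded_linear_axioms iQ(2)[of j, unfolded set_integrable_def]]
      unfolding set_integrable_def by (simp only: L.scale)
    then show ?thesis by (subst (asm) set_integrable_cong[OF refl refl ex]) simp_all
  qed
  have "z \<bullet> (info_matrix T s db P \<theta> \<theta>' *v z) = (\<Sum>j\<in>UNIV. z \<bullet> ((LINT t:{0..T}|lborel. \<integral>x. Q j t x \<partial>\<mu> \<theta> t) *v z))"
    unfolding info_matrix_def Let_def Q_def[symmetric] by (rule L.sum)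
  also have "\<dots> = (\<Sum>j\<in>UNIV. LINT t:{0..T}|lborel. z \<bullet> ((\<integral>x. Q j t x \<partial>\<mu> \<theta> t) *v z))"
    unfolding set_lebesgue_integral_def
    using integral_bounded_linear[OF L.bounded_linear_axioms iQ(2)[unfolded set_integrable_def]] by (simp only: L.scale)
  also have "\<dots> = (\<Sum>j\<in>UNIV. LINT t:{0..T}|lborel. \<integral>x. ?f j t x \<partial>\<mu> \<theta> t)"
    by (intro sum.cong refl set_lebesgue_integral_cong) (simp_all add: ex)
  also have "\<dots> = (LINT t:{0..T}|lborel. \<Sum>j\<in>UNIV. \<integral>x. ?f j t x \<partial>\<mu> \<theta> t)"
    using it unfolding set_lebesgue_integral_def set_integrable_def scaleR_sum_right by (rule Bochner_Integration.integral_sum[symmetric])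
  finally have eq: "z \<bullet> (info_matrix T s db P \<theta> \<theta>' *v z) = (LINT t:{0..T}|lborel. \<Sum>j\<in>UNIV. \<integral>x. ?f j t x \<partial>\<mu> \<theta> t)" .
  have iS: "set_integrable lborel {0..T} (\<lambda>t. \<Sum>j\<in>UNIV. \<integral>x. ?f j t x \<partial>\<mu> \<theta> t)"
    using it unfolding set_integrable_def scaleR_sum_right by (rule Bochner_Integration.integrable_sum)
  have inner: "c\<^sup>2 * \<kappa> \<le> (\<Sum>j\<in>UNIV. \<integral>x. ?f j t x \<partial>\<mu> \<theta> t)" if t: "t \<in> {a..\<delta>}" for t
  proof -
    have tT: "t \<in> {0..T}" using t ab by auto
    have \<mu>t: "prob_space (\<mu> \<theta> t)" "sets (\<mu> \<theta> t) = sets borel"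
      using marginal_P1[OF \<theta> tT] by (auto simp: P_mom_def space_prob_algebra)
    interpret prob_space "\<mu> \<theta> t" by (rule \<mu>t)
    have sq: "(\<Sum>j\<in>UNIV. ?f j t x) = (norm (s t x *v (W \<theta> \<theta>' t x (\<mu> \<theta> t) *v z)))\<^sup>2" for x
      unfolding power2_norm_eq_inner inner_vec_def[of "s t x *v _"] inner_real_def
      by (simp only: seg_grad_inner[OF seg tT marginal_P1[OF \<theta> tT]] power2_eq_square)
    have "c\<^sup>2 * \<kappa> \<le> c\<^sup>2 * measure (\<mu> \<theta> t) (ball x1 r)" using mass[OF t] by (intro mult_left_mono) auto
    also have "\<dots> = (\<integral>x. c\<^sup>2 * indicator (ball x1 r) x \<partial>\<mu> \<theta> t)" using \<mu>t by simp
    also have "\<dots> \<le> (\<integral>x. (\<Sum>j\<in>UNIV. ?f j t x) \<partial>\<mu> \<theta> t)"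
    proof (rule integral_mono)
      show "integrable (\<mu> \<theta> t) (\<lambda>x. c\<^sup>2 * indicator (ball x1 r) x)"
        using \<mu>t by (intro integrable_mult_right integrable_real_indicator) (auto simp: emeasure_eq_measure)
      show "integrable (\<mu> \<theta> t) (\<lambda>x. \<Sum>j\<in>UNIV. ?f j t x)" by (intro Bochner_Integration.integrable_sum ix tT)
      show "c\<^sup>2 * indicator (ball x1 r) x \<le> (\<Sum>j\<in>UNIV. ?f j t x)" for x
        unfolding sq using low[OF t, of x] c by (auto simp: indicator_def intro: power_mono)
    qed
    also have "\<dots> = (\<Sum>j\<in>UNIV. \<integral>x. ?f j t x \<partial>\<mu> \<theta> t)" by (rule Bochner_Integration.integral_sum) (rule ix[OF tT])
    finally show ?thesis .
  qed
  have "c\<^sup>2 * \<kappa> * (\<delta> - a) = (LINT t:{a..\<delta>}|lborel. c\<^sup>2 * \<kappa>)" using ab by (simp add: set_lebesgue_integral_def)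
  also have "\<dots> \<le> (LINT t:{a..\<delta>}|lborel. \<Sum>j\<in>UNIV. \<integral>x. ?f j t x \<partial>\<mu> \<theta> t)"
    using ab inner by (intro set_integral_mono set_integrable_const_Icc set_integrable_subset[OF iS]) auto
  also have "\<dots> \<le> (LINT t:{0..T}|lborel. \<Sum>j\<in>UNIV. \<integral>x. ?f j t x \<partial>\<mu> \<theta> t)"
    using ab by (intro set_integral_le_superset iS sum_nonneg Bochner_Integration.integral_nonneg) auto
  finally show ?thesis unfolding eq .
qed

end

context mkv_regular begin

section \<open>Local and global lower bounds\<close>

text \<open>The continuity hypothesis concerns the product with \<open>s\<close>, so the lower bound
  at time 0 is carried to small times for that product and afterwards freed of \<open>s\<close> by
  ellipticity, at the cost of a factor m. Only then are the point, the law, the segment and the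
  direction varied.\<close>

lemma information_locally_coercive:
  assumes seg: "closed_segment \<theta> \<theta>' \<subseteq> \<Theta>" and z: "norm z = 1"
    and cont: "AE x in lborel. \<forall>j. continuous (at 0 within {0..T}) (\<lambda>t. seg_grad s db j \<theta> \<theta>' t x (\<mu> \<theta> t))"
    and nondeg: "seg_grad s db j \<theta> \<theta>' 0 y \<mu>\<^sub>0 \<bullet> z \<noteq> 0"
  shows "\<exists>\<rho>>0. \<exists>\<kappa>>0. \<forall>\<eta> \<eta>' w. closed_segment \<eta> \<eta>' \<subseteq> \<Theta> \<longrightarrow> norm w = 1 \<longrightarrow>
    dist \<eta> \<theta> < \<rho> \<longrightarrow> dist \<eta>' \<theta>' < \<rho> \<longrightarrow> dist w z < \<rho> \<longrightarrow> \<kappa> \<le> w \<bullet> (info_matrix T s db P \<eta> \<eta>' *v w)"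
proof -
  have \<theta>: "\<theta> \<in> \<Theta>" using seg by auto
  have T0: "0 \<in> {0..T}" using T_pos by simp
  have mv: "norm (A *v v) \<le> norm A * norm v" for A :: "real^'p^'d" and v by (rule norm_matrix_vector_mult_le)
  obtain A Mb where Mb: "0 \<le> Mb" "\<And>\<theta> t. \<theta> \<in> \<Theta> \<Longrightarrow> t \<in> {0..T} \<Longrightarrow> mean \<theta> t \<le> Mb"
    by (rule uniform_bounds) (rule that)
  have W10: "W1 \<mu>\<^sub>0 \<mu>\<^sub>0 \<le> 0" by (rule W1_self_le[OF \<mu>0(1)])
  \<comment> \<open>Continuous in x, unlike its product with s. So G is nonzero on a neighbourhood
    of y, and that neighbourhood contains a point where continuity in time holds.\<close>
  define G where "G x = W \<theta> \<theta>' 0 x \<mu>\<^sub>0 *v z" for x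
  have "norm (G x' - G x) \<le> C * norm (x' - x)" for x x'
  proof -
    have "norm (G x' - G x) \<le> norm (W \<theta> \<theta>' 0 x' \<mu>\<^sub>0 - W \<theta> \<theta>' 0 x \<mu>\<^sub>0)"
      using mv[of "W \<theta> \<theta>' 0 x' \<mu>\<^sub>0 - W \<theta> \<theta>' 0 x \<mu>\<^sub>0" z] z by (simp add: G_def matrix_vector_mult_diff_rdistrib)
    also have "\<dots> \<le> C * (norm (x' - x) + W1 \<mu>\<^sub>0 \<mu>\<^sub>0)" by (rule W_lipschitz[OF seg T0 \<mu>0(1) \<mu>0(1)])
    also have "\<dots> \<le> C * norm (x' - x)" using W10 C_pos by (intro mult_left_mono) auto
    finally show ?thesis .
  qed
  then have "C-lipschitz_on UNIV G" using C_pos by (intro lipschitz_onI) (auto simp: dist_norm)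
  then have "continuous_on UNIV G" by (rule lipschitz_on_continuous_on)
  then have "open {x. G x \<noteq> 0}" by (rule open_Collect_neq) (rule continuous_on_const)
  moreover have "G y \<noteq> 0"
    using nondeg unfolding seg_grad_inner[OF seg T0 \<mu>0(1)] G_def[symmetric] by auto
  ultimately obtain x1 where x1: "G x1 \<noteq> 0" "\<And>j. continuous (at 0 within {0..T}) (\<lambda>t. seg_grad s db j \<theta> \<theta>' t x1 (\<mu> \<theta> t))"
    using AE_lborel_meets_open[OF _ _ cont, of "{x. G x \<noteq> 0}"] by auto
  define V where "V t = W \<theta> \<theta>' t x1 (\<mu> \<theta> t) *v z" for t
  define e where "e = norm (s 0 x1 *v G x1)"
  have "0 < norm (G x1) / p" using x1(1) p_pos by simp
  then have e: "0 < e" using s_bounds(2)[OF T0, of "G x1" x1] unfolding e_def by linarith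
  have V0: "V 0 = G x1" by (simp add: V_def G_def marginal_0[OF \<theta>])
  have "((\<lambda>t. \<chi> j. seg_grad s db j \<theta> \<theta>' t x1 (\<mu> \<theta> t) \<bullet> z) \<longlongrightarrow> (\<chi> j. seg_grad s db j \<theta> \<theta>' 0 x1 (\<mu> \<theta> 0) \<bullet> z)) (at 0 within {0..T})"
    using x1(2) by (intro tendsto_intros) (simp add: continuous_within)
  then have "((\<lambda>t. norm (\<chi> j. seg_grad s db j \<theta> \<theta>' t x1 (\<mu> \<theta> t) \<bullet> z)) \<longlongrightarrow> norm (\<chi> j. seg_grad s db j \<theta> \<theta>' 0 x1 (\<mu> \<theta> 0) \<bullet> z)) (at 0 within {0..T})"
    by (rule tendsto_norm)
  moreover have sv: "norm (\<chi> j. seg_grad s db j \<theta> \<theta>' t x1 (\<mu> \<theta> t) \<bullet> z) = norm (s t x1 *v V t)" if "t \<in> {0..T}" for t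
    unfolding seg_grad_inner[OF seg that marginal_P1[OF \<theta> that]] V_def by (simp add: vec_nth_inverse)
  ultimately have "((\<lambda>t. norm (\<chi> j. seg_grad s db j \<theta> \<theta>' t x1 (\<mu> \<theta> t) \<bullet> z)) \<longlongrightarrow> e) (at 0 within {0..T})"
    using sv[OF T0] V0 by (simp add: e_def)
  then have "\<forall>\<^sub>F t in at 0 within {0..T}. e / 2 < norm (\<chi> j. seg_grad s db j \<theta> \<theta>' t x1 (\<mu> \<theta> t) \<bullet> z)"
    by (rule order_tendstoD) (use e in simp)
  then obtain d1 where d1: "0 < d1" "\<And>t. t \<in> {0..T} \<Longrightarrow> t \<noteq> 0 \<Longrightarrow> dist t 0 < d1 \<Longrightarrow> e / 2 < norm (\<chi> j. seg_grad s db j \<theta> \<theta>' t x1 (\<mu> \<theta> t) \<bullet> z)"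
    unfolding eventually_at by blast
  \<comment> \<open>For small positive t, the norm of s V exceeds e / 2, and the norm of V is at
    least m times that.\<close>
  define \<epsilon> where "\<epsilon> = m * e / 2"
  have \<epsilon>: "0 < \<epsilon>" using m_pos e by (simp add: \<epsilon>_def)
  have V: "\<epsilon> \<le> norm (V t)" if t: "0 < t" "t < d1" "t \<le> T" for t
  proof -
    have tT: "t \<in> {0..T}" using t by auto
    have "e / 2 < norm (s t x1 *v V t)" using d1(2)[OF tT] t unfolding sv[OF tT] by auto
    also have "\<dots> \<le> norm (V t) / m" by (rule s_bounds(1)[OF tT])
    finally show ?thesis using m_pos by (simp add: \<epsilon>_def field_simps)
  qed
  \<comment> \<open>The ball used below has radius 2 r, so moving the point costs at most C * 2 r =
    \<epsilon> / 8.\<close>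
  define r where "r = \<epsilon> / (16 * C)"
  have r: "0 < r" using \<epsilon> C_pos by (simp add: r_def)
  have "0 < \<epsilon> / (8 * C)" using \<epsilon> C_pos by simp
  from W1_initial_small[OF this] obtain d2 where d2: "0 < d2" "d2 \<le> T"
    "\<And>\<theta> t. \<theta> \<in> \<Theta> \<Longrightarrow> t \<in> {0..d2} \<Longrightarrow> W1 (\<mu> \<theta> t) \<mu>\<^sub>0 \<le> \<epsilon> / (8 * C)" by blast
  obtain \<rho>1 where \<rho>1: "0 < \<rho>1" "\<And>\<eta> \<eta>' t. closed_segment \<eta> \<eta>' \<subseteq> \<Theta> \<Longrightarrow> dist \<eta> \<theta> < \<rho>1 \<Longrightarrow> dist \<eta>' \<theta>' < \<rho>1 \<Longrightarrow>
      t \<in> {0..T} \<Longrightarrow> norm (W \<eta> \<eta>' t x1 \<mu>\<^sub>0 - W \<theta> \<theta>' t x1 \<mu>\<^sub>0) \<le> \<epsilon> / 8"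
    using W_modulus[OF seg, of "\<epsilon> / 8" x1] \<epsilon> by auto
  define R where "R = C * (1 + norm x1 + Mb)"
  have R: "0 < R" using C_pos Mb(1) by (auto simp: R_def intro!: mult_pos_pos add_pos_nonneg)
  define \<rho> where "\<rho> = min \<rho>1 (\<epsilon> / (8 * R))"
  have \<rho>: "0 < \<rho>" using \<rho>1(1) \<epsilon> R by (simp add: \<rho>_def)
  \<comment> \<open>The entries keep the time within the range of continuity and of the Wasserstein
    bound, and the noise small against r.\<close>
  define \<delta> where "\<delta> = min (min (d1 / 2) d2) (r\<^sup>2 / (4 * K\<^sup>2))"
  have \<delta>: "0 < \<delta>" "\<delta> < d1" "\<delta> \<le> d2" "\<delta> \<le> T" "4 * K\<^sup>2 * \<delta> \<le> r\<^sup>2"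
  proof -
    show "0 < \<delta>" "\<delta> < d1" "\<delta> \<le> d2" "\<delta> \<le> T" using d1(1) d2(1,2) r K_pos by (auto simp: \<delta>_def)
    have "\<delta> \<le> r\<^sup>2 / (4 * K\<^sup>2)" by (simp add: \<delta>_def)
    then show "4 * K\<^sup>2 * \<delta> \<le> r\<^sup>2" using K_pos by (simp add: field_simps)
  qed
  obtain \<kappa> h where \<kappa>: "0 < \<kappa>" "0 < h" "h \<le> \<delta>"
    "\<And>\<theta> t. \<theta> \<in> \<Theta> \<Longrightarrow> t \<in> {\<delta> - h..\<delta>} \<Longrightarrow> \<kappa> \<le> measure (\<mu> \<theta> t) (ball x1 (2 * r))"
    using marginal_ball_ge[OF r \<delta>(1,4,5), of x1] by blast
  \<comment> \<open>Half of the window: h may equal \<delta>, and the lower bound on V is known for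
    positive times only.\<close>
  define a where "a = \<delta> - h / 2"
  have a: "0 < a" "0 \<le> a" "a \<le> \<delta>" "\<delta> - h \<le> a" "\<delta> - a = h / 2" using \<kappa> by (auto simp: a_def)
  have "(\<epsilon> / 4 / p)\<^sup>2 * \<kappa> * (h / 2) \<le> w \<bullet> (info_matrix T s db P \<eta> \<eta>' *v w)"
    if seg': "closed_segment \<eta> \<eta>' \<subseteq> \<Theta>" and w: "norm w = 1" and near: "dist \<eta> \<theta> < \<rho>" "dist \<eta>' \<theta>' < \<rho>" "dist w z < \<rho>" for \<eta> \<eta>' w
    unfolding a(5)[symmetric]
  proof (rule information_quadratic_ge[OF seg' _ a(2,3) \<delta>(4)])
    have \<eta>: "\<eta> \<in> \<Theta>" using seg' by auto
    show "0 \<le> \<epsilon> / 4 / p" using \<epsilon> p_pos by simp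
    show "\<kappa> \<le> measure (\<mu> \<eta> t) (ball x1 (2 * r))" if "t \<in> {a..\<delta>}" for t
      using that a by (intro \<kappa>(4)[OF \<eta>]) auto
    fix t x assume t: "t \<in> {a..\<delta>}" and x: "x \<in> ball x1 (2 * r)"
    have tT: "t \<in> {0..T}" and td: "t \<in> {0..d2}" using t a \<delta> by auto
    let ?A = "W \<theta> \<theta>' t x1 (\<mu> \<theta> t)" and ?B = "W \<theta> \<theta>' t x1 \<mu>\<^sub>0" and ?D = "W \<eta> \<eta>' t x1 \<mu>\<^sub>0" and ?E = "W \<eta> \<eta>' t x (\<mu> \<eta> t)"
    have AB: "norm (?A - ?B) \<le> \<epsilon> / 8"
    proof -
      have "norm (?A - ?B) \<le> C * (norm (x1 - x1) + W1 (\<mu> \<theta> t) \<mu>\<^sub>0)" by (rule W_lipschitz[OF seg tT \<mu>0(1) marginal_P1[OF \<theta> tT]])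
      also have "\<dots> \<le> C * (\<epsilon> / (8 * C))" using d2(3)[OF \<theta> td] C_pos by (intro mult_left_mono) auto
      finally show ?thesis using C_pos by simp
    qed
    have DB: "norm (?D - ?B) \<le> \<epsilon> / 8" using near by (intro \<rho>1(2)[OF seg' _ _ tT]) (auto simp: \<rho>_def)
    have ED: "norm (?E - ?D) \<le> \<epsilon> / 4"
    proof -
      have "norm (?E - ?D) \<le> C * (norm (x - x1) + W1 (\<mu> \<eta> t) \<mu>\<^sub>0)" by (rule W_lipschitz[OF seg' tT \<mu>0(1) marginal_P1[OF \<eta> tT]])
      also have "\<dots> \<le> C * (\<epsilon> / (8 * C) + \<epsilon> / (8 * C))"
        using x d2(3)[OF \<eta> td] C_pos by (intro mult_left_mono add_mono) (auto simp: r_def dist_norm norm_minus_commute)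
      finally show ?thesis using C_pos by (simp add: field_simps)
    qed
    have zw: "norm (?A *v (z - w)) \<le> \<epsilon> / 8"
    proof -
      obtain F B \<Phi> I where D: "diffusion (P \<theta>) F T B \<Phi> I K (path_law.path T) (\<beta> \<theta>) L m" using diffusion[OF \<theta>] by blast
      have "norm ?A \<le> C * (1 + norm x1 + W1 (\<mu> \<theta> t) \<delta>\<^sub>0)" by (rule W_growth[OF seg tT marginal_P1[OF \<theta> tT]])
      also have "\<dots> \<le> R" unfolding R_def
        using mean_eq(2)[OF \<theta> D tT] Mb(2)[OF \<theta> tT] C_pos by (intro mult_left_mono) auto
      finally have "norm ?A \<le> R" .
      moreover have "norm (z - w) \<le> \<epsilon> / (8 * R)" using near(3) by (simp add: \<rho>_def dist_norm norm_minus_commute)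
      ultimately have "norm ?A * norm (z - w) \<le> R * (\<epsilon> / (8 * R))" using R by (intro mult_mono) auto
      then show ?thesis using mv[of ?A "z - w"] R by simp
    qed
    have unit: "norm (M *v w) \<le> norm M" for M :: "real^'p^'d" using mv[of M w] w by simp
    have tri: "norm (a + b - c - d + e) \<le> norm a + norm b + norm c + norm d + norm e" for a b c d e :: "real^'d"
      using norm_triangle_ineq[of "a + b - c - d" e] norm_triangle_ineq4[of "a + b - c" d] norm_triangle_ineq4[of "a + b" c]
        norm_triangle_ineq[of a b] by linarith
    \<comment> \<open>Telescoping through the direction, the law, the segment and, jointly, the
      point and the law. The losses are \<epsilon> / 8 three times and \<epsilon> / 4 once, so 3/8
      of \<epsilon> remains.\<close>
    have "V t = ?A *v (z - w) + (?A - ?B) *v w - (?D - ?B) *v w - (?E - ?D) *v w + ?E *v w"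
      by (simp add: V_def matrix_vector_mult_diff_rdistrib matrix_vector_mult_diff_distrib)
    then have "norm (V t) \<le> norm (?A *v (z - w)) + norm ((?A - ?B) *v w) + norm ((?D - ?B) *v w) + norm ((?E - ?D) *v w) + norm (?E *v w)"
      by (simp only: tri)
    moreover have "\<epsilon> \<le> norm (V t)" using t a \<delta> by (intro V) auto
    ultimately have "\<epsilon> / 4 \<le> norm (?E *v w)"
      using zw order_trans[OF unit AB] order_trans[OF unit DB] order_trans[OF unit ED] \<epsilon> by linarith
    then show "\<epsilon> / 4 / p \<le> norm (s t x *v (?E *v w))"
      using s_bounds(2)[OF tT, of "?E *v w" x] p_pos by (meson divide_right_mono less_imp_le order_trans)
  qed
  moreover have "0 < (\<epsilon> / 4 / p)\<^sup>2 * \<kappa> * (h / 2)" using \<epsilon> p_pos \<kappa> by simp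
  ultimately show ?thesis using \<rho> by blast
qed

lemma information_nondegenerate:
  assumes ne: "\<Theta> \<noteq> {}"
    and cont: "\<And>\<theta> \<theta>'. closed_segment \<theta> \<theta>' \<subseteq> \<Theta> \<Longrightarrow>
           AE x in lborel. \<forall>j. continuous (at 0 within {0..T}) (\<lambda>t. seg_grad s db j \<theta> \<theta>' t x (\<mu> \<theta> t))"
    and nondeg: "\<And>\<theta> \<theta>' z. closed_segment \<theta> \<theta>' \<subseteq> \<Theta> \<Longrightarrow> norm z = 1 \<Longrightarrow> \<exists>j x. seg_grad s db j \<theta> \<theta>' 0 x \<mu>\<^sub>0 \<bullet> z \<noteq> 0"
  shows "0 < (INF (\<theta>, \<theta>') \<in> {(\<theta>, \<theta>'). closed_segment \<theta> \<theta>' \<subseteq> \<Theta>}. det (info_matrix T s db P \<theta> \<theta>'))"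
proof -
  let ?S = "{(\<theta>, \<theta>'). closed_segment \<theta> \<theta>' \<subseteq> \<Theta>}"
  let ?f = "\<lambda>q. snd q \<bullet> (info_matrix T s db P (fst (fst q)) (snd (fst q)) *v snd q)"
  have "\<exists>\<kappa>>0. \<forall>q\<in>?S \<times> sphere 0 1. \<kappa> \<le> ?f q"
  proof (rule compact_locally_bounded_below)
    show "compact (?S \<times> sphere 0 1 :: (((real^'p) \<times> (real^'p)) \<times> (real^'p)) set)"
      by (intro compact_Times compact_segments compact compact_sphere)
    fix q :: "((real^'p) \<times> (real^'p)) \<times> (real^'p)" assume "q \<in> ?S \<times> sphere 0 1"
    then obtain \<theta> \<theta>' z where q: "q = ((\<theta>, \<theta>'), z)" "closed_segment \<theta> \<theta>' \<subseteq> \<Theta>" "norm z = 1" by auto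
    obtain j y where jy: "seg_grad s db j \<theta> \<theta>' 0 y \<mu>\<^sub>0 \<bullet> z \<noteq> 0" using nondeg[OF q(2,3)] by blast
    obtain \<rho> \<kappa> where \<rho>: "0 < \<rho>" "0 < \<kappa>" "\<And>\<eta> \<eta>' w. closed_segment \<eta> \<eta>' \<subseteq> \<Theta> \<Longrightarrow> norm w = 1 \<Longrightarrow>
        dist \<eta> \<theta> < \<rho> \<Longrightarrow> dist \<eta>' \<theta>' < \<rho> \<Longrightarrow> dist w z < \<rho> \<Longrightarrow> \<kappa> \<le> w \<bullet> (info_matrix T s db P \<eta> \<eta>' *v w)"
      using information_locally_coercive[OF q(2,3) cont[OF q(2)] jy] by blast
    show "\<exists>U \<kappa>. open U \<and> q \<in> U \<and> 0 < \<kappa> \<and> (\<forall>y\<in>(?S \<times> sphere 0 1) \<inter> U. \<kappa> \<le> ?f y)"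
      using \<rho> by (intro exI[of _ "(ball \<theta> \<rho> \<times> ball \<theta>' \<rho>) \<times> ball z \<rho>"] exI[of _ \<kappa>]) (auto simp: q open_Times dist_commute)
  qed
  then obtain \<kappa> where \<kappa>: "0 < \<kappa>" "\<And>\<theta> \<theta>' z. closed_segment \<theta> \<theta>' \<subseteq> \<Theta> \<Longrightarrow> norm z = 1 \<Longrightarrow> \<kappa> \<le> z \<bullet> (info_matrix T s db P \<theta> \<theta>' *v z)"
    by force
  obtain c where c: "0 < c" "\<And>A :: real^'p^'p. (\<forall>z. norm z = 1 \<longrightarrow> \<kappa> \<le> z \<bullet> (A *v z)) \<Longrightarrow> c \<le> det A"
    using det_coercive_bound[OF \<kappa>(1)] by blast
  \<comment> \<open>A degenerate segment shows that the index set is nonempty, without which the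
    infimum of reals would be unspecified.\<close>
  obtain \<theta> where "\<theta> \<in> \<Theta>" using ne by blast
  then have "(\<theta>, \<theta>) \<in> ?S" by simp
  then have ne: "?S \<noteq> {}" by blast
  have "c \<le> (INF q\<in>?S. case q of (\<theta>, \<theta>') \<Rightarrow> det (info_matrix T s db P \<theta> \<theta>'))"
    using c(2) \<kappa>(2) by (intro cINF_greatest[OF ne]) auto
  then show ?thesis using c(1) by simp
qed

end

section \<open>Regularity of the drift from the assumptions\<close>

lemma norm_matrix_vector_le_columns:
  fixes A :: "real^'p^'d" and c :: real
  assumes "\<And>l. norm (column l A) \<le> c"
  shows "norm A \<le> CARD('p) * c"
proof -
  have "norm A \<le> (\<Sum>l\<in>UNIV. norm (column l A))" by (rule norm_matrix_le_sum_columns)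
  also have "\<dots> \<le> (\<Sum>l\<in>(UNIV :: 'p set). c)" by (intro sum_mono assms)
  finally show ?thesis by simp
qed

lemma column_diff: "column l (A - B) = column l A - column l (B :: 'a :: ab_group_add^'p^'d)"
  by (simp add: column_def vec_eq_iff)

text \<open>Mean value inequality on a ball inside the interior; the derivative bound B is uniform
  in t, hence so is the modulus. The radius uses B + 1 since B may be 0.\<close>

lemma derivative_bound_modulus:
  fixes f :: "'a :: real_normed_vector \<Rightarrow> real \<Rightarrow> 'b :: real_normed_vector"
  assumes \<theta>: "\<theta> \<in> interior \<Theta>" and e: "0 < e" and B: "0 \<le> B"
    and f: "\<And>\<eta> t. \<eta> \<in> interior \<Theta> \<Longrightarrow> t \<in> {0..T} \<Longrightarrow>
      \<exists>f'. ((\<lambda>\<zeta>. f \<zeta> t) has_derivative f') (at \<eta>) \<and> (\<forall>h. norm (f' h) \<le> B * norm h)"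
  shows "\<exists>\<rho>>0. \<forall>\<eta>\<in>\<Theta>. dist \<eta> \<theta> < \<rho> \<longrightarrow> (\<forall>t\<in>{0..T}. norm (f \<eta> t - f \<theta> t) \<le> e)"
proof -
  obtain \<rho>0 where \<rho>0: "0 < \<rho>0" "ball \<theta> \<rho>0 \<subseteq> interior \<Theta>" using \<theta> open_contains_ball[of "interior \<Theta>"] by auto
  define \<rho> where "\<rho> = min \<rho>0 (e / (B + 1))"
  have \<rho>: "0 < \<rho>" using \<rho>0 e B by (simp add: \<rho>_def)
  have "norm (f \<eta> t - f \<theta> t) \<le> e" if \<eta>: "dist \<eta> \<theta> < \<rho>" and t: "t \<in> {0..T}" for \<eta> t
  proof -
    obtain f' where f': "\<And>\<zeta>. \<zeta> \<in> interior \<Theta> \<Longrightarrow> ((\<lambda>\<zeta>. f \<zeta> t) has_derivative f' \<zeta>) (at \<zeta>)"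
        "\<And>\<zeta> h. \<zeta> \<in> interior \<Theta> \<Longrightarrow> norm (f' \<zeta> h) \<le> B * norm h"
      using f[OF _ t] by metis
    have "norm (f \<eta> t - f \<theta> t) \<le> B * norm (\<eta> - \<theta>)"
    proof (rule differentiable_bound[where S = "ball \<theta> \<rho>0" and f' = f'])
      fix \<zeta> assume "\<zeta> \<in> ball \<theta> \<rho>0"
      then have "\<zeta> \<in> interior \<Theta>" using \<rho>0 by auto
      then show "((\<lambda>\<zeta>. f \<zeta> t) has_derivative f' \<zeta>) (at \<zeta> within ball \<theta> \<rho>0)" "onorm (f' \<zeta>) \<le> B"
        using f' B by (auto intro: has_derivative_at_withinI onorm_bound)
    qed (use \<eta> \<rho>0 in \<open>auto simp: \<rho>_def dist_commute\<close>)
    also have "\<dots> \<le> (B + 1) * (e / (B + 1))"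
      using \<eta> B by (intro mult_mono) (auto simp: \<rho>_def dist_norm)
    finally show ?thesis using B by simp
  qed
  then show ?thesis using \<rho> by blast
qed

lemma uniform_limit_modulus:
  fixes f :: "'a :: metric_space \<Rightarrow> real \<Rightarrow> 'b :: real_normed_vector"
  assumes "uniform_limit S f (f \<theta>) (at \<theta> within \<Theta>)" and e: "0 < e"
  shows "\<exists>\<rho>>0. \<forall>\<eta>\<in>\<Theta>. dist \<eta> \<theta> < \<rho> \<longrightarrow> (\<forall>t\<in>S. norm (f \<eta> t - f \<theta> t) \<le> e)"
proof -
  have "\<forall>\<^sub>F \<eta> in at \<theta> within \<Theta>. \<forall>t\<in>S. dist (f \<eta> t) (f \<theta> t) < e" using assms by (simp add: uniform_limit_iff)
  then obtain \<rho> where "0 < \<rho>" "\<And>\<eta>. \<eta> \<in> \<Theta> \<Longrightarrow> \<eta> \<noteq> \<theta> \<Longrightarrow> dist \<eta> \<theta> < \<rho> \<Longrightarrow> \<forall>t\<in>S. dist (f \<eta> t) (f \<theta> t) < e"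
    unfolding eventually_at by blast
  then show ?thesis using e by (intro exI[of _ \<rho>]) (force simp: dist_norm)
qed

text \<open>Interior and frontier parameters are treated apart: in the interior the moduli of
  continuity come from derivative bounds, on the frontier from the uniform limits of the boundary
  extension.\<close>

lemma mkv_regular_of_assumptions:
  fixes T :: real
    and \<Theta> :: "(real^'p) set"
    and \<mu>\<^sub>0 :: "(real^'d) measure"
    and \<sigma> s :: "real \<Rightarrow> real^'d \<Rightarrow> real^'d^'d"
    and b :: "real^'p \<Rightarrow> real \<Rightarrow> real^'d \<Rightarrow> (real^'d) measure \<Rightarrow> real^'d"
    and db :: "real^'p \<Rightarrow> real \<Rightarrow> real^'d \<Rightarrow> (real^'d) measure \<Rightarrow> real^'p^'d"
    and P :: "real^'p \<Rightarrow> (real \<Rightarrow> real^'d) measure"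
  assumes T: "0 < T" and \<Theta>: "compact \<Theta>" and mom: "moment_assumption \<mu>\<^sub>0"
    and dif: "diffusion_assumption T \<sigma>" and inv: "is_inv_sqrt T \<sigma> s"
    and drift: "drift_assumption T \<Theta> b" and smooth: "smoothness_assumption T \<Theta> b db"
    and bdry: "boundary_extension T \<Theta> b db"
    and law: "\<forall>\<theta>\<in>\<Theta>. mckean_vlasov_law T \<mu>\<^sub>0 \<sigma> (b \<theta>) (P \<theta>)"
  shows "\<exists>m p L C K. mkv_regular T \<Theta> \<mu>\<^sub>0 \<sigma> s b db P m p L C K"
proof -
  let ?\<delta> = "return borel 0 :: (real^'d) measure"
  obtain m p where mp: "0 < m" "0 < p"
    "\<And>t x y. t \<in> {0..T} \<Longrightarrow> m\<^sup>2 * (norm y)\<^sup>2 \<le> (cmat \<sigma> t x *v y) \<bullet> y"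
    "\<And>t x y. t \<in> {0..T} \<Longrightarrow> (cmat \<sigma> t x *v y) \<bullet> y \<le> p\<^sup>2 * (norm y)\<^sup>2"
    using dif unfolding diffusion_assumption_def by blast
  obtain Lb where Lb: "0 \<le> Lb" "\<And>\<theta> t x x' \<nu> \<nu>'. \<theta> \<in> \<Theta> \<Longrightarrow> t \<in> {0..T} \<Longrightarrow> \<nu> \<in> P_mom 1 \<Longrightarrow> \<nu>' \<in> P_mom 1 \<Longrightarrow>
        norm (b \<theta> t x' \<nu>' - b \<theta> t x \<nu>) \<le> Lb * (norm (x' - x) + W1 \<nu>' \<nu>)"
    using drift unfolding drift_assumption_def by blast
  \<comment> \<open>Names the pointwise content of the smoothness assumption, so that the constants
    can be extracted without the quantifiers inside.\<close>
  define R where "R r1 r2 C \<theta> t x \<nu> \<longleftrightarrow>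
        ((\<lambda>\<eta>. b \<eta> t x \<nu>) has_derivative (\<lambda>h. db \<theta> t x \<nu> *v h)) (at \<theta>) \<and>
        (\<exists>H :: 'p \<Rightarrow> 'p \<Rightarrow> real^'d.
           (\<forall>l. ((\<lambda>\<eta>. column l (db \<eta> t x \<nu>)) has_derivative (\<lambda>h. \<Sum>l'\<in>UNIV. (h $ l') *\<^sub>R H l l')) (at \<theta>)) \<and>
           (\<nu> \<in> P_mom r2 \<longrightarrow> (\<forall>l l'. norm (column l (db \<theta> t x \<nu>)) + norm (H l l')
              \<le> C * (1 + norm x powr r1 + moment r2 \<nu>)))) \<and>
        (\<forall>x'. \<forall>\<nu>'\<in>P_mom 1. \<forall>l.
           norm (column l (db \<theta> t x' \<nu>') - column l (db \<theta> t x \<nu>)) \<le> C * (norm (x' - x) + W1 \<nu>' \<nu>))"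
    for r1 r2 C \<theta> t x \<nu>
  have "\<exists>r1\<ge>1. \<exists>r2\<ge>1. \<exists>C>0. \<forall>\<theta>\<in>interior \<Theta>. \<forall>t\<in>{0..T}. \<forall>x. \<forall>\<nu>\<in>P_mom 1. R r1 r2 C \<theta> t x \<nu>"
    using smooth unfolding smoothness_assumption_def R_def .
  then obtain r1 r2 C1 where r: "1 \<le> r1" "1 \<le> r2" "0 < C1"
    and sm: "\<And>\<theta> t x \<nu>. \<theta> \<in> interior \<Theta> \<Longrightarrow> t \<in> {0..T} \<Longrightarrow> \<nu> \<in> P_mom 1 \<Longrightarrow> R r1 r2 C1 \<theta> t x \<nu>"
    by blast
  have b_deriv: "((\<lambda>\<eta>. b \<eta> t x \<nu>) has_derivative (\<lambda>h. db \<theta> t x \<nu> *v h)) (at \<theta>)"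
    and db_lip: "norm (column l (db \<theta> t x' \<nu>') - column l (db \<theta> t x \<nu>)) \<le> C1 * (norm (x' - x) + W1 \<nu>' \<nu>)"
    if "\<theta> \<in> interior \<Theta>" "t \<in> {0..T}" "\<nu> \<in> P_mom 1" "\<nu>' \<in> P_mom 1" for \<theta> t x x' \<nu> \<nu>' l
    using sm[OF that(1,2,3), of x] that(4) unfolding R_def by blast+
  have db_deriv: "\<exists>H :: 'p \<Rightarrow> 'p \<Rightarrow> real^'d.
      (\<forall>l. ((\<lambda>\<eta>. column l (db \<eta> t x \<nu>)) has_derivative (\<lambda>h. \<Sum>l'\<in>UNIV. (h $ l') *\<^sub>R H l l')) (at \<theta>)) \<and>
      (\<forall>l l'. norm (column l (db \<theta> t x \<nu>)) + norm (H l l') \<le> C1 * (1 + norm x powr r1 + moment r2 \<nu>))"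
    if "\<theta> \<in> interior \<Theta>" "t \<in> {0..T}" "\<nu> \<in> P_mom 1" "\<nu> \<in> P_mom r2" for \<theta> t x \<nu>
    using sm[OF that(1,2,3), of x] that(4) unfolding R_def by blast
  obtain r3 r4 C2 where r': "1 \<le> r3" "1 \<le> r4" "0 < C2"
    and bd: "\<And>\<theta> t x \<nu> l. \<theta> \<in> frontier \<Theta> \<Longrightarrow> t \<in> {0..T} \<Longrightarrow> \<nu> \<in> P_mom 1 \<Longrightarrow>
        (\<nu> \<in> P_mom r4 \<longrightarrow> norm (column l (db \<theta> t x \<nu>)) \<le> C2 * (1 + norm x powr r3 + moment r4 \<nu>)) \<and>
        (\<forall>x'. \<forall>\<nu>'\<in>P_mom 1. norm (column l (db \<theta> t x' \<nu>') - column l (db \<theta> t x \<nu>)) \<le> C2 * (norm (x' - x) + W1 \<nu>' \<nu>))"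
    using bdry unfolding boundary_extension_def by blast
  have lim: "uniform_limit {0..T} (\<lambda>\<eta> t. b \<eta> t x \<nu>) (\<lambda>t. b \<theta> t x \<nu>) (at \<theta> within \<Theta>)"
      "uniform_limit {0..T} (\<lambda>\<eta> t. db \<eta> t x \<nu>) (\<lambda>t. db \<theta> t x \<nu>) (at \<theta> within \<Theta>)"
    if "\<theta> \<in> frontier \<Theta>" "\<nu> \<in> (\<Inter>r\<in>{1..}. P_mom r)" for \<theta> x \<nu>
    using bdry that unfolding boundary_extension_def by blast+
  have \<delta>: "?\<delta> \<in> P_mom r" if "1 \<le> r" for r using that by (intro return_0_P_mom) simp
  have \<mu>0: "\<mu>\<^sub>0 \<in> P_mom r" if "1 \<le> r" for r using mom that by (simp add: moment_assumption_def)
  have cases: "\<theta> \<in> interior \<Theta> \<or> \<theta> \<in> frontier \<Theta>" if "\<theta> \<in> \<Theta>" for \<theta>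
    using that closure_subset[of \<Theta>] by (auto simp: frontier_def)
  define N where "N = real CARD('p)"
  have N: "0 < N" by (simp add: N_def)
  \<comment> \<open>The factor N passes from columns to the matrix norm; the sum C1 + C2 serves
    interior and frontier at once.\<close>
  define C where "C = N * (C1 + C2)"
  have col_origin: "norm (column l (db \<theta> t 0 ?\<delta>)) \<le> C1 + C2" if h: "\<theta> \<in> \<Theta>" "t \<in> {0..T}" for \<theta> t l
    using cases[OF h(1)]
  proof
    assume i: "\<theta> \<in> interior \<Theta>"
    obtain H :: "'p \<Rightarrow> 'p \<Rightarrow> real^'d"
      where H: "norm (column l (db \<theta> t 0 ?\<delta>)) + norm (H l l) \<le> C1 * (1 + norm (0 :: real^'d) powr r1 + moment r2 ?\<delta>)"
      using db_deriv[OF i h(2) \<delta>[OF order_refl] \<delta>[OF r(2)], of 0] by blast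
    have "C1 * (1 + norm (0 :: real^'d) powr r1 + moment r2 ?\<delta>) = C1" using r by (simp add: moment_return_0)
    then show ?thesis using H r' norm_ge_zero[of "H l l"] by linarith
  next
    assume "\<theta> \<in> frontier \<Theta>"
    then have "norm (column l (db \<theta> t 0 ?\<delta>)) \<le> C2 * (1 + norm (0 :: real^'d) powr r3 + moment r4 ?\<delta>)"
      using bd[OF _ h(2) \<delta>[OF order_refl]] \<delta>[OF r'(2)] by blast
    then show ?thesis using r r' by (simp add: moment_return_0)
  qed
  have W1_nonneg: "0 \<le> W1 \<nu> \<nu>'" for \<nu> \<nu>' :: "(real^'d) measure" by (simp add: W1_def)
  have col_lip: "norm (column l (db \<theta> t x' \<nu>') - column l (db \<theta> t x \<nu>)) \<le> (C1 + C2) * (norm (x' - x) + W1 \<nu>' \<nu>)"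
    if h: "\<theta> \<in> \<Theta>" "t \<in> {0..T}" "\<nu> \<in> P_mom 1" "\<nu>' \<in> P_mom 1" for \<theta> t x x' \<nu> \<nu>' l
    using cases[OF h(1)]
  proof
    assume i: "\<theta> \<in> interior \<Theta>"
    then have "norm (column l (db \<theta> t x' \<nu>') - column l (db \<theta> t x \<nu>)) \<le> C1 * (norm (x' - x) + W1 \<nu>' \<nu>)"
      by (rule db_lip[OF _ h(2,3,4)])
    also have "\<dots> \<le> (C1 + C2) * (norm (x' - x) + W1 \<nu>' \<nu>)" using r r' W1_nonneg by (intro mult_right_mono) auto
    finally show ?thesis .
  next
    assume i: "\<theta> \<in> frontier \<Theta>"
    then have "norm (column l (db \<theta> t x' \<nu>') - column l (db \<theta> t x \<nu>)) \<le> C2 * (norm (x' - x) + W1 \<nu>' \<nu>)"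
      using bd[OF i h(2,3), of l x] h(4) by blast
    also have "\<dots> \<le> (C1 + C2) * (norm (x' - x) + W1 \<nu>' \<nu>)" using r r' W1_nonneg by (intro mult_right_mono) auto
    finally show ?thesis .
  qed
  \<comment> \<open>The Lipschitz constant of the drift may be 0, hence Lb + 1.\<close>
  have "mkv_regular T \<Theta> \<mu>\<^sub>0 \<sigma> s b db P m p (Lb + 1) C (sqrt (CARD('d) * p\<^sup>2))"
  proof
    show "sqrt (CARD('d) * p\<^sup>2) = sqrt (CARD('d) * p\<^sup>2)" ..
    show "0 < T" "compact \<Theta>" by (fact T \<Theta>)+
    show "\<mu>\<^sub>0 \<in> P_mom 1" "\<mu>\<^sub>0 \<in> P_mom 2" by (simp_all add: \<mu>0)
    show "(\<lambda>(t, x). \<sigma> t x) \<in> borel_measurable (restrict_space borel {0..T} \<Otimes>\<^sub>M borel)"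
      using dif by (simp add: diffusion_assumption_def)
    show "0 < m" "0 < p" by (fact mp)+
    show "m\<^sup>2 * (norm y)\<^sup>2 \<le> (cmat \<sigma> t x *v y) \<bullet> y" "(cmat \<sigma> t x *v y) \<bullet> y \<le> p\<^sup>2 * (norm y)\<^sup>2" if "t \<in> {0..T}" for t x y
      using mp(3,4) that by auto
    show "(\<lambda>(t, x). s t x) \<in> borel_measurable (restrict_space borel {0..T} \<Otimes>\<^sub>M borel)"
      using inv by (simp add: is_inv_sqrt_def)
    show "transpose (s t x) ** s t x = matrix_inv (cmat \<sigma> t x)" if "t \<in> {0..T}" for t x
      using inv that by (simp add: is_inv_sqrt_def)
    show "0 < Lb + 1" using Lb(1) by simp
    show C: "0 < C" using N r r' by (simp add: C_def)
    show "(\<lambda>(\<theta>, t, x, \<nu>). b \<theta> t x \<nu>) \<in> borel_measurable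
        (restrict_space borel \<Theta> \<Otimes>\<^sub>M restrict_space borel {0..T} \<Otimes>\<^sub>M borel \<Otimes>\<^sub>M restrict_space (prob_algebra borel) (P_mom 1))"
      using drift by (simp add: drift_assumption_def)
    show "(\<lambda>(\<theta>, t, x, \<nu>). db \<theta> t x \<nu>) \<in> borel_measurable
        (restrict_space borel \<Theta> \<Otimes>\<^sub>M restrict_space borel {0..T} \<Otimes>\<^sub>M borel \<Otimes>\<^sub>M restrict_space (prob_algebra borel) (P_mom 1))"
      using bdry by (simp add: boundary_extension_def)
    show "norm (b \<theta> t x' \<nu>' - b \<theta> t x \<nu>) \<le> (Lb + 1) * (norm (x' - x) + W1 \<nu>' \<nu>)"
      if "\<theta> \<in> \<Theta>" "t \<in> {0..T}" "\<nu> \<in> P_mom 1" "\<nu>' \<in> P_mom 1" for \<theta> t x x' \<nu> \<nu>'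
      using Lb(2)[OF that, of x' x] W1_nonneg[of \<nu>' \<nu>] norm_ge_zero[of "x' - x"]
      by (simp only: distrib_right mult_1)
    show "norm (db \<theta> t x' \<nu>' - db \<theta> t x \<nu>) \<le> C * (norm (x' - x) + W1 \<nu>' \<nu>)"
      if "\<theta> \<in> \<Theta>" "t \<in> {0..T}" "\<nu> \<in> P_mom 1" "\<nu>' \<in> P_mom 1" for \<theta> t x x' \<nu> \<nu>'
      unfolding C_def N_def mult.assoc
      by (rule norm_matrix_vector_le_columns) (unfold column_diff, rule col_lip[OF that])
    show "norm (db \<theta> t 0 ?\<delta>) \<le> C" if "\<theta> \<in> \<Theta>" "t \<in> {0..T}" for \<theta> t
      unfolding C_def N_def by (rule norm_matrix_vector_le_columns) (rule col_origin[OF that])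
    show "\<exists>\<rho>>0. \<forall>\<eta>\<in>\<Theta>. dist \<eta> \<theta> < \<rho> \<longrightarrow> (\<forall>t\<in>{0..T}. norm (b \<eta> t 0 ?\<delta> - b \<theta> t 0 ?\<delta>) \<le> e)"
      if \<theta>: "\<theta> \<in> \<Theta>" and e: "0 < e" for \<theta> e
      using cases[OF \<theta>]
    proof
      assume i: "\<theta> \<in> interior \<Theta>"
      show ?thesis
      proof (rule derivative_bound_modulus[OF i e, of C])
        fix \<eta> t assume \<eta>: "\<eta> \<in> interior \<Theta>" and t: "t \<in> {0..T}"
        have "norm (db \<eta> t 0 ?\<delta> *v h) \<le> C * norm h" for h
        proof -
          have "norm (db \<eta> t 0 ?\<delta>) \<le> C"
            unfolding C_def N_def using interior_subset[of \<Theta>] \<eta> t by (intro norm_matrix_vector_le_columns col_origin) auto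
          then have "norm (db \<eta> t 0 ?\<delta>) * norm h \<le> C * norm h" by (intro mult_right_mono) auto
          then show ?thesis using norm_matrix_vector_mult_le[of "db \<eta> t 0 ?\<delta>" h] by linarith
        qed
        then show "\<exists>f'. ((\<lambda>\<zeta>. b \<zeta> t 0 ?\<delta>) has_derivative f') (at \<eta>) \<and> (\<forall>h. norm (f' h) \<le> C * norm h)"
          using b_deriv[OF \<eta> t \<delta>[OF order_refl] \<delta>[OF order_refl]] by blast
      qed (use C in simp)
    next
      assume "\<theta> \<in> frontier \<Theta>"
      then show ?thesis using \<delta> by (intro uniform_limit_modulus[OF lim(1) e]) auto
    qed
    show "\<exists>\<rho>>0. \<forall>\<eta>\<in>\<Theta>. dist \<eta> \<theta> < \<rho> \<longrightarrow> (\<forall>t\<in>{0..T}. norm (db \<eta> t x \<mu>\<^sub>0 - db \<theta> t x \<mu>\<^sub>0) \<le> e)"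
      if \<theta>: "\<theta> \<in> \<Theta>" and e: "0 < e" for \<theta> x e
      using cases[OF \<theta>]
    proof
      assume i: "\<theta> \<in> interior \<Theta>"
      \<comment> \<open>Bounds the derivative in the parameter of each column at the fixed point x
        and law \<open>\<mu>\<^sub>0\<close>, uniformly in t and over the interior; N counts the
        coordinates of the parameter.\<close>
      define B where "B = N * (C1 * (1 + norm x powr r1 + moment r2 \<mu>\<^sub>0))"
      have mom0: "0 \<le> moment r2 \<mu>\<^sub>0" unfolding moment_def by (intro Bochner_Integration.integral_nonneg) simp
      then have B: "0 \<le> B" using N r by (auto simp: B_def intro!: mult_nonneg_nonneg add_nonneg_nonneg)
      have col: "\<exists>\<rho>>0. \<forall>\<eta>\<in>\<Theta>. dist \<eta> \<theta> < \<rho> \<longrightarrow> (\<forall>t\<in>{0..T}. norm (column l (db \<eta> t x \<mu>\<^sub>0) - column l (db \<theta> t x \<mu>\<^sub>0)) \<le> e / N)" for l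
      proof (rule derivative_bound_modulus[OF i _ B])
        show "0 < e / N" using e N by simp
        fix \<eta> t assume \<eta>: "\<eta> \<in> interior \<Theta>" and t: "t \<in> {0..T}"
        obtain H :: "'p \<Rightarrow> 'p \<Rightarrow> real^'d"
          where H: "((\<lambda>\<zeta>. column l (db \<zeta> t x \<mu>\<^sub>0)) has_derivative (\<lambda>h. \<Sum>l'\<in>UNIV. (h $ l') *\<^sub>R H l l')) (at \<eta>)"
            "\<And>l'. norm (column l (db \<eta> t x \<mu>\<^sub>0)) + norm (H l l') \<le> C1 * (1 + norm x powr r1 + moment r2 \<mu>\<^sub>0)"
          using db_deriv[OF \<eta> t \<mu>0[OF order_refl] \<mu>0[OF r(2)], of x] by blast
        have Hb: "norm (H l l') \<le> C1 * (1 + norm x powr r1 + moment r2 \<mu>\<^sub>0)" for l'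
          using H(2)[of l'] norm_ge_zero[of "column l (db \<eta> t x \<mu>\<^sub>0)"] by linarith
        have "norm (\<Sum>l'\<in>UNIV. (h $ l') *\<^sub>R H l l') \<le> B * norm h" for h :: "real^'p"
        proof -
          have "norm (\<Sum>l'\<in>UNIV. (h $ l') *\<^sub>R H l l') \<le> (\<Sum>l'\<in>(UNIV :: 'p set). norm h * (C1 * (1 + norm x powr r1 + moment r2 \<mu>\<^sub>0)))"
            using Hb component_le_norm_cart[of h] by (intro sum_norm_le) (auto intro!: mult_mono)
          then show ?thesis by (simp add: B_def N_def mult_ac)
        qed
        then show "\<exists>f'. ((\<lambda>\<zeta>. column l (db \<zeta> t x \<mu>\<^sub>0)) has_derivative f') (at \<eta>) \<and> (\<forall>h. norm (f' h) \<le> B * norm h)"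
          using H(1) by blast
      qed
      then obtain \<rho> where \<rho>: "\<And>l. 0 < \<rho> l" "\<And>l \<eta> t. \<eta> \<in> \<Theta> \<Longrightarrow> dist \<eta> \<theta> < \<rho> l \<Longrightarrow> t \<in> {0..T} \<Longrightarrow>
          norm (column l (db \<eta> t x \<mu>\<^sub>0) - column l (db \<theta> t x \<mu>\<^sub>0)) \<le> e / N"
        by metis
      have "norm (db \<eta> t x \<mu>\<^sub>0 - db \<theta> t x \<mu>\<^sub>0) \<le> e" if "\<eta> \<in> \<Theta>" "dist \<eta> \<theta> < Min (range \<rho>)" "t \<in> {0..T}" for \<eta> t
      proof -
        have "norm (db \<eta> t x \<mu>\<^sub>0 - db \<theta> t x \<mu>\<^sub>0) \<le> real CARD('p) * (e / N)"
          using that by (intro norm_matrix_vector_le_columns, unfold column_diff, intro \<rho>(2)) auto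
        then show ?thesis by (simp add: N_def)
      qed
      moreover have "0 < Min (range \<rho>)" using \<rho>(1) by simp
      ultimately show ?thesis by blast
    next
      assume "\<theta> \<in> frontier \<Theta>"
      then show ?thesis using \<mu>0 by (intro uniform_limit_modulus[OF lim(2) e]) auto
    qed
    show "mckean_vlasov_law T \<mu>\<^sub>0 \<sigma> (b \<theta>) (P \<theta>)" if "\<theta> \<in> \<Theta>" for \<theta> using law that by blast
  qed
  then show ?thesis by blast
qed

theorem proposition15:
  fixes T :: real
    and \<Theta> :: "(real^'p) set"
    and \<mu>\<^sub>0 :: "(real^'d) measure"
    and \<sigma> s :: "real \<Rightarrow> real^'d \<Rightarrow> real^'d^'d"
    and b :: "real^'p \<Rightarrow> real \<Rightarrow> real^'d \<Rightarrow> (real^'d) measure \<Rightarrow> real^'d"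
    and db :: "real^'p \<Rightarrow> real \<Rightarrow> real^'d \<Rightarrow> (real^'d) measure \<Rightarrow> real^'p^'d"
    and P :: "real^'p \<Rightarrow> (real \<Rightarrow> real^'d) measure"
  assumes "0 < T"
    and "compact \<Theta>" and "interior \<Theta> \<noteq> {}"
    and "moment_assumption \<mu>\<^sub>0"
    and "diffusion_assumption T \<sigma>"
    and "is_inv_sqrt T \<sigma> s"
    and "drift_assumption T \<Theta> b"
    and "smoothness_assumption T \<Theta> b db"
    and "boundary_extension T \<Theta> b db"
    and "\<forall>\<theta>\<in>\<Theta>. mckean_vlasov_law T \<mu>\<^sub>0 \<sigma> (b \<theta>) (P \<theta>)"
    and "\<forall>\<theta> \<theta>'. closed_segment \<theta> \<theta>' \<subseteq> \<Theta> \<longrightarrow>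
           (AE x in lborel. \<forall>j. continuous (at 0 within {0..T})
              (\<lambda>t. seg_grad s db j \<theta> \<theta>' t x (marginal (P \<theta>) t)))"
    and "\<forall>\<theta> \<theta>'. closed_segment \<theta> \<theta>' \<subseteq> \<Theta> \<longrightarrow>
           (\<forall>z. norm z = 1 \<longrightarrow> (\<exists>j. \<exists>x. seg_grad s db j \<theta> \<theta>' 0 x \<mu>\<^sub>0 \<bullet> z \<noteq> 0))"
  shows "0 < (INF (\<theta>, \<theta>') \<in> {(\<theta>, \<theta>'). closed_segment \<theta> \<theta>' \<subseteq> \<Theta>}. det (info_matrix T s db P \<theta> \<theta>'))"
proof -
  obtain m p L C K where "mkv_regular T \<Theta> \<mu>\<^sub>0 \<sigma> s b db P m p L C K"
    using mkv_regular_of_assumptions[OF assms(1,2,4-10)] by blast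
  then interpret mkv_regular T \<Theta> \<mu>\<^sub>0 \<sigma> s b db P m p L C K .
  show ?thesis
  proof (rule information_nondegenerate)
    show "\<Theta> \<noteq> {}" using assms(3) interior_subset by blast
  qed (use assms(11,12) in blast)+
qed

end
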